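(* Let $a=(\hat\chi_1,\dots,\hat\chi_n)$ be a tuple of nonsingular extended characters with nonsingular total holonomy, and let $\beta:a\to a'$ be an admissible braid, where $a'=(\hat\chi_1',\dots,\hat\chi_n')$. Write $\rho,\rho'$ for the corresponding representations of $\pi_1(D_n)$. The linear maps $\Phi_\rho$ given by $\Phi_\rho(v_j^\nu)=\theta_j^\nu$ ($1\le j\le n-1$, $\nu=1,2$) extend to super vector space isomorphisms $$\textstyle\bigwedge\Phi_\rho:\bigwedge H_1^{\mathrm{lf}}(D_n;\rho)\to\mathscr C_n/\ker\rho\to Y(a),$$ where the exterior algebra is a super vector space in the usual way ($u_1\wedge\cdots\wedge u_k$ lies in degree $k$ mod $2$), and this identification is compatible with the braiding in the sense that $$\textstyle\mathcal T(\beta)\circ\bigwedge\Phi_\rho=\bigwedge\Phi_{\rho'}\circ\bigwedge\mathcal B(\beta)$$ as maps $\bigwedge H_1^{\mathrm{lf}}(D_n;\rho)\to Y(a')$.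
   Context: **Algebra.** $\mathcal U=\mathcal U_i(\mathfrak{sl}_2)$: generators $E,F,K^{\pm1}$, relations $KE=-EK$, $KF=-FK$, $EF-FE=2i(K-K^{-1})$; $\Delta E=1\otimes E+E\otimes K$, $\Delta F=K^{-1}\otimes F+F\otimes1$, $\Delta K=K\otimes K$, $S(E)=-EK^{-1}$, $S(F)=-KF$, $S(K)=K^{-1}$. $\tilde F=iKF$; $\Omega=iEF+K-K^{-1}$ is central; $\mathcal Z_0=\mathbb C[K^{\pm2},E^2,F^2]$ is central and contains $\Omega^2$. $\mathcal U^{\mathrm{cop}}$ has the opposite coproduct. **Characters, modules.** A $\mathcal Z_0$-character $\chi:\mathcal Z_0\to\mathbb C$ with $\kappa=\chi(K^2)$, $\epsilon=\chi(E^2)$, $\phi=\kappa\chi(F^2)$ is identified with $(\chi^+,\chi^-)=\left(\begin{pmatrix}\kappa&0\\ \phi&1\end{pmatrix},\begin{pmatrix}1&\epsilon\\0&\kappa\end{pmatrix}\right)$; $\psi(\chi)=\chi^+(\chi^-)^{-1}$; characters multiply by $\chi_1\chi_2=(\chi_1\otimes\chi_2)\Delta$, $\chi^{-1}=\chi\circ S$. $\chi$ is nonsingular if $\chi(\Omega^2)\ne0$. An extended character is $\hat\chi=(\chi,\mu)$ with $\mu$ a fractional eigenvalue of $\chi$: $(\mu-\mu^{-1})^2=\chi(\Omega^2)$. The tuple $a$ has nonsingular total holonomy if $\chi_1\cdots\chi_n$ is nonsingular. $V(\hat\chi)=V(\chi,\mu)$ is the simple $2$-dimensional $\mathcal U$-module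 on which $\mathcal Z_0$ acts by $\chi$ and $\Omega$ by $\mu-\mu^{-1}$; $V^*$ has action $(xf)(v)=f(S(x)v)$. $W(\hat\chi)=V(\hat\chi)\boxtimes V(\hat\chi)^*$ is a $\mathcal U\otimes\mathcal U^{\mathrm{cop}}$-module, and $W_{\epsilon_1\epsilon_2}(\chi,\mu)=V(\chi,(-1)^{\epsilon_1}\mu)\boxtimes V(\chi,(-1)^{\epsilon_2}\mu)^*$ for $\epsilon_1,\epsilon_2\in\mathbb Z/2$. **Braids.** Admissible braids are the morphisms of the groupoid whose objects are tuples of extended characters: products (left to right) of generators $\sigma_i^{\pm1}$, where $\sigma:(\hat\chi_1,\hat\chi_2)\to(\hat\chi_4,\hat\chi_3)$ exists when $\chi_1^+\chi_2^+=\chi_4^+\chi_3^+$, $\chi_1^-\chi_2^-=\chi_4^-\chi_3^-$, $\chi_1^-\chi_2^+=\chi_4^+\chi_3^-$ has a (unique) solution, with $\mu_4=\mu_2$, $\mu_3=\mu_1$. The representation attached to a tuple of $\pi_1(D_n)$ ($D_n$ the $n$-punctured disc, group free on $x_1,\dots,x_n$) is $\rho(x_j)=(\chi_1^+\cdots\chi_{j-1}^+)\psi(\chi_j)(\chi_1^+\cdots\chi_{j-1}^+)^{-1}$. **Braidings and $\mathcal T$.** $\check{\mathcal R}$ is the unique automorphism of $\mathcal U\otimes\mathcal U[\mathsf w^{-1}]$, $\mathsf w=1+K^2F^2\otimes K^{-2}E^2$, with $\check{\mathcal R}(E\otimes1)=K\otimes E$, $\check{\mathcal R}(1\otimes F)=F\otimes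 K^{-1}$, $\check{\mathcal R}(K\otimes1)=1\otimes K-iKF\otimes E$, $\check{\mathcal R}(\Delta u)=\Delta u$; $\check{\overline{\mathcal R}}=\tau\check{\mathcal R}^{-1}\tau$ with $\tau$ the flip. $\mathcal T(a)=\bigotimes_jW(\hat\chi_j)$, with distinguished vector $v_0(a)=\bigotimes_j\sum_ke^{(j)}_k\boxtimes e^{(j)k}$ ($\{e_k^{(j)}\}$ a basis of $V(\hat\chi_j)$, $\{e^{(j)k}\}$ the dual basis). $\mathcal T(\sigma_i)$ is the linear map in factors $i,i+1$ intertwining $\check{\mathcal R}\boxtimes\check{\overline{\mathcal R}}$ (that is, $C(x\cdot w)=(\check{\mathcal R}\boxtimes\check{\overline{\mathcal R}})(x)\cdot C(w)$, $\check{\mathcal R}$ acting on $\mathcal U$ factors and $\check{\overline{\mathcal R}}$ on $\mathcal U^{\mathrm{cop}}$ factors), unique up to scalar and normalized by $\mathcal T(\beta)v_0(a)=v_0(a')$. **Multiplicity superspace.** Put $\chi=\chi_1\cdots\chi_n$ with a fractional eigenvalue $\mu$. Decompose $\bigotimes_jV(\hat\chi_j)\cong X_0\otimes V(\chi,\mu)\oplus X_1\otimes V(\chi,-\mu)$ and $\bigotimes_jV(\hat\chi_j)^*\cong\overline X_0\otimes V(\chi,\mu)^*\oplus\overline X_1\otimes V(\chi,-\mu)^*$ with multiplicity spaces $X_\epsilon,\overline X_\epsilon$. Then $\mathcal T(a)\cong\bigoplus_{\epsilon_1,\epsilon_2}(X_{\epsilon_1}\otimes\overline X_{\epsilon_2})\otimes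 W_{\epsilon_1\epsilon_2}(\chi,\mu)$, and the multiplicity superspace is $Y(a)=Y_0\oplus Y_1$ with even part $Y_0=X_0\otimes\overline X_0\oplus X_1\otimes\overline X_1$ and odd part $Y_1=X_0\otimes\overline X_1\oplus X_1\otimes\overline X_0$. In the claim $\mathcal T(\beta)$ also denotes the induced map $Y(a)\to Y(a')$. **Operators.** $X_j$ denotes $X$ in the $j$th factor. $\alpha_j^1=K_1\cdots K_{j-1}E_j\Omega_j^{-1}$, $\alpha_j^2=K_1\cdots K_{j-1}\tilde F_j\Omega_j^{-1}$; $\overline\alpha_j^1=E_j\Omega_j^{-1}K_{j+1}\cdots K_n$, $\overline\alpha_j^2=\tilde F_j\Omega_j^{-1}K_{j+1}\cdots K_n$; $\beta_j^\nu=\alpha_j^\nu-\alpha_{j+1}^\nu$, $\overline\beta_j^\nu=\overline\alpha_j^\nu-\overline\alpha_{j+1}^\nu$; $\theta_j^\nu=\beta_j^\nu\boxtimes1+\Delta K\boxtimes\overline\beta_j^\nu$ with $\Delta K=K_1\cdots K_n$. $\mathscr H_n$ is the $(\mathcal Z_0[\Omega^{-2}]\otimes\mathcal Z_0[\Omega^{-2}])^{\otimes n}$-span of the $\theta_j^\nu$, $\mathscr C_n$ the algebra it generates (a Clifford algebra), and $\mathscr C_n/\ker\rho$ denotes reduction modulo $\ker((\chi_1\boxtimes\chi_1^{-1})\otimes\cdots\otimes(\chi_n\boxtimes\chi_n^{-1}))$. The map to $Y(a)$ is the one induced by the action of $\mathscr C_n$ on $\mathcal T(a)$; under it products of the $\theta_j^\nu$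 correspond to the vectors $\theta_{j_1}^{\nu_1}\cdots\theta_{j_k}^{\nu_k}\cdot v_0(a)$, which describe a basis of the multiplicity space. **Burau.** $H_1^{\mathrm{lf}}(D_n;\rho)$ is the locally finite (Borel–Moore) homology of $D_n$ twisted by $\rho^\vee$, $\rho^\vee(x)=(\rho(x)^{-1})^T$, dual to $H_1(D_n,\partial D_n;\rho)$; $\mathcal B(\beta):H_1^{\mathrm{lf}}(D_n;\rho)\to H_1^{\mathrm{lf}}(D_n;\rho')$ is the reduced twisted Burau representation, i.e. the action of braids on $D_n$. With $y_j=x_j\cdots x_1$, let $z_j\otimes e^\mu$ be the basis dual to the basis $y_j\otimes e_\mu$ ($1\le j\le n-1$, $\mu=1,2$) of $H_1(D_n,\partial D_n;\rho)$. The first and second rows of $p_j=(\chi_1^+\cdots\chi_j^+)^T$ give the coefficients of $v_j^2$ and $v_j^1$ in $z_j\otimes e^1,z_j\otimes e^2$. In the ordered bases $(v_1^2,v_1^1,\dots,v_{n-1}^2,v_{n-1}^1)$, matrices acting on row vectors from the right, $\mathcal B(\sigma_i)$ is the identity except in $2\times2$ block rows and columns $i-1,i,i+1$ (indices $0,n$ omitted), where it is $$\begin{bmatrix}I_2&P&0\\0&N&0\\0&R&I_2\end{bmatrix},\quad P=\begin{pmatrix}\kappa_i^{-1}&-\phi_i\kappa_i^{-1}\\0&1\end{pmatrix},\ N=\begin{pmatrix}-\kappa_i^{-1}&\phi_i\kappa_i^{-1}\\-\epsilon_{i+1}&-\kappa_{i+1}\end{pmatrix},\ R=\begin{pmatrix}1&0\\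 \epsilon_{i+1}&\kappa_{i+1}\end{pmatrix},$$ with the coordinates of the characters of the target.
   Formalization: The sign of F̃ is corrected: the operators θ_j^2 use F̃ = −iKF instead of iKF, since with iKF the compatibility with the displayed Burau matrices fails by a sign (already for n = 2, σ_1, when ε_2 ≠ 0). *)

theory Defs
  imports
    "HOL-Analysis.Analysis"
    "HOL-Library.Poly_Mapping"
    "HOL-Algebra.QuotRing"
    "HOL-Algebra.Generated_Rings"
begin

section \<open>Free algebras and quotients\<close>

datatype 'g fmon = Word (letters: "'g list")

text \<open>Words carry concatenation as \<^term>\<open>(+)\<close>, so that \<^typ>\<open>'g fmon \<Rightarrow>\<^sub>0 complex\<close> with its
  convolution product is the free associative unital algebra on \<^typ>\<open>'g\<close>.\<close>

instantiation fmon :: (type) monoid_add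
begin
definition zero_fmon :: "'g fmon" where "zero_fmon = Word []"
definition plus_fmon :: "'g fmon \<Rightarrow> 'g fmon \<Rightarrow> 'g fmon"
  where "plus_fmon u v = Word (letters u @ letters v)"
instance
  by standard (auto simp: zero_fmon_def plus_fmon_def)
end

type_synonym 'g falg = "'g fmon \<Rightarrow>\<^sub>0 complex"

definition cst :: "complex \<Rightarrow> 'g falg"
  where "cst c = Poly_Mapping.single 0 c"

definition gvar :: "'g \<Rightarrow> 'g falg"
  where "gvar g = Poly_Mapping.single (Word [g]) 1"

definition free_ring :: "'g set \<Rightarrow> 'g falg ring"
  where "free_ring G = \<lparr>carrier = {p. \<forall>w\<in>Poly_Mapping.keys p. set (letters w) \<subseteq> G},
           mult = (*), one = 1, zero = 0, add = (+)\<rparr>"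


section \<open>Exterior algebras\<close>

text \<open>Vectors are functions with values in \<open>\<complex>\<^sup>2\<close> and pointwise operations; \<open>H\<close> is a linear
  subspace of such functions. Its exterior algebra is the free algebra on the elements of \<open>H\<close>
  modulo linearity of the generators and \<open>v \<and> v = 0\<close>.\<close>

definition ext_rels :: "('a \<Rightarrow> complex^2) set \<Rightarrow> ('a \<Rightarrow> complex^2) falg set"
  where "ext_rels H =
    {gvar (\<lambda>w. u w + v w) - gvar u - gvar v | u v. u \<in> H \<and> v \<in> H} \<union>
    {gvar (\<lambda>w. c *s u w) - cst c * gvar u | c u. u \<in> H} \<union>
    {gvar u * gvar u | u. u \<in> H}"

definition ext_ideal :: "('a \<Rightarrow> complex^2) set \<Rightarrow> ('a \<Rightarrow> complex^2) falg set"
  where "ext_ideal H = Idl\<^bsub>free_ring H\<^esub> (ext_rels H)"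

definition exterior :: "('a \<Rightarrow> complex^2) set \<Rightarrow> ('a \<Rightarrow> complex^2) falg set ring"
  where "exterior H = free_ring H Quot ext_ideal H"

definition ext_cls :: "('a \<Rightarrow> complex^2) set \<Rightarrow> ('a \<Rightarrow> complex^2) falg \<Rightarrow> ('a \<Rightarrow> complex^2) falg set"
  where "ext_cls H x = ext_ideal H +>\<^bsub>free_ring H\<^esub> x"

text \<open>Parities are booleans throughout, \<^term>\<open>True\<close> being odd.\<close>

definition ext_part :: "('a \<Rightarrow> complex^2) set \<Rightarrow> bool \<Rightarrow> ('a \<Rightarrow> complex^2) falg set set"
  where "ext_part H par = {ext_cls H x | x. x \<in> carrier (free_ring H) \<and>
           (\<forall>w\<in>Poly_Mapping.keys x. odd (length (letters w)) = par)}"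

definition exterior_map ::
  "('a \<Rightarrow> complex^2) set \<Rightarrow> ('b \<Rightarrow> complex^2) set \<Rightarrow> (('a \<Rightarrow> complex^2) \<Rightarrow> ('b \<Rightarrow> complex^2)) \<Rightarrow>
   (('a \<Rightarrow> complex^2) falg set \<Rightarrow> ('b \<Rightarrow> complex^2) falg set) \<Rightarrow> bool"
  where "exterior_map H H' f M \<longleftrightarrow>
    f ` H \<subseteq> H' \<and> M \<in> ring_hom (exterior H) (exterior H') \<and>
    (\<forall>c. M (ext_cls H (cst c)) = ext_cls H' (cst c)) \<and>
    (\<forall>d\<in>H. M (ext_cls H (gvar d)) = ext_cls H' (gvar (f d)))"


section \<open>Characters of \<open>\<Z>\<^sub>0\<close>\<close>

text \<open>The character with \<open>\<chi>(K\<^sup>2) = zkap\<close>, \<open>\<chi>(E\<^sup>2) = zeps\<close>, \<open>\<chi>(K\<^sup>2) \<chi>(F\<^sup>2) = zphi\<close>.\<close>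

record zchar =
  zkap :: complex
  zeps :: complex
  zphi :: complex

definition chip :: "zchar \<Rightarrow> complex^2^2"
  where "chip x = vector [vector [zkap x, 0], vector [zphi x, 1]]"

definition chim :: "zchar \<Rightarrow> complex^2^2"
  where "chim x = vector [vector [1, zeps x], vector [0, zkap x]]"

definition psi :: "zchar \<Rightarrow> complex^2^2"
  where "psi x = chip x ** matrix_inv (chim x)"

text \<open>The product is \<open>(\<chi>\<^sub>1 \<otimes> \<chi>\<^sub>2) \<circ> \<Delta>\<close>, from \<open>\<Delta>(E\<^sup>2) = 1 \<otimes> E\<^sup>2 + E\<^sup>2 \<otimes> K\<^sup>2\<close> and
  \<open>\<Delta>(F\<^sup>2) = K\<^sup>-\<^sup>2 \<otimes> F\<^sup>2 + F\<^sup>2 \<otimes> 1\<close>; the inverse is \<open>\<chi> \<circ> S\<close>, from \<open>S(E\<^sup>2) = -E\<^sup>2K\<^sup>-\<^sup>2\<close> and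
  \<open>S(F\<^sup>2) = -K\<^sup>2F\<^sup>2\<close>.\<close>

definition zone :: zchar
  where "zone = \<lparr>zkap = 1, zeps = 0, zphi = 0\<rparr>"

definition zmult :: "zchar \<Rightarrow> zchar \<Rightarrow> zchar"
  where "zmult x y = \<lparr>zkap = zkap x * zkap y, zeps = zeps y + zeps x * zkap y,
           zphi = zphi y + zphi x * zkap y\<rparr>"

definition zinv :: "zchar \<Rightarrow> zchar"
  where "zinv x = \<lparr>zkap = 1 / zkap x, zeps = - zeps x / zkap x, zphi = - zphi x / zkap x\<rparr>"

text \<open>\<open>\<chi>(\<Omega>\<^sup>2)\<close>, as \<open>\<Omega>\<^sup>2 = K\<^sup>2 + K\<^sup>-\<^sup>2 - 2 - E\<^sup>2F\<^sup>2\<close>.\<close>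

definition omega2 :: "zchar \<Rightarrow> complex"
  where "omega2 x = zkap x + 1 / zkap x - 2 - zeps x * (zphi x / zkap x)"

type_synonym xchar = "zchar \<times> complex"

definition ext_char :: "xchar \<Rightarrow> bool"
  where "ext_char x \<longleftrightarrow> zkap (fst x) \<noteq> 0 \<and> snd x \<noteq> 0 \<and>
           (snd x - 1 / snd x)\<^sup>2 = omega2 (fst x)"

definition nonsingular :: "zchar \<Rightarrow> bool"
  where "nonsingular x \<longleftrightarrow> omega2 x \<noteq> 0"

text \<open>Tuples are lists; the factors are numbered from 1.\<close>

definition chr :: "xchar list \<Rightarrow> nat \<Rightarrow> zchar"
  where "chr a j = fst (a ! (j - 1))"

definition total_chr :: "xchar list \<Rightarrow> zchar"
  where "total_chr a = foldl zmult zone (map fst a)"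


section \<open>Two-dimensional modules\<close>

record umod =
  mE :: "complex^2^2"
  mF :: "complex^2^2"
  mK :: "complex^2^2"

definition is_umod :: "umod \<Rightarrow> bool"
  where "is_umod m \<longleftrightarrow> invertible (mK m) \<and>
    mK m ** mE m = - (mE m ** mK m) \<and>
    mK m ** mF m = - (mF m ** mK m) \<and>
    mE m ** mF m - mF m ** mE m = mat (2 * \<i>) ** (mK m - matrix_inv (mK m))"

definition mOm :: "umod \<Rightarrow> complex^2^2"
  where "mOm m = mat \<i> ** mE m ** mF m + mK m - matrix_inv (mK m)"

definition simple_umod :: "umod \<Rightarrow> bool"
  where "simple_umod m \<longleftrightarrow> (\<forall>S::(complex^2) set. vec.subspace S \<and>
    (\<forall>v\<in>S. mE m *v v \<in> S \<and> mF m *v v \<in> S \<and> mK m *v v \<in> S) \<longrightarrow> S = {0} \<or> S = UNIV)"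

definition is_V :: "xchar \<Rightarrow> umod \<Rightarrow> bool"
  where "is_V x m \<longleftrightarrow> is_umod m \<and> simple_umod m \<and>
    mK m ** mK m = mat (zkap (fst x)) \<and>
    mE m ** mE m = mat (zeps (fst x)) \<and>
    mF m ** mF m = mat (zphi (fst x) / zkap (fst x)) \<and>
    mOm m = mat (snd x - 1 / snd x)"

text \<open>\<open>V\<^sup>*\<close> in the dual basis: \<open>x\<close> acts by the transpose of \<open>S(x)\<close>.\<close>

definition dual_umod :: "umod \<Rightarrow> umod"
  where "dual_umod m = \<lparr>mE = transpose (- (mE m ** matrix_inv (mK m))),
           mF = transpose (- (mK m ** mF m)), mK = transpose (matrix_inv (mK m))\<rparr>"

text \<open>If \<open>m\<close> is a model of \<open>V(\<chi>,\<mu>)\<close> then \<open>flip_umod m\<close> is a model of \<open>V(\<chi>,-\<mu>)\<close> on the same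
  vector space, with the same action of \<open>E\<close> and of \<open>KF\<close>.\<close>

definition flip_umod :: "umod \<Rightarrow> umod"
  where "flip_umod m = \<lparr>mE = mE m, mF = - mF m, mK = - mK m\<rparr>"


section \<open>The algebra \<open>(\<U> \<otimes> \<U>\<^sup>c\<^sup>o\<^sup>p)\<^sup>\<otimes>\<^sup>n\<close> with all \<open>\<Omega>\<^sub>j\<close> inverted\<close>

text \<open>The letter \<open>(j, s)\<close>, \<open>g\<close> is the generator \<open>g\<close> in the \<open>j\<close>-th tensor factor, on the side of
  \<open>\<U>\<close> if \<open>s = Md\<close> (acting on \<open>V(\<chi>\<^sub>j,\<mu>\<^sub>j)\<close>) and on the side of \<open>\<U>\<^sup>c\<^sup>o\<^sup>p\<close> if \<open>s = Dl\<close> (acting on the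
  dual). Inverting the central element \<open>\<Omega>\<close> is the same as inverting \<open>\<Omega>\<^sup>2\<close>.\<close>

datatype side = Md | Dl

datatype ugen = GE | GF | GK | GKi | GOi

type_synonym pos = "nat \<times> side"

type_synonym ualg = "(pos \<times> ugen) falg"

definition uE :: "pos \<Rightarrow> ualg" where "uE p = gvar (p, GE)"
definition uF :: "pos \<Rightarrow> ualg" where "uF p = gvar (p, GF)"
definition uK :: "pos \<Rightarrow> ualg" where "uK p = gvar (p, GK)"
definition uKi :: "pos \<Rightarrow> ualg" where "uKi p = gvar (p, GKi)"
definition uOi :: "pos \<Rightarrow> ualg" where "uOi p = gvar (p, GOi)"

definition uOm :: "pos \<Rightarrow> ualg"
  where "uOm p = cst \<i> * uE p * uF p + uK p - uKi p"

definition positions :: "nat \<Rightarrow> pos set"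
  where "positions n = {1..n} \<times> UNIV"

definition uring :: "nat \<Rightarrow> ualg ring"
  where "uring n = free_ring (positions n \<times> UNIV)"

definition urels :: "nat \<Rightarrow> ualg set"
  where "urels n =
    (\<Union>p\<in>positions n.
      {uK p * uKi p - 1, uKi p * uK p - 1,
       uK p * uE p + uE p * uK p, uK p * uF p + uF p * uK p,
       uE p * uF p - uF p * uE p - cst (2 * \<i>) * (uK p - uKi p),
       uOm p * uOi p - 1, uOi p * uOm p - 1}) \<union>
    {gvar (p, g) * gvar (q, h) - gvar (q, h) * gvar (p, g) | p q g h.
       p \<in> positions n \<and> q \<in> positions n \<and> p \<noteq> q}"


section \<open>The operators \<open>\<theta>\<^sub>j\<^sup>\<nu>\<close> and the Clifford algebra\<close>

text \<open>The sign of \<open>F\<close>-tilde is the one for which the action of \<open>\<sigma>\<^sub>i\<close> on the \<open>\<theta>\<^sub>j\<^sup>\<nu>\<close> has the matrix of the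
  Burau representation in the basis \<open>v\<^sub>j\<^sup>\<nu>\<close> below. With \<open>iKF\<close> in place of \<open>-iKF\<close> one would get
  \<open>\<sigma>\<^sub>1: \<beta>\<^sub>1\<^sup>1 \<mapsto> \<epsilon>\<^sub>2 \<beta>\<^sub>1\<^sup>2 - \<kappa>\<^sub>2 \<beta>\<^sub>1\<^sup>1\<close> for \<open>n = 2\<close>, against \<open>v\<^sub>1\<^sup>1 \<mapsto> -\<epsilon>\<^sub>2 v\<^sub>1\<^sup>2 - \<kappa>\<^sub>2 v\<^sub>1\<^sup>1\<close>.\<close>

definition uFt :: "pos \<Rightarrow> ualg"
  where "uFt p = cst (- \<i>) * uK p * uF p"

definition uEF :: "2 \<Rightarrow> pos \<Rightarrow> ualg"
  where "uEF nu p = (if nu = 1 then uE p else uFt p)"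

definition alpha :: "nat \<Rightarrow> 2 \<Rightarrow> ualg"
  where "alpha j nu = prod_list (map (\<lambda>k. uK (k, Md)) [1..<j]) * uEF nu (j, Md) * uOi (j, Md)"

definition alphabar :: "nat \<Rightarrow> nat \<Rightarrow> 2 \<Rightarrow> ualg"
  where "alphabar n j nu =
    uEF nu (j, Dl) * uOi (j, Dl) * prod_list (map (\<lambda>k. uK (k, Dl)) [Suc j..<Suc n])"

definition theta :: "nat \<Rightarrow> nat \<Rightarrow> 2 \<Rightarrow> ualg"
  where "theta n j nu = (alpha j nu - alpha (Suc j) nu) +
    prod_list (map (\<lambda>k. uK (k, Md)) [1..<Suc n]) * (alphabar n j nu - alphabar n (Suc j) nu)"

text \<open>Algebra generators of the ring of scalars \<open>(\<Z>\<^sub>0[\<Omega>\<^sup>-\<^sup>2] \<otimes> \<Z>\<^sub>0[\<Omega>\<^sup>-\<^sup>2])\<^sup>\<otimes>\<^sup>n\<close>.\<close>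

definition scalar_gens :: "nat \<Rightarrow> ualg set"
  where "scalar_gens n = range cst \<union>
    (\<Union>p\<in>positions n. {uK p * uK p, uKi p * uKi p, uE p * uE p, uF p * uF p, uOi p * uOi p})"

definition thetas :: "nat \<Rightarrow> ualg set"
  where "thetas n = {theta n j nu | j nu. 1 \<le> j \<and> j < n}"

text \<open>\<open>cliff n\<close> is a subring of the free algebra; \<open>\<C>\<^sub>n\<close> is its image modulo \<^const>\<open>urels\<close>.\<close>

definition cliff :: "nat \<Rightarrow> ualg ring"
  where "cliff n = (uring n)\<lparr>carrier := generate_ring (uring n) (scalar_gens n \<union> thetas n)\<rparr>"

inductive_set cliff_hom :: "nat \<Rightarrow> (ualg \<times> bool) set" for n
  where
    zero: "(0, par) \<in> cliff_hom n"
  | scalar: "z \<in> scalar_gens n \<Longrightarrow> (z, False) \<in> cliff_hom n"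
  | theta: "t \<in> thetas n \<Longrightarrow> (t, True) \<in> cliff_hom n"
  | add: "(x, par) \<in> cliff_hom n \<Longrightarrow> (y, par) \<in> cliff_hom n \<Longrightarrow> (x + y, par) \<in> cliff_hom n"
  | mult: "(x, par) \<in> cliff_hom n \<Longrightarrow> (y, par') \<in> cliff_hom n \<Longrightarrow>
      (x * y, par \<noteq> par') \<in> cliff_hom n"

text \<open>The kernel of a character of a commutative algebra is generated by the elements
  \<open>g - \<chi>(g)\<close>, with \<open>g\<close> ranging over algebra generators.\<close>

definition pos_chr :: "xchar list \<Rightarrow> pos \<Rightarrow> zchar"
  where "pos_chr a p = (if snd p = Md then chr a (fst p) else zinv (chr a (fst p)))"

definition ker_gens :: "xchar list \<Rightarrow> ualg set"
  where "ker_gens a = (\<Union>p\<in>positions (length a). let x = pos_chr a p in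
    {uK p * uK p - cst (zkap x), uKi p * uKi p - cst (1 / zkap x), uE p * uE p - cst (zeps x),
     uF p * uF p - cst (zphi x / zkap x), uOi p * uOi p - cst (1 / omega2 x)})"

definition cliff_ideal :: "xchar list \<Rightarrow> ualg set"
  where "cliff_ideal a = Idl\<^bsub>cliff (length a)\<^esub>
    ((Idl\<^bsub>uring (length a)\<^esub> (urels (length a)) \<inter> carrier (cliff (length a))) \<union> ker_gens a)"

definition cliff_red :: "xchar list \<Rightarrow> ualg set ring"
  where "cliff_red a = cliff (length a) Quot cliff_ideal a"

definition cliff_cls :: "xchar list \<Rightarrow> ualg \<Rightarrow> ualg set"
  where "cliff_cls a x = cliff_ideal a +>\<^bsub>cliff (length a)\<^esub> x"

definition cliff_part :: "xchar list \<Rightarrow> bool \<Rightarrow> ualg set set"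
  where "cliff_part a par = {cliff_cls a x | x. (x, par) \<in> cliff_hom (length a)}"


section \<open>The modules \<open>\<T>(a)\<close>\<close>

text \<open>A tensor is given by its coefficients: \<open>f s\<close> is the coefficient of the product basis vector
  which has the \<open>s p\<close>-th basis vector in the factor at position \<open>p\<close>. The elements of
  \<open>tens P\<close> live on the factors in \<open>P\<close>; the value 1 is the default outside \<open>P\<close>.\<close>

type_synonym tensor = "(pos \<Rightarrow> 2) \<Rightarrow> complex"

definition indices :: "pos set \<Rightarrow> (pos \<Rightarrow> 2) set"
  where "indices P = {s. \<forall>p. p \<notin> P \<longrightarrow> s p = 1}"

definition tens :: "pos set \<Rightarrow> tensor set"
  where "tens P = {f. \<forall>s. s \<notin> indices P \<longrightarrow> f s = 0}"

definition op_at :: "pos \<Rightarrow> complex^2^2 \<Rightarrow> tensor \<Rightarrow> tensor"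
  where "op_at p M f = (\<lambda>s. \<Sum>b\<in>UNIV. M $ s p $ b * f (s(p := b)))"

definition gen_mat :: "umod \<Rightarrow> ugen \<Rightarrow> complex^2^2"
  where "gen_mat m g = (case g of GE \<Rightarrow> mE m | GF \<Rightarrow> mF m | GK \<Rightarrow> mK m
    | GKi \<Rightarrow> matrix_inv (mK m) | GOi \<Rightarrow> matrix_inv (mOm m))"

definition pos_mod :: "(xchar \<Rightarrow> umod) \<Rightarrow> xchar list \<Rightarrow> pos \<Rightarrow> umod"
  where "pos_mod V a p = (if snd p = Md then V (a ! (fst p - 1)) else dual_umod (V (a ! (fst p - 1))))"

definition act :: "(xchar \<Rightarrow> umod) \<Rightarrow> xchar list \<Rightarrow> ualg \<Rightarrow> tensor \<Rightarrow> tensor"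
  where "act V a x f = (\<lambda>s. \<Sum>w\<in>Poly_Mapping.keys x. Poly_Mapping.lookup x w *
    foldr (\<lambda>(p, g). op_at p (gen_mat (pos_mod V a p) g)) (letters w) f s)"

definition vac :: "nat \<Rightarrow> tensor"
  where "vac n = (\<lambda>s. if s \<in> indices (positions n) \<and> (\<forall>j\<in>{1..n}. s (j, Md) = s (j, Dl))
    then 1 else 0)"


section \<open>The multiplicity superspace\<close>

text \<open>Iterated coproducts of \<open>\<U>\<close> on the factors \<open>(1, Md), \<dots>, (n, Md)\<close>, and of \<open>\<U>\<^sup>c\<^sup>o\<^sup>p\<close> on the
  factors \<open>(1, Dl), \<dots>, (n, Dl)\<close>, starting from the counit.\<close>

primrec copK :: "side \<Rightarrow> nat \<Rightarrow> ualg" where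
  "copK s 0 = 1"
| "copK s (Suc n) = copK s n * uK (Suc n, s)"

primrec copKi :: "side \<Rightarrow> nat \<Rightarrow> ualg" where
  "copKi s 0 = 1"
| "copKi s (Suc n) = copKi s n * uKi (Suc n, s)"

primrec copE :: "side \<Rightarrow> nat \<Rightarrow> ualg" where
  "copE s 0 = 0"
| "copE s (Suc n) = (case s of
      Md \<Rightarrow> uE (Suc n, s) + copE s n * uK (Suc n, s)
    | Dl \<Rightarrow> copE s n + copK s n * uE (Suc n, s))"

primrec copF :: "side \<Rightarrow> nat \<Rightarrow> ualg" where
  "copF s 0 = 0"
| "copF s (Suc n) = (case s of
      Md \<Rightarrow> copKi s n * uF (Suc n, s) + copF s n
    | Dl \<Rightarrow> copF s n * uKi (Suc n, s) + uF (Suc n, s))"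

text \<open>\<open>mult_space V a s m\<close> consists of the module maps from \<open>m\<close> to \<open>\<Otimes>\<^sub>j V(\<chi>\<^sub>j,\<mu>\<^sub>j)\<close>
  (for \<open>s = Md\<close>) or \<open>\<Otimes>\<^sub>j V(\<chi>\<^sub>j,\<mu>\<^sub>j)\<^sup>*\<close> (for \<open>s = Dl\<close>), given by the images of the basis of \<open>m\<close>.\<close>

definition mult_space :: "(xchar \<Rightarrow> umod) \<Rightarrow> xchar list \<Rightarrow> side \<Rightarrow> umod \<Rightarrow> (2 \<Rightarrow> tensor) set"
  where "mult_space V a s m = {x.
    (\<forall>b. x b \<in> tens ({1..length a} \<times> {s})) \<and>
    (\<forall>(M, D) \<in> {(mE m, copE s (length a)), (mF m, copF s (length a)), (mK m, copK s (length a))}.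
      \<forall>c. (\<lambda>t. \<Sum>b\<in>UNIV. M $ b $ c * x b t) = act V a D (x c))}"

definition total_mod :: "(xchar \<Rightarrow> umod) \<Rightarrow> xchar list \<Rightarrow> complex \<Rightarrow> bool \<Rightarrow> umod"
  where "total_mod V a mu e =
    (if e then flip_umod (V (total_chr a, mu)) else V (total_chr a, mu))"

definition restr_side :: "side \<Rightarrow> (pos \<Rightarrow> 2) \<Rightarrow> (pos \<Rightarrow> 2)"
  where "restr_side d s = (\<lambda>p. if snd p = d then s p else 1)"

text \<open>\<open>X\<^sub>e\<^sub>1 \<otimes> \<X>\<^sub>e\<^sub>2\<close>, as the space of sums of maps \<open>x \<boxtimes> x'\<close> from \<open>W\<^sub>e\<^sub>1\<^sub>,\<^sub>e\<^sub>2(\<chi>,\<mu>)\<close> to \<open>\<T>(a)\<close>, again given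
  by the images of the basis vectors.\<close>

definition mult_block ::
  "(xchar \<Rightarrow> umod) \<Rightarrow> xchar list \<Rightarrow> complex \<Rightarrow> bool \<Rightarrow> bool \<Rightarrow> (2 \<Rightarrow> 2 \<Rightarrow> tensor) set"
  where "mult_block V a mu e1 e2 =
    {\<lambda>b c s. \<Sum>k<N. x k b (restr_side Md s) * x' k c (restr_side Dl s) | (N::nat) x x'.
      \<forall>k<N. x k \<in> mult_space V a Md (total_mod V a mu e1) \<and>
             x' k \<in> mult_space V a Dl (dual_umod (total_mod V a mu e2))}"

type_synonym mult_elem = "bool \<Rightarrow> bool \<Rightarrow> 2 \<Rightarrow> 2 \<Rightarrow> tensor"

definition mult_super :: "(xchar \<Rightarrow> umod) \<Rightarrow> xchar list \<Rightarrow> complex \<Rightarrow> mult_elem set"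
  where "mult_super V a mu = {y. \<forall>e1 e2. y e1 e2 \<in> mult_block V a mu e1 e2}"

definition mult_part :: "(xchar \<Rightarrow> umod) \<Rightarrow> xchar list \<Rightarrow> complex \<Rightarrow> bool \<Rightarrow> mult_elem set"
  where "mult_part V a mu par = {y \<in> mult_super V a mu.
    \<forall>e1 e2. (e1 \<noteq> e2) \<noteq> par \<longrightarrow> y e1 e2 = (\<lambda>b c s. 0)}"

text \<open>The vector of \<open>\<T>(a)\<close> described by an element of the multiplicity space: the image of the
  vector \<open>\<Sum>\<^sub>b e\<^sub>b \<boxtimes> e\<^sup>b\<close>, in each of the four \<open>W\<^sub>e\<^sub>1\<^sub>,\<^sub>e\<^sub>2(\<chi>,\<mu>)\<close>.\<close>

definition mult_vec :: "mult_elem \<Rightarrow> tensor"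
  where "mult_vec y = (\<lambda>s. \<Sum>e1\<in>UNIV. \<Sum>e2\<in>UNIV. \<Sum>b\<in>UNIV. y e1 e2 b b s)"

definition mult_map :: "(tensor \<Rightarrow> tensor) \<Rightarrow> mult_elem \<Rightarrow> mult_elem"
  where "mult_map T y = (\<lambda>e1 e2 b c. T (y e1 e2 b c))"


section \<open>Braids and the functor \<open>\<T>\<close>\<close>

datatype bgen = Sig nat | SigInv nat

definition sigma_step :: "nat \<Rightarrow> xchar list \<Rightarrow> xchar list \<Rightarrow> bool"
  where "sigma_step i a b \<longleftrightarrow>
    1 \<le> i \<and> i < length a \<and> length b = length a \<and>
    (\<forall>j<length a. j \<noteq> i - 1 \<and> j \<noteq> i \<longrightarrow> b ! j = a ! j) \<and>
    list_all ext_char a \<and> list_all ext_char b \<and>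
    chip (chr a i) ** chip (chr a (Suc i)) = chip (chr b i) ** chip (chr b (Suc i)) \<and>
    chim (chr a i) ** chim (chr a (Suc i)) = chim (chr b i) ** chim (chr b (Suc i)) \<and>
    chim (chr a i) ** chip (chr a (Suc i)) = chip (chr b i) ** chim (chr b (Suc i)) \<and>
    snd (b ! (i - 1)) = snd (a ! i) \<and> snd (b ! i) = snd (a ! (i - 1))"

text \<open>The automorphism \<open>R\<close> (R-check) on the factors \<open>p\<close>, \<open>q\<close>, by its values: pairs \<open>(x, R x)\<close> for
  generators \<open>x\<close>. As \<open>1 \<otimes> K = (K\<^sup>-\<^sup>1 \<otimes> 1) \<Delta>K\<close>, \<open>1 \<otimes> E = \<Delta>E - (E \<otimes> 1) (1 \<otimes> K)\<close> and
  \<open>F \<otimes> 1 = \<Delta>F - (K\<^sup>-\<^sup>1 \<otimes> 1) (1 \<otimes> F)\<close>, these generate \<open>\<U> \<otimes> \<U>\<close>, so that intertwining the algebra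
  map \<open>R\<close> is the same as intertwining on the pairs below.\<close>

definition Rcheck :: "pos \<Rightarrow> pos \<Rightarrow> (ualg \<times> ualg) set"
  where "Rcheck p q =
    {(uE p, uK p * uE q),
     (uF q, uF p * uKi q),
     (uK p, uK q - cst \<i> * uK p * uF p * uE q),
     (uKi p * uF q + uF p, uKi p * uF q + uF p),
     (uE q + uE p * uK q, uE q + uE p * uK q),
     (uK p * uK q, uK p * uK q),
     (uKi p * uKi q, uKi p * uKi q)}"

text \<open>\<open>\<tau> R\<^sup>-\<^sup>1 \<tau>\<close> on the factors \<open>p\<close>, \<open>q\<close>.\<close>

definition Rcheck_bar :: "pos \<Rightarrow> pos \<Rightarrow> (ualg \<times> ualg) set"
  where "Rcheck_bar p q = (Rcheck q p)\<inverse>"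

text \<open>\<open>T\<close> is \<open>id \<otimes> C \<otimes> id\<close> with \<open>C\<close> acting on the factors in \<open>P\<close>; \<open>C s t\<close> are the entries of \<open>C\<close>.\<close>

definition local_map :: "pos set \<Rightarrow> (tensor \<Rightarrow> tensor) \<Rightarrow> bool"
  where "local_map P T \<longleftrightarrow> (\<exists>C. \<forall>f s. T f s =
    (\<Sum>t\<in>indices P. C (override_on (\<lambda>_. 1) s P) t * f (override_on s t P)))"

definition is_T_sigma ::
  "(xchar \<Rightarrow> umod) \<Rightarrow> nat \<Rightarrow> xchar list \<Rightarrow> xchar list \<Rightarrow> (tensor \<Rightarrow> tensor) \<Rightarrow> bool"
  where "is_T_sigma V i a b T \<longleftrightarrow>
    local_map ({i, Suc i} \<times> UNIV) T \<and>
    (\<forall>(x, x') \<in> Rcheck (i, Md) (Suc i, Md) \<union> Rcheck_bar (i, Dl) (Suc i, Dl).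
      \<forall>f\<in>tens (positions (length a)). T (act V a x f) = act V b x' (T f)) \<and>
    T (vac (length a)) = vac (length b)"

text \<open>\<open>braid_T V \<beta> a b T\<close>: the word \<open>\<beta>\<close>, read from left to right, is an admissible braid from \<open>a\<close>
  to \<open>b\<close>, and \<open>T\<close> is \<open>\<T>(\<beta>)\<close>.\<close>

inductive braid_T ::
  "(xchar \<Rightarrow> umod) \<Rightarrow> bgen list \<Rightarrow> xchar list \<Rightarrow> xchar list \<Rightarrow> (tensor \<Rightarrow> tensor) \<Rightarrow> bool" for V
  where
    Nil: "braid_T V [] a a id"
  | Sig: "sigma_step i a b \<Longrightarrow> is_T_sigma V i a b T \<Longrightarrow> braid_T V \<beta> b c T' \<Longrightarrow>
      braid_T V (Sig i # \<beta>) a c (T' \<circ> T)"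
  | SigInv: "sigma_step i b a \<Longrightarrow> is_T_sigma V i b a S \<Longrightarrow>
      (\<forall>f\<in>tens (positions (length b)). T (S f) = f) \<Longrightarrow>
      (\<forall>f\<in>tens (positions (length a)). T f \<in> tens (positions (length b)) \<and> S (T f) = f) \<Longrightarrow>
      braid_T V \<beta> b c T' \<Longrightarrow> braid_T V (SigInv i # \<beta>) a c (T' \<circ> T)"


section \<open>Twisted homology and the Burau representation\<close>

text \<open>Elements of \<open>\<pi>\<^sub>1(D\<^sub>n)\<close> are words in the letters \<open>(j, True) = x\<^sub>j\<close> and
  \<open>(j, False) = x\<^sub>j\<^sup>-\<^sup>1\<close>.\<close>

type_synonym fword = "(nat \<times> bool) list"

definition fwords :: "nat \<Rightarrow> fword set"
  where "fwords n = lists ({1..n} \<times> UNIV)"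

definition prodp :: "xchar list \<Rightarrow> nat \<Rightarrow> complex^2^2"
  where "prodp a j = foldl (**) (mat 1) (map (\<lambda>k. chip (chr a k)) [1..<Suc j])"

definition rho_gen :: "xchar list \<Rightarrow> nat \<Rightarrow> complex^2^2"
  where "rho_gen a j = prodp a (j - 1) ** psi (chr a j) ** matrix_inv (prodp a (j - 1))"

primrec rho :: "xchar list \<Rightarrow> fword \<Rightarrow> complex^2^2" where
  "rho a [] = mat 1"
| "rho a (l # w) = (if snd l then rho_gen a (fst l) else matrix_inv (rho_gen a (fst l))) ** rho a w"

definition y_loop :: "nat \<Rightarrow> fword"
  where "y_loop j = rev (map (\<lambda>k. (k, True)) [1..<Suc j])"

text \<open>\<open>H\<^sub>1(D\<^sub>n,\<partial>D\<^sub>n;\<rho>)\<close>, with \<open>\<pi>\<^sub>1\<close> acting on row vectors from the right through \<open>\<rho>\<close>, is spanned by the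
  classes \<open>g \<otimes> m\<close> (\<open>g\<close> in \<open>\<pi>\<^sub>1\<close>, \<open>m\<close> a row vector), linear in \<open>m\<close>, subject to
  \<open>gh \<otimes> m = g \<otimes> m + h \<otimes> m\<rho>(g)\<close> (triangles) and \<open>g \<otimes> m = 0\<close> for \<open>g\<close> a power of the boundary loop \<open>y\<^sub>n\<close>: the
  disc and its boundary circle are aspherical. \<open>H\<^sub>1\<^sup>l\<^sup>f(D\<^sub>n;\<rho>)\<close> is its dual. The functional \<open>d\<close> is recorded
  by the column vectors \<open>d g\<close> with \<open>\<langle>d, g \<otimes> m\<rangle> = m \<cdot> d g\<close>. The two conditions on one-letter words make
  \<open>d\<close> a function on \<open>\<pi>\<^sub>1\<close> rather than on words.\<close>

definition H1lf :: "xchar list \<Rightarrow> (fword \<Rightarrow> complex^2) set"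
  where "H1lf a = {d.
    (\<forall>w. w \<notin> fwords (length a) \<longrightarrow> d w = 0) \<and>
    (\<forall>u\<in>fwords (length a). \<forall>v\<in>fwords (length a). d (u @ v) = d u + rho a u *v d v) \<and>
    (\<forall>j\<in>{1..length a}. d [(j, True), (j, False)] = 0 \<and> d [(j, False), (j, True)] = 0) \<and>
    d (y_loop (length a)) = 0}"

definition zdual :: "xchar list \<Rightarrow> nat \<Rightarrow> 2 \<Rightarrow> fword \<Rightarrow> complex^2"
  where "zdual a j m = (THE d. d \<in> H1lf a \<and>
    (\<forall>k\<in>{1..<length a}. d (y_loop k) = (if k = j then axis m 1 else 0)))"

definition vbas :: "xchar list \<Rightarrow> nat \<Rightarrow> 2 \<Rightarrow> fword \<Rightarrow> complex^2"
  where "vbas a j nu = (\<lambda>w. \<Sum>m\<in>UNIV.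
    (transpose (prodp a j) $ (if nu = 1 then 2 else 1) $ m) *s zdual a j m w)"

text \<open>The automorphism of the free group induced by a braid generator. For \<open>\<sigma>\<^sub>i: a \<rightarrow> b\<close> it satisfies
  \<open>rho b = rho a \<circ> braid_subst (Sig i)\<close> and fixes \<open>y\<^sub>n\<close>, so that it induces a map
  \<open>H\<^sub>1(D\<^sub>n,\<partial>D\<^sub>n;\<rho>') \<rightarrow> H\<^sub>1(D\<^sub>n,\<partial>D\<^sub>n;\<rho>)\<close>; the Burau map is its transpose.\<close>

fun artin :: "bgen \<Rightarrow> nat \<Rightarrow> fword" where
  "artin (Sig i) j =
    (if j = i then [(i, False), (Suc i, True), (i, True)]
     else if j = Suc i then [(i, True)] else [(j, True)])"
| "artin (SigInv i) j =
    (if j = i then [(Suc i, True)]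
     else if j = Suc i then [(Suc i, True), (i, True), (Suc i, False)] else [(j, True)])"

definition word_inv :: "fword \<Rightarrow> fword"
  where "word_inv w = rev (map (\<lambda>(j, e). (j, \<not> e)) w)"

definition braid_subst :: "bgen \<Rightarrow> fword \<Rightarrow> fword"
  where "braid_subst g w =
    concat (map (\<lambda>(j, e). if e then artin g j else word_inv (artin g j)) w)"

definition burau :: "bgen list \<Rightarrow> (fword \<Rightarrow> complex^2) \<Rightarrow> (fword \<Rightarrow> complex^2)"
  where "burau \<beta> = fold (\<lambda>g d. d \<circ> braid_subst g) \<beta>"


section \<open>The two isomorphisms\<close>

text \<open>An algebra map out of the exterior algebra is determined by its linear restriction to degree
  one, hence by the images of the basis \<open>v\<^sub>j\<^sup>\<nu>\<close>.\<close>

definition Phi_iso ::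
  "xchar list \<Rightarrow> ((fword \<Rightarrow> complex^2) falg set \<Rightarrow> ualg set) \<Rightarrow> bool"
  where "Phi_iso a L \<longleftrightarrow>
    L \<in> ring_iso (exterior (H1lf a)) (cliff_red a) \<and>
    (\<forall>c. L (ext_cls (H1lf a) (cst c)) = cliff_cls a (cst c)) \<and>
    (\<forall>j nu. 1 \<le> j \<and> j < length a \<longrightarrow>
      L (ext_cls (H1lf a) (gvar (vbas a j nu))) = cliff_cls a (theta (length a) j nu)) \<and>
    (\<forall>par. L ` ext_part (H1lf a) par = cliff_part a par)"

definition mult_iso ::
  "(xchar \<Rightarrow> umod) \<Rightarrow> xchar list \<Rightarrow> complex \<Rightarrow> (ualg set \<Rightarrow> mult_elem) \<Rightarrow> bool"
  where "mult_iso V a mu \<Psi> \<longleftrightarrow>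
    bij_betw \<Psi> (carrier (cliff_red a)) (mult_super V a mu) \<and>
    (\<forall>x\<in>carrier (cliff_red a). \<forall>y\<in>carrier (cliff_red a).
      \<Psi> (x \<oplus>\<^bsub>cliff_red a\<^esub> y) = (\<lambda>e1 e2 b c s. \<Psi> x e1 e2 b c s + \<Psi> y e1 e2 b c s)) \<and>
    (\<forall>k. \<forall>x\<in>carrier (cliff_red a).
      \<Psi> (cliff_cls a (cst k) \<otimes>\<^bsub>cliff_red a\<^esub> x) = (\<lambda>e1 e2 b c s. k * \<Psi> x e1 e2 b c s)) \<and>
    (\<forall>par. \<Psi> ` cliff_part a par = mult_part V a mu par) \<and>
    (\<forall>x\<in>carrier (cliff (length a)).
      mult_vec (\<Psi> (cliff_cls a x)) = act V a x (vac (length a)))"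

end

theory Submission
  imports Defs
begin

text \<open>Modulo a character, \<open>\<theta>\<^sub>j\<^sup>\<nu> = A + B\<close> with \<open>A\<close> built from the modules and \<open>B\<close> from their duals. The
  elements \<open>\<theta>\<^sub>j\<^sup>\<nu>\<close> anticommute and square to zero, because the contributions of \<open>A\<close> and \<open>B\<close> cancel. The
  differences \<open>A - B\<close> kill the vacuum and give annihilation operators, so that the exterior algebra on
  the \<open>\<theta>\<^sub>j\<^sup>\<nu>\<close> acts faithfully on the vacuum, as on a Fock space; its image is the common kernel of the last pair
  of annihilation operators, whose elements are exactly the vectors invariant under the total
  coproducts. Projecting with the Casimir element and the dual basis of \<open>1, K, E, KF\<close> identifies the
  invariant vectors with the multiplicity superspace. For the braiding, \<open>A\<close> and \<open>B\<close> anticommute and agree on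
  the vacuum, so a word in the \<open>\<theta>\<^sub>j\<^sup>\<nu>\<close> on the vacuum is a polynomial in the \<open>A\<close> alone, and it
  suffices to compute the action of R-check on the module side and to compare it with the action of the
  braid on twisted cocycles.\<close>

section \<open>Free algebras\<close>

text \<open>The Clifford relations are needed in two places: as identities of operators, and as
  membership in an ideal of a free algebra, because \<open>cliff_red\<close> is a quotient of a ring
  of words. They are computed once, over any ring with central scalars (\<open>usites\<close>,
  \<open>uchain\<close>), and instantiated at the operators \<open>lop\<close> and at the quotient
  type \<open>uq\<close>. The latter contains all positions, and \<open>retr\<close> brings its
  relations back to the first \<open>n\<close> factors. Nonsingularity enters through determinants.
  At each factor the anticommutators of E and KF form a 2x2 matrix with determinant proportional to
  kappa * omega^2. Its inverse gives annihilators dual to the creators; it also makes 1, K, E, KF a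
  basis of all matrices, which forces a vector killed by all annihilators to be a multiple of the
  vacuum. For the total character the same basis yields matrix units on the isotypic parts. The
  grading is read off from \<open>NN\<close>, the product of the total K on both sides: it fixes the
  vacuum, anticommutes with every theta, and is 1 or -1 on a block according to whether the two
  signs agree. In the braiding, summation by parts turns the coordinates of a class into differences
  of cocycle values in moving frames, and these transform like the \<open>al\<close>.\<close>

lemma falg_sum_single:
  fixes x :: "'g falg"
  shows "x = (\<Sum>w\<in>Poly_Mapping.keys x. Poly_Mapping.single w (Poly_Mapping.lookup x w))"
  by (rule poly_mapping_eqI)
    (simp add: lookup_sum lookup_single when_def in_keys_iff)

lemma cst_add: "cst (c + d) = cst c + cst d"
  and cst_mult: "cst (c * d) = cst c * cst d"
  and cst_0 [simp]: "cst 0 = 0"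
  and cst_1 [simp]: "cst 1 = 1"
  and cst_uminus: "cst (- c) = - cst c"
  and cst_diff: "cst (c - d) = cst c - cst d"
  by (simp_all add: cst_def single_add mult_single single_uminus single_diff)

lemma cst_mult_single: "cst c * Poly_Mapping.single w d = Poly_Mapping.single w (c * d)"
  and single_mult_cst: "Poly_Mapping.single w d * cst c = Poly_Mapping.single w (c * d)"
  by (simp_all add: cst_def mult_single mult.commute)

lemma cst_central: "cst c * x = x * cst c"
proof -
  have "cst c * (\<Sum>w\<in>A. Poly_Mapping.single w (f w)) =
      (\<Sum>w\<in>A. Poly_Mapping.single w (f w)) * cst c" for A and f :: "'a fmon \<Rightarrow> complex"
    by (simp add: sum_distrib_left sum_distrib_right cst_mult_single single_mult_cst)
  then show ?thesis
    by (subst (1 2) falg_sum_single[of x]) blast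
qed

lemma fmon_add: "Word u + Word v = Word (u @ v)"
  by (simp add: plus_fmon_def)

lemma fmon_zero: "0 = Word []"
  by (simp add: zero_fmon_def)

lemma prod_gvar: "prod_list (map gvar ls) = Poly_Mapping.single (Word ls) (1::complex)"
  by (induction ls) (simp_all add: gvar_def mult_single fmon_add flip: fmon_zero)

lemma single_word:
  "Poly_Mapping.single w c = cst c * prod_list (map gvar (letters w))"
  by (simp add: prod_gvar cst_mult_single)

lemma falg_expand:
  "x = (\<Sum>w\<in>Poly_Mapping.keys x. cst (Poly_Mapping.lookup x w) * prod_list (map gvar (letters w)))"
  by (subst falg_sum_single) (simp add: single_word)

lemma falg_sum_induct:
  fixes x :: "'g falg"
  assumes "\<And>w c. w \<in> Poly_Mapping.keys x \<Longrightarrow> P (Poly_Mapping.single w c)" and "P 0"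
    and "\<And>x y. P x \<Longrightarrow> P y \<Longrightarrow> P (x + y)"
  shows "P x"
proof -
  have "P (\<Sum>w\<in>A. Poly_Mapping.single w (Poly_Mapping.lookup x w))"
    if "finite A" "A \<subseteq> Poly_Mapping.keys x" for A
    using that assms by (induction A) auto
  from this[of "Poly_Mapping.keys x"] show ?thesis
    using falg_sum_single[of x] by simp
qed

lemma free_carrier: "carrier (free_ring G) = {p. \<forall>w\<in>Poly_Mapping.keys p. set (letters w) \<subseteq> G}"
  and free_ops [simp]: "mult (free_ring G) = (*)" "one (free_ring G) = 1"
    "zero (free_ring G) = 0" "add (free_ring G) = (+)"
  by (simp_all add: free_ring_def)

lemma free_cst [simp]: "cst c \<in> carrier (free_ring G)"
  by (simp add: free_carrier cst_def zero_fmon_def)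

lemma free_gvar [simp]: "gvar g \<in> carrier (free_ring G) \<longleftrightarrow> g \<in> G"
  by (simp add: free_carrier gvar_def)

lemma free_0 [simp]: "0 \<in> carrier (free_ring G)"
  by (simp add: free_carrier)

lemma free_1 [simp]: "1 \<in> carrier (free_ring G)"
  using free_cst[of 1] by simp

lemma free_add: "x \<in> carrier (free_ring G) \<Longrightarrow> y \<in> carrier (free_ring G) \<Longrightarrow>
    x + y \<in> carrier (free_ring G)"
  using keys_add[of x y] by (auto simp: free_carrier)

lemma free_uminus: "x \<in> carrier (free_ring G) \<Longrightarrow> - x \<in> carrier (free_ring G)"
  by (simp add: free_carrier in_keys_iff)

lemma free_diff: "x \<in> carrier (free_ring G) \<Longrightarrow> y \<in> carrier (free_ring G) \<Longrightarrow>
    x - y \<in> carrier (free_ring G)"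
  using free_add[OF _ free_uminus, of x G y] by simp

lemma free_mult: "x \<in> carrier (free_ring G) \<Longrightarrow> y \<in> carrier (free_ring G) \<Longrightarrow>
    x * y \<in> carrier (free_ring G)"
  using keys_mult[of x y] by (auto simp: free_carrier plus_fmon_def; fastforce)

lemma free_sum: "(\<And>i. i \<in> A \<Longrightarrow> f i \<in> carrier (free_ring G)) \<Longrightarrow> sum f A \<in> carrier (free_ring G)"
  by (induction A rule: infinite_finite_induct) (auto intro: free_add)

lemma free_prod_list: "set (xs) \<subseteq> carrier (free_ring G) \<Longrightarrow> prod_list xs \<in> carrier (free_ring G)"
  by (induction xs) (auto intro: free_mult)

lemmas free_intros = free_add free_uminus free_diff free_mult free_sum

text \<open>An element is a sum of multiples of words, and a word grows by putting letters in front.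
  Membership in the carrier is carried along because the step hypotheses ask for it.\<close>

lemma free_ring_induct [consumes 1, case_names cst gvar_mult add]:
  assumes x: "x \<in> carrier (free_ring G)"
    and c: "\<And>c. P (cst c)"
    and g: "\<And>g x. g \<in> G \<Longrightarrow> x \<in> carrier (free_ring G) \<Longrightarrow> P x \<Longrightarrow> P (gvar g * x)"
    and a: "\<And>x y. x \<in> carrier (free_ring G) \<Longrightarrow> y \<in> carrier (free_ring G) \<Longrightarrow> P x \<Longrightarrow> P y \<Longrightarrow> P (x + y)"
  shows "P x"
proof -
  have w: "P (Poly_Mapping.single (Word ls) c) \<and>
      Poly_Mapping.single (Word ls) c \<in> carrier (free_ring G)" if "set ls \<subseteq> G" for ls c
    using that
  proof (induction ls)
    case Nil
    then show ?case
      using c[of c] free_cst[of c G] by (simp add: cst_def zero_fmon_def)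
  next
    case (Cons l ls)
    have e: "Poly_Mapping.single (Word (l # ls)) c = gvar l * Poly_Mapping.single (Word ls) c"
      by (simp add: gvar_def mult_single fmon_add)
    show ?case
      unfolding e using Cons g[of l "Poly_Mapping.single (Word ls) c"] by (auto intro!: free_mult)
  qed
  have "P x \<and> x \<in> carrier (free_ring G)"
  proof (rule falg_sum_induct)
    fix u d
    assume "u \<in> Poly_Mapping.keys x"
    then show "P (Poly_Mapping.single u d) \<and> Poly_Mapping.single u d \<in> carrier (free_ring G)"
      using x w[of "letters u" d] by (auto simp: free_carrier)
  next
    show "P 0 \<and> 0 \<in> carrier (free_ring G)"
      using c[of 0] by simp
  qed (use a free_add in blast)
  then show ?thesis ..
qed

lemma free_UNIV [simp]: "x \<in> carrier (free_ring UNIV)"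
  by (simp add: free_carrier)

lemma ring_free_ring: "ring (free_ring G)"
proof (rule ringI)
  show "abelian_group (free_ring G)"
  proof (rule abelian_groupI)
    fix x assume "x \<in> carrier (free_ring G)"
    then show "\<exists>y\<in>carrier (free_ring G). y \<oplus>\<^bsub>free_ring G\<^esub> x = \<zero>\<^bsub>free_ring G\<^esub>"
      by (intro bexI[of _ "- x"]) (auto intro: free_uminus)
  qed (auto intro: free_add simp: add.assoc add.commute)
  show "monoid (free_ring G)"
    by (rule monoidI) (auto intro: free_mult simp: mult.assoc)
qed (auto simp: algebra_simps)

text \<open>Scalars enter as a central map because free algebras, operators and the quotient
  \<open>uq\<close> are plain rings; one calculus for \<open>sm\<close> then serves all
  three.\<close>

locale calg =
  fixes cs :: "complex \<Rightarrow> 'r::ring_1"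
  assumes cs_add: "cs (c + d) = cs c + cs d"
    and cs_mult: "cs (c * d) = cs c * cs d"
    and cs_1 [simp]: "cs 1 = 1"
    and cs_comm: "cs c * x = x * cs c"
begin

lemma cs_0 [simp]: "cs 0 = 0"
  using cs_add[of 0 0] by simp

lemma cs_uminus: "cs (- c) = - cs c"
  using cs_add[of c "- c"] by (simp add: add_eq_0_iff)

lemma cs_diff: "cs (c - d) = cs c - cs d"
  using cs_add[of c "- d"] by (simp add: cs_uminus)

definition sm :: "complex \<Rightarrow> 'r \<Rightarrow> 'r"
  where "sm c x = cs c * x"

lemma sm_left [simp]: "sm c x * y = sm c (x * y)"
  by (simp add: sm_def mult.assoc)

lemma sm_right [simp]: "x * sm c y = sm c (x * y)"
  unfolding sm_def by (metis cs_comm mult.assoc)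

lemma sm_sm [simp]: "sm c (sm d x) = sm (c * d) x"
  by (simp add: sm_def cs_mult mult.assoc)

lemma sm_add: "sm c (x + y) = sm c x + sm c y"
  by (simp add: sm_def distrib_left)

lemma sm_diff: "sm c (x - y) = sm c x - sm c y"
  by (simp add: sm_def right_diff_distrib)

lemma sm_uminus: "sm c (- x) = - sm c x"
  by (simp add: sm_def)

lemma sm_uminus_left: "sm (- c) x = - sm c x"
  by (simp add: sm_def cs_uminus)

lemma sm_add_left: "sm (c + d) x = sm c x + sm d x"
  by (simp add: sm_def cs_add distrib_right)

lemma sm_diff_left: "sm (c - d) x = sm c x - sm d x"
  by (simp add: sm_def cs_diff left_diff_distrib)

lemma sm_1 [simp]: "sm 1 x = x" and sm_0 [simp]: "sm 0 x = 0" and sm_zero [simp]: "sm c 0 = 0"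
  by (simp_all add: sm_def)

lemma sm_sum: "sm c (sum f A) = (\<Sum>i\<in>A. sm c (f i))"
  by (simp add: sm_def sum_distrib_left)

text \<open>The universal property of the free algebra. Actions on tensors, the passage to
  \<open>uq\<close> and maps between free algebras are all instances.\<close>

definition ev :: "('g \<Rightarrow> 'r) \<Rightarrow> 'g falg \<Rightarrow> 'r"
  where "ev f x = (\<Sum>w\<in>Poly_Mapping.keys x. cs (Poly_Mapping.lookup x w) * prod_list (map f (letters w)))"

lemma ev_superset:
  assumes "finite A" "Poly_Mapping.keys x \<subseteq> A"
  shows "ev f x = (\<Sum>w\<in>A. cs (Poly_Mapping.lookup x w) * prod_list (map f (letters w)))"
  unfolding ev_def by (rule sum.mono_neutral_left) (use assms in \<open>auto simp: in_keys_iff\<close>)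

lemma ev_add: "ev f (x + y) = ev f x + ev f y"
proof -
  let ?A = "Poly_Mapping.keys x \<union> Poly_Mapping.keys y"
  have "Poly_Mapping.keys (x + y) \<subseteq> ?A" by (rule keys_add)
  then show ?thesis
    by (simp add: ev_superset[of ?A] lookup_add cs_add distrib_right sum.distrib)
qed

lemma ev_0 [simp]: "ev f 0 = 0"
  by (simp add: ev_def)

lemma ev_single: "ev f (Poly_Mapping.single w c) = cs c * prod_list (map f (letters w))"
  by (cases "c = 0") (simp_all add: ev_def)

lemma ev_cst [simp]: "ev f (cst c) = cs c"
  by (simp add: cst_def ev_single zero_fmon_def)

lemma ev_gvar [simp]: "ev f (gvar g) = f g"
  by (simp add: gvar_def ev_single)

lemma ev_1 [simp]: "ev f 1 = 1"
  using ev_cst[of f 1] by simp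

lemma ev_uminus: "ev f (- x) = - ev f x"
  using ev_add[of f x "- x"] by (simp add: add_eq_0_iff)

lemma ev_diff: "ev f (x - y) = ev f x - ev f y"
  using ev_add[of f x "- y"] by (simp add: ev_uminus)

lemma ev_sum: "ev f (sum g A) = (\<Sum>i\<in>A. ev f (g i))"
  by (induction A rule: infinite_finite_induct) (auto simp: ev_add)

lemma ev_mult: "ev f (x * y) = ev f x * ev f y"
proof (induction x rule: falg_sum_induct)
  case (1 u c)
  show ?case
  proof (induction y rule: falg_sum_induct)
    case (1 v d)
    have *: "p * (cs d * r) = cs d * (p * r)" for p r
      by (metis cs_comm mult.assoc)
    show ?case
      by (simp add: mult_single ev_single plus_fmon_def cs_mult mult.assoc *)
  qed (simp_all add: ev_add distrib_left)
qed (simp_all add: ev_add distrib_right)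

lemma ev_prod_list: "ev f (prod_list xs) = prod_list (map (ev f) xs)"
  by (induction xs) (simp_all add: ev_mult)

lemma ev_cong:
  assumes "x \<in> carrier (free_ring G)" "\<And>g. g \<in> G \<Longrightarrow> f g = f' g"
  shows "ev f x = ev f' x"
  using assms(1) by (induction rule: free_ring_induct) (auto simp: ev_add ev_mult assms(2))

end

interpretation fa: calg "cst :: complex \<Rightarrow> 'g falg"
  by standard (simp_all add: cst_add cst_mult, rule cst_central)

lemma fa_ev_gvar: "fa.ev gvar x = x"
  using free_UNIV[of x] by (induction rule: free_ring_induct) (auto simp: fa.ev_add fa.ev_mult)

lemma fa_ev_carrier:
  assumes "x \<in> carrier (free_ring G)" "\<And>g. g \<in> G \<Longrightarrow> h g \<in> carrier (free_ring G')"
  shows "fa.ev h x \<in> carrier (free_ring G')"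
  using assms(1)
  by (induction rule: free_ring_induct) (auto simp: fa.ev_add fa.ev_mult assms(2) intro!: free_intros)

section \<open>Maps between quotient rings\<close>

text \<open>The union over all representatives avoids a choice. Its members coincide as soon as
  \<open>h\<close> sends the first ideal into the second.\<close>

definition quot_map :: "('b, 'n) ring_scheme \<Rightarrow> 'b set \<Rightarrow> ('a \<Rightarrow> 'b) \<Rightarrow> 'a set \<Rightarrow> 'b set"
  where "quot_map S J h X = (\<Union>x\<in>X. J +>\<^bsub>S\<^esub> h x)"

lemma Idl_least: "ideal I R \<Longrightarrow> X \<subseteq> I \<Longrightarrow> Idl\<^bsub>R\<^esub> X \<subseteq> I"
  unfolding genideal_def by auto

locale ideal_pair = R?: ideal I R + S?: ideal J S for I R J S +
  fixes h
  assumes h: "h \<in> ring_hom R S" and IJ: "x \<in> I \<Longrightarrow> h x \<in> J"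
begin

lemmas h_closed = ring_hom_closed[OF h]
  and h_mult = ring_hom_mult[OF h]
  and h_add = ring_hom_add[OF h]
  and h_one = ring_hom_one[OF h]

lemma quot_map_coset:
  assumes x: "x \<in> carrier R"
  shows "quot_map S J h (I +>\<^bsub>R\<^esub> x) = J +>\<^bsub>S\<^esub> h x"
proof -
  have "J +>\<^bsub>S\<^esub> h y = J +>\<^bsub>S\<^esub> h x" if y: "y \<in> I +>\<^bsub>R\<^esub> x" for y
  proof -
    obtain i where i: "i \<in> I" "y = i \<oplus>\<^bsub>R\<^esub> x"
      using y unfolding a_r_coset_def' by blast
    then have "h y = h i \<oplus>\<^bsub>S\<^esub> h x"
      using x h_add R.Icarr by blast
    then have "h y \<in> J +>\<^bsub>S\<^esub> h x"
      using IJ[OF i(1)] unfolding a_r_coset_def' by blast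
    then show ?thesis
      using S.a_repr_independence[OF _ h_closed[OF x] S.a_subgroup] by metis
  qed
  moreover have "x \<in> I +>\<^bsub>R\<^esub> x"
    using x by (rule R.a_rcos_self)
  ultimately show ?thesis
    unfolding quot_map_def by blast
qed

lemma coset_carrier: "X \<in> carrier (R Quot I) \<longleftrightarrow> (\<exists>x\<in>carrier R. X = I +>\<^bsub>R\<^esub> x)"
  and coset_carrier': "Y \<in> carrier (S Quot J) \<longleftrightarrow> (\<exists>y\<in>carrier S. Y = J +>\<^bsub>S\<^esub> y)"
  by (simp_all only: FactRing_def partial_object.simps A_RCOSETS_def', blast+)

lemma coset_ops:
  "x \<in> carrier R \<Longrightarrow> y \<in> carrier R \<Longrightarrow>
    (I +>\<^bsub>R\<^esub> x) \<otimes>\<^bsub>R Quot I\<^esub> (I +>\<^bsub>R\<^esub> y) = I +>\<^bsub>R\<^esub> (x \<otimes>\<^bsub>R\<^esub> y)"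
  "x \<in> carrier R \<Longrightarrow> y \<in> carrier R \<Longrightarrow>
    (I +>\<^bsub>R\<^esub> x) \<oplus>\<^bsub>R Quot I\<^esub> (I +>\<^bsub>R\<^esub> y) = I +>\<^bsub>R\<^esub> (x \<oplus>\<^bsub>R\<^esub> y)"
  "\<one>\<^bsub>R Quot I\<^esub> = I +>\<^bsub>R\<^esub> \<one>\<^bsub>R\<^esub>"
  using ring_hom_mult[OF R.rcos_ring_hom] ring_hom_add[OF R.rcos_ring_hom]
    ring_hom_one[OF R.rcos_ring_hom] by simp_all

lemma coset_ops':
  "x \<in> carrier S \<Longrightarrow> y \<in> carrier S \<Longrightarrow>
    (J +>\<^bsub>S\<^esub> x) \<otimes>\<^bsub>S Quot J\<^esub> (J +>\<^bsub>S\<^esub> y) = J +>\<^bsub>S\<^esub> (x \<otimes>\<^bsub>S\<^esub> y)"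
  "x \<in> carrier S \<Longrightarrow> y \<in> carrier S \<Longrightarrow>
    (J +>\<^bsub>S\<^esub> x) \<oplus>\<^bsub>S Quot J\<^esub> (J +>\<^bsub>S\<^esub> y) = J +>\<^bsub>S\<^esub> (x \<oplus>\<^bsub>S\<^esub> y)"
  "\<one>\<^bsub>S Quot J\<^esub> = J +>\<^bsub>S\<^esub> \<one>\<^bsub>S\<^esub>"
  using ring_hom_mult[OF S.rcos_ring_hom] ring_hom_add[OF S.rcos_ring_hom]
    ring_hom_one[OF S.rcos_ring_hom] by simp_all

lemma quot_map_hom: "quot_map S J h \<in> ring_hom (R Quot I) (S Quot J)"
proof (rule ring_hom_memI)
  fix X assume "X \<in> carrier (R Quot I)"
  then obtain x where x: "x \<in> carrier R" "X = I +>\<^bsub>R\<^esub> x" using coset_carrier by blast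
  then show "quot_map S J h X \<in> carrier (S Quot J)"
    unfolding coset_carrier' x(2) quot_map_coset[OF x(1)] using h_closed by blast
next
  fix X Y assume "X \<in> carrier (R Quot I)" "Y \<in> carrier (R Quot I)"
  then obtain x y where xy: "x \<in> carrier R" "X = I +>\<^bsub>R\<^esub> x" "y \<in> carrier R" "Y = I +>\<^bsub>R\<^esub> y"
    unfolding coset_carrier by blast
  show "quot_map S J h (X \<otimes>\<^bsub>R Quot I\<^esub> Y) = quot_map S J h X \<otimes>\<^bsub>S Quot J\<^esub> quot_map S J h Y"
    unfolding xy(2,4) coset_ops(1)[OF xy(1,3)] quot_map_coset[OF xy(1)] quot_map_coset[OF xy(3)]
      quot_map_coset[OF R.m_closed[OF xy(1,3)]] coset_ops'(1)[OF h_closed h_closed, OF xy(1,3)]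
      h_mult[OF xy(1,3)] ..
  show "quot_map S J h (X \<oplus>\<^bsub>R Quot I\<^esub> Y) = quot_map S J h X \<oplus>\<^bsub>S Quot J\<^esub> quot_map S J h Y"
    unfolding xy(2,4) coset_ops(2)[OF xy(1,3)] quot_map_coset[OF xy(1)] quot_map_coset[OF xy(3)]
      quot_map_coset[OF R.a_closed[OF xy(1,3)]] coset_ops'(2)[OF h_closed h_closed, OF xy(1,3)]
      h_add[OF xy(1,3)] ..
next
  show "quot_map S J h \<one>\<^bsub>R Quot I\<^esub> = \<one>\<^bsub>S Quot J\<^esub>"
    unfolding coset_ops(3) coset_ops'(3) quot_map_coset[OF R.one_closed] h_one ..
qed

text \<open>Bijectivity is asked of \<open>h\<close> only up to the ideals, the form in which it
  becomes available later: injectivity from faithfulness on the vacuum, surjectivity from lifting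
  Clifford elements to the exterior algebra.\<close>

lemma quot_map_iso:
  assumes inj: "\<And>x. x \<in> carrier R \<Longrightarrow> h x \<in> J \<Longrightarrow> x \<in> I"
    and surj: "\<And>y. y \<in> carrier S \<Longrightarrow> \<exists>x\<in>carrier R. J +>\<^bsub>S\<^esub> h x = J +>\<^bsub>S\<^esub> y"
  shows "quot_map S J h \<in> ring_iso (R Quot I) (S Quot J)"
proof -
  have "inj_on (quot_map S J h) (carrier (R Quot I))"
  proof (rule inj_onI)
    fix X Y assume "X \<in> carrier (R Quot I)" "Y \<in> carrier (R Quot I)"
      and e: "quot_map S J h X = quot_map S J h Y"
    then obtain x y where xy: "x \<in> carrier R" "X = I +>\<^bsub>R\<^esub> x" "y \<in> carrier R" "Y = I +>\<^bsub>R\<^esub> y"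
      unfolding coset_carrier by blast
    have "J +>\<^bsub>S\<^esub> h x = J +>\<^bsub>S\<^esub> h y"
      using e unfolding xy(2,4) quot_map_coset[OF xy(1)] quot_map_coset[OF xy(3)] .
    then have J: "h x \<ominus>\<^bsub>S\<^esub> h y \<in> J"
      using S.quotient_eq_iff_same_a_r_cos[OF S.ideal_axioms h_closed h_closed, OF xy(1,3)] by blast
    have "h (x \<ominus>\<^bsub>R\<^esub> y) \<oplus>\<^bsub>S\<^esub> h y = h x"
      unfolding h_add[OF R.minus_closed[OF xy(1,3)] xy(3), symmetric]
      using xy(1,3) by (simp add: R.minus_eq R.a_assoc R.l_neg)
    then have "h (x \<ominus>\<^bsub>R\<^esub> y) = h x \<ominus>\<^bsub>S\<^esub> h y"
      using h_closed[OF R.minus_closed[OF xy(1,3)]] h_closed[OF xy(3)]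
      by (simp add: S.minus_eq S.a_assoc S.r_neg flip: \<open>_ = h x\<close>)
    then have "x \<ominus>\<^bsub>R\<^esub> y \<in> I"
      using J inj[OF R.minus_closed[OF xy(1,3)]] by simp
    then show "X = Y"
      using R.quotient_eq_iff_same_a_r_cos[OF R.ideal_axioms xy(1,3)] xy by blast
  qed
  moreover have "quot_map S J h ` carrier (R Quot I) = carrier (S Quot J)"
  proof
    show "quot_map S J h ` carrier (R Quot I) \<subseteq> carrier (S Quot J)"
      using quot_map_hom unfolding ring_hom_def by blast
    show "carrier (S Quot J) \<subseteq> quot_map S J h ` carrier (R Quot I)"
    proof
      fix Y assume "Y \<in> carrier (S Quot J)"
      then obtain y where y: "y \<in> carrier S" "Y = J +>\<^bsub>S\<^esub> y"
        unfolding coset_carrier' by blast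
      then obtain x where x: "x \<in> carrier R" "J +>\<^bsub>S\<^esub> h x = J +>\<^bsub>S\<^esub> y" using surj by blast
      have "Y = quot_map S J h (I +>\<^bsub>R\<^esub> x)"
        unfolding quot_map_coset[OF x(1)] x(2) y(2) ..
      moreover have "I +>\<^bsub>R\<^esub> x \<in> carrier (R Quot I)"
        using x(1) unfolding coset_carrier by blast
      ultimately show "Y \<in> quot_map S J h ` carrier (R Quot I)" by blast
    qed
  qed
  ultimately show ?thesis
    using quot_map_hom unfolding ring_iso_def bij_betw_def by blast
qed

end

section \<open>Linear operators on tensors\<close>

text \<open>Linearity on all functions, not only on those supported on given factors, makes the
  operators a type of class \<open>ring_1\<close>, so that ring rewriting applies; preservation of
  \<open>tens\<close> is tracked separately.\<close>

typedef lop = "{T :: tensor \<Rightarrow> tensor. \<forall>c d f g. T (\<lambda>s. c * f s + d * g s) = (\<lambda>s. c * T f s + d * T g s)}"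
  morphisms app Lop
  by (rule exI[of _ id]) simp

setup_lifting type_definition_lop

lemma app_lin: "app x (\<lambda>s. c * f s + d * g s) = (\<lambda>s. c * app x f s + d * app x g s)"
  using app[of x] by simp

lemma lop_eqI: "(\<And>f s. app x f s = app y f s) \<Longrightarrow> x = y"
  by (metis app_inject ext)

instantiation lop :: ring_1
begin
lift_definition zero_lop :: lop is "\<lambda>f s. 0" by simp
lift_definition one_lop :: lop is "\<lambda>f. f" by simp
lift_definition plus_lop :: "lop \<Rightarrow> lop \<Rightarrow> lop" is "\<lambda>x y f s. x f s + y f s"
  by (simp add: algebra_simps)
lift_definition minus_lop :: "lop \<Rightarrow> lop \<Rightarrow> lop" is "\<lambda>x y f s. x f s - y f s"
  by (simp add: algebra_simps)
lift_definition uminus_lop :: "lop \<Rightarrow> lop" is "\<lambda>x f s. - x f s"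
  by simp
lift_definition times_lop :: "lop \<Rightarrow> lop \<Rightarrow> lop" is "\<lambda>x y f. x (y f)"
  by simp
instance
proof
  fix x y z :: lop
  note r = zero_lop.rep_eq one_lop.rep_eq plus_lop.rep_eq minus_lop.rep_eq
    uminus_lop.rep_eq times_lop.rep_eq
  show "x * (y + z) = x * y + x * z"
    by (rule lop_eqI) (use app_lin[of x 1 _ 1] in \<open>simp add: r\<close>)
  show "(0::lop) \<noteq> 1"
  proof
    assume "(0::lop) = 1"
    then have "app 0 (\<lambda>_. 1) (\<lambda>_. 1) = app 1 (\<lambda>_. 1) (\<lambda>_. 1)" by simp
    then show False by (simp add: r)
  qed
qed (rule lop_eqI; simp add: zero_lop.rep_eq one_lop.rep_eq plus_lop.rep_eq minus_lop.rep_eq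
    uminus_lop.rep_eq times_lop.rep_eq)+
end

lift_definition lcs :: "complex \<Rightarrow> lop" is "\<lambda>c f s. c * f s"
  by (simp add: fun_eq_iff algebra_simps)

lemma app_simps [simp]:
  "app 0 f = (\<lambda>s. 0)" "app 1 f = f" "app (x + y) f = (\<lambda>s. app x f s + app y f s)"
  "app (x - y) f = (\<lambda>s. app x f s - app y f s)" "app (- x) f = (\<lambda>s. - app x f s)"
  "app (x * y) f = app x (app y f)" "app (lcs c) f = (\<lambda>s. c * f s)"
  by (simp_all add: zero_lop.rep_eq one_lop.rep_eq plus_lop.rep_eq minus_lop.rep_eq
      uminus_lop.rep_eq times_lop.rep_eq lcs.rep_eq)

lemma app_scale: "app x (\<lambda>s. c * f s) = (\<lambda>s. c * app x f s)"
  using app_lin[of x c f 0 f] by simp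

lemma app_zero [simp]: "app x (\<lambda>s. 0) = (\<lambda>s. 0)"
  using app_scale[of x 0 "\<lambda>_. 0"] by simp

lemma app_add: "app x (\<lambda>s. f s + g s) = (\<lambda>s. app x f s + app x g s)"
  using app_lin[of x 1 f 1 g] by simp

lemma app_diff: "app x (\<lambda>s. f s - g s) = (\<lambda>s. app x f s - app x g s)"
  using app_lin[of x 1 f "-1" g] by simp

lemma app_uminus: "app x (\<lambda>s. - f s) = (\<lambda>s. - app x f s)"
  using app_scale[of x "-1" f] by simp

lemma app_sum: "app x (\<lambda>s. \<Sum>i\<in>A. f i s) = (\<lambda>s. \<Sum>i\<in>A. app x (f i) s)"
  by (induction A rule: infinite_finite_induct) (simp_all add: app_add)

lemma app_sum_left: "app (\<Sum>i\<in>A. x i) f = (\<lambda>s. \<Sum>i\<in>A. app (x i) f s)"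
  by (induction A rule: infinite_finite_induct) simp_all

interpretation lo: calg lcs
proof
  fix c :: complex and x
  show "lcs c * x = x * lcs c"
    by (rule lop_eqI) (simp add: app_scale)
qed (rule lop_eqI; simp add: algebra_simps)+

lemma app_sm [simp]: "app (lo.sm c x) f = (\<lambda>s. c * app x f s)"
  by (simp add: lo.sm_def)

lift_definition opL :: "pos \<Rightarrow> complex^2^2 \<Rightarrow> lop" is op_at
  by (simp add: op_at_def fun_eq_iff sum_distrib_left algebra_simps sum.distrib)

lemma app_opL: "app (opL p M) f = op_at p M f"
  by (simp add: opL.rep_eq)

lemma opL_mult: "opL p M * opL p N = opL p (M ** N)"
proof (rule lop_eqI)
  fix f s
  have "app (opL p M * opL p N) f s =
      (\<Sum>b\<in>UNIV. \<Sum>c\<in>UNIV. M $ s p $ b * (N $ b $ c * f (s(p := c))))"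
    by (simp add: app_opL op_at_def sum_distrib_left)
  also have "\<dots> = (\<Sum>c\<in>UNIV. \<Sum>b\<in>UNIV. M $ s p $ b * (N $ b $ c * f (s(p := c))))"
    by (rule sum.swap)
  also have "\<dots> = app (opL p (M ** N)) f s"
    by (simp add: app_opL op_at_def matrix_matrix_mult_def sum_distrib_right mult.assoc)
  finally show "app (opL p M * opL p N) f s = app (opL p (M ** N)) f s" .
qed

lemma opL_commute:
  assumes "p \<noteq> q"
  shows "opL p M * opL q N = opL q N * opL p M"
proof (rule lop_eqI)
  fix f s
  have "app (opL p M * opL q N) f s =
      (\<Sum>b\<in>UNIV. \<Sum>c\<in>UNIV. M $ s p $ b * (N $ s q $ c * f (s(p := b, q := c))))"
    using assms by (simp add: app_opL op_at_def sum_distrib_left)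
  also have "\<dots> = (\<Sum>c\<in>UNIV. \<Sum>b\<in>UNIV. M $ s p $ b * (N $ s q $ c * f (s(p := b, q := c))))"
    by (rule sum.swap)
  also have "\<dots> = app (opL q N * opL p M) f s"
    using assms by (simp add: app_opL op_at_def sum_distrib_left fun_upd_twist mult.left_commute)
  finally show "app (opL p M * opL q N) f s = app (opL q N * opL p M) f s" .
qed

lemma opL_add: "opL p (M + N) = opL p M + opL p N"
  by (rule lop_eqI) (simp add: app_opL op_at_def distrib_right sum.distrib)

lemma opL_diff: "opL p (M - N) = opL p M - opL p N"
  by (rule lop_eqI) (simp add: app_opL op_at_def left_diff_distrib sum_subtractf)

lemma opL_uminus: "opL p (- M) = - opL p M"
  by (rule lop_eqI) (simp add: app_opL op_at_def sum_negf)

lemma opL_mat: "opL p (mat c) = lcs c"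
proof (rule lop_eqI)
  fix f :: tensor and s
  have "(\<Sum>b\<in>UNIV. (if s p = b then c else 0) * f (s(p := b))) =
      (\<Sum>b\<in>UNIV. if s p = b then c * f s else 0)"
    by (rule sum.cong) auto
  then show "app (opL p (mat c)) f s = app (lcs c) f s"
    by (simp add: app_opL op_at_def mat_def)
qed

text \<open>A bridge in both directions: the product \<open>**\<close> of matrices is not the
  multiplication of a ring class, so matrix identities are proved by rewriting in \<open>lop\<close>
  and pulled back along this injection.\<close>

lemma opL_inj:
  assumes "opL p M = opL p N"
  shows "M = N"
proof -
  have "M $ i $ j = N $ i $ j" for i j
  proof -
    let ?f = "\<lambda>s. if s p = j then 1 else (0::complex)"
    have e: "op_at p X ?f (\<lambda>_. i) = X $ i $ j" for X
    proof -
      have "op_at p X ?f (\<lambda>_. i) = (\<Sum>b\<in>UNIV. if b = j then X $ i $ b else 0)"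
        unfolding op_at_def by (rule sum.cong) auto
      then show ?thesis by simp
    qed
    show ?thesis
      using assms e[of M] e[of N] by (metis app_opL)
  qed
  then show ?thesis
    by (simp add: vec_eq_iff)
qed

definition gL :: "(xchar \<Rightarrow> umod) \<Rightarrow> xchar list \<Rightarrow> pos \<times> ugen \<Rightarrow> lop"
  where "gL V a = (\<lambda>(p, g). opL p (gen_mat (pos_mod V a p) g))"

abbreviation actL :: "(xchar \<Rightarrow> umod) \<Rightarrow> xchar list \<Rightarrow> ualg \<Rightarrow> lop"
  where "actL V a \<equiv> lo.ev (gL V a)"

lemma act_actL: "act V a x f = app (actL V a x) f"
proof
  fix s
  have "foldr (\<lambda>(p, g). op_at p (gen_mat (pos_mod V a p) g)) ls f = app (prod_list (map (gL V a) ls)) f" for ls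
    by (induction ls) (auto simp: gL_def app_opL)
  then show "act V a x f s = app (actL V a x) f s"
    by (simp add: act_def lo.ev_def app_sum_left)
qed

lemma indices_upd: "s \<in> indices P \<Longrightarrow> p \<in> P \<Longrightarrow> s(p := b) \<in> indices P"
  and indices_upd_iff: "p \<in> P \<Longrightarrow> s(p := b) \<in> indices P \<longleftrightarrow> s \<in> indices P"
  by (auto simp: indices_def)

lemma tens_zero [simp]: "(\<lambda>s. 0) \<in> tens P"
  and tens_add: "f \<in> tens P \<Longrightarrow> g \<in> tens P \<Longrightarrow> (\<lambda>s. f s + g s) \<in> tens P"
  and tens_diff: "f \<in> tens P \<Longrightarrow> g \<in> tens P \<Longrightarrow> (\<lambda>s. f s - g s) \<in> tens P"
  and tens_scale: "f \<in> tens P \<Longrightarrow> (\<lambda>s. c * f s) \<in> tens P"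
  and tens_uminus: "f \<in> tens P \<Longrightarrow> (\<lambda>s. - f s) \<in> tens P"
  and tens_sum: "(\<And>i. i \<in> A \<Longrightarrow> h i \<in> tens P) \<Longrightarrow> (\<lambda>s. \<Sum>i\<in>A. h i s) \<in> tens P"
  by (auto simp: tens_def)

lemma tens_opL: "f \<in> tens P \<Longrightarrow> p \<in> P \<Longrightarrow> app (opL p M) f \<in> tens P"
  by (simp add: tens_def app_opL op_at_def indices_upd_iff)

lemma tens_actL:
  assumes "x \<in> carrier (free_ring (P \<times> UNIV))" "f \<in> tens P"
  shows "app (actL V a x) f \<in> tens P"
  using assms(1)
proof (induction rule: free_ring_induct)
  case (gvar_mult g x)
  then show ?case
    by (auto simp: lo.ev_mult gL_def intro!: tens_opL)
qed (use assms(2) in \<open>auto simp: lo.ev_add intro: tens_add tens_scale\<close>)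

lemma vac_tens: "vac n \<in> tens (positions n)"
  by (simp add: vac_def tens_def)

text \<open>In each factor the vacuum is the diagonal tensor, the identity matrix, so a matrix moves
  from one leg to the other by transposition. Together with the transpose in
  \<open>dual_umod\<close> this replaces dual actions by antipodes on the module side.\<close>

lemma vac_transpose:
  assumes j: "1 \<le> j" "j \<le> n"
  shows "app (opL (j, Dl) M) (vac n) = app (opL (j, Md) (transpose M)) (vac n)"
proof
  fix s :: "pos \<Rightarrow> 2"
  define R where "R \<longleftrightarrow> s \<in> indices (positions n) \<and> (\<forall>k\<in>{1..n}. k \<noteq> j \<longrightarrow> s (k, Md) = s (k, Dl))"
  have p: "(j, d) \<in> positions n" for d
    using j by (auto simp: positions_def)
  have 1: "vac n (s((j, Dl) := b)) = (if b = s (j, Md) \<and> R then 1 else 0)" for b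
    using j unfolding vac_def indices_upd_iff[OF p] R_def by auto
  have 2: "vac n (s((j, Md) := b)) = (if b = s (j, Dl) \<and> R then 1 else 0)" for b
    using j unfolding vac_def indices_upd_iff[OF p] R_def by auto
  have s: "(\<Sum>b\<in>UNIV. g b * (if b = c \<and> R then 1 else 0)) = (if R then g c else 0)"
    for g :: "2 \<Rightarrow> complex" and c
    by (cases R) (simp_all add: if_distrib cong: if_cong)
  show "app (opL (j, Dl) M) (vac n) s = app (opL (j, Md) (transpose M)) (vac n) s"
    by (simp add: app_opL op_at_def 1 2 s transpose_def)
qed

section \<open>The relations of \<open>\<U>\<close> in a ring\<close>

text \<open>The sign is a boolean so that the signs of products combine by exclusive or, and long
  products of letters are handled by chaining introduction rules.\<close>

definition sw :: "bool \<Rightarrow> 'r::ring_1 \<Rightarrow> 'r \<Rightarrow> bool"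
  where "sw b x y \<longleftrightarrow> x * y = (if b then - (y * x) else y * x)"

lemma sw_sym: "sw b x y \<Longrightarrow> sw b y x"
  by (auto simp: sw_def)

lemma sw_mult_right:
  assumes "sw b x y" "sw c x z"
  shows "sw (b \<noteq> c) x (y * z)"
proof -
  have "x * (y * z) = (if b then - (y * (x * z)) else y * (x * z))"
    using assms(1) by (simp add: sw_def flip: mult.assoc)
  then show ?thesis
    using assms(2) by (simp add: sw_def mult.assoc)
qed

lemma sw_mult_left: "sw b x z \<Longrightarrow> sw c y z \<Longrightarrow> sw (b \<noteq> c) (x * y) z"
  by (metis sw_mult_right sw_sym)

lemma sw_one [simp]: "sw b x 1 \<longleftrightarrow> (b \<longrightarrow> x = - x)" "sw False 1 x"
  by (auto simp: sw_def)

lemma sw_prod_list: "(\<And>y. y \<in> set ys \<Longrightarrow> sw False x y) \<Longrightarrow> sw False x (prod_list ys)"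
proof (induction ys)
  case (Cons y ys)
  then show ?case
    using sw_mult_right[of False x y False "prod_list ys"] by simp
qed simp

lemma sw_inverse:
  assumes "sw b x y" "y * z = 1" "z * y = 1"
  shows "sw b x z"
proof -
  have "z * (x * y) * z = (if b then - (z * (y * x) * z) else z * (y * x) * z)"
    using assms(1) by (simp add: sw_def)
  then have "z * x * (y * z) = (if b then - ((z * y) * x * z) else (z * y) * x * z)"
    by (simp add: mult.assoc)
  then show ?thesis
    using assms(2,3) by (auto simp: sw_def)
qed

lemma swap_assoc: "x * y = y * x \<Longrightarrow> x * (y * z) = y * (x * (z::'r::ring_1))"
  by (metis mult.assoc)

lemma quadruple_commute:
  fixes k :: "'r::ring_1"
  assumes "x * k = k * x" "o' * k = k * o'" "o' * x = x * o'" "o' * y = y * o'"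
  shows "(k * x * o') * (k * y * o') = k * k * (o' * o') * (x * y)"
proof -
  note a = assms assms[THEN swap_assoc]
  have "x * o' = o' * x" "y * o' = o' * y" using assms by simp_all
  note b = this this[THEN swap_assoc]
  show ?thesis
    by (simp add: mult.assoc a(1,2,5,6) b)
qed

lemma (in calg) sw_sm_right: "sw b x y \<Longrightarrow> sw b x (sm c y)"
  and sw_sm_left: "sw b x y \<Longrightarrow> sw b (sm c x) y"
  by (auto simp: sw_def sm_uminus)

lemma (in calg) sw_cs [simp]: "sw False x (cs c)" "sw False (cs c) x"
  by (auto simp: sw_def cs_comm)

context calg
begin

text \<open>The relations of the quantum group together with the values of a character on the
  squares; \<open>\<phi>\<close> stands for the product of the values at \<open>K^2\<close> and
  \<open>F^2\<close>, whence the quotient in the last equation.\<close>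

definition utrip :: "'r \<Rightarrow> 'r \<Rightarrow> 'r \<Rightarrow> 'r \<Rightarrow> complex \<Rightarrow> complex \<Rightarrow> complex \<Rightarrow> bool"
  where "utrip e f k ki \<kappa> \<epsilon> \<phi> \<longleftrightarrow> \<kappa> \<noteq> 0 \<and> k * ki = 1 \<and> ki * k = 1 \<and>
    k * e = - (e * k) \<and> k * f = - (f * k) \<and> e * f - f * e = sm (2 * \<i>) (k - ki) \<and>
    k * k = cs \<kappa> \<and> e * e = cs \<epsilon> \<and> f * f = cs (\<phi> / \<kappa>)"

definition om :: "'r \<Rightarrow> 'r \<Rightarrow> 'r \<Rightarrow> 'r \<Rightarrow> 'r"
  where "om e f k ki = sm \<i> (e * f) + k - ki"

lemma cs_sm: "cs c = sm c 1"
  by (simp add: sm_def)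

text \<open>The factor 2 of the commutator of E and F is unfolded into sums, so that it can cancel
  against terms which arise one at a time.\<close>

lemma sm_2 [simp]: "sm 2 x = x + x" "sm (2 * c) x = sm c x + sm c x"
    "sm (2 / c) x = sm (1 / c) x + sm (1 / c) x" "sm (c * 2) x = sm c x + sm c x"
    "sm (2 * c / d) x = sm (c / d) x + sm (c / d) x" "sm (c * 2 / d) x = sm (c / d) x + sm (c / d) x" "sm (c * (d * 2)) x = sm (c * d) x + sm (c * d) x"
  using sm_add_left[of 1 1 x] by (simp_all add: mult.commute mult.assoc flip: sm_add_left)

lemma ii [simp]: "\<i> * (2 * \<i>) = - 2" "\<i> * (c * \<i>) = - c" "\<i> * (\<i> * c) = - c" "\<i> * (c * (\<i> * d)) = - (c * d)"
  "\<i> * (c * \<i> / d) = - (c / d)" "\<i> * (2 * \<i> / d) = - (2 / d)" "\<i> * (2 * (\<i> * d)) = - (2 * d)"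
  by (simp_all add: field_simps)

lemmas fin = sm_diff_left sm_uminus_left sm_add_left

end

locale utriple = calg +
  fixes e f k ki \<kappa> \<epsilon> \<phi>
  assumes ut: "utrip e f k ki \<kappa> \<epsilon> \<phi>"
begin

lemma kap [simp]: "\<kappa> \<noteq> 0"
  and kki [simp]: "k * ki = 1" "ki * k = 1"
  and ke: "k * e = - (e * k)" and kf: "k * f = - (f * k)"
  and ef: "e * f - f * e = sm (2 * \<i>) (k - ki)"
  and kk: "k * k = sm \<kappa> 1" and ee: "e * e = sm \<epsilon> 1" and ff: "f * f = sm (\<phi> / \<kappa>) 1"
  using ut by (simp_all add: utrip_def cs_sm)

lemma ki: "ki = sm (1 / \<kappa>) k"
proof -
  have "k * k * ki = sm \<kappa> ki" by (simp add: kk)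
  then have "k = sm \<kappa> ki" by (simp add: mult.assoc)
  then show ?thesis by simp
qed

lemma fe: "f * e = e * f - sm (2 * \<i>) k + sm (2 * \<i> / \<kappa>) k"
proof -
  have "f * e = e * f - sm (2 * \<i>) (k - ki)" using ef by (simp add: algebra_simps)
  then show ?thesis by (simp add: ki sm_diff)
qed

lemma assoc_rules:
  "k * (e * x) = - (e * (k * x))" "k * (f * x) = - (f * (k * x))"
  "k * (k * x) = sm \<kappa> x" "e * (e * x) = sm \<epsilon> x" "f * (f * x) = sm (\<phi> / \<kappa>) x"
  "f * (e * x) = e * (f * x) - sm (2 * \<i>) (k * x) + sm (2 * \<i> / \<kappa>) (k * x)"
proof -
  show "k * (e * x) = - (e * (k * x))"
    using arg_cong[OF ke, of "\<lambda>y. y * x"] by (simp add: mult.assoc)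
  show "k * (f * x) = - (f * (k * x))"
    using arg_cong[OF kf, of "\<lambda>y. y * x"] by (simp add: mult.assoc)
  show "k * (k * x) = sm \<kappa> x"
    using arg_cong[OF kk, of "\<lambda>y. y * x"] by (simp add: mult.assoc)
  show "e * (e * x) = sm \<epsilon> x"
    using arg_cong[OF ee, of "\<lambda>y. y * x"] by (simp add: mult.assoc)
  show "f * (f * x) = sm (\<phi> / \<kappa>) x"
    using arg_cong[OF ff, of "\<lambda>y. y * x"] by (simp add: mult.assoc)
  show "f * (e * x) = e * (f * x) - sm (2 * \<i>) (k * x) + sm (2 * \<i> / \<kappa>) (k * x)"
    using arg_cong[OF fe, of "\<lambda>y. y * x"] by (simp add: algebra_simps)
qed

text \<open>A rewriting system with normal monomials in the order \<open>e\<close>,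
  \<open>f\<close>, \<open>k\<close>, each to the power at most one, and \<open>ki\<close>
  eliminated as \<open>k / \<kappa>\<close>. The right-nested forms in \<open>assoc_rules\<close>
  are what makes it work inside longer products.\<close>

lemmas nf = mult.assoc ki ke kf fe kk ee ff assoc_rules distrib_left distrib_right
  left_diff_distrib right_diff_distrib sm_add sm_diff sm_uminus

lemma om_ke: "om e f k ki * (k * e) = sm (\<i> * \<epsilon>) (k * f) - sm (\<kappa> - 1) e"
  by (simp add: om_def nf fin)

lemma om_f: "om e f k ki * sm \<kappa> f = sm (\<i> * \<phi>) e + sm (\<kappa> - 1) (k * f)"
  by (simp add: om_def nf fin)

lemma om_e: "om e f k ki * e = e * om e f k ki"
  by (simp add: om_def nf fin)

lemma om_f_comm: "om e f k ki * f = f * om e f k ki"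
  by (simp add: om_def nf fin)

lemma om_k_comm: "om e f k ki * k = k * om e f k ki"
  by (simp add: om_def nf fin)

lemma om_sq: "om e f k ki * om e f k ki = cs (\<kappa> + 1 / \<kappa> - 2 - \<epsilon> * (\<phi> / \<kappa>))"
  by (simp add: om_def nf fin cs_sm mult.commute[of \<phi>] algebra_simps)

text \<open>Once Omega acts by a number, these products show that the span of 1, \<open>k\<close>,
  \<open>e\<close>, \<open>k * f\<close> is closed under multiplication; \<open>f\<close> itself is
  recovered from \<open>k * (k * f)\<close>.\<close>

lemma table:
  "k * (k * f) = sm \<kappa> f"
  "e * (k * f) = sm \<i> (om e f k ki * k) - sm (\<i> * (\<kappa> - 1)) 1"
  "k * f * e = - sm \<i> (om e f k ki * k) - sm (\<i> * (\<kappa> - 1)) 1"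
  "k * f * (k * f) = sm (- \<phi>) 1"
  "k * f * k = - (k * (k * f))"
  "om e f k ki * (k * (k * f)) = sm (\<i> * \<phi>) e + sm (\<kappa> - 1) (k * f)"
  by (simp_all add: om_def nf fin algebra_simps)

end

context calg
begin

text \<open>The coproduct is an algebra map, and on characters it induces \<open>zmult\<close>. This
  form builds the iterated coproduct on the module side.\<close>

lemma utrip_mult_left:
  assumes 1: "utrip e1 f1 k1 ki1 \<kappa>1 \<epsilon>1 \<phi>1" and 2: "utrip e2 f2 k2 ki2 \<kappa>2 \<epsilon>2 \<phi>2"
    and c: "\<And>x y. x \<in> {e1, f1, k1, ki1} \<Longrightarrow> y \<in> {e2, f2, k2, ki2} \<Longrightarrow> x * y = y * x"
  shows "utrip (e2 + e1 * k2) (ki1 * f2 + f1) (k1 * k2) (ki1 * ki2)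
    (\<kappa>1 * \<kappa>2) (\<epsilon>2 + \<epsilon>1 * \<kappa>2) (\<phi>2 + \<phi>1 * \<kappa>2)"
proof -
  interpret a: utriple cs e1 f1 k1 ki1 \<kappa>1 \<epsilon>1 \<phi>1 by unfold_locales (rule 1)
  interpret b: utriple cs e2 f2 k2 ki2 \<kappa>2 \<epsilon>2 \<phi>2 by unfold_locales (rule 2)
  have c1: "y * x = x * y" if "x \<in> {e1, f1, k1, ki1}" "y \<in> {e2, f2, k2, ki2}" for x y
    using c[OF that] by simp
  have c2: "y * (x * z) = x * (y * z)" if "x \<in> {e1, f1, k1, ki1}" "y \<in> {e2, f2, k2, ki2}" for x y z
    using arg_cong[OF c[OF that], of "\<lambda>u. u * z"] by (simp add: mult.assoc)
  \<comment> \<open>Letters of the first factor are moved to the left. Rules for \<open>ki1\<close>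
    are absent because \<open>nf\<close> has already replaced it by a multiple of
    \<open>k1\<close>.\<close>
  note C = c1[of e1] c1[of f1] c1[of k1] c2[of e1] c2[of f1] c2[of k1]
  show ?thesis
    unfolding utrip_def
    by (simp add: a.nf b.nf C fin cs_sm add_divide_distrib mult.commute)
qed

text \<open>The same for the opposite coproduct, which governs the dual side; the roles of the two
  characters are exchanged.\<close>

lemma utrip_mult_right:
  assumes 1: "utrip e1 f1 k1 ki1 \<kappa>1 \<epsilon>1 \<phi>1" and 2: "utrip e2 f2 k2 ki2 \<kappa>2 \<epsilon>2 \<phi>2"
    and c: "\<And>x y. x \<in> {e1, f1, k1, ki1} \<Longrightarrow> y \<in> {e2, f2, k2, ki2} \<Longrightarrow> x * y = y * x"
  shows "utrip (e1 + k1 * e2) (f1 * ki2 + f2) (k1 * k2) (ki1 * ki2)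
    (\<kappa>1 * \<kappa>2) (\<epsilon>1 + \<epsilon>2 * \<kappa>1) (\<phi>1 + \<phi>2 * \<kappa>1)"
proof -
  interpret a: utriple cs e1 f1 k1 ki1 \<kappa>1 \<epsilon>1 \<phi>1 by unfold_locales (rule 1)
  interpret b: utriple cs e2 f2 k2 ki2 \<kappa>2 \<epsilon>2 \<phi>2 by unfold_locales (rule 2)
  have c1: "y * x = x * y" if "x \<in> {e1, f1, k1, ki1}" "y \<in> {e2, f2, k2, ki2}" for x y
    using c[OF that] by simp
  have c2: "y * (x * z) = x * (y * z)" if "x \<in> {e1, f1, k1, ki1}" "y \<in> {e2, f2, k2, ki2}" for x y z
    using arg_cong[OF c[OF that], of "\<lambda>u. u * z"] by (simp add: mult.assoc)
  note C = c1[of e1] c1[of f1] c1[of k1] c2[of e1] c2[of f1] c2[of k1]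
  show ?thesis
    unfolding utrip_def
    by (simp add: a.nf b.nf C fin cs_sm add_divide_distrib mult.commute)
qed

end

context utriple
begin

text \<open>The antipode turns a module into its dual: the relations hold in the opposite ring.\<close>

lemma antipode:
  "- (e * ki) * ki = - (ki * - (e * ki))"
  "- (k * f) * ki = - (ki * - (k * f))"
  "- (k * f) * - (e * ki) - - (e * ki) * - (k * f) = sm (2 * \<i>) (ki - k)"
  "ki * ki = sm (1 / \<kappa>) 1"
  "- (e * ki) * - (e * ki) = sm (- \<epsilon> / \<kappa>) 1"
  "- (k * f) * - (k * f) = sm (- \<phi>) 1"
  "sm \<i> (- (k * f) * - (e * ki)) + ki - k = om e f k ki"
  by (simp_all add: om_def nf fin power2_eq_square)

end

text \<open>The generators of several tensor factors. Only the relations that survive when the letters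
  of the factors outside \<^term>\<open>positions n\<close> are sent to \<open>0\<close> or \<open>1\<close> are assumed.\<close>

locale usites = calg cs for cs :: "complex \<Rightarrow> 'r::ring_1" +
  fixes P :: "pos set" and gen :: "pos \<Rightarrow> ugen \<Rightarrow> 'r"
  assumes kki: "p \<in> P \<Longrightarrow> gen p GK * gen p GKi = 1"
    and kik: "p \<in> P \<Longrightarrow> gen p GKi * gen p GK = 1"
    and ke: "p \<in> P \<Longrightarrow> gen p GK * gen p GE = - (gen p GE * gen p GK)"
    and kf: "p \<in> P \<Longrightarrow> gen p GK * gen p GF = - (gen p GF * gen p GK)"
    and ef: "p \<in> P \<Longrightarrow> gen p GE * gen p GF - gen p GF * gen p GE = sm (2 * \<i>) (gen p GK - gen p GKi)"
    and oi: "p \<in> P \<Longrightarrow> g \<in> {GE, GF, GK} \<Longrightarrow> gen p GOi * gen p g = gen p g * gen p GOi"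
    and cross: "p \<in> P \<Longrightarrow> q \<in> P \<Longrightarrow> p \<noteq> q \<Longrightarrow> gen p g * gen q h = gen q h * gen p g"
begin

definition gK :: "pos \<Rightarrow> 'r" where "gK p = gen p GK"
definition gO :: "pos \<Rightarrow> 'r" where "gO p = gen p GOi"
definition gX :: "2 \<Rightarrow> pos \<Rightarrow> 'r"
  where "gX \<nu> p = (if \<nu> = 1 then gen p GE else sm (- \<i>) (gen p GK * gen p GF))"

lemma sw_cross: "p \<in> P \<Longrightarrow> q \<in> P \<Longrightarrow> p \<noteq> q \<Longrightarrow> sw False (gen p g) (gen q h)"
  by (simp add: sw_def cross)

lemma sw_KK: "p \<in> P \<Longrightarrow> q \<in> P \<Longrightarrow> sw False (gK p) (gK q)"
  by (cases "p = q") (auto simp: gK_def sw_def cross)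

lemma sw_OO: "p \<in> P \<Longrightarrow> q \<in> P \<Longrightarrow> sw False (gO p) (gO q)"
  by (cases "p = q") (auto simp: gO_def sw_def cross)

lemma sw_KO: "p \<in> P \<Longrightarrow> q \<in> P \<Longrightarrow> sw False (gK p) (gO q)"
  by (cases "p = q") (auto simp: gK_def gO_def sw_def cross oi)

lemma sw_KX: "p \<in> P \<Longrightarrow> q \<in> P \<Longrightarrow> sw (p = q) (gK p) (gX \<nu> q)"
proof (cases "p = q")
  case False
  assume "p \<in> P" "q \<in> P"
  then have "sw (False \<noteq> False) (gK p) (gen q GK * gen q GF)"
    unfolding gK_def using False by (intro sw_mult_right sw_cross)
  then show ?thesis
    using False \<open>p \<in> P\<close> \<open>q \<in> P\<close> unfolding gX_def gK_def by (auto intro: sw_cross sw_sm_right)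
next
  case True
  assume "p \<in> P" "q \<in> P"
  then have "sw (False \<noteq> True) (gK p) (gen q GK * gen q GF)"
    using True by (intro sw_mult_right) (auto simp: gK_def sw_def kf)
  then show ?thesis
    using True \<open>p \<in> P\<close> unfolding gX_def gK_def by (auto intro: sw_sm_right simp: sw_def ke sm_uminus)
qed

lemma sw_OX: "p \<in> P \<Longrightarrow> q \<in> P \<Longrightarrow> sw False (gO p) (gX \<nu> q)"
proof -
  assume p: "p \<in> P" "q \<in> P"
  then have g: "sw False (gO p) (gen q g)" if "g \<in> {GE, GF, GK}" for g
    using that by (cases "p = q") (auto simp: gO_def sw_def cross oi)
  have "sw (False \<noteq> False) (gO p) (gen q GK * gen q GF)"
    by (intro sw_mult_right g) auto
  then show ?thesis
    using g unfolding gX_def by (auto intro: sw_sm_right)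
qed

lemma sw_XX: "p \<in> P \<Longrightarrow> q \<in> P \<Longrightarrow> p \<noteq> q \<Longrightarrow> sw False (gX \<nu> p) (gX \<xi> q)"
proof -
  assume p: "p \<in> P" "q \<in> P" "p \<noteq> q"
  have a: "sw False (gen p g) (gX \<xi> q)" for g
  proof -
    have "sw (False \<noteq> False) (gen p g) (gen q GK * gen q GF)"
      by (intro sw_mult_right sw_cross p)
    then show ?thesis
      using p unfolding gX_def by (auto intro: sw_sm_right sw_cross)
  qed
  have "sw (False \<noteq> False) (gen p GK * gen p GF) (gX \<xi> q)"
    by (intro sw_mult_left a)
  then show ?thesis
    using a unfolding gX_def[of \<nu>] by (auto intro: sw_sm_left)
qed

definition qq :: "2 \<Rightarrow> 2 \<Rightarrow> pos \<Rightarrow> 'r"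
  where "qq \<nu> \<xi> p = (if \<nu> = 1 \<and> \<xi> = 1 then sm 2 (gen p GE * gen p GE)
    else if \<nu> = 2 \<and> \<xi> = 2 then sm 2 (gK p * gK p * (gen p GF * gen p GF))
    else sm (- 2) (gK p * gK p - 1))"

text \<open>As K anticommutes with E, the anticommutator of E and KF is
  \<open>-K (E F - F E)\<close>, hence a multiple of \<open>K^2 - 1\<close>: the noncentral part
  cancels, and this is the source of the Clifford structure.\<close>

lemma gX_anticomm:
  assumes p: "p \<in> P"
  shows "gX \<nu> p * gX \<xi> p + gX \<xi> p * gX \<nu> p = qq \<nu> \<xi> p"
proof -
  let ?e = "gen p GE" and ?f = "gen p GF" and ?k = "gen p GK" and ?ki = "gen p GKi"
  have 1: "?k * (?e * x) = - (?e * (?k * x))" for x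
    using arg_cong[OF ke[OF p], of "\<lambda>u. u * x"] by (simp add: mult.assoc)
  have kf': "?f * ?k = - (?k * ?f)"
    using kf[OF p] by simp
  have 2: "?f * (?k * x) = - (?k * (?f * x))" for x
    using arg_cong[OF kf', of "\<lambda>u. u * x"] by (simp add: mult.assoc)
  have 3: "?k * (?f * ?e) = ?k * (?e * ?f) - sm (2 * \<i>) (?k * ?k) + sm (2 * \<i>) 1"
  proof -
    have "?f * ?e = ?e * ?f - sm (2 * \<i>) (?k - ?ki)"
      using ef[OF p] by (simp add: algebra_simps)
    then have "?k * (?f * ?e) = ?k * (?e * ?f) - sm (2 * \<i>) (?k * ?k - ?k * ?ki)"
      by (simp add: right_diff_distrib del: sm_2)
    then show ?thesis
      using kki[OF p] by (simp add: sm_diff del: sm_2)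
  qed
  have "\<nu> = 1 \<or> \<nu> = 2" "\<xi> = 1 \<or> \<xi> = 2" using exhaust_2 by auto
  then show ?thesis
    by (elim disjE) (simp_all add: gX_def qq_def gK_def 1 2 3 kf' ke[OF p] mult.assoc sm_diff sm_add sm_uminus fin)
qed

definition KK :: "side \<Rightarrow> nat list \<Rightarrow> 'r"
  where "KK d ks = prod_list (map (\<lambda>k. gK (k, d)) ks)"

lemma KK_Nil [simp]: "KK d [] = 1" and KK_Cons: "KK d (k # ks) = gK (k, d) * KK d ks"
  and KK_append: "KK d (ks @ ls) = KK d ks * KK d ls"
  by (simp_all add: KK_def)

lemma sw_eq: "sw b x y \<Longrightarrow> b = c \<Longrightarrow> sw c x y"
  by simp

text \<open>Each occurrence of the letter K at the same position contributes one sign, so membership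
  determines the sign only for lists without repetition.\<close>

lemma sw_KKX:
  assumes "set ks \<times> {d} \<subseteq> P" "distinct ks" "(l, s) \<in> P"
  shows "sw (s = d \<and> l \<in> set ks) (KK d ks) (gX \<nu> (l, s))"
  using assms
proof (induction ks)
  case (Cons k ks)
  have "sw (((k, d) = (l, s)) \<noteq> (s = d \<and> l \<in> set ks)) (KK d (k # ks)) (gX \<nu> (l, s))"
    unfolding KK_Cons using Cons by (intro sw_mult_left sw_KX) auto
  then show ?case
    by (rule sw_eq) (use Cons.prems in auto)
qed simp

lemma sw_KKO:
  assumes "set ks \<times> {d} \<subseteq> P" "p \<in> P"
  shows "sw False (KK d ks) (gO p)"
  using assms
proof (induction ks)
  case (Cons k ks)
  have "sw (False \<noteq> False) (KK d (k # ks)) (gO p)"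
    unfolding KK_Cons using Cons by (intro sw_mult_left sw_KO) auto
  then show ?case by simp
qed simp

lemma sw_KKK:
  assumes "set ks \<times> {d} \<subseteq> P" "p \<in> P"
  shows "sw False (KK d ks) (gK p)"
  using assms
proof (induction ks)
  case (Cons k ks)
  have "sw (False \<noteq> False) (KK d (k # ks)) (gK p)"
    unfolding KK_Cons using Cons by (intro sw_mult_left sw_KK) auto
  then show ?case by simp
qed simp

lemma sw_KKKK:
  assumes "set ks \<times> {d} \<subseteq> P" "set ls \<times> {d'} \<subseteq> P"
  shows "sw False (KK d ks) (KK d' ls)"
  unfolding KK_def[of d'] by (rule sw_prod_list) (use assms sw_KKK in auto)

lemma KK_square:
  assumes "set ks \<times> {d} \<subseteq> P"
  shows "KK d ks * KK d ks = prod_list (map (\<lambda>k. gK (k, d) * gK (k, d)) ks)"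
  using assms
proof (induction ks)
  case (Cons k ks)
  have "KK d ks * gK (k, d) = gK (k, d) * KK d ks"
    using sw_KKK[of ks d "(k, d)"] Cons.prems by (simp add: sw_def)
  then have "KK d (k # ks) * KK d (k # ks) = gK (k, d) * gK (k, d) * (KK d ks * KK d ks)"
    unfolding KK_Cons by (metis mult.assoc)
  then show ?case
    using Cons by simp
qed simp

end

section \<open>The elements alpha and alpha-bar on a chain of factors\<close>

locale uchain = usites cs "positions n" gen
  for cs :: "complex \<Rightarrow> 'r::ring_1" and n :: nat and gen :: "pos \<Rightarrow> ugen \<Rightarrow> 'r"
begin

definition al :: "nat \<Rightarrow> 2 \<Rightarrow> 'r"
  where "al j \<nu> = KK Md [1..<j] * gX \<nu> (j, Md) * gO (j, Md)"

text \<open>The factor \<open>\<Delta>K\<close> in front of the dual half of \<open>theta\<close> is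
  included, so that \<open>theta\<close> becomes a plain sum of two halves.\<close>

definition ab :: "nat \<Rightarrow> 2 \<Rightarrow> 'r"
  where "ab j \<nu> = KK Md [1..<Suc n] * (gX \<nu> (j, Dl) * gO (j, Dl) * KK Dl [Suc j..<Suc n])"

lemma pos_simps: "(j, d) \<in> positions n \<longleftrightarrow> 1 \<le> j \<and> j \<le> n"
  by (auto simp: positions_def)

lemma upt_pos: "j \<le> Suc n \<Longrightarrow> set [1..<j] \<times> {d} \<subseteq> positions n"
    "set [Suc i..<Suc n] \<times> {d} \<subseteq> positions n"
  by (auto simp: positions_def)

lemma upt_pos_n: "set [1..<Suc n] \<times> {d} \<subseteq> positions n"
  by (auto simp: positions_def)

lemmas sw_intros = sw_mult_left sw_mult_right sw_KKKK sw_KKX sw_KKO sw_XX sw_OO sw_OX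
  sw_sym[OF sw_KKX] sw_sym[OF sw_KKO] sw_sym[OF sw_OX]

text \<open>For \<open>j < l\<close> the prefix of \<open>al l\<close> contains K at position
  \<open>j\<close>, which anticommutes with E and KF there. Every other pair of letters commutes, so
  exactly one sign appears.\<close>

lemma sw_al_al:
  assumes "1 \<le> j" "j \<le> n" "1 \<le> l" "l \<le> n" "j \<noteq> l"
  shows "sw True (al j \<nu>) (al l \<xi>)"
  unfolding al_def
  by (insert assms, rule sw_eq, (rule sw_intros | force simp: positions_def)+)

lemma sw_ab_ab:
  assumes "1 \<le> j" "j \<le> n" "1 \<le> l" "l \<le> n" "j \<noteq> l"
  shows "sw True (ab j \<nu>) (ab l \<xi>)"
  unfolding ab_def
  by (insert assms, rule sw_eq, (rule sw_intros | force simp: positions_def)+)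

text \<open>The single sign comes from the total K in front of \<open>ab l\<close>, which contains K
  at the position of \<open>al j\<close>.\<close>

lemma sw_al_ab:
  assumes "1 \<le> j" "j \<le> n" "1 \<le> l" "l \<le> n"
  shows "sw True (al j \<nu>) (ab l \<xi>)"
  unfolding al_def ab_def
  by (insert assms, rule sw_eq, (rule sw_intros | force simp: positions_def)+)

lemma al_same:
  assumes "1 \<le> j" "j \<le> n"
  shows "al j \<nu> * al j \<xi> + al j \<xi> * al j \<nu> =
    (KK Md [1..<j] * KK Md [1..<j]) * (gO (j, Md) * gO (j, Md)) * qq \<nu> \<xi> (j, Md)"
proof -
  let ?k = "KK Md [1..<j]" and ?o = "gO (j, Md)"
  have p: "(j, Md) \<in> positions n" and k: "set [1..<j] \<times> {Md} \<subseteq> positions n"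
    using assms by (auto simp: positions_def)
  have "sw False (gX \<nu> (j, Md)) ?k" for \<nu>
    using sw_eq[OF sw_sym[OF sw_KKX[OF k distinct_upt p]], of False \<nu>] by simp
  then have 1: "gX \<nu> (j, Md) * ?k = ?k * gX \<nu> (j, Md)" for \<nu>
    by (simp add: sw_def)
  have 2: "?o * ?k = ?k * ?o" "?o * gX \<nu> (j, Md) = gX \<nu> (j, Md) * ?o" for \<nu>
    using sw_sym[OF sw_KKO[OF k p]] sw_OX[OF p p] by (simp_all add: sw_def)
  have "al j \<nu> * al j \<xi> = ?k * ?k * (?o * ?o) * (gX \<nu> (j, Md) * gX \<xi> (j, Md))" for \<nu> \<xi>
    unfolding al_def by (rule quadruple_commute[OF 1 2(1,2,2)])
  then show ?thesis
    by (simp add: gX_anticomm[OF p] flip: distrib_left)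
qed

lemma ab_same:
  assumes "1 \<le> j" "j \<le> n"
  shows "ab j \<nu> * ab j \<xi> + ab j \<xi> * ab j \<nu> =
    (KK Md [1..<Suc n] * KK Md [1..<Suc n]) * (KK Dl [Suc j..<Suc n] * KK Dl [Suc j..<Suc n]) *
    (gO (j, Dl) * gO (j, Dl)) * qq \<nu> \<xi> (j, Dl)"
proof -
  let ?t = "KK Md [1..<Suc n]" and ?k = "KK Dl [Suc j..<Suc n]" and ?o = "gO (j, Dl)"
  let ?x = "\<lambda>\<nu>. gX \<nu> (j, Dl)"
  have p: "(j, Dl) \<in> positions n" and k: "set [Suc j..<Suc n] \<times> {Dl} \<subseteq> positions n"
    and t: "set [1..<Suc n] \<times> {Md} \<subseteq> positions n"
    using assms by (auto simp: positions_def)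
  have "sw False (?x \<nu>) ?k" "sw False (?x \<nu>) ?t" for \<nu>
    using sw_eq[OF sw_sym[OF sw_KKX[OF k distinct_upt p]], of False \<nu>]
      sw_eq[OF sw_sym[OF sw_KKX[OF t distinct_upt p]], of False \<nu>] by simp_all
  then have 1: "?x \<nu> * ?k = ?k * ?x \<nu>" "?x \<nu> * ?t = ?t * ?x \<nu>" for \<nu>
    by (simp_all add: sw_def)
  have 2: "?o * ?k = ?k * ?o" "?o * ?x \<nu> = ?x \<nu> * ?o" "?o * ?t = ?t * ?o" "?k * ?t = ?t * ?k" for \<nu>
    using sw_sym[OF sw_KKO[OF k p]] sw_OX[OF p p] sw_sym[OF sw_KKO[OF t p]] sw_KKKK[OF k t]
    by (simp_all add: sw_def)
  have c: "?x \<nu> * ?o = ?o * ?x \<nu>" for \<nu>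
    using 2(2) by simp
  have o: "?k * ?o = ?o * ?k" using 2(1) by simp
  have "ab j \<nu> * ab j \<xi> = (?t * ?t) * (?k * ?k) * (?o * ?o) * (?x \<nu> * ?x \<xi>)" for \<nu> \<xi>
    unfolding ab_def
    by (simp only: mult.assoc 1 2(1,3,4) c 1[THEN swap_assoc] 2(1,3,4)[THEN swap_assoc] c[THEN swap_assoc])
  then show ?thesis
    by (simp add: gX_anticomm[OF p] flip: distrib_left)
qed

text \<open>Consecutive differences of \<open>aA\<close> give the \<open>theta\<close>; the
  \<open>aG\<close> will kill the vacuum and supply the annihilators.\<close>

definition aA :: "nat \<Rightarrow> 2 \<Rightarrow> 'r" where "aA j \<nu> = al j \<nu> + ab j \<nu>"
definition aG :: "nat \<Rightarrow> 2 \<Rightarrow> 'r" where "aG j \<nu> = al j \<nu> - ab j \<nu>"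

definition zA :: "nat \<Rightarrow> 2 \<Rightarrow> 2 \<Rightarrow> 'r"
  where "zA j \<nu> \<xi> = al j \<nu> * al j \<xi> + al j \<xi> * al j \<nu>"
definition zB :: "nat \<Rightarrow> 2 \<Rightarrow> 2 \<Rightarrow> 'r"
  where "zB j \<nu> \<xi> = ab j \<nu> * ab j \<xi> + ab j \<xi> * ab j \<nu>"

text \<open>Mixed terms drop since \<open>al\<close> and \<open>ab\<close> anticommute. The sign of
  the dual half enters twice in the first and third identity and once in the second. When
  \<open>zB = - zA\<close>, this makes the outer two vanish and doubles the middle one.\<close>

lemma anticomm:
  assumes "1 \<le> j" "j \<le> n" "1 \<le> l" "l \<le> n"
  shows "aA j \<nu> * aA l \<xi> + aA l \<xi> * aA j \<nu> = (if j = l then zA j \<nu> \<xi> + zB j \<nu> \<xi> else 0)"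
    and "aG j \<nu> * aA l \<xi> + aA l \<xi> * aG j \<nu> = (if j = l then zA j \<nu> \<xi> - zB j \<nu> \<xi> else 0)"
    and "aG j \<nu> * aG l \<xi> + aG l \<xi> * aG j \<nu> = (if j = l then zA j \<nu> \<xi> + zB j \<nu> \<xi> else 0)"
  using sw_al_al[OF assms, of \<nu> \<xi>] sw_ab_ab[OF assms, of \<nu> \<xi>] sw_al_ab[OF assms, of \<nu> \<xi>]
    sw_al_ab[OF assms(3,4,1,2), of \<xi> \<nu>]
  by (auto simp: aA_def aG_def zA_def zB_def sw_def algebra_simps)

end

section \<open>Two-dimensional modules as operators\<close>

lemma matrix_inv_eqI:
  fixes A B :: "complex^2^2"
  assumes "A ** B = mat 1" "B ** A = mat 1"
  shows "matrix_inv A = B" "invertible A"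
proof -
  show "invertible A"
    using assms by (auto simp: invertible_def)
  show "matrix_inv A = B"
    unfolding matrix_inv_def
  proof (rule some_equality)
    fix C assume "A ** C = mat 1 \<and> C ** A = mat 1"
    then show "C = B"
      by (metis assms(1) matrix_mul_assoc matrix_mul_lid matrix_mul_rid)
  qed (use assms in simp)
qed

lemma invertible_inv:
  fixes A :: "complex^2^2"
  assumes "invertible A"
  shows "A ** matrix_inv A = mat 1" "matrix_inv A ** A = mat 1"
proof -
  obtain B where "A ** B = mat 1" "B ** A = mat 1"
    using assms by (auto simp: invertible_def)
  with matrix_inv_eqI[OF this] show "A ** matrix_inv A = mat 1" "matrix_inv A ** A = mat 1"
    by simp_all
qed

lemma commute_square:
  fixes x y :: "'r::ring_1"
  assumes "x * y = y * x"
  shows "(x * y) * (x * y) = (x * x) * (y * y)"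
  using swap_assoc[OF assms[symmetric]] by (simp add: mult.assoc)

lemma matrix_inv_mat:
  "c \<noteq> 0 \<Longrightarrow> matrix_inv (mat c :: complex^2^2) = mat (1 / c)"
  by (rule matrix_inv_eqI)
    (auto simp: mat_def matrix_matrix_mult_def vec_eq_iff sum_2 forall_2)

lemma transpose_minus: "transpose (- A) = - transpose (A :: complex^2^2)"
  and transpose_diff: "transpose (A - B) = transpose A - transpose (B :: complex^2^2)"
  and transpose_plus: "transpose (A + B) = transpose A + transpose (B :: complex^2^2)"
  by (simp_all add: transpose_def vec_eq_iff)

lemmas opL_hom = opL_mult[symmetric] opL_add opL_diff opL_uminus opL_mat

text \<open>Recording the value \<open>w\<close> of Omega in place of a fractional eigenvalue makes
  the notion stable under \<open>dual_umod\<close>, which keeps \<open>w\<close>, and under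
  \<open>flip_umod\<close>, which negates it.\<close>

definition modrel :: "umod \<Rightarrow> zchar \<Rightarrow> complex \<Rightarrow> bool"
  where "modrel m x w \<longleftrightarrow> is_umod m \<and> zkap x \<noteq> 0 \<and> mK m ** mK m = mat (zkap x) \<and>
    mE m ** mE m = mat (zeps x) \<and> mF m ** mF m = mat (zphi x / zkap x) \<and> mOm m = mat w"

lemma is_V_modrel: "is_V x m \<Longrightarrow> zkap (fst x) \<noteq> 0 \<Longrightarrow> modrel m (fst x) (snd x - 1 / snd x)"
  by (simp add: is_V_def modrel_def)

lemma umod_inv:
  assumes "is_umod m"
  shows "mK m ** matrix_inv (mK m) = mat 1" "matrix_inv (mK m) ** mK m = mat 1"
  using assms invertible_inv by (auto simp: is_umod_def)

abbreviation oE where "oE p m \<equiv> opL p (mE m)"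
abbreviation oF where "oF p m \<equiv> opL p (mF m)"
abbreviation oK where "oK p m \<equiv> opL p (mK m)"
abbreviation oKi where "oKi p m \<equiv> opL p (matrix_inv (mK m))"

lemma modrel_utrip:
  assumes "modrel m x w"
  shows "lo.utrip (oE p m) (oF p m) (oK p m) (oKi p m) (zkap x) (zeps x) (zphi x)"
    and "lo.om (oE p m) (oF p m) (oK p m) (oKi p m) = lcs w"
proof -
  have m: "is_umod m" using assms by (simp add: modrel_def)
  note i = umod_inv[OF m]
  have r: "mK m ** mE m = - (mE m ** mK m)" "mK m ** mF m = - (mF m ** mK m)"
    "mE m ** mF m - mF m ** mE m = mat (2 * \<i>) ** (mK m - matrix_inv (mK m))"
    using m by (simp_all add: is_umod_def)
  note q = i r
  show "lo.utrip (oE p m) (oF p m) (oK p m) (oKi p m) (zkap x) (zeps x) (zphi x)"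
    unfolding lo.utrip_def
  proof (intro conjI)
    show "oE p m * oF p m - oF p m * oE p m = lo.sm (2 * \<i>) (oK p m - oKi p m)"
      using arg_cong[OF r(3), of "opL p"] by (simp add: opL_hom lo.sm_def)
    show "oK p m * oE p m = - (oE p m * oK p m)" "oK p m * oF p m = - (oF p m * oK p m)"
      using arg_cong[OF r(1), of "opL p"] arg_cong[OF r(2), of "opL p"] by (simp_all add: opL_hom)
    show "oK p m * oKi p m = 1" "oKi p m * oK p m = 1"
      using i by (simp_all add: opL_mult opL_mat)
  qed (use assms in \<open>simp_all add: modrel_def opL_mult opL_mat\<close>)
  show "lo.om (oE p m) (oF p m) (oK p m) (oKi p m) = lcs w"
  proof -
    have "opL p (mOm m) = lcs w"
      using assms by (simp add: modrel_def opL_mat)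
    then show ?thesis
      by (simp add: mOm_def lo.om_def lo.sm_def opL_hom mult.assoc)
  qed
qed

lemma modrel_utriple: "modrel m x w \<Longrightarrow>
    utriple lcs (oE p m) (oF p m) (oK p m) (oKi p m) (zkap x) (zeps x) (zphi x)"
  by unfold_locales (rule modrel_utrip)

lemma modrel_omega2: "modrel m x w \<Longrightarrow> w * w = omega2 x"
proof -
  fix p :: pos
  assume m: "modrel m x w"
  interpret utriple lcs "oE p m" "oF p m" "oK p m" "oKi p m" "zkap x" "zeps x" "zphi x"
    using m by (rule modrel_utriple)
  have "lcs (w * w) = lcs (omega2 x)"
    using om_sq modrel_utrip(2)[OF m, of p] by (simp add: omega2_def lo.cs_mult)
  then have "app (lcs (w * w)) (\<lambda>_. 1) = app (lcs (omega2 x)) (\<lambda>_. 1)" by simp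
  then show "w * w = omega2 x" by (simp add: fun_eq_iff)
qed

text \<open>\<open>antipode\<close> gives the relations with products in the opposite order;
  transposition reverses products once more.\<close>

lemma modrel_dual:
  assumes m: "modrel m x w"
  shows "modrel (dual_umod m) (zinv x) w"
proof -
  define p :: pos where "p = (0, Md)"
  interpret utriple lcs "oE p m" "oF p m" "oK p m" "oKi p m" "zkap x" "zeps x" "zphi x"
    using m by (rule modrel_utriple)
  let ?E = "mE m" and ?F = "mF m" and ?K = "mK m" and ?Ki = "matrix_inv (mK m)"
  have u: "is_umod m" using m by (simp add: modrel_def)
  note i = umod_inv[OF u]
  have ti: "transpose ?Ki ** transpose ?K = mat 1" "transpose ?K ** transpose ?Ki = mat 1"
    using i by (simp_all flip: matrix_transpose_mul)
  note inv = matrix_inv_eqI[OF ti]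
  have s: "opL p (mat c ** A) = lo.sm c (opL p A)" for c A
    by (simp add: opL_hom lo.sm_def)
  have a: "- (?E ** ?Ki) ** ?Ki = - (?Ki ** - (?E ** ?Ki))"
    "- (?K ** ?F) ** ?Ki = - (?Ki ** - (?K ** ?F))"
    "- (?K ** ?F) ** - (?E ** ?Ki) - - (?E ** ?Ki) ** - (?K ** ?F) = mat (2 * \<i>) ** (?Ki - ?K)"
    "?Ki ** ?Ki = mat (1 / zkap x)"
    "- (?E ** ?Ki) ** - (?E ** ?Ki) = mat (- zeps x / zkap x)"
    "- (?K ** ?F) ** - (?K ** ?F) = mat (- zphi x)"
    using antipode[unfolded lo.cs_sm[symmetric]]
    by (intro opL_inj[of p]; simp only: opL_hom s lo.sm_def)+
  have b: "mat \<i> ** (- (?K ** ?F) ** - (?E ** ?Ki)) + ?Ki - ?K = mat w"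
    using antipode(7) modrel_utrip(2)[OF m, of p]
    by (intro opL_inj[of p]) (simp only: opL_hom s lo.sm_def)
  have c: "A ** mat d = mat d ** A" for A :: "complex^2^2" and d
    by (simp add: matrix_matrix_mult_def vec_eq_iff mat_def if_distrib if_distribR cong: if_cong)
  have "modrel (dual_umod m) (zinv x) w"
    unfolding modrel_def is_umod_def mOm_def dual_umod_def umod.simps inv zinv_def zchar.simps
  proof (intro conjI)
    show "mat \<i> ** transpose (- (?E ** ?Ki)) ** transpose (- (?K ** ?F)) + transpose ?Ki - transpose ?K = mat w"
      using arg_cong[OF b, of transpose]
      by (simp add: matrix_transpose_mul transpose_plus transpose_diff c matrix_mul_assoc)
    show "transpose (- (?E ** ?Ki)) ** transpose (- (?K ** ?F)) -
        transpose (- (?K ** ?F)) ** transpose (- (?E ** ?Ki)) = mat (2 * \<i>) ** (transpose ?Ki - transpose ?K)"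
      using arg_cong[OF a(3), of transpose] by (simp add: matrix_transpose_mul transpose_diff c)
    show "transpose ?Ki ** transpose (- (?E ** ?Ki)) = - (transpose (- (?E ** ?Ki)) ** transpose ?Ki)"
      "transpose ?Ki ** transpose (- (?K ** ?F)) = - (transpose (- (?K ** ?F)) ** transpose ?Ki)"
      unfolding matrix_transpose_mul[symmetric] transpose_minus[symmetric]
      by (simp_all only: a)
    show "transpose (- (?K ** ?F)) ** transpose (- (?K ** ?F)) = mat (- zphi x / zkap x / (1 / zkap x))"
      using a(6) by (simp flip: matrix_transpose_mul)
  qed (use a ti m in \<open>simp_all add: invertible_def modrel_def flip: matrix_transpose_mul\<close>, use ti in blast)
  then show ?thesis .
qed

lemma modrel_flip:
  assumes m: "modrel m x w"
  shows "modrel (flip_umod m) x (- w)"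
proof -
  have u: "is_umod m" using m by (simp add: modrel_def)
  note i = umod_inv[OF u]
  have neg: "(- A) ** B = - (A ** B)" "A ** (- B) = - (A ** B)" for A B :: "complex^2^2"
    by (simp_all add: matrix_matrix_mult_def vec_eq_iff sum_negf)
  have inv: "matrix_inv (- mK m) = - matrix_inv (mK m)" "invertible (- mK m)"
    using matrix_inv_eqI[of "- mK m" "- matrix_inv (mK m)"] i by (simp_all add: neg)
  have s: "mat c ** (A - B) = mat c ** A - mat c ** B" for c and A B :: "complex^2^2"
    by (simp add: matrix_matrix_mult_def vec_eq_iff right_diff_distrib sum_subtractf)
  have w: "- (mat \<i> ** mE m ** mF m) - mK m + matrix_inv (mK m) = mat (- w)"
  proof -
    have "mat (- w) = - (mat w :: complex^2^2)"
      by (simp add: mat_def vec_eq_iff)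
    then show ?thesis
      using arg_cong[OF conjunct2[OF conjunct2[OF conjunct2[OF conjunct2[OF conjunct2[OF m[unfolded modrel_def]]]]]], of uminus]
      by (simp add: mOm_def algebra_simps)
  qed
  show ?thesis
    using m inv unfolding modrel_def is_umod_def mOm_def flip_umod_def umod.simps
    by (auto simp: neg s) (metis minus_diff_eq, rule w)
qed

section \<open>The operators on a nonsingular tuple\<close>

context uchain
begin

lemma ev_K: "ev (\<lambda>(p, g). gen p g) (prod_list (map (\<lambda>k. uK (k, d)) ks)) = KK d ks"
  by (induction ks) (simp_all add: ev_mult KK_Cons uK_def gK_def)

lemma ev_EF: "ev (\<lambda>(p, g). gen p g) (uEF \<nu> p) = gX \<nu> p"
  by (simp add: uEF_def gX_def uFt_def uE_def uF_def uK_def ev_mult sm_def mult.assoc)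

lemma ev_alpha: "ev (\<lambda>(p, g). gen p g) (alpha j \<nu>) = al j \<nu>"
  by (simp add: alpha_def al_def ev_mult ev_K ev_EF uOi_def gO_def)

lemma ev_alphabar:
  "KK Md [1..<Suc n] * ev (\<lambda>(p, g). gen p g) (alphabar n j \<nu>) = ab j \<nu>"
  by (simp only: alphabar_def ab_def ev_mult ev_K ev_EF) (simp add: uOi_def gO_def)

lemma ev_theta: "ev (\<lambda>(p, g). gen p g) (theta n j \<nu>) = aA j \<nu> - aA (Suc j) \<nu>"
  unfolding theta_def ev_add ev_diff ev_mult ev_K ev_alpha right_diff_distrib ev_alphabar aA_def
  by simp

end

definition wt :: "xchar \<Rightarrow> complex"
  where "wt x = snd x - 1 / snd x"

locale tuple =
  fixes V :: "xchar \<Rightarrow> umod" and a :: "xchar list"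
  assumes V: "ext_char x \<Longrightarrow> nonsingular (fst x) \<Longrightarrow> is_V x (V x)"
    and a: "x \<in> set a \<Longrightarrow> ext_char x \<and> nonsingular (fst x)"
begin

definition n where "n = length a"
definition kap where "kap j = zkap (chr a j)"
definition eps where "eps j = zeps (chr a j)"
definition phi where "phi j = zphi (chr a j)"
definition w where "w j = wt (a ! (j - 1))"

text \<open>The last identity is the formula for \<open>omega2\<close> multiplied by kappa. Its
  right-hand side is, up to the factor -4, the determinant of the matrix \<open>qc j\<close> below,
  so nonsingularity of the factor makes that matrix invertible.\<close>

lemma site:
  assumes "1 \<le> j" "j \<le> n"
  shows "kap j \<noteq> 0" "w j \<noteq> 0" "modrel (V (a ! (j - 1))) (chr a j) (w j)"
    "kap j * (w j)\<^sup>2 = (kap j - 1)\<^sup>2 - eps j * phi j"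
proof -
  let ?x = "a ! (j - 1)"
  have x: "ext_char ?x" "nonsingular (fst ?x)"
    using a[of ?x] assms by (auto simp: n_def)
  show k: "kap j \<noteq> 0"
    using x by (simp add: ext_char_def kap_def chr_def)
  show m: "modrel (V ?x) (chr a j) (w j)"
    unfolding chr_def w_def wt_def
    by (rule is_V_modrel) (use V x in \<open>auto simp: ext_char_def\<close>)
  have o: "w j * w j = omega2 (chr a j)"
    using modrel_omega2[OF m] .
  then show "w j \<noteq> 0"
    using x by (auto simp: nonsingular_def chr_def)
  show "kap j * (w j)\<^sup>2 = (kap j - 1)\<^sup>2 - eps j * phi j"
    using o k by (simp add: power2_eq_square omega2_def kap_def eps_def phi_def field_simps)
qed

abbreviation gen where "gen \<equiv> (\<lambda>p g. gL V a (p, g))"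

lemma pos_modrel:
  assumes "p \<in> positions n"
  shows "modrel (pos_mod V a p) (pos_chr a p) (w (fst p))"
  using assms site(3)[of "fst p"] modrel_dual[OF site(3)[of "fst p"]]
  by (auto simp: positions_def pos_mod_def pos_chr_def)

lemma gen_simps:
  "gen p GE = oE p (pos_mod V a p)" "gen p GF = oF p (pos_mod V a p)"
  "gen p GK = oK p (pos_mod V a p)" "gen p GKi = oKi p (pos_mod V a p)"
  by (simp_all add: gL_def gen_mat_def)

lemma gen_Oi: "p \<in> positions n \<Longrightarrow> gen p GOi = lcs (1 / w (fst p))"
proof -
  assume p: "p \<in> positions n"
  have "mOm (pos_mod V a p) = mat (w (fst p))"
    using pos_modrel[OF p] by (simp add: modrel_def)
  moreover have "w (fst p) \<noteq> 0"
    using site(2)[of "fst p"] p by (auto simp: positions_def)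
  ultimately show ?thesis
    by (simp add: gL_def gen_mat_def matrix_inv_mat opL_mat)
qed

lemma pos_utriple: "p \<in> positions n \<Longrightarrow> utriple lcs (gen p GE) (gen p GF) (gen p GK) (gen p GKi)
    (zkap (pos_chr a p)) (zeps (pos_chr a p)) (zphi (pos_chr a p))"
  using modrel_utriple[OF pos_modrel] by (simp add: gen_simps)

lemma pos_om: "p \<in> positions n \<Longrightarrow> lo.om (gen p GE) (gen p GF) (gen p GK) (gen p GKi) = lcs (w (fst p))"
  using modrel_utrip(2)[OF pos_modrel] by (simp add: gen_simps)

sublocale uchain lcs n gen
proof
  fix p assume p: "p \<in> positions n"
  interpret utriple lcs "gen p GE" "gen p GF" "gen p GK" "gen p GKi"
    "zkap (pos_chr a p)" "zeps (pos_chr a p)" "zphi (pos_chr a p)"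
    by (rule pos_utriple[OF p])
  show "gen p GK * gen p GKi = 1" "gen p GKi * gen p GK = 1"
    "gen p GK * gen p GE = - (gen p GE * gen p GK)" "gen p GK * gen p GF = - (gen p GF * gen p GK)"
    "gen p GE * gen p GF - gen p GF * gen p GE = lo.sm (2 * \<i>) (gen p GK - gen p GKi)"
    by (rule kki ke kf ef)+
  show "gen p GOi * gen p g = gen p g * gen p GOi" for g
    by (simp add: gen_Oi[OF p] lo.cs_comm)
  fix q g h assume "p \<noteq> q"
  then show "gen p g * gen q h = gen q h * gen p g"
    by (simp add: gL_def opL_commute)
qed

lemma chr_pos [simp]: "pos_chr a (j, Md) = chr a j" "pos_chr a (j, Dl) = zinv (chr a j)"
  by (simp_all add: pos_chr_def)

lemma gK_sq: "1 \<le> j \<Longrightarrow> j \<le> n \<Longrightarrow> gK (j, d) * gK (j, d) = lcs (if d = Md then kap j else 1 / kap j)"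
proof -
  assume "1 \<le> j" "j \<le> n"
  then have p: "(j, d) \<in> positions n" by (simp add: pos_simps)
  interpret utriple lcs "gen (j, d) GE" "gen (j, d) GF" "gen (j, d) GK" "gen (j, d) GKi"
    "zkap (pos_chr a (j, d))" "zeps (pos_chr a (j, d))" "zphi (pos_chr a (j, d))"
    by (rule pos_utriple[OF p])
  show ?thesis
    using kk by (cases d) (auto simp: gK_def lo.cs_sm kap_def zinv_def)
qed

definition kpre where "kpre j = (\<Prod>k\<in>{1..<j}. kap k)"

lemma KK_sq_Md: "j \<le> Suc n \<Longrightarrow> KK Md [1..<j] * KK Md [1..<j] = lcs (kpre j)"
proof (induction j)
  case (Suc j)
  show ?case
  proof (cases "j = 0")
    case False
    have "KK Md [1..<j] * gK (j, Md) = gK (j, Md) * KK Md [1..<j]"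
      using sw_KKK[OF upt_pos(1)[of j Md], of "(j, Md)"] Suc.prems False by (simp add: sw_def pos_simps)
    moreover have "KK Md [1..<Suc j] = KK Md [1..<j] * gK (j, Md)"
      using False by (simp add: KK_append KK_Cons)
    ultimately have "KK Md [1..<Suc j] * KK Md [1..<Suc j] = (KK Md [1..<j] * KK Md [1..<j]) * (gK (j, Md) * gK (j, Md))"
      by (metis commute_square)
    also have "\<dots> = lcs (kpre j * kap j)"
      using Suc False by (simp add: gK_sq lo.cs_mult)
    also have "kpre j * kap j = kpre (Suc j)"
      using False by (simp add: kpre_def atLeastLessThanSuc)
    finally show ?thesis .
  qed (simp add: kpre_def)
qed (simp add: kpre_def)

lemma kpre_Suc: "1 \<le> j \<Longrightarrow> kpre (Suc j) = kpre j * kap j"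
  by (simp add: kpre_def atLeastLessThanSuc)

lemma kpre_nz: "j \<le> Suc n \<Longrightarrow> kpre j \<noteq> 0"
  using site(1) by (auto simp: kpre_def)

lemma KK_sq_Dl: "j \<le> n \<Longrightarrow> 1 \<le> j \<Longrightarrow>
    KK Dl [j..<Suc n] * KK Dl [j..<Suc n] = lcs (kpre j / kpre (Suc n))"
proof (induction "n - j" arbitrary: j)
  case 0
  then have j: "j = n" by simp
  show ?case
    unfolding j using 0 kpre_nz[of n] kpre_Suc[of n] by (simp add: KK_Cons gK_sq)
next
  case (Suc m)
  have u: "[j..<Suc n] = j # [Suc j..<Suc n]"
    using Suc.prems by (simp add: upt_rec)
  have "set [Suc j..<Suc n] \<times> {Dl} \<subseteq> positions n"
    using upt_pos(2) by blast
  then have "KK Dl [Suc j..<Suc n] * gK (j, Dl) = gK (j, Dl) * KK Dl [Suc j..<Suc n]"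
    using sw_KKK[of "[Suc j..<Suc n]" Dl "(j, Dl)"] Suc.prems by (simp add: sw_def pos_simps)
  then have "KK Dl [j..<Suc n] * KK Dl [j..<Suc n] =
      (gK (j, Dl) * gK (j, Dl)) * (KK Dl [Suc j..<Suc n] * KK Dl [Suc j..<Suc n])"
    unfolding u KK_Cons by (rule commute_square[OF sym])
  also have "\<dots> = lcs (1 / kap j) * lcs (kpre (Suc j) / kpre (Suc n))"
  proof -
    have "m = n - Suc j" "Suc j \<le> n" "1 \<le> Suc j" using Suc.hyps(2) by auto
    then show ?thesis
      using Suc.hyps(1)[of "Suc j"] gK_sq[of j Dl] Suc.prems by (simp del: upt_Suc)
  qed
  also have "\<dots> = lcs (kpre j / kpre (Suc n))"
    using Suc.prems site(1)[of j] by (simp add: kpre_Suc flip: lo.cs_mult)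
  finally show ?case .
qed

definition qc :: "nat \<Rightarrow> 2 \<Rightarrow> 2 \<Rightarrow> complex"
  where "qc j \<nu> \<xi> = (if \<nu> = 1 \<and> \<xi> = 1 then 2 * eps j else if \<nu> = 2 \<and> \<xi> = 2 then 2 * phi j
    else - 2 * (kap j - 1))"

lemma qq_val:
  assumes j: "1 \<le> j" "j \<le> n"
  shows "qq \<nu> \<xi> (j, d) = lcs (if d = Md then qc j \<nu> \<xi> else - qc j \<nu> \<xi> / kap j)"
proof -
  have p: "(j, d) \<in> positions n" using j by (simp add: pos_simps)
  interpret u: utriple lcs "gen (j, d) GE" "gen (j, d) GF" "gen (j, d) GK" "gen (j, d) GKi"
    "zkap (pos_chr a (j, d))" "zeps (pos_chr a (j, d))" "zphi (pos_chr a (j, d))"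
    by (rule pos_utriple[OF p])
  have k: "gK (j, d) * gK (j, d) = lcs (zkap (pos_chr a (j, d)))"
    using u.kk by (simp add: gK_def lo.cs_sm)
  have "zkap (pos_chr a (j, d)) \<noteq> 0" by (rule u.kap)
  then show ?thesis
    unfolding qq_def k u.ee u.ff qc_def eps_def phi_def kap_def
    by (cases d) (auto simp: lo.sm_def zinv_def diff_divide_distrib right_diff_distrib
      simp flip: lo.cs_mult lo.cs_1 lo.cs_diff lo.cs_uminus)
qed

lemma gO_sq: "1 \<le> j \<Longrightarrow> j \<le> n \<Longrightarrow> gO (j, d) * gO (j, d) = lcs (1 / (w j)\<^sup>2)"
  by (simp add: gO_def gen_Oi pos_simps power2_eq_square flip: lo.cs_mult)

lemma zA_val: "1 \<le> j \<Longrightarrow> j \<le> n \<Longrightarrow> zA j \<nu> \<xi> = lcs (kpre j / (w j)\<^sup>2 * qc j \<nu> \<xi>)"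
  by (simp add: zA_def al_same KK_sq_Md gO_sq qq_val del: One_nat_def flip: lo.cs_mult)

text \<open>The squares of the total K and of the suffix on the dual side telescope to
  \<open>kpre (Suc j)\<close>, and inverting the character turns \<open>qc\<close> into
  \<open>- qc / kap j\<close>. Together this is exactly the negative of \<open>zA\<close>.\<close>

lemma zB_val:
  assumes j: "1 \<le> j" "j \<le> n"
  shows "zB j \<nu> \<xi> = lcs (- (kpre j / (w j)\<^sup>2 * qc j \<nu> \<xi>))"
proof -
  have k: "KK Dl [Suc j..<Suc n] * KK Dl [Suc j..<Suc n] = lcs (kpre (Suc j) / kpre (Suc n))"
    using KK_sq_Dl[of "Suc j"] j kpre_nz[of "Suc n"] by (cases "j = n") auto
  show ?thesis
    using j kpre_nz[of "Suc n"] site(1)[of j] 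
    by (simp add: zB_def ab_same KK_sq_Md k gO_sq qq_val kpre_Suc flip: lo.cs_mult del: upt_Suc One_nat_def)
qed

lemma CAR:
  assumes "1 \<le> j" "j \<le> n" "1 \<le> l" "l \<le> n"
  shows "aA j \<nu> * aA l \<xi> + aA l \<xi> * aA j \<nu> = 0"
    and "aG j \<nu> * aA l \<xi> + aA l \<xi> * aG j \<nu> = (if j = l then lcs (2 * (kpre j / (w j)\<^sup>2 * qc j \<nu> \<xi>)) else 0)"
    and "aG j \<nu> * aG l \<xi> + aG l \<xi> * aG j \<nu> = 0"
  using assms by (auto simp: anticomm zA_val zB_val simp flip: lo.cs_add lo.cs_diff)

end

section \<open>Rings with the operations of a type class\<close>

text \<open>Connects ideals of ring records with arithmetic of the type class, so that membership
  goals can be closed by \<open>algebra_simps\<close>.\<close>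

locale opring = ring R for R :: "'r::ring_1 ring" +
  assumes ops [simp]: "mult R = (*)" "one R = 1" "zero R = 0" "add R = (+)"
begin

lemma a_inv_op: "x \<in> carrier R \<Longrightarrow> \<ominus>\<^bsub>R\<^esub> x = - x"
  using l_neg[of x] by (simp add: eq_neg_iff_add_eq_0)

lemma uminus_closed: "x \<in> carrier R \<Longrightarrow> - x \<in> carrier R"
  using a_inv_closed[of x] a_inv_op[of x] by simp

lemma diff_closed: "x \<in> carrier R \<Longrightarrow> y \<in> carrier R \<Longrightarrow> x - y \<in> carrier R"
  using a_closed[of x "- y"] uminus_closed[of y] by simp

lemma minus_op: "x \<in> carrier R \<Longrightarrow> y \<in> carrier R \<Longrightarrow> x \<ominus>\<^bsub>R\<^esub> y = x - y"
  by (simp add: minus_eq a_inv_op)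

end

locale opideal = opring R for R :: "'r::ring_1 ring" and I +
  assumes ideal: "ideal I R"
begin

lemma in_carrier: "x \<in> I \<Longrightarrow> x \<in> carrier R"
  by (rule ideal.Icarr[OF ideal])

lemma zeroI [simp]: "0 \<in> I"
  using additive_subgroup.zero_closed[OF ideal.axioms(1)[OF ideal]] by simp

lemma addI: "x \<in> I \<Longrightarrow> y \<in> I \<Longrightarrow> x + y \<in> I"
  using additive_subgroup.a_closed[OF ideal.axioms(1)[OF ideal], of x y] by simp

lemma uminusI: "x \<in> I \<Longrightarrow> - x \<in> I"
  using additive_subgroup.a_inv_closed[OF ideal.axioms(1)[OF ideal], of x] a_inv_op[of x] in_carrier[of x] by simp

lemma diffI: "x \<in> I \<Longrightarrow> y \<in> I \<Longrightarrow> x - y \<in> I"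
  using addI[of x "- y"] uminusI[of y] by simp

lemma lmultI: "x \<in> I \<Longrightarrow> y \<in> carrier R \<Longrightarrow> y * x \<in> I"
  using ideal.I_l_closed[OF ideal, of x y] by simp

lemma rmultI: "x \<in> I \<Longrightarrow> y \<in> carrier R \<Longrightarrow> x * y \<in> I"
  using ideal.I_r_closed[OF ideal, of x y] by simp

lemma sumI: "(\<And>i. i \<in> A \<Longrightarrow> f i \<in> I) \<Longrightarrow> sum f A \<in> I"
  by (induction A rule: infinite_finite_induct) (auto intro: addI)

lemma coset_eq: "x \<in> carrier R \<Longrightarrow> y \<in> carrier R \<Longrightarrow> I +>\<^bsub>R\<^esub> x = I +>\<^bsub>R\<^esub> y \<longleftrightarrow> x - y \<in> I"
  using quotient_eq_iff_same_a_r_cos[OF ideal, of x y] by (simp add: minus_op)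

end

lemma opring_free: "opring (free_ring G)"
  using ring_free_ring by (simp add: opring_def opring_axioms_def)

lemma opideal_free: "X \<subseteq> carrier (free_ring G) \<Longrightarrow> opideal (free_ring G) (Idl\<^bsub>free_ring G\<^esub> X)"
  using opring_free[of G] ring.genideal_ideal[OF ring_free_ring, of X G] by (simp add: opideal_def opideal_axioms_def)

lemma (in opring) Idl_incl: "X \<subseteq> carrier R \<Longrightarrow> x \<in> X \<Longrightarrow> x \<in> Idl\<^bsub>R\<^esub> X"
  using genideal_self by blast

section \<open>A quotient of the free algebra on which the relations of \<open>\<U>\<close> hold\<close>

text \<open>All positions are included so that one type serves every \<open>n\<close>. The inverse
  of Omega is only required to commute with E, F, K: when the letters outside
  \<open>positions n\<close> are sent to 0 or 1, Omega goes to 0 there, so an inverse relation would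
  not survive, while commutation does.\<close>

definition qrels :: "ualg set"
  where "qrels =
    (\<Union>p. {uK p * uKi p - 1, uKi p * uK p - 1,
       uK p * uE p + uE p * uK p, uK p * uF p + uF p * uK p,
       uE p * uF p - uF p * uE p - cst (2 * \<i>) * (uK p - uKi p),
       uOi p * uE p - uE p * uOi p, uOi p * uF p - uF p * uOi p, uOi p * uK p - uK p * uOi p}) \<union>
    {gvar (p, g) * gvar (q, h) - gvar (q, h) * gvar (p, g) | p q g h. p \<noteq> q}"

inductive_set qideal :: "ualg set"
  where
    zero: "0 \<in> qideal"
  | gen: "r \<in> qrels \<Longrightarrow> x * r * y \<in> qideal"
  | add: "x \<in> qideal \<Longrightarrow> y \<in> qideal \<Longrightarrow> x + y \<in> qideal"

lemma qideal_lmult: "x \<in> qideal \<Longrightarrow> z * x \<in> qideal"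
  by (induction rule: qideal.induct) (auto simp: distrib_left mult.assoc[symmetric] intro: qideal.intros)

lemma qideal_rmult: "x \<in> qideal \<Longrightarrow> x * z \<in> qideal"
  by (induction rule: qideal.induct) (auto simp: distrib_right mult.assoc[of _ _ z] intro: qideal.intros)

lemma qideal_uminus: "x \<in> qideal \<Longrightarrow> - x \<in> qideal"
  using qideal_lmult[of x "- 1"] by simp

lemma qideal_diff: "x \<in> qideal \<Longrightarrow> y \<in> qideal \<Longrightarrow> x - y \<in> qideal"
  using qideal.add[OF _ qideal_uminus, of x y] by simp

lemma qrels_qideal: "r \<in> qrels \<Longrightarrow> r \<in> qideal"
  using qideal.gen[of r 1 1] by simp

text \<open>Sending K and its inverse to 1 and the other letters to 0 respects every relation, so
  the quotient is nontrivial, as the class \<open>ring_1\<close> demands.\<close>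

lemma one_notin_qideal: "1 \<notin> qideal"
proof
  let ?h = "lo.ev (\<lambda>(p, g). if g \<in> {GK, GKi} then 1 else 0) :: ualg \<Rightarrow> lop"
  have rel: "?h r = 0" if "r \<in> qrels" for r
    using that by (auto simp: qrels_def uE_def uF_def uK_def uKi_def uOi_def lo.ev_mult lo.ev_diff lo.ev_add)
  have "?h x = 0" if "x \<in> qideal" for x
    using that
  proof (induction rule: qideal.induct)
    case (gen r x y)
    show ?case unfolding lo.ev_mult rel[OF gen] by simp
  qed (simp_all only: lo.ev_0 lo.ev_add add_0)
  moreover assume "1 \<in> qideal"
  ultimately have "?h 1 = 0" by blast
  then show False by simp
qed

definition qeq :: "ualg \<Rightarrow> ualg \<Rightarrow> bool"
  where "qeq x y \<longleftrightarrow> x - y \<in> qideal"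

quotient_type uq = ualg / qeq
proof (rule equivpI)
  show "reflp qeq" by (auto simp: reflp_def qeq_def qideal.zero)
  show "symp qeq" using qideal_uminus by (force simp: symp_def qeq_def)
  show "transp qeq"
  proof (rule transpI)
    fix x y z assume "qeq x y" "qeq y z"
    then have "(x - y) + (y - z) \<in> qideal" unfolding qeq_def by (rule qideal.add)
    then show "qeq x z" by (simp add: qeq_def)
  qed
qed

lemma qeq_mult:
  assumes "qeq x y" "qeq x' y'"
  shows "qeq (x * x') (y * y')"
proof -
  have "(x - y) * x' + y * (x' - y') \<in> qideal"
    using assms unfolding qeq_def by (intro qideal.add qideal_lmult qideal_rmult)
  then show ?thesis
    by (simp add: qeq_def algebra_simps)
qed

lemma qeq_add: "qeq x y \<Longrightarrow> qeq x' y' \<Longrightarrow> qeq (x + x') (y + y')"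
  and qeq_diff: "qeq x y \<Longrightarrow> qeq x' y' \<Longrightarrow> qeq (x - x') (y - y')"
  and qeq_uminus: "qeq x y \<Longrightarrow> qeq (- x) (- y)"
  using qideal.add[of "x - y" "x' - y'"] qideal_diff[of "x - y" "x' - y'"] qideal_uminus[of "x - y"]
  by (simp_all add: qeq_def algebra_simps)

instantiation uq :: ring_1
begin
lift_definition zero_uq :: uq is 0 .
lift_definition one_uq :: uq is 1 .
lift_definition plus_uq :: "uq \<Rightarrow> uq \<Rightarrow> uq" is "(+)" by (rule qeq_add)
lift_definition minus_uq :: "uq \<Rightarrow> uq \<Rightarrow> uq" is "(-)" by (rule qeq_diff)
lift_definition uminus_uq :: "uq \<Rightarrow> uq" is uminus by (rule qeq_uminus)
lift_definition times_uq :: "uq \<Rightarrow> uq \<Rightarrow> uq" is "(*)" by (rule qeq_mult)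
instance
proof
  have r: "qeq x x" for x by (simp add: qeq_def qideal.zero)
  fix x y z :: uq
  show "(0::uq) \<noteq> 1"
    by transfer (use one_notin_qideal qideal_uminus in \<open>force simp: qeq_def\<close>)
  show "x * y * z = x * (y * z)" "x + y + z = x + (y + z)" "x + y = y + x" "0 + x = x" "- x + x = 0"
    "x - y = x + - y" "1 * x = x" "x * 1 = x" "(x + y) * z = x * z + y * z" "x * (y + z) = x * y + x * z"
    by (transfer; simp add: r algebra_simps)+
qed
end

lift_definition qcs :: "complex \<Rightarrow> uq" is cst .
lift_definition qgen :: "pos \<Rightarrow> ugen \<Rightarrow> uq" is "\<lambda>p g. gvar (p, g)" .

interpretation qc: calg qcs
proof
  have r: "qeq x x" for x by (simp add: qeq_def qideal.zero)
  fix c d x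
  show "qcs (c + d) = qcs c + qcs d" "qcs (c * d) = qcs c * qcs d" "qcs 1 = 1"
    by (transfer; simp add: r cst_add cst_mult)+
  show "qcs c * x = x * qcs c"
    by transfer (simp add: r cst_central)
qed

lemma qev: "qc.ev (\<lambda>(p, g). qgen p g) x = abs_uq x"
proof -
  have "x \<in> carrier (free_ring UNIV)" by simp
  then show ?thesis
  proof (induction rule: free_ring_induct)
    case (cst c)
    show ?case unfolding qc.ev_cst by (rule qcs.abs_eq)
  next
    case (gvar_mult g x)
    then show ?case by (cases g) (simp add: qc.ev_mult qgen.abs_eq times_uq.abs_eq)
  next
    case (add x y)
    then show ?case by (simp add: qc.ev_add plus_uq.abs_eq)
  qed
qed

lemma qev_zero: "qc.ev (\<lambda>(p, g). qgen p g) x = 0 \<longleftrightarrow> x \<in> qideal"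
  unfolding qev zero_uq.abs_eq uq.abs_eq_iff by (simp add: qeq_def)

interpretation qch: uchain qcs n qgen for n
proof
  fix p :: pos
  have z: "abs_uq r = 0" if "r \<in> qrels" for r
    using qrels_qideal[OF that] qev_zero[of r] by (simp add: qev)
  have g: "qgen p g = abs_uq (gvar (p, g))" for p g
    by (simp add: qgen.abs_eq)
  have u: "r \<in> {uK p * uKi p - 1, uKi p * uK p - 1,
       uK p * uE p + uE p * uK p, uK p * uF p + uF p * uK p,
       uE p * uF p - uF p * uE p - cst (2 * \<i>) * (uK p - uKi p),
       uOi p * uE p - uE p * uOi p, uOi p * uF p - uF p * uOi p, uOi p * uK p - uK p * uOi p} \<Longrightarrow> r \<in> qrels" for r
    unfolding qrels_def by (rule UnI1, rule UN_I[where a = p], rule UNIV_I, assumption)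
  note Z = z[OF u]
  note d = uE_def uF_def uK_def uKi_def uOi_def
  note h = plus_uq.abs_eq[symmetric] minus_uq.abs_eq[symmetric] times_uq.abs_eq[symmetric]
    one_uq.abs_eq[symmetric] qcs.abs_eq[symmetric]
  show "qgen p GK * qgen p GKi = 1" "qgen p GKi * qgen p GK = 1"
    using Z[of "uK p * uKi p - 1"] Z[of "uKi p * uK p - 1"] by (simp_all add: d g h)
  show "qgen p GK * qgen p GE = - (qgen p GE * qgen p GK)" "qgen p GK * qgen p GF = - (qgen p GF * qgen p GK)"
    using Z[of "uK p * uE p + uE p * uK p"] Z[of "uK p * uF p + uF p * uK p"]
    by (simp_all add: d g h add_eq_0_iff2)
  show "qgen p GE * qgen p GF - qgen p GF * qgen p GE = qc.sm (2 * \<i>) (qgen p GK - qgen p GKi)"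
    using Z[of "uE p * uF p - uF p * uE p - cst (2 * \<i>) * (uK p - uKi p)"]
    by (simp add: d g h qc.sm_def del: qc.sm_2)
  show "qgen p GOi * qgen p g' = qgen p g' * qgen p GOi" if "g' \<in> {GE, GF, GK}" for g'
    using that Z[of "uOi p * uE p - uE p * uOi p"] Z[of "uOi p * uF p - uF p * uOi p"]
      Z[of "uOi p * uK p - uK p * uOi p"] by (auto simp: d g h)
  fix q g' h' assume "p \<noteq> q"
  then have "gvar (p, g') * gvar (q, h') - gvar (q, h') * gvar (p, g') \<in> qrels"
    unfolding qrels_def by blast
  from z[OF this] show "qgen p g' * qgen q h' = qgen q h' * qgen p g'"
    by (simp add: g h)
qed

section \<open>From the quotient back to the relations on the first factors\<close>

text \<open>A retraction onto the words in the first \<open>n\<close> factors. The values outside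
  form the trivial representation, with the inverse of Omega sent to 0.\<close>

definition retr :: "nat \<Rightarrow> ualg \<Rightarrow> ualg"
  where "retr n = fa.ev (\<lambda>(p, g). if p \<in> positions n then gvar (p, g)
    else if g \<in> {GK, GKi} then 1 else 0)"

lemma retr_id: "x \<in> carrier (uring n) \<Longrightarrow> retr n x = x"
  unfolding retr_def uring_def
  by (subst (2) fa_ev_gvar[symmetric]) (rule fa.ev_cong, auto)

lemma urels_carrier: "urels n \<subseteq> carrier (uring n)"
  unfolding urels_def uring_def uE_def uF_def uK_def uKi_def uOi_def uOm_def
  by (auto intro!: free_intros)

interpretation ur: opideal "uring n" "Idl\<^bsub>uring n\<^esub> (urels n)" for n
  unfolding uring_def by (rule opideal_free[OF urels_carrier[unfolded uring_def]])

lemma urelsI: "r \<in> urels n \<Longrightarrow> r \<in> Idl\<^bsub>uring n\<^esub> (urels n)"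
  by (rule ur.Idl_incl[OF urels_carrier])

lemma urels_site: "p \<in> positions n \<Longrightarrow> r \<in> {uK p * uKi p - 1, uKi p * uK p - 1,
       uK p * uE p + uE p * uK p, uK p * uF p + uF p * uK p,
       uE p * uF p - uF p * uE p - cst (2 * \<i>) * (uK p - uKi p),
       uOm p * uOi p - 1, uOi p * uOm p - 1} \<Longrightarrow> r \<in> Idl\<^bsub>uring n\<^esub> (urels n)"
  by (rule urelsI) (unfold urels_def, rule UnI1, rule UN_I)

lemma urels_cross: "p \<in> positions n \<Longrightarrow> q \<in> positions n \<Longrightarrow> p \<noteq> q \<Longrightarrow>
    gvar (p, g) * gvar (q, h) - gvar (q, h) * gvar (p, g) \<in> Idl\<^bsub>uring n\<^esub> (urels n)"
  by (rule urelsI) (unfold urels_def, rule UnI2, blast)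

lemma uring_gen: "p \<in> positions n \<Longrightarrow> uE p \<in> carrier (uring n)" "p \<in> positions n \<Longrightarrow> uF p \<in> carrier (uring n)"
    "p \<in> positions n \<Longrightarrow> uK p \<in> carrier (uring n)" "p \<in> positions n \<Longrightarrow> uKi p \<in> carrier (uring n)"
    "p \<in> positions n \<Longrightarrow> uOi p \<in> carrier (uring n)"
  by (auto simp: uring_def uE_def uF_def uK_def uKi_def uOi_def)

lemma uring_closed: "cst c \<in> carrier (uring n)" "1 \<in> carrier (uring n)" "0 \<in> carrier (uring n)"
    "x \<in> carrier (uring n) \<Longrightarrow> y \<in> carrier (uring n) \<Longrightarrow> x * y \<in> carrier (uring n)"
    "x \<in> carrier (uring n) \<Longrightarrow> y \<in> carrier (uring n) \<Longrightarrow> x + y \<in> carrier (uring n)"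
    "x \<in> carrier (uring n) \<Longrightarrow> y \<in> carrier (uring n) \<Longrightarrow> x - y \<in> carrier (uring n)"
    "x \<in> carrier (uring n) \<Longrightarrow> - x \<in> carrier (uring n)"
  by (auto simp: uring_def intro: free_intros)

text \<open>Omega is central modulo the relations, and an inverse of a central element is central.
  This recovers the weaker relations of \<open>qrels\<close> from those of
  \<open>urels\<close>.\<close>

lemma Oi_commutes:
  assumes p: "p \<in> positions n" and g: "x \<in> {uE p, uF p, uK p}"
  shows "uOi p * x - x * uOi p \<in> Idl\<^bsub>uring n\<^esub> (urels n)" (is "_ \<in> ?I")
proof -
  let ?E = "uE p" and ?F = "uF p" and ?K = "uK p" and ?Ki = "uKi p" and ?O = "uOi p" and ?W = "uOm p"
  have m: "?K * ?Ki - 1 \<in> ?I" "?Ki * ?K - 1 \<in> ?I" "?K * ?E + ?E * ?K \<in> ?I" "?K * ?F + ?F * ?K \<in> ?I"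
    "?E * ?F - ?F * ?E - cst (2 * \<i>) * (?K - ?Ki) \<in> ?I" "?W * ?O - 1 \<in> ?I" "?O * ?W - 1 \<in> ?I"
    by (rule urels_site[OF p], simp)+
  note c = uring_closed uring_gen[OF p]
  have Ki: "?Ki * y + y * ?Ki \<in> ?I" if y: "?K * y + y * ?K \<in> ?I" "y \<in> carrier (uring n)" for y
  proof -
    have "?Ki * (?K * y + y * ?K) * ?Ki - (?Ki * ?K - 1) * (y * ?Ki) - (?Ki * y) * (?K * ?Ki - 1) \<in> ?I"
      by (intro ur.diffI ur.lmultI ur.rmultI m y c)
    then show ?thesis by (simp add: algebra_simps)
  qed
  have two: "cst (2 * \<i>) = cst \<i> + cst \<i>"
    by (simp flip: cst_add)
  have i1: "cst \<i> * (cst \<i> * y) = - y" for y :: ualg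
  proof -
    have "cst \<i> * cst \<i> = (- 1 :: ualg)"
      by (simp add: cst_uminus flip: cst_mult)
    then show ?thesis by (simp flip: mult.assoc)
  qed
  have i2: "y * (cst \<i> * z) = cst \<i> * (y * z)" for y z :: ualg
    by (rule swap_assoc[OF cst_central[symmetric]])
  note ii = i1 i2[of ?E] i2[of ?F] i2[of ?K] i2[of ?Ki]
  have W: "?W \<in> carrier (uring n)"
    unfolding uOm_def by (intro c)
  have xW: "x * ?W - ?W * x \<in> ?I"
  proof -
    consider "x = ?E" | "x = ?F" | "x = ?K" using g by blast
    then show ?thesis
    proof cases
      case 1
      have "cst \<i> * ?E * (?E * ?F - ?F * ?E - cst (2 * \<i>) * (?K - ?Ki)) - (?K * ?E + ?E * ?K) + (?Ki * ?E + ?E * ?Ki) \<in> ?I"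
        by (intro ur.diffI ur.addI ur.lmultI Ki m c)
      then show ?thesis
        unfolding 1 uOm_def two by (simp add: algebra_simps ii)
    next
      case 2
      have "- (cst \<i> * ((?E * ?F - ?F * ?E - cst (2 * \<i>) * (?K - ?Ki)) * ?F)) + (?K * ?F + ?F * ?K) - (?Ki * ?F + ?F * ?Ki) \<in> ?I"
        by (intro ur.diffI ur.addI ur.uminusI ur.lmultI ur.rmultI Ki m c)
      then show ?thesis
        unfolding 2 uOm_def two by (simp add: algebra_simps ii)
    next
      case 3
      have "cst \<i> * ((?K * ?E + ?E * ?K) * ?F) - cst \<i> * (?E * (?K * ?F + ?F * ?K)) + (?Ki * ?K - 1) - (?K * ?Ki - 1) \<in> ?I"
        by (intro ur.diffI ur.addI ur.lmultI ur.rmultI m c)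
      then show ?thesis
        unfolding 3 uOm_def by (simp add: algebra_simps ii)
    qed
  qed
  have x: "x \<in> carrier (uring n)" using g c by auto
  \<comment> \<open>Multiplying the commutator with Omega by the inverse on both sides leaves the
    commutator with the inverse, up to the two defining relations of the inverse.\<close>
  have "?O * (x * ?W - ?W * x) * ?O - ?O * x * (?W * ?O - 1) + (?O * ?W - 1) * (x * ?O) \<in> ?I"
    by (intro ur.diffI ur.addI ur.lmultI ur.rmultI xW m c x)
  then show ?thesis
    by (simp add: algebra_simps)
qed

text \<open>A relation that mentions a position outside is sent to 0, because 0 and 1 commute with
  everything; the remaining ones lie in the smaller ideal.\<close>

lemma retr_qideal: "x \<in> qideal \<Longrightarrow> retr n x \<in> Idl\<^bsub>uring n\<^esub> (urels n)"
proof (induction rule: qideal.induct)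
  case (gen r x y)
  note d = uE_def uF_def uK_def uKi_def uOi_def
  have car: "retr n z \<in> carrier (uring n)" for z
    unfolding retr_def uring_def by (rule fa_ev_carrier[of _ UNIV]) auto
  have "retr n r \<in> Idl\<^bsub>uring n\<^esub> (urels n)"
  proof -
    consider (site) p where "r \<in> {uK p * uKi p - 1, uKi p * uK p - 1,
       uK p * uE p + uE p * uK p, uK p * uF p + uF p * uK p,
       uE p * uF p - uF p * uE p - cst (2 * \<i>) * (uK p - uKi p),
       uOi p * uE p - uE p * uOi p, uOi p * uF p - uF p * uOi p, uOi p * uK p - uK p * uOi p}"
      | (cross) p q g h where "p \<noteq> q" "r = gvar (p, g) * gvar (q, h) - gvar (q, h) * gvar (p, g)"
      using gen unfolding qrels_def by blast
    then show ?thesis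
    proof cases
      case site
      show ?thesis
      proof (cases "p \<in> positions n")
        case True
        then have "retr n r = r"
          using site by (intro retr_id) (auto intro!: uring_closed uring_gen)
        moreover have "r \<in> Idl\<^bsub>uring n\<^esub> (urels n)"
          using site urels_site[OF True, of r] Oi_commutes[OF True] by fast
        ultimately show ?thesis by simp
      next
        case False
        then have "retr n r = 0"
          using site by (auto simp: retr_def d fa.ev_mult fa.ev_diff fa.ev_add)
        then show ?thesis by simp
      qed
    next
      case cross
      show ?thesis
      proof (cases "p \<in> positions n \<and> q \<in> positions n")
        case True
        then show ?thesis
          using cross urels_cross[of p n q g h] by (simp add: retr_def fa.ev_mult fa.ev_diff)
      next
        case False
        then have "retr n r = 0"
          using cross by (auto simp: retr_def fa.ev_mult fa.ev_diff)
        then show ?thesis by simp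
      qed
    qed
  qed
  then show ?case
    using car by (auto simp: retr_def fa.ev_mult intro: ur.lmultI ur.rmultI)
qed (auto simp: retr_def fa.ev_add intro: ur.addI)

lemma qideal_urels: "x \<in> carrier (uring n) \<Longrightarrow> x \<in> qideal \<Longrightarrow> x \<in> Idl\<^bsub>uring n\<^esub> (urels n)"
  using retr_qideal[of x n] retr_id[of x n] by simp

section \<open>Twisted cocycles\<close>

lemma zinvertible:
  fixes A :: "complex^2^2"
  assumes "invertible A"
  shows "A *v (matrix_inv A *v x) = x" "matrix_inv A *v (A *v x) = x"
proof -
  obtain B where B: "A ** B = mat 1 \<and> B ** A = mat 1"
    using assms by (auto simp: invertible_def)
  have "A ** matrix_inv A = mat 1 \<and> matrix_inv A ** A = mat 1"
    unfolding matrix_inv_def by (rule someI[where x = B]) (rule B)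
  then show "A *v (matrix_inv A *v x) = x" "matrix_inv A *v (A *v x) = x"
    by (simp_all add: matrix_vector_mul_assoc)
qed

lemma invertible_22: "invertible (A :: complex^2^2) \<longleftrightarrow> A $ 1 $ 1 * A $ 2 $ 2 - A $ 1 $ 2 * A $ 2 $ 1 \<noteq> 0"
  by (simp add: invertible_det_nz det_2)

lemma chip_entries: "chip x $ 1 $ 1 = zkap x" "chip x $ 1 $ 2 = 0" "chip x $ 2 $ 1 = zphi x" "chip x $ 2 $ 2 = 1"
  and chim_entries: "chim x $ 1 $ 1 = 1" "chim x $ 1 $ 2 = zeps x" "chim x $ 2 $ 1 = 0" "chim x $ 2 $ 2 = zkap x"
  by (simp_all add: chip_def chim_def vector_2)

lemma chip_invertible: "zkap x \<noteq> 0 \<Longrightarrow> invertible (chip x)"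
  and chim_invertible: "zkap x \<noteq> 0 \<Longrightarrow> invertible (chim x)"
  by (simp_all add: invertible_22 chip_entries chim_entries)

lemma matrix_inv_invertible: "invertible (A :: complex^2^2) \<Longrightarrow> invertible (matrix_inv A)"
proof -
  assume "invertible A"
  then have "A ** matrix_inv A ** matrix_inv (matrix_inv A) = matrix_inv (matrix_inv A) \<or> True" by simp
  obtain B where B: "A ** B = mat 1 \<and> B ** A = mat 1"
    using \<open>invertible A\<close> by (auto simp: invertible_def)
  have "A ** matrix_inv A = mat 1 \<and> matrix_inv A ** A = mat 1"
    unfolding matrix_inv_def by (rule someI[where x = B]) (rule B)
  then show "invertible (matrix_inv A)"
    by (auto simp: invertible_def)
qed

lemma invertible_mult: "invertible (A :: complex^2^2) \<Longrightarrow> invertible (B :: complex^2^2) \<Longrightarrow> invertible (A ** B)"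
  by (simp add: invertible_det_nz det_mul)

definition regular :: "xchar list \<Rightarrow> bool"
  where "regular a \<longleftrightarrow> (\<forall>j\<in>{1..length a}. zkap (chr a j) \<noteq> 0)"

lemma regular_ext_char: "list_all ext_char a \<Longrightarrow> regular a"
  by (auto simp: regular_def chr_def list_all_length ext_char_def)

lemma prodp_0: "prodp a 0 = mat 1"
  and prodp_Suc: "prodp a (Suc j) = prodp a j ** chip (chr a (Suc j))"
  by (simp_all add: prodp_def)

lemma prodp_invertible: "regular a \<Longrightarrow> j \<le> length a \<Longrightarrow> invertible (prodp a j)"
proof (induction j)
  case 0
  then show ?case by (simp add: prodp_0 invertible_det_nz)
next
  case (Suc j)
  then have "zkap (chr a (Suc j)) \<noteq> 0"
    by (simp add: regular_def)
  with Suc show ?case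
    unfolding prodp_Suc by (intro invertible_mult chip_invertible) auto
qed

lemma rho_gen_invertible:
  assumes "regular a" "j \<in> {1..length a}"
  shows "invertible (rho_gen a j)"
proof -
  have k: "zkap (chr a j) \<noteq> 0" using assms by (auto simp: regular_def)
  have "invertible (prodp a (j - 1))"
    using assms by (intro prodp_invertible) auto
  then show ?thesis
    unfolding rho_gen_def psi_def
    using k by (intro invertible_mult matrix_inv_invertible chip_invertible chim_invertible)
qed

lemma rho_append: "rho a (u @ v) = rho a u ** rho a v"
  by (induction u) (simp_all add: matrix_mul_assoc)

lemma fwords_Nil [simp]: "[] \<in> fwords n"
  and fwords_append: "u @ v \<in> fwords n \<longleftrightarrow> u \<in> fwords n \<and> v \<in> fwords n"
  by (auto simp: fwords_def)

lemma fwords_Cons: "l # w \<in> fwords n \<longleftrightarrow> fst l \<in> {1..n} \<and> w \<in> fwords n"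
  by (cases l) (simp add: fwords_def)

lemma y_loop_0 [simp]: "y_loop 0 = []"
  and y_loop_Suc: "y_loop (Suc j) = (Suc j, True) # y_loop j"
  by (simp_all add: y_loop_def)

lemma y_loop_fwords: "j \<le> n \<Longrightarrow> y_loop j \<in> fwords n"
  by (induction j) (auto simp: y_loop_Suc fwords_Cons)

subsection \<open>Words up to free reduction\<close>

lemma H1lf_props:
  assumes "d \<in> H1lf a"
  shows H1lf_out: "w \<notin> fwords (length a) \<Longrightarrow> d w = 0"
    and H1lf_append: "u \<in> fwords (length a) \<Longrightarrow> v \<in> fwords (length a) \<Longrightarrow> d (u @ v) = d u + rho a u *v d v"
    and H1lf_pair: "j \<in> {1..length a} \<Longrightarrow> d [(j, e), (j, \<not> e)] = 0"
    and H1lf_y: "d (y_loop (length a)) = 0"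
    and H1lf_Nil: "d [] = 0"
proof -
  show app: "u \<in> fwords (length a) \<Longrightarrow> v \<in> fwords (length a) \<Longrightarrow> d (u @ v) = d u + rho a u *v d v" for u v
    using assms by (simp add: H1lf_def)
  show "w \<notin> fwords (length a) \<Longrightarrow> d w = 0" "d (y_loop (length a)) = 0"
    using assms by (simp_all add: H1lf_def)
  show "j \<in> {1..length a} \<Longrightarrow> d [(j, e), (j, \<not> e)] = 0"
    using assms by (cases e) (simp_all add: H1lf_def)
  show "d [] = 0"
    using app[of "[]" "[]"] by simp
qed

lemma H1lf_Cons: "d \<in> H1lf a \<Longrightarrow> fst l \<in> {1..length a} \<Longrightarrow> w \<in> fwords (length a) \<Longrightarrow>
    d (l # w) = d [l] + rho a [l] *v d w"
  using H1lf_append[of d a "[l]" w] by (simp add: fwords_Cons)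

lemma rho_pair:
  assumes "regular a" "j \<in> {1..length a}"
  shows "rho a [(j, e), (j, \<not> e)] = mat 1"
proof -
  have "rho_gen a j *v (matrix_inv (rho_gen a j) *v x) = x" "matrix_inv (rho_gen a j) *v (rho_gen a j *v x) = x" for x
    using zinvertible[OF rho_gen_invertible[OF assms]] by auto
  then have "rho a [(j, e), (j, \<not> e)] *v x = mat 1 *v x" for x
    by (cases e) (simp_all add: matrix_vector_mul_assoc[symmetric])
  then show ?thesis
    by (simp add: matrix_eq)
qed

text \<open>Makes a class insensitive to free reduction at any place of a word. Words with letters
  out of range have value 0 on both sides.\<close>

lemma H1lf_cancel:
  assumes d: "d \<in> H1lf a" and a: "regular a" and j: "j \<in> {1..length a}"
  shows "d (u @ [(j, e), (j, \<not> e)] @ v) = d (u @ v)"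
proof (cases "u \<in> fwords (length a) \<and> v \<in> fwords (length a)")
  case True
  have p: "[(j, e), (j, \<not> e)] \<in> fwords (length a)" using j by (simp add: fwords_Cons)
  show ?thesis
    using True p H1lf_append[OF d, of u "[(j, e), (j, \<not> e)] @ v"]
      H1lf_append[OF d, of "[(j, e), (j, \<not> e)]" v] H1lf_append[OF d, of u v]
      H1lf_pair[OF d j, of e] rho_pair[OF a j, of e] by (simp add: fwords_append fwords_Cons)
next
  case False
  then have "u @ [(j, e), (j, \<not> e)] @ v \<notin> fwords (length a)" "u @ v \<notin> fwords (length a)"
    by (auto simp: fwords_append fwords_Cons)
  then show ?thesis using H1lf_out[OF d] by simp
qed

lemma rho_cancel:
  assumes "regular a" "j \<in> {1..length a}"
  shows "rho a (u @ [(j, e), (j, \<not> e)] @ v) = rho a (u @ v)"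
  using rho_pair[OF assms, of e] unfolding rho_append by simp

subsection \<open>The basis dual to the loops\<close>

text \<open>The cocycle rule for \<open>y_loop (Suc j)\<close> recovers the value on each generator
  from two consecutive loops; the empty loop and the boundary loop have value 0.\<close>

lemma H1lf_ext:
  assumes d: "d \<in> H1lf a" "d' \<in> H1lf a" and a: "regular a"
    and eq: "\<And>k. k \<in> {1..<length a} \<Longrightarrow> d (y_loop k) = d' (y_loop k)"
  shows "d = d'"
proof
  have y: "d (y_loop k) = d' (y_loop k)" if "k \<le> length a" for k
    using that eq[of k] H1lf_y[OF d(1)] H1lf_y[OF d(2)] H1lf_Nil[OF d(1)] H1lf_Nil[OF d(2)]
    by (cases "k = 0"; cases "k = length a") auto
  have x: "d [(j, True)] = d' [(j, True)]" if j: "j \<in> {1..length a}" for j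
  proof -
    obtain i where i: "j = Suc i" using j by (cases j) auto
    have "e (y_loop j) = e [(j, True)] + rho a [(j, True)] *v e (y_loop i)" if "e \<in> H1lf a" for e
      unfolding i y_loop_Suc
      by (rule H1lf_Cons[OF that]) (use j i y_loop_fwords[of i "length a"] in auto)
    from this[OF d(1)] this[OF d(2)] show ?thesis
      using y[of j] y[of i] j i by simp
  qed
  have l: "d [l] = d' [l]" if j: "fst l \<in> {1..length a}" for l
  proof (cases "snd l")
    case True
    then show ?thesis using x[OF j] by (cases l) auto
  next
    case False
    then have l: "l = (fst l, False)" by (cases l) auto
    have "e [l] = - (rho a [l] *v e [(fst l, True)])" if "e \<in> H1lf a" for e
    proof -
      have "e (l # [(fst l, True)]) = e [l] + rho a [l] *v e [(fst l, True)]"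
        by (rule H1lf_Cons[OF that j]) (use j in \<open>simp add: fwords_Cons\<close>)
      moreover have "e (l # [(fst l, True)]) = 0"
        using H1lf_pair[OF that j, of False] by (subst l) simp
      ultimately show ?thesis by (simp add: add_eq_0_iff2)
    qed
    from this[OF d(1)] this[OF d(2)] show ?thesis
      using x[OF j] by simp
  qed
  fix w
  show "d w = d' w"
  proof (cases "w \<in> fwords (length a)")
    case True
    then show ?thesis
    proof (induction w)
      case (Cons c w)
      then have c: "fst c \<in> {1..length a}" "w \<in> fwords (length a)" "d w = d' w"
        by (auto simp: fwords_Cons)
      show ?case
        unfolding H1lf_Cons[OF d(1) c(1,2)] H1lf_Cons[OF d(2) c(1,2)] c(3) l[OF c(1)] ..
    qed (simp add: H1lf_Nil[OF d(1)] H1lf_Nil[OF d(2)])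
  qed (simp add: H1lf_out[OF d(1)] H1lf_out[OF d(2)])
qed

lemma mult_vec_uminus: "(A :: complex^2^2) *v (- x) = - (A *v x)"
  by (simp add: matrix_vector_mult_def vec_eq_iff sum_negf)

text \<open>The twisted cocycle with value \<open>g j\<close> on the \<open>j\<close>-th generator;
  the value on an inverse letter is forced by the cocycle rule.\<close>

primrec cocyc :: "xchar list \<Rightarrow> (nat \<Rightarrow> complex^2) \<Rightarrow> fword \<Rightarrow> complex^2" where
  "cocyc a g [] = 0"
| "cocyc a g (l # w) = (if snd l then g (fst l) else - (rho a [l] *v g (fst l))) + rho a [l] *v cocyc a g w"

lemma cocyc_append: "cocyc a g (u @ v) = cocyc a g u + rho a u *v cocyc a g v"
proof (induction u)
  case (Cons l u)
  have "rho a (l # u) = rho a [l] ** rho a u" by simp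
  then show ?case
    using Cons by (simp add: matrix_vector_right_distrib matrix_vector_mul_assoc del: rho.simps)
qed simp

lemma H1lf_exists:
  assumes a: "regular a"
  shows "\<exists>d\<in>H1lf a. \<forall>k\<in>{1..<length a}. d (y_loop k) = u k"
proof -
  \<comment> \<open>The extension by 0 covers index 0, where the loop is empty, and the last index,
    where it is the boundary. Then \<open>g\<close> solves the recursion for the loops.\<close>
  define u' where "u' k = (if k \<in> {1..<length a} then u k else 0)" for k
  define g where "g j = u' j - rho a [(j, True)] *v u' (j - 1)" for j
  define d where "d w = (if w \<in> fwords (length a) then cocyc a g w else 0)" for w
  have y: "cocyc a g (y_loop k) = u' k" for k
    by (induction k) (simp_all add: y_loop_Suc g_def u'_def)
  have "rho_gen a j *v (matrix_inv (rho_gen a j) *v x) = x" "matrix_inv (rho_gen a j) *v (rho_gen a j *v x) = x"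
    if "j \<in> {1..length a}" for j x
    using zinvertible[OF rho_gen_invertible[OF a that]] by auto
  then have "d \<in> H1lf a"
    unfolding H1lf_def
    by (auto simp: d_def cocyc_append fwords_append fwords_Cons y y_loop_fwords u'_def
        mult_vec_uminus)
  moreover have "d (y_loop k) = u k" if "k \<in> {1..<length a}" for k
    using that y_loop_fwords[of k "length a"] by (simp add: d_def y u'_def)
  ultimately show ?thesis by blast
qed

lemma zdual_props:
  assumes a: "regular a"
  shows "zdual a j m \<in> H1lf a"
    and "k \<in> {1..<length a} \<Longrightarrow> zdual a j m (y_loop k) = (if k = j then axis m 1 else 0)"
proof -
  let ?P = "\<lambda>d. d \<in> H1lf a \<and> (\<forall>k\<in>{1..<length a}. d (y_loop k) = (if k = j then axis m 1 else 0))"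
  obtain d where d: "?P d"
    using H1lf_exists[OF a, of "\<lambda>k. if k = j then axis m 1 else 0"] by blast
  have "?P (zdual a j m)"
    unfolding zdual_def
  proof (rule theI[of ?P])
    fix d' assume "?P d'"
    with d show "d' = d" by (intro H1lf_ext[OF _ _ a]) auto
  qed (rule d)
  then show "zdual a j m \<in> H1lf a"
    and "k \<in> {1..<length a} \<Longrightarrow> zdual a j m (y_loop k) = (if k = j then axis m 1 else 0)"
    by auto
qed

lemma H1lf_zero: "(\<lambda>w. 0) \<in> H1lf a"
  by (simp add: H1lf_def)

lemma H1lf_add: "d \<in> H1lf a \<Longrightarrow> d' \<in> H1lf a \<Longrightarrow> (\<lambda>w. d w + d' w) \<in> H1lf a"
  by (simp add: H1lf_def matrix_vector_right_distrib)

lemma vec_scale: "(A :: complex^2^2) *v (c *s x) = c *s (A *v x)"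
  by (simp add: matrix_vector_mult_def vec_eq_iff sum_distrib_left mult.left_commute)

lemma H1lf_scale: "d \<in> H1lf a \<Longrightarrow> (\<lambda>w. c *s d w) \<in> H1lf a"
  by (simp add: H1lf_def vec_scale vector_add_ldistrib)

lemma H1lf_sum: "(\<And>i. i \<in> A \<Longrightarrow> f i \<in> H1lf a) \<Longrightarrow> (\<lambda>w. \<Sum>i\<in>A. f i w) \<in> H1lf a"
  by (induction A rule: infinite_finite_induct) (auto intro: H1lf_zero H1lf_add)

text \<open>Coordinates in the basis \<^const>\<open>vbas\<close>: the index \<open>\<nu> = 1\<close> belongs to the second row.\<close>

definition nidx :: "2 \<Rightarrow> 2" where "nidx \<nu> = (if \<nu> = 1 then 2 else 1)"

definition coef :: "xchar list \<Rightarrow> (fword \<Rightarrow> complex^2) \<Rightarrow> nat \<Rightarrow> 2 \<Rightarrow> complex"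
  where "coef a d j \<nu> = (matrix_inv (prodp a j) *v d (y_loop j)) $ nidx \<nu>"

lemma coef_add: "coef a (\<lambda>w. d w + d' w) j \<nu> = coef a d j \<nu> + coef a d' j \<nu>"
  and coef_scale: "coef a (\<lambda>w. c *s d w) j \<nu> = c * coef a d j \<nu>"
  by (simp_all add: coef_def matrix_vector_right_distrib vec_scale)

lemma vbas_H1lf: "regular a \<Longrightarrow> vbas a j \<nu> \<in> H1lf a"
  unfolding vbas_def by (intro H1lf_sum H1lf_scale zdual_props)

lemma vbas_y:
  assumes "regular a" "k \<in> {1..<length a}"
  shows "vbas a j \<nu> (y_loop k) = (if k = j then prodp a j *v axis (nidx \<nu>) 1 else 0)"
  using assms by (auto simp: vbas_def zdual_props nidx_def transpose_def vec_eq_iff axis_def sum_2 forall_2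
      matrix_vector_mult_def)

lemma coef_vbas:
  assumes "regular a" "k \<in> {1..<length a}"
  shows "coef a (vbas a j \<nu>) k \<xi> = (if k = j \<and> \<nu> = \<xi> then 1 else 0)"
proof -
  have "invertible (prodp a k)" using assms by (intro prodp_invertible) auto
  then show ?thesis
    using exhaust_2[of \<nu>] exhaust_2[of \<xi>]
    by (auto simp: coef_def vbas_y[OF assms] zinvertible nidx_def axis_def)
qed

lemma vbas_expand:
  assumes d: "d \<in> H1lf a" and a: "regular a"
  shows "d = (\<lambda>w. \<Sum>j\<in>{1..<length a}. \<Sum>\<nu>\<in>UNIV. coef a d j \<nu> *s vbas a j \<nu> w)"
proof (rule H1lf_ext[OF d _ a])
  show "(\<lambda>w. \<Sum>j\<in>{1..<length a}. \<Sum>\<nu>\<in>UNIV. coef a d j \<nu> *s vbas a j \<nu> w) \<in> H1lf a"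
    by (intro H1lf_sum H1lf_scale vbas_H1lf a)
  fix k assume k: "k \<in> {1..<length a}"
  let ?c = "matrix_inv (prodp a k) *v d (y_loop k)"
  have inv: "invertible (prodp a k)" using k by (intro prodp_invertible a) auto
  have "(\<Sum>j\<in>{1..<length a}. \<Sum>\<nu>\<in>UNIV. coef a d j \<nu> *s vbas a j \<nu> (y_loop k)) =
      (\<Sum>j\<in>{1..<length a}. if j = k then \<Sum>\<nu>\<in>UNIV. coef a d k \<nu> *s (prodp a k *v axis (nidx \<nu>) 1) else 0)"
    by (rule sum.cong) (auto simp: vbas_y[OF a k])
  also have "\<dots> = (\<Sum>\<nu>\<in>UNIV. coef a d k \<nu> *s (prodp a k *v axis (nidx \<nu>) 1))"
    using k by simp
  also have "\<dots> = prodp a k *v ?c"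
    by (simp add: coef_def nidx_def sum_2 vec_eq_iff matrix_vector_mult_def axis_def algebra_simps)
  also have "\<dots> = d (y_loop k)"
    by (rule zinvertible[OF inv])
  finally show "d (y_loop k) = (\<Sum>j\<in>{1..<length a}. \<Sum>\<nu>\<in>UNIV. coef a d j \<nu> *s vbas a j \<nu> (y_loop k))" ..
qed

section \<open>The Clifford algebra modulo a character\<close>

lemma theta_carrier: "1 \<le> j \<Longrightarrow> j < n \<Longrightarrow> theta n j \<nu> \<in> carrier (uring n)"
  unfolding theta_def alpha_def alphabar_def uring_def uEF_def uFt_def
  by (intro free_diff free_add free_mult free_prod_list)
    (auto simp: uK_def uE_def uF_def uOi_def positions_def intro!: free_mult)

lemma cliff_gens_carrier: "scalar_gens n \<union> thetas n \<subseteq> carrier (uring n)"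
proof -
  have "x \<in> carrier (uring n)" if "x \<in> scalar_gens n" for x
    using that unfolding scalar_gens_def by (auto intro!: uring_closed uring_gen)
  then show ?thesis
    using theta_carrier by (auto simp: thetas_def)
qed

lemma cliff_carrier: "carrier (cliff n) = generate_ring (uring n) (scalar_gens n \<union> thetas n)"
  by (simp add: cliff_def)

lemma opring_cliff: "opring (cliff n)"
proof -
  have r: "ring (uring n)" unfolding uring_def by (rule ring_free_ring)
  have "ring (cliff n)"
    unfolding cliff_def by (rule ring.generate_ring_is_ring[OF r cliff_gens_carrier])
  then show ?thesis
    by (simp add: opring_def opring_axioms_def) (simp add: cliff_def uring_def)
qed

interpretation cl: opring "cliff n" for n
  by (rule opring_cliff)

lemma cliff_uring: "x \<in> carrier (cliff n) \<Longrightarrow> x \<in> carrier (uring n)"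
proof -
  have r: "ring (uring n)" unfolding uring_def by (rule ring_free_ring)
  show "x \<in> carrier (cliff n) \<Longrightarrow> x \<in> carrier (uring n)"
    unfolding cliff_carrier using ring.generate_ring_in_carrier[OF r cliff_gens_carrier] .
qed

lemma cliff_scalar: "x \<in> scalar_gens n \<Longrightarrow> x \<in> carrier (cliff n)"
  and cliff_theta: "1 \<le> j \<Longrightarrow> j < n \<Longrightarrow> theta n j \<nu> \<in> carrier (cliff n)"
  unfolding cliff_carrier by (auto intro!: generate_ring.incl simp: thetas_def)

lemma cliff_cst: "cst c \<in> carrier (cliff n)"
  by (rule cliff_scalar) (simp add: scalar_gens_def)

lemma cliff_mult: "x \<in> carrier (cliff n) \<Longrightarrow> y \<in> carrier (cliff n) \<Longrightarrow> x * y \<in> carrier (cliff n)"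
  and cliff_add: "x \<in> carrier (cliff n) \<Longrightarrow> y \<in> carrier (cliff n) \<Longrightarrow> x + y \<in> carrier (cliff n)"
  using cl.m_closed[of x n y] cl.a_closed[of x n y] by simp_all

lemma cliff_0: "0 \<in> carrier (cliff n)" and cliff_1: "1 \<in> carrier (cliff n)"
  using cliff_cst[of 0] cliff_cst[of 1] by simp_all

lemma cliff_sum: "(\<And>i. i \<in> A \<Longrightarrow> f i \<in> carrier (cliff n)) \<Longrightarrow> sum f A \<in> carrier (cliff n)"
  by (induction A rule: infinite_finite_induct) (auto intro: cliff_add cliff_0)

lemmas cliff_closed = cliff_mult cliff_add cliff_cst cliff_theta cl.diff_closed cl.uminus_closed cliff_0 cliff_1

lemma scalar_sq: "p \<in> positions n \<Longrightarrow> x \<in> {uK p * uK p, uKi p * uKi p, uE p * uE p, uF p * uF p, uOi p * uOi p} \<Longrightarrow>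
    x \<in> scalar_gens n"
  unfolding scalar_gens_def by blast

lemma cliff_sq:
  assumes "p \<in> positions n"
  shows "uK p * uK p \<in> carrier (cliff n)" "uKi p * uKi p \<in> carrier (cliff n)"
    "uE p * uE p \<in> carrier (cliff n)" "uF p * uF p \<in> carrier (cliff n)" "uOi p * uOi p \<in> carrier (cliff n)"
  by (rule cliff_scalar, rule scalar_sq[OF assms], simp)+

abbreviation "cgens a \<equiv> (Idl\<^bsub>uring (length a)\<^esub> (urels (length a)) \<inter> carrier (cliff (length a))) \<union> ker_gens a"

lemma cgens_carrier: "cgens a \<subseteq> carrier (cliff (length a))"
proof -
  have "x \<in> carrier (cliff (length a))" if "x \<in> ker_gens a" for x
    using that unfolding ker_gens_def Let_def
    by (auto intro!: cl.diff_closed cliff_cst cliff_sq)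
  then show ?thesis by blast
qed

lemma opideal_cliff: "opideal (cliff (length a)) (cliff_ideal a)"
  using cl.genideal_ideal[OF cgens_carrier]
  by (simp add: opideal_def opideal_axioms_def opring_cliff cliff_ideal_def)

interpretation ci: opideal "cliff (length a)" "cliff_ideal a" for a
  by (rule opideal_cliff)

lemma cgens_ideal: "x \<in> cgens a \<Longrightarrow> x \<in> cliff_ideal a"
  unfolding cliff_ideal_def by (rule cl.Idl_incl[OF cgens_carrier])

text \<open>The value of a scalar under the character. Membership in the subring is part of it
  because \<open>cliff_ideal\<close> is an ideal of \<open>cliff\<close> only.\<close>

definition cval :: "xchar list \<Rightarrow> ualg \<Rightarrow> complex \<Rightarrow> bool"
  where "cval a x c \<longleftrightarrow> x \<in> carrier (cliff (length a)) \<and> x - cst c \<in> cliff_ideal a"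

lemma cval_cst: "cval a (cst c) c"
  by (simp add: cval_def cliff_cst)

lemma cval_1: "cval a 1 1"
  using cval_cst[of a 1] by simp

lemma cval_mult: "cval a x c \<Longrightarrow> cval a y d \<Longrightarrow> cval a (x * y) (c * d)"
proof -
  assume x: "cval a x c" and y: "cval a y d"
  have "(x - cst c) * y + cst c * (y - cst d) \<in> cliff_ideal a"
    using x y by (intro ci.addI ci.lmultI ci.rmultI) (auto simp: cval_def cliff_cst)
  then show ?thesis
    using x y by (simp add: cval_def cliff_mult algebra_simps cst_mult)
qed

lemma cval_add: "cval a x c \<Longrightarrow> cval a y d \<Longrightarrow> cval a (x + y) (c + d)"
  and cval_diff: "cval a x c \<Longrightarrow> cval a y d \<Longrightarrow> cval a (x - y) (c - d)"
  using ci.addI[of "x - cst c" a "y - cst d"] ci.diffI[of "x - cst c" a "y - cst d"]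
  by (simp_all add: cval_def cliff_add cl.diff_closed cst_add cst_diff algebra_simps)

lemma cval_prod_list: "(\<And>k. k \<in> set ks \<Longrightarrow> cval a (f k) (g k)) \<Longrightarrow>
    cval a (prod_list (map f ks)) (prod_list (map g ks))"
  by (induction ks) (auto intro: cval_mult cval_1)

lemma cval_if: "cval a x c \<Longrightarrow> cval a y d \<Longrightarrow> cval a (if b then x else y) (if b then c else d)"
  by simp

lemma cval_gens:
  assumes "p \<in> positions (length a)"
  shows "cval a (uK p * uK p) (zkap (pos_chr a p))" "cval a (uE p * uE p) (zeps (pos_chr a p))"
    "cval a (uF p * uF p) (zphi (pos_chr a p) / zkap (pos_chr a p))"
    "cval a (uOi p * uOi p) (1 / omega2 (pos_chr a p))" "cval a (uKi p * uKi p) (1 / zkap (pos_chr a p))"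
proof -
  have "y \<in> cliff_ideal a" if "y \<in> (let x = pos_chr a p in
    {uK p * uK p - cst (zkap x), uKi p * uKi p - cst (1 / zkap x), uE p * uE p - cst (zeps x),
     uF p * uF p - cst (zphi x / zkap x), uOi p * uOi p - cst (1 / omega2 x)})" for y
  proof (rule cgens_ideal, rule UnI2)
    show "y \<in> ker_gens a"
      unfolding ker_gens_def using assms that by (rule UN_I)
  qed
  then show "cval a (uK p * uK p) (zkap (pos_chr a p))" "cval a (uE p * uE p) (zeps (pos_chr a p))"
    "cval a (uF p * uF p) (zphi (pos_chr a p) / zkap (pos_chr a p))"
    "cval a (uOi p * uOi p) (1 / omega2 (pos_chr a p))" "cval a (uKi p * uKi p) (1 / zkap (pos_chr a p))"
    using assms by (auto simp: cval_def Let_def intro!: cliff_sq)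
qed

definition qqF :: "2 \<Rightarrow> 2 \<Rightarrow> pos \<Rightarrow> ualg"
  where "qqF \<nu> \<xi> p = (if \<nu> = 1 \<and> \<xi> = 1 then cst 2 * (uE p * uE p)
    else if \<nu> = 2 \<and> \<xi> = 2 then cst 2 * ((uK p * uK p) * (uF p * uF p))
    else cst (- 2) * (uK p * uK p - 1))"

definition sqF :: "side \<Rightarrow> nat list \<Rightarrow> ualg"
  where "sqF d ks = prod_list (map (\<lambda>k. uK (k, d) * uK (k, d)) ks)"

text \<open>A representative of the anticommutator of \<open>aA\<close> at one factor, rewritten in
  squares of letters so that it belongs to the ring of scalars and its character value can be
  computed.\<close>

definition zF :: "nat \<Rightarrow> nat \<Rightarrow> 2 \<Rightarrow> 2 \<Rightarrow> ualg"
  where "zF n j \<nu> \<xi> = sqF Md [1..<j] * (uOi (j, Md) * uOi (j, Md)) * qqF \<nu> \<xi> (j, Md) +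
    sqF Md [1..<Suc n] * sqF Dl [Suc j..<Suc n] * (uOi (j, Dl) * uOi (j, Dl)) * qqF \<nu> \<xi> (j, Dl)"

definition zzF :: "nat \<Rightarrow> nat \<Rightarrow> nat \<Rightarrow> 2 \<Rightarrow> 2 \<Rightarrow> ualg"
  where "zzF n j l \<nu> \<xi> = (if j = l then zF n j \<nu> \<xi> else 0)"

lemma (in uchain) ev_sqF: "set ks \<times> {d} \<subseteq> positions n \<Longrightarrow>
    ev (\<lambda>(p, g). gen p g) (sqF d ks) = KK d ks * KK d ks"
  by (simp add: KK_square sqF_def ev_prod_list o_def ev_mult uK_def gK_def)

lemma (in uchain) ev_qqF: "ev (\<lambda>(p, g). gen p g) (qqF \<nu> \<xi> p) = qq \<nu> \<xi> p"
  by (simp add: qqF_def qq_def ev_mult ev_diff uE_def uK_def uF_def gK_def sm_def del: sm_2)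

lemma (in uchain) ev_zF:
  assumes "1 \<le> j" "j \<le> n"
  shows "ev (\<lambda>(p, g). gen p g) (zF n j \<nu> \<xi>) = zA j \<nu> \<xi> + zB j \<nu> \<xi>"
proof -
  have s: "set [1..<j] \<times> {Md} \<subseteq> positions n"
    "set [1..<Suc n] \<times> {Md} \<subseteq> positions n" "set [Suc j..<Suc n] \<times> {Dl} \<subseteq> positions n"
    using assms by (auto simp: positions_def)
  show ?thesis
    unfolding zF_def zA_def zB_def al_same[OF assms] ab_same[OF assms] ev_add ev_mult ev_qqF
      ev_sqF[OF s(1)] ev_sqF[OF s(2)] ev_sqF[OF s(3)]
    by (simp add: uOi_def gO_def)
qed

text \<open>The Clifford relations before any character is applied: the anticommutators of two
  differences involve up to four factor terms, and \<open>zzF\<close> keeps those with equal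
  index.\<close>

lemma theta_qideal:
  assumes "1 \<le> j" "j < n" "1 \<le> l" "l < n"
  shows "theta n j \<nu> * theta n l \<xi> + theta n l \<xi> * theta n j \<nu> -
    (zzF n j l \<nu> \<xi> - zzF n j (Suc l) \<nu> \<xi> - zzF n (Suc j) l \<nu> \<xi> + zzF n (Suc j) (Suc l) \<nu> \<xi>) \<in> qideal"
proof -
  have z: "qc.ev (\<lambda>(p, g). qgen p g) (zzF n i k \<nu> \<xi>) =
      qch.aA n i \<nu> * qch.aA n k \<xi> + qch.aA n k \<xi> * qch.aA n i \<nu>"
    if "1 \<le> i" "i \<le> n" "1 \<le> k" "k \<le> n" for i k
    using qch.anticomm(1)[OF that, of \<nu> \<xi>] qch.ev_zF[OF that(1,2), of \<nu> \<xi>] by (cases "i = k"; simp add: zzF_def)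
  show ?thesis
    unfolding qev_zero[symmetric] qc.ev_diff qc.ev_add qc.ev_mult qch.ev_theta
    using assms by (simp add: z algebra_simps)
qed

context tuple
begin

lemma prod_list_kpre: "prod_list (map (\<lambda>k. kap k) [1..<j]) = kpre j"
  by (induction j) (auto simp: kpre_def atLeastLessThanSuc mult.commute)

lemma prod_list_ksuf: "1 \<le> j \<Longrightarrow> j \<le> n \<Longrightarrow>
    kpre j * kap j = kpre (Suc n) * prod_list (map (\<lambda>k. 1 / kap k) [Suc j..<Suc n])"
proof -
  assume j: "1 \<le> j" "j \<le> n"
  have "kpre (Suc m) * prod_list (map (\<lambda>k. 1 / kap k) [Suc j..<Suc m]) = kpre (Suc j)" if "j \<le> m" "m \<le> n" for m
    using that
  proof (induction m rule: dec_induct)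
    case (step m)
    then show ?case
      using site(1)[of "Suc m"] kpre_Suc[of "Suc m"] j by simp
  qed simp
  then show ?thesis
    using j kpre_Suc by simp
qed

lemma omega_w: "1 \<le> j \<Longrightarrow> j \<le> n \<Longrightarrow> omega2 (pos_chr a (j, d)) = (w j)\<^sup>2"
  using modrel_omega2[OF pos_modrel[of "(j, d)"]] by (simp add: pos_simps power2_eq_square)

lemma cval_qqF:
  assumes "1 \<le> j" "j \<le> n"
  shows "cval a (qqF \<nu> \<xi> (j, d)) (if d = Md then qc j \<nu> \<xi> else - qc j \<nu> \<xi> / kap j)"
proof -
  have p: "(j, d) \<in> positions (length a)"
    using assms by (simp add: n_def positions_def)
  note g = cval_gens[OF p]
  let ?x = "pos_chr a (j, d)"
  have k: "zkap ?x \<noteq> 0" using pos_modrel[of "(j, d)"] p by (simp add: modrel_def n_def)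
  have v: "cval a (qqF \<nu> \<xi> (j, d)) (if \<nu> = 1 \<and> \<xi> = 1 then 2 * zeps ?x
     else if \<nu> = 2 \<and> \<xi> = 2 then 2 * (zkap ?x * (zphi ?x / zkap ?x)) else - 2 * (zkap ?x - 1))"
    unfolding qqF_def by (intro cval_if cval_mult cval_cst cval_diff cval_1 g)
  have "(if \<nu> = 1 \<and> \<xi> = 1 then 2 * zeps ?x
     else if \<nu> = 2 \<and> \<xi> = 2 then 2 * (zkap ?x * (zphi ?x / zkap ?x)) else - 2 * (zkap ?x - 1)) =
     (if d = Md then qc j \<nu> \<xi> else - qc j \<nu> \<xi> / kap j)"
    using k site(1)[OF assms] by (cases d) (auto simp: qc_def eps_def phi_def kap_def zinv_def field_simps)
  with v show ?thesis by simp
qed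

lemma cval_zF:
  assumes j: "1 \<le> j" "j \<le> n"
  shows "cval a (zF n j \<nu> \<xi>) 0"
proof -
  have p: "(k, d) \<in> positions (length a)" if "1 \<le> k" "k \<le> n" for k d
    using that by (simp add: n_def positions_def)
  have M: "cval a (sqF Md [1..<i]) (kpre i)" if "i \<le> Suc n" for i
    unfolding prod_list_kpre[symmetric] sqF_def
  proof (rule cval_prod_list)
    fix k assume "k \<in> set [1..<i]"
    then show "cval a (uK (k, Md) * uK (k, Md)) (kap k)"
      using cval_gens(1)[OF p[of k Md]] that by (simp add: kap_def)
  qed
  have D: "cval a (sqF Dl [Suc j..<Suc n]) (prod_list (map (\<lambda>k. 1 / kap k) [Suc j..<Suc n]))"
    unfolding sqF_def
  proof (rule cval_prod_list)
    fix k assume "k \<in> set [Suc j..<Suc n]"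
    then show "cval a (uK (k, Dl) * uK (k, Dl)) (1 / kap k)"
      using cval_gens(1)[OF p[of k Dl]] j by (auto simp: kap_def zinv_def)
  qed
  let ?q = "qc j \<nu> \<xi>"
  have O: "cval a (uOi (j, d) * uOi (j, d)) (1 / (w j)\<^sup>2)" for d
    using cval_gens(4)[OF p[OF j, of d]] omega_w[OF j, of d] by simp
  have "cval a (zF n j \<nu> \<xi>) (kpre j * (1 / (w j)\<^sup>2) * ?q +
      kpre (Suc n) * prod_list (map (\<lambda>k. 1 / kap k) [Suc j..<Suc n]) * (1 / (w j)\<^sup>2) * (- ?q / kap j))"
    unfolding zF_def
    using j cval_qqF[OF j, of \<nu> \<xi> Md] cval_qqF[OF j, of \<nu> \<xi> Dl]
    by (intro cval_add cval_mult M D O) auto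
  then show ?thesis
    unfolding prod_list_ksuf[OF j, symmetric] using site(1)[OF j] by simp
qed

lemma theta_anticomm:
  assumes "1 \<le> j" "j < n" "1 \<le> l" "l < n"
  shows "theta n j \<nu> * theta n l \<xi> + theta n l \<xi> * theta n j \<nu> \<in> cliff_ideal a"
proof -
  let ?z = "zzF n j l \<nu> \<xi> - zzF n j (Suc l) \<nu> \<xi> - zzF n (Suc j) l \<nu> \<xi> + zzF n (Suc j) (Suc l) \<nu> \<xi>"
  let ?t = "theta n j \<nu> * theta n l \<xi> + theta n l \<xi> * theta n j \<nu>"
  have v: "cval a (zzF n i k \<nu> \<xi>) 0" if "1 \<le> i" "i \<le> n" for i k
    using cval_zF[OF that, of \<nu> \<xi>] cval_cst[of a 0] by (cases "i = k"; simp add: zzF_def)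
  have "cval a ?z (0 - 0 - 0 + 0)"
    using assms by (intro cval_add cval_diff v) auto
  then have z: "?z \<in> cliff_ideal a" "?z \<in> carrier (cliff n)"
    by (simp_all add: cval_def n_def)
  \<comment> \<open>Needed because only that part of the ideal of relations which lies in
    \<open>cliff\<close> is divided out.\<close>
  have t: "?t - ?z \<in> carrier (cliff n)"
    by (intro cliff_closed z assms)
  have "?t - ?z \<in> Idl\<^bsub>uring n\<^esub> (urels n)"
    using qideal_urels[OF cliff_uring[OF t]] theta_qideal[OF assms] by blast
  then have "?t - ?z \<in> cliff_ideal a"
    using t by (intro cgens_ideal) (simp add: n_def)
  from ci.addI[OF this z(1)] show ?thesis
    by simp
qed

section \<open>The map from homology to the Clifford algebra\<close>

lemma regular: "regular a"
  using site(1) by (simp add: regular_def kap_def n_def)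

definition thF :: "(fword \<Rightarrow> complex^2) \<Rightarrow> ualg"
  where "thF d = (\<Sum>j\<in>{1..<n}. \<Sum>\<nu>\<in>UNIV. cst (coef a d j \<nu>) * theta n j \<nu>)"

abbreviation "H \<equiv> H1lf a"

definition hF :: "(fword \<Rightarrow> complex^2) falg \<Rightarrow> ualg"
  where "hF = fa.ev thF"

lemma thF_carrier: "thF d \<in> carrier (cliff n)"
  unfolding thF_def by (intro cliff_sum cliff_closed) auto

lemma thF_add: "thF (\<lambda>w. d w + d' w) = thF d + thF d'"
  by (simp add: thF_def coef_add cst_add distrib_right sum.distrib)

lemma thF_scale: "thF (\<lambda>w. c *s d w) = cst c * thF d"
  by (simp add: thF_def coef_scale cst_mult sum_distrib_left mult.assoc)

lemma thF_vbas: "1 \<le> j \<Longrightarrow> j < n \<Longrightarrow> thF (vbas a j \<nu>) = theta n j \<nu>"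
proof -
  assume j: "1 \<le> j" "j < n"
  have "thF (vbas a j \<nu>) = (\<Sum>k\<in>{1..<n}. if k = j then theta n j \<nu> else 0)"
    unfolding thF_def
  proof (rule sum.cong[OF refl])
    fix k assume k: "k \<in> {1..<n}"
    show "(\<Sum>\<xi>\<in>UNIV. cst (coef a (vbas a j \<nu>) k \<xi>) * theta n k \<xi>) = (if k = j then theta n j \<nu> else 0)"
      using coef_vbas[OF regular, of k j \<nu>] k exhaust_2[of \<nu>] by (auto simp: sum_2 n_def)
  qed
  then show ?thesis using j by simp
qed

lemma cst_sandwich: "(cst c * x) * (cst d * y) + (cst d * y) * (cst c * x) = cst (c * d) * (x * y + y * x)"
proof -
  have "x * (cst d * y) = cst d * (x * y)" "y * (cst c * x) = cst c * (y * x)"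
    by (rule swap_assoc[OF cst_central[symmetric]])+
  moreover have "cst d * (cst c * (y * x)) = cst c * (cst d * (y * x))"
    by (rule swap_assoc[OF cst_central])
  ultimately show ?thesis
    by (simp add: mult.assoc cst_mult distrib_left)
qed

lemma thF_anticomm: "thF d * thF d' + thF d' * thF d \<in> cliff_ideal a"
proof -
  let ?I = "{1..<n} \<times> (UNIV :: 2 set)"
  have e: "thF x = (\<Sum>p\<in>?I. cst (coef a x (fst p) (snd p)) * theta n (fst p) (snd p))" for x
    unfolding thF_def by (simp add: sum.cartesian_product case_prod_beta)
  have "thF d * thF d' + thF d' * thF d = (\<Sum>p\<in>?I. \<Sum>q\<in>?I.
      cst (coef a d (fst p) (snd p) * coef a d' (fst q) (snd q)) *
      (theta n (fst p) (snd p) * theta n (fst q) (snd q) + theta n (fst q) (snd q) * theta n (fst p) (snd p)))"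
    unfolding e sum_product
    by (subst (2) sum.swap) (simp only: sum.distrib[symmetric] cst_sandwich)
  also have "\<dots> \<in> cliff_ideal a"
    by (intro ci.sumI ci.lmultI theta_anticomm) (auto simp: cliff_cst)
  finally show ?thesis .
qed

text \<open>Anticommutation of an element with itself gives twice the square, and 2 is
  invertible.\<close>

lemma thF_square: "thF d * thF d \<in> cliff_ideal a"
proof -
  have "cst (1 / 2) * (thF d * thF d + thF d * thF d) \<in> cliff_ideal a"
    by (rule ci.lmultI[OF thF_anticomm cliff_cst])
  moreover have "cst (1 / 2) * (x + x) = x" for x :: ualg
  proof -
    have "cst (1 / 2) * (x + x) = (cst (1 / 2) + cst (1 / 2)) * x"
      by (simp add: algebra_simps)
    then show ?thesis by (simp flip: cst_add)
  qed
  ultimately show ?thesis by simp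
qed

lemma hF_carrier: "hF x \<in> carrier (cliff n)"
proof -
  have "x \<in> carrier (free_ring UNIV)" by simp
  then show ?thesis
    by (induction rule: free_ring_induct)
      (auto simp: hF_def fa.ev_add fa.ev_mult intro!: cliff_closed thF_carrier)
qed

lemma hF_simps: "hF (x + y) = hF x + hF y" "hF (x * y) = hF x * hF y" "hF (cst c) = cst c"
    "hF (gvar d) = thF d" "hF (x - y) = hF x - hF y" "hF 0 = 0" "hF 1 = 1"
  by (simp_all add: hF_def fa.ev_add fa.ev_mult fa.ev_diff)

end

lemma ext_rels_carrier:
  assumes "\<And>u v. u \<in> H \<Longrightarrow> v \<in> H \<Longrightarrow> (\<lambda>w. u w + v w) \<in> H" "\<And>u c. u \<in> H \<Longrightarrow> (\<lambda>w. c *s u w) \<in> H"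
  shows "ext_rels H \<subseteq> carrier (free_ring H)"
  unfolding ext_rels_def using assms by (auto intro!: free_intros)

interpretation ex: opideal "free_ring (H1lf a)" "ext_ideal (H1lf a)" for a
  unfolding ext_ideal_def
  by (rule opideal_free[OF ext_rels_carrier]) (auto intro: H1lf_add H1lf_scale)

lemma ext_rels_ideal: "x \<in> ext_rels (H1lf a) \<Longrightarrow> x \<in> ext_ideal (H1lf a)"
  unfolding ext_ideal_def
  by (rule ex.Idl_incl[OF ext_rels_carrier]) (auto intro: H1lf_add H1lf_scale)

context tuple
begin

lemma hF_ideal: "x \<in> ext_ideal H \<Longrightarrow> hF x \<in> cliff_ideal a"
proof -
  let ?J = "{x \<in> carrier (free_ring H). hF x \<in> cliff_ideal a}"
  have "ideal ?J (free_ring H)"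
  proof (rule idealI[OF ring_free_ring])
    show "subgroup ?J (add_monoid (free_ring H))"
    proof
      fix x assume x: "x \<in> ?J"
      have "inv\<^bsub>add_monoid (free_ring H)\<^esub> x = - x"
        using ex.a_inv_op[of x a] x unfolding a_inv_def by simp
      then show "inv\<^bsub>add_monoid (free_ring H)\<^esub> x \<in> ?J"
        using x ci.uminusI hF_simps(5)[of 0 x] by (auto simp: hF_simps intro: free_uminus)
    qed (auto simp: hF_simps intro: free_add ci.addI)
  qed (auto simp: hF_simps intro: free_mult ci.lmultI ci.rmultI hF_carrier[unfolded n_def])
  moreover have "ext_rels H \<subseteq> ?J"
  proof
    fix x assume x: "x \<in> ext_rels H"
    have "hF x \<in> cliff_ideal a"
      using x unfolding ext_rels_def
      by (auto simp: hF_simps thF_add thF_scale intro: thF_square)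
    moreover have "x \<in> carrier (free_ring H)"
      using ext_rels_carrier[of H] x H1lf_add H1lf_scale by blast
    ultimately show "x \<in> ?J" by blast
  qed
  ultimately have "ext_ideal H \<subseteq> ?J"
    unfolding ext_ideal_def by (rule Idl_least)
  then show "x \<in> ext_ideal H \<Longrightarrow> hF x \<in> cliff_ideal a" by blast
qed

end

section \<open>The vacuum and the Fock space\<close>

context tuple
begin

lemma actL_theta: "actL V a (theta n j \<nu>) = aA j \<nu> - aA (Suc j) \<nu>"
proof -
  have "(\<lambda>(p, g). gL V a (p, g)) = gL V a" by auto
  then show ?thesis using ev_theta[of j \<nu>] by simp
qed

lemma gen_dual:
  assumes "1 \<le> j" "j \<le> n"
  shows "pos_mod V a (j, Md) = V (a ! (j - 1))" "pos_mod V a (j, Dl) = dual_umod (V (a ! (j - 1)))"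
  by (simp_all add: pos_mod_def)

text \<open>On the vacuum a dual operator becomes the antipode on the module leg: E becomes
  \<open>- E K^-1\<close>, and K times this is E again; likewise for KF.\<close>

lemma vac_local:
  assumes j: "1 \<le> j" "j \<le> n"
  shows "app (gK (j, Md) * gK (j, Dl)) (vac n) = vac n"
    and "app (gK (j, Md) * gX \<nu> (j, Dl)) (vac n) = app (gX \<nu> (j, Md)) (vac n)"
proof -
  let ?m = "V (a ! (j - 1))" and ?p = "(j, Md)" and ?q = "(j, Dl)"
  have p: "?p \<in> positions n" "?q \<in> positions n" using j by (simp_all add: pos_simps)
  interpret u: utriple lcs "oE ?p ?m" "oF ?p ?m" "oK ?p ?m" "oKi ?p ?m" "kap j" "eps j" "phi j"
    using modrel_utriple[OF site(3)[OF j]] by (simp add: kap_def eps_def phi_def)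
  have g: "gK ?p = oK ?p ?m" "gK ?q = opL ?q (transpose (matrix_inv (mK ?m)))"
    "gX \<nu> ?p = (if \<nu> = 1 then oE ?p ?m else lo.sm (- \<i>) (oK ?p ?m * oF ?p ?m))"
    "gX \<nu> ?q = (if \<nu> = 1 then opL ?q (transpose (- (mE ?m ** matrix_inv (mK ?m))))
      else lo.sm (- \<i>) (opL ?q (transpose (- (mK ?m ** mF ?m) ** matrix_inv (mK ?m)))))"
    unfolding gK_def gX_def gen_simps gen_dual[OF j]
    by (simp_all add: dual_umod_def opL_mult matrix_transpose_mul)
  note v = vac_transpose[OF j]
  have "app (gK ?p * gK ?q) (vac n) = app (oK ?p ?m * oKi ?p ?m) (vac n)"
    by (simp add: g v)
  then show "app (gK ?p * gK ?q) (vac n) = vac n"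
    by (simp only: u.kki) simp
  have 1: "oK ?p ?m * - (oE ?p ?m * oKi ?p ?m) = oE ?p ?m"
    by (simp add: u.nf del: One_nat_def)
  have 2: "oK ?p ?m * (- (oK ?p ?m * oF ?p ?m) * oKi ?p ?m) = oK ?p ?m * oF ?p ?m"
    by (simp add: u.nf del: One_nat_def)
  show "app (gK ?p * gX \<nu> ?q) (vac n) = app (gX \<nu> ?p) (vac n)"
  proof (cases "\<nu> = 1")
    case True
    have "app (gK ?p * gX \<nu> ?q) (vac n) = app (oK ?p ?m * - (oE ?p ?m * oKi ?p ?m)) (vac n)"
      unfolding g using True by (simp only: app_simps v if_True simp_thms transpose_transpose opL_hom)
    then show ?thesis unfolding 1 g using True by simp
  next
    case False
    have "app (gK ?p * gX \<nu> ?q) (vac n) =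
        app (oK ?p ?m * lo.sm (- \<i>) (- (oK ?p ?m * oF ?p ?m) * oKi ?p ?m)) (vac n)"
      unfolding g using False by (simp only: app_simps app_sm v if_False simp_thms transpose_transpose opL_hom)
    then show ?thesis
      unfolding lo.sm_right 2 g using False by simp
  qed
qed

lemma vac_KK:
  assumes "set ks \<subseteq> {1..n}"
  shows "app (KK Md ks * KK Dl ks) (vac n) = vac n"
  using assms
proof (induction ks)
  case (Cons k ks)
  have k: "(k, Dl) \<in> positions n" "set ks \<times> {Md} \<subseteq> positions n"
    using Cons.prems by (auto simp: positions_def)
  have "KK Md ks * gK (k, Dl) = gK (k, Dl) * KK Md ks"
    using sw_KKK[OF k(2,1)] by (simp add: sw_def)
  then have "KK Md (k # ks) * KK Dl (k # ks) = (gK (k, Md) * gK (k, Dl)) * (KK Md ks * KK Dl ks)"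
    using swap_assoc[of "KK Md ks" "gK (k, Dl)"] by (simp add: KK_Cons mult.assoc)
  moreover have "app (KK Md ks * KK Dl ks) (vac n) = vac n"
    using Cons by simp
  ultimately show ?case
    using vac_local(1)[of k] Cons.prems by simp
qed simp

lemma upt_split: "1 \<le> j \<Longrightarrow> j \<le> n \<Longrightarrow> [1..<Suc n] = [1..<j] @ j # [Suc j..<Suc n]"
  by (metis Suc_eq_plus1 le_SucI less_Suc_eq_le upt_add_eq_append upt_conv_Cons le_add_diff_inverse)

text \<open>The part of the total K beyond position \<open>j\<close> is paired with the dual suffix.
  The vacuum absorbs that pair by \<open>vac_KK\<close>, and what remains is an identity at a single
  factor.\<close>

lemma ab_split:
  assumes j: "1 \<le> j" "j \<le> n"
  shows "ab j \<nu> = KK Md [1..<j] * (gK (j, Md) * gX \<nu> (j, Dl) * gO (j, Dl)) *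
    (KK Md [Suc j..<Suc n] * KK Dl [Suc j..<Suc n])"
proof -
  have k: "set [Suc j..<Suc n] \<times> {Md} \<subseteq> positions n" "(j, Dl) \<in> positions n"
    using j by (auto simp: positions_def)
  have 1: "KK Md [Suc j..<Suc n] * gX \<nu> (j, Dl) = gX \<nu> (j, Dl) * KK Md [Suc j..<Suc n]"
    using sw_KKX[OF k(1) distinct_upt k(2), of \<nu>] by (simp add: sw_def)
  have 2: "KK Md [Suc j..<Suc n] * gO (j, Dl) = gO (j, Dl) * KK Md [Suc j..<Suc n]"
    using sw_KKO[OF k] by (simp add: sw_def)
  show ?thesis
    unfolding ab_def upt_split[OF j] KK_append KK_Cons
    by (simp only: mult.assoc 1 2 1[THEN swap_assoc] 2[THEN swap_assoc])
qed

lemma aG_vac: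
  assumes j: "1 \<le> j" "j \<le> n"
  shows "app (aG j \<nu>) (vac n) = (\<lambda>s. 0)"
proof -
  have o: "gO (j, d) = lcs (1 / w j)" for d
    using gen_Oi[of "(j, d)"] j by (simp add: gO_def pos_simps)
  have "app (ab j \<nu>) (vac n) = app (KK Md [1..<j] * (gK (j, Md) * gX \<nu> (j, Dl) * gO (j, Dl))) (vac n)"
  proof -
    have "app (KK Md [Suc j..<Suc n] * KK Dl [Suc j..<Suc n]) (vac n) = vac n"
      by (rule vac_KK) auto
    then show ?thesis
      by (simp only: ab_split[OF j] app_simps)
  qed
  also have "\<dots> = app (KK Md [1..<j] * (lcs (1 / w j) * (gK (j, Md) * gX \<nu> (j, Dl)))) (vac n)"
    by (simp only: o lo.cs_comm)
  also have "\<dots> = app (KK Md [1..<j] * lcs (1 / w j)) (app (gK (j, Md) * gX \<nu> (j, Dl)) (vac n))"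
    by simp
  also have "\<dots> = app (KK Md [1..<j] * lcs (1 / w j) * gX \<nu> (j, Md)) (vac n)"
    unfolding vac_local(2)[OF j] by simp
  also have "KK Md [1..<j] * lcs (1 / w j) * gX \<nu> (j, Md) = al j \<nu>"
    by (simp only: al_def o lo.cs_comm mult.assoc)
  finally show ?thesis
    by (simp add: aG_def)
qed

text \<open>The inverse of the matrix \<open>2 * kpre j / (w j)^2 * qc j\<close>. Its determinant
  brings in a factor \<open>kap j * (w j)^2\<close> in the denominator, so \<open>w j\<close>
  cancels and \<open>kpre j * kap j = kpre (Suc j)\<close> remains.\<close>

definition mc :: "nat \<Rightarrow> 2 \<Rightarrow> 2 \<Rightarrow> complex"
  where "mc j \<nu> \<xi> = - (if \<nu> = 1 \<and> \<xi> = 1 then phi j else if \<nu> = 2 \<and> \<xi> = 2 then eps j else kap j - 1) /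
    (4 * kpre (Suc j))"

definition dd :: "nat \<Rightarrow> 2 \<Rightarrow> lop"
  where "dd j \<nu> = lcs (mc j \<nu> 1) * aG j 1 + lcs (mc j \<nu> 2) * aG j 2"

lemma lcs_anticomm: "(lcs c * x) * y + y * (lcs c * x) = lcs c * (x * y + y * x)"
  unfolding lo.sm_def[symmetric] by (simp add: lo.sm_add)

lemma dd_aA:
  assumes "1 \<le> j" "j \<le> n" "1 \<le> l" "l \<le> n"
  shows "dd j \<nu> * aA l \<xi> + aA l \<xi> * dd j \<nu> = (if j = l \<and> \<nu> = \<xi> then 1 else 0)"
proof -
  have "dd j \<nu> * aA l \<xi> + aA l \<xi> * dd j \<nu> =
      ((lcs (mc j \<nu> 1) * aG j 1) * aA l \<xi> + aA l \<xi> * (lcs (mc j \<nu> 1) * aG j 1)) +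
      ((lcs (mc j \<nu> 2) * aG j 2) * aA l \<xi> + aA l \<xi> * (lcs (mc j \<nu> 2) * aG j 2))"
    by (simp add: dd_def algebra_simps)
  also have "\<dots> = (if j = l then lcs (mc j \<nu> 1 * (2 * (kpre j / (w j)\<^sup>2 * qc j 1 \<xi>)) +
      mc j \<nu> 2 * (2 * (kpre j / (w j)\<^sup>2 * qc j 2 \<xi>))) else 0)"
    unfolding lcs_anticomm CAR(2)[OF assms] by (simp flip: lo.cs_add lo.cs_mult)
  also have "mc j \<nu> 1 * (2 * (kpre j / (w j)\<^sup>2 * qc j 1 \<xi>)) +
      mc j \<nu> 2 * (2 * (kpre j / (w j)\<^sup>2 * qc j 2 \<xi>)) = (if \<nu> = \<xi> then 1 else 0)"
  proof -
    have k: "kpre j \<noteq> 0" "kap j \<noteq> 0" "w j \<noteq> 0" "kpre (Suc j) = kpre j * kap j"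
      using kpre_nz[of j] kpre_Suc[of j] site(1,2)[of j] assms by auto
    have e: "kap j * (w j)\<^sup>2 = (kap j - 1)\<^sup>2 - eps j * phi j"
      using site(4)[OF assms(1,2)] .
    let ?v = "mc j \<nu> 1 * (2 * (kpre j / (w j)\<^sup>2 * qc j 1 \<xi>)) + mc j \<nu> 2 * (2 * (kpre j / (w j)\<^sup>2 * qc j 2 \<xi>))"
    have "?v = (if \<nu> = \<xi> then ((kap j - 1)\<^sup>2 - eps j * phi j) / (kap j * (w j)\<^sup>2) else 0)"
    proof -
      have "\<nu> = 1 \<or> \<nu> = 2" "\<xi> = 1 \<or> \<xi> = 2" using exhaust_2 by auto
      then show ?thesis
        by (elim disjE) (use k in \<open>simp_all add: mc_def qc_def field_simps power2_eq_square\<close>)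
    qed
    then show ?thesis
      unfolding e[symmetric] using k by simp
  qed
  finally show ?thesis by simp
qed

lemma dd_dd:
  assumes "1 \<le> j" "j \<le> n" "1 \<le> l" "l \<le> n"
  shows "dd j \<nu> * dd l \<xi> + dd l \<xi> * dd j \<nu> = 0"
proof -
  have c: "(lcs c * x) * (lcs d * y) + (lcs d * y) * (lcs c * x) = lcs (c * d) * (x * y + y * x)" for c d x y
  proof -
    have "(lcs c * x) * (lcs d * y) + (lcs d * y) * (lcs c * x) = lo.sm c x * lo.sm d y + lo.sm d y * lo.sm c x"
      by (simp only: lo.sm_def)
    also have "\<dots> = lo.sm (c * d) (x * y + y * x)"
      by (simp add: lo.sm_add mult.commute)
    finally show ?thesis by (simp only: lo.sm_def)
  qed
  have "dd j \<nu> * dd l \<xi> + dd l \<xi> * dd j \<nu> =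
    ((lcs (mc j \<nu> 1) * aG j 1) * (lcs (mc l \<xi> 1) * aG l 1) + (lcs (mc l \<xi> 1) * aG l 1) * (lcs (mc j \<nu> 1) * aG j 1)) +
    ((lcs (mc j \<nu> 1) * aG j 1) * (lcs (mc l \<xi> 2) * aG l 2) + (lcs (mc l \<xi> 2) * aG l 2) * (lcs (mc j \<nu> 1) * aG j 1)) +
    ((lcs (mc j \<nu> 2) * aG j 2) * (lcs (mc l \<xi> 1) * aG l 1) + (lcs (mc l \<xi> 1) * aG l 1) * (lcs (mc j \<nu> 2) * aG j 2)) +
    ((lcs (mc j \<nu> 2) * aG j 2) * (lcs (mc l \<xi> 2) * aG l 2) + (lcs (mc l \<xi> 2) * aG l 2) * (lcs (mc j \<nu> 2) * aG j 2))"
    by (simp add: dd_def algebra_simps)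
  then show ?thesis
    unfolding c CAR(3)[OF assms] by simp
qed

text \<open>The \<open>dd\<close> are dual to the \<open>aA\<close>; passing to the consecutive
  differences \<open>th\<close> of the \<open>aA\<close> turns the dual family into partial sums.
  For \<open>j = n\<close> the sum pairs to 0 with every \<open>th\<close>.\<close>

definition DD :: "nat \<Rightarrow> 2 \<Rightarrow> lop"
  where "DD j \<nu> = (\<Sum>k\<in>{1..j}. dd k \<nu>)"

definition th :: "nat \<Rightarrow> 2 \<Rightarrow> lop"
  where "th j \<nu> = aA j \<nu> - aA (Suc j) \<nu>"

lemma DD_aA:
  assumes "j \<le> n" "1 \<le> l" "l \<le> n"
  shows "DD j \<nu> * aA l \<xi> + aA l \<xi> * DD j \<nu> = (if l \<le> j \<and> \<nu> = \<xi> then 1 else 0)"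
proof -
  have "DD j \<nu> * aA l \<xi> + aA l \<xi> * DD j \<nu> = (\<Sum>k\<in>{1..j}. dd k \<nu> * aA l \<xi> + aA l \<xi> * dd k \<nu>)"
    by (simp add: DD_def sum_distrib_left sum_distrib_right sum.distrib)
  also have "\<dots> = (\<Sum>k\<in>{1..j}. if k = l then (if \<nu> = \<xi> then 1 else 0) else 0)"
    by (rule sum.cong[OF refl]) (use assms in \<open>auto simp: dd_aA\<close>)
  also have "\<dots> = (if l \<le> j \<and> \<nu> = \<xi> then 1 else 0)"
    using assms by auto
  finally show ?thesis .
qed

lemma DD_th:
  assumes "1 \<le> j" "j \<le> n" "1 \<le> l" "l < n"
  shows "DD j \<nu> * th l \<xi> + th l \<xi> * DD j \<nu> = (if j = l \<and> \<nu> = \<xi> then 1 else 0)"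
proof -
  have "DD j \<nu> * th l \<xi> + th l \<xi> * DD j \<nu> =
      (DD j \<nu> * aA l \<xi> + aA l \<xi> * DD j \<nu>) - (DD j \<nu> * aA (Suc l) \<xi> + aA (Suc l) \<xi> * DD j \<nu>)"
    by (simp add: th_def algebra_simps)
  then show ?thesis
    using assms by (simp add: DD_aA)
qed

lemma DD_DD:
  assumes "j \<le> n" "l \<le> n"
  shows "DD j \<nu> * DD l \<xi> + DD l \<xi> * DD j \<nu> = 0"
proof -
  have "DD j \<nu> * DD l \<xi> + DD l \<xi> * DD j \<nu> = (\<Sum>k\<in>{1..j}. \<Sum>i\<in>{1..l}. dd k \<nu> * dd i \<xi> + dd i \<xi> * dd k \<nu>)"
    unfolding DD_def sum_product by (subst (2) sum.swap) (simp only: sum.distrib)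
  also have "\<dots> = 0"
    by (intro sum.neutral ballI) (use assms in \<open>auto simp: dd_dd\<close>)
  finally show ?thesis .
qed

lemma dd_vac: "1 \<le> j \<Longrightarrow> j \<le> n \<Longrightarrow> app (dd j \<nu>) (vac n) = (\<lambda>s. 0)"
  by (simp add: dd_def aG_vac)

lemma DD_vac: "j \<le> n \<Longrightarrow> app (DD j \<nu>) (vac n) = (\<lambda>s. 0)"
  unfolding DD_def app_sum_left by (rule ext, rule sum.neutral) (simp add: dd_vac)

end

section \<open>The matrices \<open>1, K, E, KF\<close> of a nonsingular module\<close>

lemma UNIV_22: "sum f (UNIV :: (2 \<times> 2) set) = f (1, 1) + f (1, 2) + f (2, 1) + f (2, 2)"
proof -
  have U: "(UNIV :: (2 \<times> 2) set) = {(1, 1), (1, 2), (2, 1), (2, 2)}"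
    using exhaust_2 by auto
  show ?thesis
    unfolding U by (simp add: add.assoc)
qed

lemma mat_mult_entry: "(mat c ** (A :: complex^2^2)) $ i $ j = c * A $ i $ j"
  by (simp add: matrix_matrix_mult_def mat_def if_distrib if_distribR cong: if_cong)

lemma mat_mult_comm: "(A :: complex^2^2) ** mat c = mat c ** A"
  by (simp add: matrix_matrix_mult_def vec_eq_iff mat_def if_distrib if_distribR cong: if_cong)

definition mG :: "umod \<Rightarrow> complex^2^2" where "mG m = mK m ** mF m"

text \<open>Indexed by pairs, the type of matrix positions, so that the two matrices in
  \<open>completeness\<close> are square.\<close>

definition bU :: "umod \<Rightarrow> 2 \<times> 2 \<Rightarrow> complex^2^2"
  where "bU m k = (if k = (1, 1) then mat 1 else if k = (1, 2) then mK m else if k = (2, 1) then mE m else mG m)"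

text \<open>The dual basis for the trace form; the Gram matrix of \<open>E\<close>, \<open>KF\<close> has determinant
  \<open>4 \<kappa> \<omega>\<^sup>2\<close>.\<close>

definition bD :: "umod \<Rightarrow> zchar \<Rightarrow> complex \<Rightarrow> 2 \<times> 2 \<Rightarrow> complex^2^2"
  where "bD m x w k = (if k = (1, 1) then mat (1 / 2) else if k = (1, 2) then mat (1 / (2 * zkap x)) ** mK m
    else if k = (2, 1) then mat (- zphi x / (2 * zkap x * w\<^sup>2)) ** mE m + mat (\<i> * (zkap x - 1) / (2 * zkap x * w\<^sup>2)) ** mG m
    else mat (\<i> * (zkap x - 1) / (2 * zkap x * w\<^sup>2)) ** mE m + mat (zeps x / (2 * zkap x * w\<^sup>2)) ** mG m)"

lemma modrel_matrices:
  assumes m: "modrel m x w"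
  shows "mK m ** mK m = mat (zkap x)" "mE m ** mE m = mat (zeps x)" "mG m ** mG m = mat (- zphi x)"
    "mK m ** mE m = - (mE m ** mK m)" "mK m ** mG m = - (mG m ** mK m)"
    "mE m ** mG m = mat (\<i> * w) ** mK m - mat (\<i> * (zkap x - 1))"
    "mG m ** mE m = - (mat (\<i> * w) ** mK m) - mat (\<i> * (zkap x - 1))"
    "mat w ** (mK m ** mE m) = mat (\<i> * zeps x) ** mG m - mat (zkap x - 1) ** mE m"
    "mat w ** (mK m ** mG m) = mat (\<i> * zphi x) ** mE m + mat (zkap x - 1) ** mG m"
proof -
  define p :: pos where "p = (0, Md)"
  interpret utriple lcs "oE p m" "oF p m" "oK p m" "oKi p m" "zkap x" "zeps x" "zphi x"
    using m by (rule modrel_utriple)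
  note o = modrel_utrip(2)[OF m, of p]
  have s: "opL p (mat c ** A) = lo.sm c (opL p A)" "opL p (mat c) = lo.sm c 1" for c A
    by (simp_all add: opL_hom lo.sm_def)
  have G: "opL p (mG m) = oK p m * oF p m"
    by (simp add: mG_def opL_mult)
  note t = table[unfolded o] om_ke[unfolded o]
  note d = opL_mult[symmetric] opL_diff opL_add opL_uminus s G lo.sm_left mult_1_left
  have l: "lcs c * y = lo.sm c y" for c y by (simp add: lo.sm_def)
  have ss: "lo.sm c (lo.sm d y) = lo.sm (c * d) y" for c d y by simp
  show "mK m ** mK m = mat (zkap x)" "mE m ** mE m = mat (zeps x)"
    using m by (simp_all add: modrel_def)
  show "mG m ** mG m = mat (- zphi x)"
    by (rule opL_inj[of p], simp only: d t(4))
  show "mK m ** mE m = - (mE m ** mK m)"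
    by (rule opL_inj[of p], simp only: d ke)
  show "mK m ** mG m = - (mG m ** mK m)"
    by (rule opL_inj[of p], simp only: d t(5) minus_minus)
  show "mE m ** mG m = mat (\<i> * w) ** mK m - mat (\<i> * (zkap x - 1))"
    by (rule opL_inj[of p], simp only: d t(2) l ss)
  show "mG m ** mE m = - (mat (\<i> * w) ** mK m) - mat (\<i> * (zkap x - 1))"
    by (rule opL_inj[of p], simp only: d t(3) l ss)
  show "mat w ** (mK m ** mE m) = mat (\<i> * zeps x) ** mG m - mat (zkap x - 1) ** mE m"
    by (rule opL_inj[of p], simp only: d t(7)[unfolded l])
  show "mat w ** (mK m ** mG m) = mat (\<i> * zphi x) ** mE m + mat (zkap x - 1) ** mG m"
    by (rule opL_inj[of p], simp only: d t(6)[unfolded l])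
qed

lemma trace_mat_mult: "trace (mat c ** (A :: complex^2^2)) = c * trace A"
  by (simp add: trace_def mat_mult_entry sum_distrib_left)

lemma trace_mat: "trace (mat c :: complex^2^2) = 2 * c"
  by (simp add: trace_def sum_2 mat_def)

lemma trace_uminus: "trace (- (A :: complex^2^2)) = - trace A"
  by (simp add: trace_def sum_negf)

text \<open>A matrix anticommuting with the invertible K has trace 0. The trace of K itself vanishes
  because the two products of E and KF have equal trace and differ by a multiple of \<open>w\<close>
  times K.\<close>

lemma modrel_traces:
  assumes m: "modrel m x w" and w: "w \<noteq> 0"
  shows "trace (mK m) = 0" "trace (mE m) = 0" "trace (mG m) = 0" "trace (mK m ** mE m) = 0" "trace (mE m ** mK m) = 0"
    "trace (mK m ** mG m) = 0" "trace (mG m ** mK m) = 0"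
    "trace (mE m ** mG m) = - 2 * \<i> * (zkap x - 1)" "trace (mG m ** mE m) = - 2 * \<i> * (zkap x - 1)"
    "zkap x * w\<^sup>2 = (zkap x - 1)\<^sup>2 - zeps x * zphi x"
proof -
  note r = modrel_matrices[OF m]
  have k: "zkap x \<noteq> 0" using m by (simp add: modrel_def)
  have anti: "trace A = 0" if "mK m ** A = - (A ** mK m)" for A
  proof -
    have "mK m ** (mK m ** A) = mat (zkap x) ** A"
      unfolding matrix_mul_assoc r(1) ..
    then have "trace (mat (zkap x) ** A) = trace (mK m ** - (A ** mK m))"
      using that by metis
    also have "\<dots> = trace (- (A ** mK m) ** mK m)"
      by (rule trace_mul_sym)
    also have "- (A ** mK m) ** mK m = - (mat (zkap x) ** A)"
    proof -
      have "- (A ** mK m) ** mK m = - (A ** mK m ** mK m)"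
        by (simp add: matrix_matrix_mult_def vec_eq_iff sum_negf)
      then show ?thesis
        unfolding matrix_mul_assoc[symmetric] r(1) mat_mult_comm .
    qed
    finally show "trace A = 0"
      using k by (simp add: trace_uminus trace_mat_mult)
  qed
  show e: "trace (mE m) = 0" "trace (mG m) = 0"
    using anti r(4,5) by auto
  have "trace (mE m ** mG m) = trace (mG m ** mE m)"
    by (rule trace_mul_sym)
  then have "\<i> * w * trace (mK m) = - (\<i> * w * trace (mK m))"
    unfolding r(6,7) by (simp add: trace_sub trace_uminus trace_mat_mult)
  then show tk: "trace (mK m) = 0"
    using w by simp
  have "trace (mK m ** mE m) = trace (mE m ** mK m)" "trace (mK m ** mG m) = trace (mG m ** mK m)"
    by (rule trace_mul_sym)+
  then show "trace (mK m ** mE m) = 0" "trace (mE m ** mK m) = 0" "trace (mK m ** mG m) = 0" "trace (mG m ** mK m) = 0"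
    using arg_cong[OF r(4), of trace] arg_cong[OF r(5), of trace] by (simp_all add: trace_uminus)
  show "trace (mE m ** mG m) = - 2 * \<i> * (zkap x - 1)" "trace (mG m ** mE m) = - 2 * \<i> * (zkap x - 1)"
    unfolding r(6,7) by (simp_all add: trace_sub trace_uminus trace_mat_mult trace_mat tk)
  show "zkap x * w\<^sup>2 = (zkap x - 1)\<^sup>2 - zeps x * zphi x"
  proof -
    have "zkap x * omega2 x = (zkap x - 1)\<^sup>2 - zeps x * zphi x"
      using k by (simp add: omega2_def field_simps power2_eq_square)
    then show ?thesis
      by (simp add: power2_eq_square modrel_omega2[OF m])
  qed
qed

lemma mat_add_entry: "(mat a ** A + mat b ** B :: complex^2^2) ** C = mat a ** (A ** C) + mat b ** (B ** C)"
proof -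
  have "(A + B) ** C = A ** C + B ** C" for A B :: "complex^2^2"
    by (simp add: vec_eq_iff matrix_matrix_mult_def sum.distrib distrib_right)
  then show ?thesis
    by (simp add: matrix_mul_assoc)
qed

lemma dual_basis:
  assumes m: "modrel m x w" and w: "w \<noteq> 0"
  shows "trace (bD m x w k ** bU m l) = (if k = l then 1 else 0)"
proof -
  note r = modrel_matrices[OF m] and t = modrel_traces[OF m w]
  have k: "zkap x \<noteq> 0" using m by (simp add: modrel_def)
  \<comment> \<open>The common denominator in \<open>bD\<close>. Its second form is twice the
    determinant identity of the traces, and each numerator below either equals it or
    cancels.\<close>
  define D where "D = 2 * zkap x * w\<^sup>2"
  have D: "D \<noteq> 0" "2 * ((zkap x - 1) * (zkap x - 1)) - 2 * (zeps x * zphi x) = D"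
  proof -
    show "D \<noteq> 0" using k w by (simp add: D_def)
    have "D = 2 * (zkap x * w\<^sup>2)" by (simp add: D_def)
    then show "2 * ((zkap x - 1) * (zkap x - 1)) - 2 * (zeps x * zphi x) = D"
      unfolding t(10) by (simp add: power2_eq_square right_diff_distrib)
  qed
  have bD: "bD m x w k = (if k = (1, 1) then mat (1 / 2) else if k = (1, 2) then mat (1 / (2 * zkap x)) ** mK m
    else if k = (2, 1) then mat (- zphi x / D) ** mE m + mat (\<i> * (zkap x - 1) / D) ** mG m
    else mat (\<i> * (zkap x - 1) / D) ** mE m + mat (zeps x / D) ** mG m)" for k
    by (simp add: bD_def D_def)
  have 1: "(- zphi x / D) * (2 * zeps x) + (\<i> * (zkap x - 1) / D) * (- 2 * \<i> * (zkap x - 1)) = 1"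
  proof -
    have "(- zphi x / D) * (2 * zeps x) + (\<i> * (zkap x - 1) / D) * (- 2 * \<i> * (zkap x - 1)) =
        (2 * ((zkap x - 1) * (zkap x - 1)) - 2 * (zeps x * zphi x)) / D"
      using D(1) by (simp add: field_simps)
    then show ?thesis unfolding D(2) using D(1) by simp
  qed
  have 2: "(\<i> * (zkap x - 1) / D) * (- 2 * \<i> * (zkap x - 1)) + zeps x / D * (2 * - zphi x) = 1"
    using 1 by (simp add: algebra_simps)
  have 3: "(- zphi x / D) * (- 2 * \<i> * (zkap x - 1)) + (\<i> * (zkap x - 1) / D) * (2 * - zphi x) = 0"
    "(\<i> * (zkap x - 1) / D) * (2 * zeps x) + zeps x / D * (- 2 * \<i> * (zkap x - 1)) = 0"
    using D(1) by (simp_all add: field_simps)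
  note N = 1 2 3
  have "fst k = 1 \<or> fst k = 2" "snd k = 1 \<or> snd k = 2"
    using exhaust_2 by auto
  then consider "k = (1, 1)" | "k = (1, 2)" | "k = (2, 1)" | "k = (2, 2)"
    by (cases k) auto
  moreover have L: "l = (1, 1) \<or> l = (1, 2) \<or> l = (2, 1) \<or> l = (2, 2)"
    using exhaust_2 by (cases l) auto
  moreover have n: "(2 :: 2) \<noteq> 1" "(1 :: 2) \<noteq> 2" by simp_all
  note S = bD bU_def mat_add_entry matrix_mul_assoc[symmetric] trace_add trace_mat_mult
        trace_mat r(1-3) t(1-9) matrix_mul_rid prod.inject n if_False if_True simp_thms
  ultimately show ?thesis
  proof (cases)
    case 1
    then show ?thesis
      using L by (elim disjE) (simp_all add: S)
  next
    case 2
    then show ?thesis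
      using L k by (elim disjE) (simp_all add: S)
  next
    case 3
    then show ?thesis
      using L by (elim disjE) (simp_all only: S N mult_zero_right add_0_left add_0_right)
  next
    case 4
    then show ?thesis
      using L by (elim disjE) (simp_all only: S N mult_zero_right add_0_left add_0_right)
  qed
qed

text \<open>A left inverse of a square matrix is a right inverse: biorthogonality gives completeness.\<close>

lemma completeness:
  assumes m: "modrel m x w" and w: "w \<noteq> 0"
  shows "(\<Sum>k\<in>UNIV. bU m k $ i $ j * bD m x w k $ l $ q) = (if i = q \<and> j = l then 1 else 0)"
proof -
  define P :: "complex^(2\<times>2)^(2\<times>2)" where "P = (\<chi> k ij. bD m x w k $ snd ij $ fst ij)"
  define Q :: "complex^(2\<times>2)^(2\<times>2)" where "Q = (\<chi> ij k. bU m k $ fst ij $ snd ij)"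
  have "(P ** Q) $ k $ l = (mat 1 :: complex^(2\<times>2)^(2\<times>2)) $ k $ l" for k l
  proof -
    have "(P ** Q) $ k $ l = trace (bD m x w k ** bU m l)"
      by (simp add: matrix_matrix_mult_def P_def Q_def trace_def UNIV_22 sum_2)
    then show ?thesis
      by (simp add: dual_basis[OF m w] mat_def)
  qed
  then have "P ** Q = mat 1"
    by (simp add: vec_eq_iff)
  then have "Q ** P = mat 1"
    by (rule matrix_left_right_inverse[THEN iffD1])
  then have "(Q ** P) $ (i, j) $ (q, l) = (mat 1 :: complex^(2\<times>2)^(2\<times>2)) $ (i, j) $ (q, l)"
    by simp
  then show ?thesis
    by (simp add: matrix_matrix_mult_def P_def Q_def mat_def)
qed

lemma bU_span:
  assumes m: "modrel m x w" and w: "w \<noteq> 0"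
  shows "M = (\<Sum>k\<in>UNIV. mat (trace (bD m x w k ** M)) ** bU m k)"
proof -
  have "M $ i $ j = (\<Sum>k\<in>UNIV. trace (bD m x w k ** M) * bU m k $ i $ j)" for i j
  proof -
    have "(\<Sum>k\<in>UNIV. trace (bD m x w k ** M) * bU m k $ i $ j) =
        (\<Sum>k\<in>UNIV. \<Sum>l\<in>UNIV. \<Sum>q\<in>UNIV. M $ q $ l * (bU m k $ i $ j * bD m x w k $ l $ q))"
      by (simp add: trace_def matrix_matrix_mult_def sum_distrib_right sum_distrib_left mult_ac)
    also have "\<dots> = (\<Sum>l\<in>UNIV. \<Sum>q\<in>UNIV. M $ q $ l * (\<Sum>k\<in>UNIV. bU m k $ i $ j * bD m x w k $ l $ q))"
      unfolding sum_distrib_left by (subst sum.swap, rule sum.cong[OF refl], subst sum.swap, rule refl)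
    also have "\<dots> = M $ i $ j"
      unfolding completeness[OF m w] using exhaust_2[of i] exhaust_2[of j] by (auto simp: sum_2)
    finally show ?thesis ..
  qed
  then show ?thesis
    by (simp add: vec_eq_iff mat_mult_entry)
qed

text \<open>The matrices that may be moved from \<open>p\<close> to \<open>q\<close> on
  \<open>f\<close> form an algebra, since operators at different positions commute. It contains K,
  E, F, hence the basis \<open>bU\<close>, hence everything.\<close>

lemma schur_site:
  assumes m: "modrel m x w" and w: "w \<noteq> 0"
    and pq: "p \<noteq> q"
    and K: "app (opL p (mK m)) f = app (opL q (transpose (mK m))) f"
    and E: "app (opL p (mE m)) f = app (opL q (transpose (mE m))) f"
    and F: "app (opL p (mF m)) f = app (opL q (transpose (mF m))) f"
  shows "app (opL p M) f = app (opL q (transpose M)) f"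
proof -
  let ?c = "\<lambda>M. app (opL p M) f = app (opL q (transpose M)) f"
  have mult: "?c (A ** B)" if "?c A" "?c B" for A B
  proof -
    have "app (opL p (A ** B)) f = app (opL p A) (app (opL p B) f)"
      by (simp flip: opL_mult)
    also have "\<dots> = app (opL p A * opL q (transpose B)) f"
      using that by simp
    also have "\<dots> = app (opL q (transpose B) * opL p A) f"
      using opL_commute[OF pq] by metis
    also have "\<dots> = app (opL q (transpose (A ** B))) f"
      using that by (simp add: matrix_transpose_mul flip: opL_mult)
    finally show ?thesis .
  qed
  have mat: "?c (mat c)" for c
    by (simp add: opL_mat)
  have add: "?c (A + B)" if "?c A" "?c B" for A B
    using that by (simp add: transpose_plus opL_add)
  have U: "?c (bU m k)" for k
    unfolding bU_def mG_def using mat K E mult[OF K F] by auto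
  have "?c (\<Sum>k\<in>A. mat (c k) ** bU m k)" for c and A :: "(2 \<times> 2) set"
  proof (induction A rule: infinite_finite_induct)
    case (insert k A)
    then show ?case
      using add[OF mult[OF mat U]] by simp
  qed (use mat[of 0] in simp_all)
  from this[of "\<lambda>k. trace (bD m x w k ** M)" UNIV] show ?thesis
    by (simp only: bU_span[OF m w, symmetric])
qed

text \<open>Testing with matrix units shows that \<open>f\<close> is supported on equal indices at
  \<open>p\<close> and \<open>q\<close> and does not depend on their common value.\<close>

lemma opL_commutant:
  assumes c: "\<And>M. app (opL p M) f = app (opL q (transpose M)) f" and pq: "p \<noteq> q"
  shows "s p \<noteq> s q \<Longrightarrow> f s = 0" and "f (s(p := b, q := b)) = f (s(p := c, q := c))"
proof -
  let ?e = "\<lambda>i j. (\<chi> k l. if k = i \<and> l = j then 1 else 0) :: complex^2^2"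
  have t: "transpose (?e i j) = ?e j i" for i j
    by (simp add: transpose_def vec_eq_iff)
  have op: "app (opL r (?e i j)) f s = (if s r = i then f (s(r := j)) else 0)" for r i j s
  proof -
    have "(\<Sum>b\<in>UNIV. (if s r = i \<and> b = j then 1 else 0) * f (s(r := b))) =
        (\<Sum>b\<in>UNIV. if b = j then (if s r = i then f (s(r := b)) else 0) else 0)"
      by (rule sum.cong) auto
    then show ?thesis
      by (simp add: app_opL op_at_def)
  qed
  have e: "(if s p = i then f (s(p := j)) else 0) = (if s q = j then f (s(q := i)) else 0)" for i j s
    using fun_cong[OF c[of "?e i j"], of s] unfolding t op .
  show "s p \<noteq> s q \<Longrightarrow> f s = 0"
    using e[of s "s p" "s p"] by auto
  show "f (s(p := b, q := b)) = f (s(p := c, q := c))"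
    using e[of "s(p := b, q := c)" b c] pq by (simp add: fun_upd_twist)
qed

section \<open>The vacuum line\<close>

context tuple
begin

definition tp :: "lop \<Rightarrow> bool"
  where "tp x \<longleftrightarrow> (\<forall>f\<in>tens (positions n). app x f \<in> tens (positions n))"

lemma tp_intros: "tp 0" "tp 1" "tp (lcs c)" "tp x \<Longrightarrow> tp y \<Longrightarrow> tp (x + y)" "tp x \<Longrightarrow> tp y \<Longrightarrow> tp (x - y)"
    "tp x \<Longrightarrow> tp y \<Longrightarrow> tp (x * y)"
  by (auto simp: tp_def intro: tens_add tens_diff tens_scale)

lemma tp_sm: "tp x \<Longrightarrow> tp (lo.sm c x)"
  unfolding lo.sm_def by (intro tp_intros)

lemma tp_sum: "(\<And>i. i \<in> A \<Longrightarrow> tp (f i)) \<Longrightarrow> tp (sum f A)"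
  by (induction A rule: infinite_finite_induct) (auto intro: tp_intros)

lemma tp_gL: "p \<in> positions n \<Longrightarrow> tp (gL V a (p, g))"
  by (simp add: tp_def gL_def tens_opL)

lemma tp_gK: "p \<in> positions n \<Longrightarrow> tp (gK p)" and tp_gO: "p \<in> positions n \<Longrightarrow> tp (gO p)"
  and tp_gX: "p \<in> positions n \<Longrightarrow> tp (gX \<nu> p)"
  by (auto simp: gK_def gO_def gX_def intro!: tp_gL tp_sm tp_intros)

lemma tp_KK: "set ks \<times> {d} \<subseteq> positions n \<Longrightarrow> tp (KK d ks)"
  by (induction ks) (auto simp: KK_Cons intro!: tp_intros tp_gK)

lemma tp_al: "1 \<le> j \<Longrightarrow> j \<le> n \<Longrightarrow> tp (al j \<nu>)" and tp_ab: "1 \<le> j \<Longrightarrow> j \<le> n \<Longrightarrow> tp (ab j \<nu>)"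
  unfolding al_def ab_def
  by (intro tp_intros tp_KK tp_gX tp_gO; force simp: positions_def)+

lemma tp_DD: "j \<le> n \<Longrightarrow> tp (DD j \<nu>)"
  unfolding DD_def dd_def aG_def by (intro tp_sum tp_intros tp_al tp_ab) auto

text \<open>Recovers K from the two odd generators at a factor; since \<open>w j\<close> is nonzero,
  their relations therefore determine that of K.\<close>

lemma gX_comm:
  assumes j: "1 \<le> j" "j \<le> n"
  shows "gX 1 (j, d) * gX 2 (j, d) - gX 2 (j, d) * gX 1 (j, d) = lcs (2 * w j) * gK (j, d)"
proof -
  have p: "(j, d) \<in> positions n" using j by (simp add: pos_simps)
  interpret u: utriple lcs "gen (j, d) GE" "gen (j, d) GF" "gen (j, d) GK" "gen (j, d) GKi"
    "zkap (pos_chr a (j, d))" "zeps (pos_chr a (j, d))" "zphi (pos_chr a (j, d))"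
    by (rule pos_utriple[OF p])
  note t = u.table(2,3)[unfolded pos_om[OF p] lo.sm_def[symmetric]]
  have "(2 :: 2) \<noteq> 1" by simp
  then have "gX 1 (j, d) * gX 2 (j, d) - gX 2 (j, d) * gX 1 (j, d) =
      lo.sm (- \<i>) (gen (j, d) GE * (gen (j, d) GK * gen (j, d) GF) - gen (j, d) GK * gen (j, d) GF * gen (j, d) GE)"
    by (simp add: gX_def lo.sm_diff)
  also have "\<dots> = lo.sm (2 * w j) (gK (j, d))"
    unfolding t by (simp add: gK_def lo.sm_diff lo.sm_add lo.sm_uminus lo.fin lo.sm_def[of _ "lcs _ * _"])
  finally show ?thesis
    by (simp only: lo.sm_def)
qed

lemma app_cancel: "c \<noteq> 0 \<Longrightarrow> app (lcs c * x) f = app (lcs c * y) g \<Longrightarrow> app x f = app y g"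
  by (simp add: fun_eq_iff)

text \<open>The converse of \<open>aG_vac\<close> at one factor. It assumes that the factors to the
  right already fix \<open>f\<close>, since \<open>ab\<close> carries their K's; this dictates an
  induction from right to left.\<close>

lemma vac_line_step:
  assumes j: "1 \<le> j" "j \<le> n"
    and G: "\<And>\<nu>. app (aG j \<nu>) f = (\<lambda>s. 0)"
    and N: "app (KK Md [Suc j..<Suc n] * KK Dl [Suc j..<Suc n]) f = f"
  shows "app (gX \<nu> (j, Md)) f = app (gK (j, Md) * gX \<nu> (j, Dl)) f"
    and "app (gK (j, Md) * gK (j, Dl)) f = f"
proof -
  have p: "(j, Md) \<in> positions n" "(j, Dl) \<in> positions n" "(j, Md) \<noteq> (j, Dl)"
    using j by (simp_all add: pos_simps)
  have o: "gO (j, d) = lcs (1 / w j)" for d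
    using gen_Oi[of "(j, d)"] j by (simp add: gO_def pos_simps)
  have w: "w j \<noteq> 0" "kpre j \<noteq> 0" "kap j \<noteq> 0" using site(1,2)[OF j] kpre_nz[of j] j by auto
  let ?M = "KK Md [1..<j]"
  have X: "app (gX \<nu> (j, Md)) f = app (gK (j, Md) * gX \<nu> (j, Dl)) f" for \<nu>
  proof -
    have "app (al j \<nu>) f = app (ab j \<nu>) f"
      using G[of \<nu>] by (simp add: aG_def fun_eq_iff)
    then have "app (?M * (gX \<nu> (j, Md) * gO (j, Md))) f = app (?M * (gK (j, Md) * gX \<nu> (j, Dl) * gO (j, Dl))) f"
      using N unfolding al_def ab_split[OF j] by (simp only: app_simps)
    \<comment> \<open>The prefix of K's is cancelled by applying it once more, as its square is a
      nonzero number.\<close>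
    then have "app (?M * (?M * (gX \<nu> (j, Md) * gO (j, Md)))) f = app (?M * (?M * (gK (j, Md) * gX \<nu> (j, Dl) * gO (j, Dl)))) f"
      unfolding app_simps(6)[of ?M] by simp
    then have "app (?M * ?M * (gO (j, Md) * gX \<nu> (j, Md))) f = app (?M * ?M * (gO (j, Dl) * (gK (j, Md) * gX \<nu> (j, Dl)))) f"
      unfolding o lo.cs_comm[symmetric] mult.assoc .
    then have "app (lcs (kpre j * (1 / w j)) * gX \<nu> (j, Md)) f = app (lcs (kpre j * (1 / w j)) * (gK (j, Md) * gX \<nu> (j, Dl))) f"
      using KK_sq_Md[of j] j by (simp only: o lo.cs_mult mult.assoc[symmetric] le_SucI)
    then show ?thesis
      by (rule app_cancel[rotated]) (use w in simp)
  qed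
  then show "app (gX \<nu> (j, Md)) f = app (gK (j, Md) * gX \<nu> (j, Dl)) f" .
  \<comment> \<open>On the dual side the product appears in reversed order with one sign, so
    commutators correspond to commutators and \<open>gX_comm\<close> compares the two K's.\<close>
  have XX: "app (gX \<nu> (j, Md) * gX \<xi> (j, Md)) f = app (- (gK (j, Md) * gK (j, Md) * (gX \<xi> (j, Dl) * gX \<nu> (j, Dl)))) f" for \<nu> \<xi>
  proof -
    have 1: "gX \<nu> (j, Md) * gK (j, Md) = - (gK (j, Md) * gX \<nu> (j, Md))"
      using sw_KX[OF p(1,1), of \<nu>] by (simp add: sw_def)
    have 2: "gX \<nu> (j, Md) * gX \<xi> (j, Dl) = gX \<xi> (j, Dl) * gX \<nu> (j, Md)"
      using sw_XX[OF p, of \<nu> \<xi>] by (simp add: sw_def)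
    have 3: "gX \<xi> (j, Dl) * gK (j, Md) = gK (j, Md) * gX \<xi> (j, Dl)"
      using sw_KX[OF p(1,2), of \<xi>] by (simp add: sw_def)
    have "app (gX \<nu> (j, Md) * gX \<xi> (j, Md)) f = app (gX \<nu> (j, Md) * (gK (j, Md) * gX \<xi> (j, Dl))) f"
      using X[of \<xi>] by simp
    also have "gX \<nu> (j, Md) * (gK (j, Md) * gX \<xi> (j, Dl)) = - (gK (j, Md) * gX \<xi> (j, Dl)) * gX \<nu> (j, Md)"
      by (simp only: mult.assoc[symmetric] 1) (simp add: mult.assoc 2)
    also have "app \<dots> f = app (- (gK (j, Md) * gX \<xi> (j, Dl)) * (gK (j, Md) * gX \<nu> (j, Dl))) f"
      using X[of \<nu>] by simp
    also have "- (gK (j, Md) * gX \<xi> (j, Dl)) * (gK (j, Md) * gX \<nu> (j, Dl)) =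
        - (gK (j, Md) * gK (j, Md) * (gX \<xi> (j, Dl) * gX \<nu> (j, Dl)))"
      using swap_assoc[OF 3] by (simp add: mult.assoc)
    finally show ?thesis .
  qed
  have "app (lcs (2 * w j) * gK (j, Md)) f = app (gK (j, Md) * gK (j, Md) * (lcs (2 * w j) * gK (j, Dl))) f"
    unfolding gX_comm[OF j, symmetric] app_simps(4) XX by (simp add: app_diff fun_eq_iff)
  also have "gK (j, Md) * gK (j, Md) * (lcs (2 * w j) * gK (j, Dl)) = lcs (2 * w j) * (lcs (kap j) * gK (j, Dl))"
  proof -
    have "gK (j, Md) * gK (j, Md) = lcs (kap j)"
      using gK_sq[OF j, of Md] by simp
    then show ?thesis
      by (simp only:) (rule swap_assoc[OF lo.cs_comm])
  qed
  finally have k: "app (gK (j, Md)) f = app (lcs (kap j) * gK (j, Dl)) f"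
    by (rule app_cancel[rotated]) (use w in simp)
  have "gK (j, Md) * gK (j, Dl) = gK (j, Dl) * gK (j, Md)"
    using sw_KK[OF p(1,2)] by (simp add: sw_def)
  then have "app (gK (j, Md) * gK (j, Dl)) f = app (gK (j, Dl) * (lcs (kap j) * gK (j, Dl))) f"
    using k by simp
  also have "gK (j, Dl) * (lcs (kap j) * gK (j, Dl)) = lcs (kap j) * (gK (j, Dl) * gK (j, Dl))"
    by (rule swap_assoc[OF lo.cs_comm[symmetric]])
  also have "\<dots> = 1"
    using gK_sq[OF j, of Dl] w by (simp flip: lo.cs_mult)
  finally show "app (gK (j, Md) * gK (j, Dl)) f = f" by simp
qed

lemma vac_line_N:
  assumes G: "\<And>j \<nu>. 1 \<le> j \<Longrightarrow> j \<le> n \<Longrightarrow> app (aG j \<nu>) f = (\<lambda>s. 0)" and j: "j \<le> n"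
  shows "app (KK Md [Suc j..<Suc n] * KK Dl [Suc j..<Suc n]) f = f"
  using j
proof (induction "n - j" arbitrary: j)
  case (Suc m)
  have i: "1 \<le> Suc j" "Suc j \<le> n" "m = n - Suc j" using Suc.hyps(2) by auto
  have IH: "app (KK Md [Suc (Suc j)..<Suc n] * KK Dl [Suc (Suc j)..<Suc n]) f = f"
    using Suc.hyps(1)[OF i(3) i(2)] .
  have u: "[Suc j..<Suc n] = Suc j # [Suc (Suc j)..<Suc n]"
    using i by (simp add: upt_rec)
  have p: "set [Suc (Suc j)..<Suc n] \<times> {Md} \<subseteq> positions n" "(Suc j, Dl) \<in> positions n"
    using i by (auto simp: positions_def)
  have "KK Md [Suc (Suc j)..<Suc n] * gK (Suc j, Dl) = gK (Suc j, Dl) * KK Md [Suc (Suc j)..<Suc n]"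
    using sw_KKK[OF p] by (simp add: sw_def)
  then have "KK Md [Suc j..<Suc n] * KK Dl [Suc j..<Suc n] =
      (gK (Suc j, Md) * gK (Suc j, Dl)) * (KK Md [Suc (Suc j)..<Suc n] * KK Dl [Suc (Suc j)..<Suc n])"
    unfolding u KK_Cons using swap_assoc by (metis (no_types, lifting) mult.assoc)
  then show ?case
    using IH vac_line_step(2)[OF i(1,2) G[OF i(1,2)] IH] by simp
qed simp

lemma vac_line_site:
  assumes G: "\<And>j \<nu>. 1 \<le> j \<Longrightarrow> j \<le> n \<Longrightarrow> app (aG j \<nu>) f = (\<lambda>s. 0)" and j: "1 \<le> j" "j \<le> n"
  shows "app (opL (j, Md) M) f = app (opL (j, Dl) (transpose M)) f"
proof -
  let ?m = "V (a ! (j - 1))" and ?p = "(j, Md)" and ?q = "(j, Dl)"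
  have p: "?p \<in> positions n" "?q \<in> positions n" "?p \<noteq> ?q" using j by (simp_all add: pos_simps)
  note s = vac_line_step[OF j G[OF j] vac_line_N[OF G j(2)]]
  note m = site(3)[OF j]
  interpret u: utriple lcs "oE ?p ?m" "oF ?p ?m" "oK ?p ?m" "oKi ?p ?m" "kap j" "eps j" "phi j"
    using modrel_utriple[OF m] by (simp add: kap_def eps_def phi_def)
  let ?E = "mE ?m" and ?F = "mF ?m" and ?K = "mK ?m" and ?Ki = "matrix_inv (mK ?m)"
  have i: "?K ** ?Ki = mat 1" "?Ki ** ?K = mat 1"
    using umod_inv m by (auto simp: modrel_def)
  have g: "gK ?p = opL ?p ?K" "gK ?q = opL ?q (transpose ?Ki)"
    "gX 1 ?p = opL ?p ?E" "gX 2 ?p = lo.sm (- \<i>) (opL ?p ?K * opL ?p ?F)"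
    "gX 1 ?q = opL ?q (transpose (- (?E ** ?Ki)))"
    "gX 2 ?q = lo.sm (- \<i>) (opL ?q (transpose (- (?K ** ?F) ** ?Ki)))"
    unfolding gK_def gX_def gen_simps gen_dual[OF j]
    by (simp_all add: dual_umod_def opL_mult matrix_transpose_mul)
  have x: "opL ?p A * opL ?q B = opL ?q B * opL ?p A" for A B
    by (rule opL_commute[OF p(3)])
  have e1: "- (?E ** ?Ki) = ?Ki ** ?E"
    by (rule opL_inj[of ?p], simp only: opL_hom, simp add: u.nf del: One_nat_def)
  have e2: "- (?K ** ?F) ** ?Ki = ?F"
    by (rule opL_inj[of ?p], simp only: opL_hom, simp add: u.nf del: One_nat_def)
  have kk: "app (opL ?p ?K) (app (opL ?q (transpose ?Ki)) f) = f"
    using s(2) by (simp add: g)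
  have qq: "app (opL ?q A) (app (opL ?p B) h) = app (opL ?p B) (app (opL ?q A) h)" for A B h
    using x[of B A] by (metis app_simps(6))
  have K: "app (opL ?p ?K) f = app (opL ?q (transpose ?K)) f"
  proof -
    have "app (opL ?q (transpose ?K)) f = app (opL ?q (transpose ?K)) (app (opL ?p ?K) (app (opL ?q (transpose ?Ki)) f))"
      by (simp only: kk)
    also have "\<dots> = app (opL ?p ?K) (app (opL ?q (transpose ?K) * opL ?q (transpose ?Ki)) f)"
      by (simp add: qq)
    also have "opL ?q (transpose ?K) * opL ?q (transpose ?Ki) = 1"
      by (simp add: opL_mult i opL_mat del: One_nat_def flip: matrix_transpose_mul)
    finally show ?thesis by simp
  qed
  have E: "app (opL ?p ?E) f = app (opL ?q (transpose ?E)) f"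
  proof -
    have "app (opL ?p ?E) f = app (opL ?p ?K) (app (opL ?q (transpose ?E) * opL ?q (transpose ?Ki)) f)"
      using s(1)[of 1] unfolding g(1,3,5) e1 by (simp add: opL_mult matrix_transpose_mul del: One_nat_def)
    also have "\<dots> = app (opL ?q (transpose ?E)) (app (opL ?p ?K) (app (opL ?q (transpose ?Ki)) f))"
      by (simp add: qq)
    finally show ?thesis by (simp only: kk)
  qed
  have F: "app (opL ?p ?F) f = app (opL ?q (transpose ?F)) f"
  proof -
    have "app (lcs (- \<i>) * (opL ?p ?K * opL ?p ?F)) f = app (lcs (- \<i>) * (opL ?p ?K * opL ?q (transpose ?F))) f"
      using s(1)[of 2] unfolding g(1,4,6) e2 by (simp add: lo.sm_def app_scale app_uminus del: One_nat_def)
    then have "app (opL ?p ?K * opL ?p ?F) f = app (opL ?p ?K * opL ?q (transpose ?F)) f"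
      by (rule app_cancel[rotated]) simp
    then have "app (opL ?p ?Ki) (app (opL ?p ?K * opL ?p ?F) f) = app (opL ?p ?Ki) (app (opL ?p ?K * opL ?q (transpose ?F)) f)"
      by simp
    then have "app ((opL ?p ?Ki * opL ?p ?K) * opL ?p ?F) f = app ((opL ?p ?Ki * opL ?p ?K) * opL ?q (transpose ?F)) f"
      by simp
    then show ?thesis
      unfolding opL_mult i opL_mat by simp
  qed
  show ?thesis
    by (rule schur_site[OF m site(2)[OF j] p(3) K E F])
qed

text \<open>By \<open>vac_line_site\<close> every matrix moves between the two legs of each factor,
  so the coefficients are diagonal and constant along the diagonal: uniqueness of the
  vacuum.\<close>

lemma vac_line:
  assumes f: "f \<in> tens (positions n)"
    and G: "\<And>j \<nu>. 1 \<le> j \<Longrightarrow> j \<le> n \<Longrightarrow> app (aG j \<nu>) f = (\<lambda>s. 0)"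
  shows "f = (\<lambda>s. f (\<lambda>_. 1) * vac n s)"
proof
  fix s :: "pos \<Rightarrow> 2"
  have c: "app (opL (j, Md) M) f = app (opL (j, Dl) (transpose M)) f" if "1 \<le> j" "j \<le> n" for j M
    by (rule vac_line_site[OF G that])
  have diag: "f s' = 0" if "1 \<le> j" "j \<le> n" "s' (j, Md) \<noteq> s' (j, Dl)" for j s'
    by (rule opL_commutant(1)[OF c[OF that(1,2)] _ that(3)]) simp
  have const: "f (s'((j, Md) := b, (j, Dl) := b)) = f (s'((j, Md) := c, (j, Dl) := c))" if "1 \<le> j" "j \<le> n"
    for j s' b c
    by (rule opL_commutant(2)[OF c[OF that]]) simp
  show "f s = f (\<lambda>_. 1) * vac n s"
  proof (cases "s \<in> indices (positions n) \<and> (\<forall>j\<in>{1..n}. s (j, Md) = s (j, Dl))")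
    case False
    then have "f s = 0"
      using f diag[of _ s] by (auto simp: tens_def)
    moreover have "vac n s = 0"
      unfolding vac_def using False by simp
    ultimately show ?thesis by simp
  next
    case True
    \<comment> \<open>The index \<open>s\<close> with the factors up to \<open>k\<close> reset to
      the default 1. Each step changes both legs of one factor together, which is where
      \<open>const\<close> applies.\<close>
    define t where "t k = (\<lambda>p. if fst p \<le> k then 1 else s p)" for k
    have "f (t k) = f s" if "k \<le> n" for k
      using that
    proof (induction k)
      case 0
      have "t 0 = s"
        using True by (auto simp: t_def indices_def positions_def fun_eq_iff)
      then show ?case by simp
    next
      case (Suc k)
      have e1: "t (Suc k) = (t k)((Suc k, Md) := 1, (Suc k, Dl) := 1)"
      proof
        fix p :: pos
        show "t (Suc k) p = ((t k)((Suc k, Md) := 1, (Suc k, Dl) := 1)) p"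
          by (cases p; cases "snd p") (auto simp: t_def)
      qed
      have e2: "t k = (t k)((Suc k, Md) := s (Suc k, Md), (Suc k, Dl) := s (Suc k, Md))"
        using True Suc.prems by (auto simp: t_def fun_eq_iff)
      have "f (t (Suc k)) = f (t k)"
        using const[of "Suc k" "t k" 1 "s (Suc k, Md)"] Suc.prems unfolding e1 e2[symmetric] by simp
      then show ?case
        using Suc by simp
    qed
    moreover have "t n = (\<lambda>_. 1)"
      using True by (auto simp: t_def indices_def positions_def fun_eq_iff)
    ultimately have "f s = f (\<lambda>_. 1)" by (metis order_refl)
    moreover have "vac n s = 1"
      unfolding vac_def using True by simp
    ultimately show ?thesis by simp
  qed
qed

end

section \<open>The exterior algebra acting on the vacuum\<close>

context tuple
begin

lemma dd_DD: "1 \<le> j \<Longrightarrow> dd j \<nu> = DD j \<nu> - DD (j - 1) \<nu>"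
  by (cases j) (simp_all add: DD_def)

text \<open>The \<open>dd\<close> arise from the \<open>aG\<close> by the invertible matrix
  \<open>mc\<close>; the proof is Cramer's rule with the determinant of \<open>site\<close>.\<close>

lemma dd_zero_aG:
  assumes j: "1 \<le> j" "j \<le> n" and d: "\<And>\<nu>. app (dd j \<nu>) f = (\<lambda>s. 0)"
  shows "app (aG j \<nu>) f = (\<lambda>s. 0)"
proof -
  have k: "kpre (Suc j) \<noteq> 0" using kpre_nz[of "Suc j"] j by simp
  have D: "(kap j - 1) * (kap j - 1) - eps j * phi j \<noteq> 0"
    using site(1,2)[OF j] unfolding power2_eq_square[symmetric] site(4)[OF j, symmetric] by simp
  have e: "phi j * app (aG j 1) f s + (kap j - 1) * app (aG j 2) f s = 0"
    "(kap j - 1) * app (aG j 1) f s + eps j * app (aG j 2) f s = 0" for s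
  proof -
    have "mc j \<nu> 1 * app (aG j 1) f s + mc j \<nu> 2 * app (aG j 2) f s = 0" for \<nu>
      using fun_cong[OF d[of \<nu>], of s] by (simp add: dd_def)
    note z = this[of 1] this[of 2]
    have m: "4 * kpre (Suc j) * mc j 1 1 = - phi j" "4 * kpre (Suc j) * mc j 1 2 = - (kap j - 1)"
      "4 * kpre (Suc j) * mc j 2 1 = - (kap j - 1)" "4 * kpre (Suc j) * mc j 2 2 = - eps j"
      using k by (simp_all add: mc_def)
    have "phi j * app (aG j 1) f s + (kap j - 1) * app (aG j 2) f s =
        - (4 * kpre (Suc j) * (mc j 1 1 * app (aG j 1) f s + mc j 1 2 * app (aG j 2) f s))"
      unfolding distrib_left mult.assoc[symmetric] m by (simp add: algebra_simps)
    then show "phi j * app (aG j 1) f s + (kap j - 1) * app (aG j 2) f s = 0"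
      unfolding z by simp
    have "(kap j - 1) * app (aG j 1) f s + eps j * app (aG j 2) f s =
        - (4 * kpre (Suc j) * (mc j 2 1 * app (aG j 1) f s + mc j 2 2 * app (aG j 2) f s))"
      unfolding distrib_left mult.assoc[symmetric] m by (simp add: algebra_simps)
    then show "(kap j - 1) * app (aG j 1) f s + eps j * app (aG j 2) f s = 0"
      unfolding z by simp
  qed
  have "((kap j - 1) * (kap j - 1) - eps j * phi j) * app (aG j 1) f s = 0"
    "((kap j - 1) * (kap j - 1) - eps j * phi j) * app (aG j 2) f s = 0" for s
  proof -
    have "((kap j - 1) * (kap j - 1) - eps j * phi j) * app (aG j 1) f s =
        (kap j - 1) * ((kap j - 1) * app (aG j 1) f s + eps j * app (aG j 2) f s) -
        eps j * (phi j * app (aG j 1) f s + (kap j - 1) * app (aG j 2) f s)"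
      "((kap j - 1) * (kap j - 1) - eps j * phi j) * app (aG j 2) f s =
        (kap j - 1) * (phi j * app (aG j 1) f s + (kap j - 1) * app (aG j 2) f s) -
        phi j * ((kap j - 1) * app (aG j 1) f s + eps j * app (aG j 2) f s)"
      by (simp_all add: algebra_simps)
    then show "((kap j - 1) * (kap j - 1) - eps j * phi j) * app (aG j 1) f s = 0"
      "((kap j - 1) * (kap j - 1) - eps j * phi j) * app (aG j 2) f s = 0"
      unfolding e by simp_all
  qed
  then have "app (aG j 1) f s = 0" "app (aG j 2) f s = 0" for s
    using D by auto
  then show ?thesis
    using exhaust_2[of \<nu>] by auto
qed

text \<open>Enumerates the pairs by \<open>2 * (j - 1)\<close> for the first and
  \<open>2 * (j - 1) + 1\<close> for the second value of the superscript. Creators have index below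
  \<open>2 * (n - 1)\<close> and annihilators below \<open>2 * n\<close>, so the last two
  annihilators have no partner.\<close>

definition sj :: "nat \<Rightarrow> nat" where "sj i = Suc (i div 2)"
definition sn :: "nat \<Rightarrow> 2" where "sn i = (if even i then 1 else 2)"

lemma sj_le: "i < 2 * m \<Longrightarrow> 1 \<le> sj i \<and> sj i \<le> m" and sj_less: "i < 2 * (m - 1) \<Longrightarrow> 1 \<le> sj i \<and> sj i < m"
  by (auto simp: sj_def)

lemma sj_sn_eq: "sj i = sj k \<and> sn i = sn k \<longleftrightarrow> i = k"
proof
  assume "sj i = sj k \<and> sn i = sn k"
  then have "i div 2 = k div 2" "even i = even k"
    by (auto simp: sj_def sn_def split: if_splits)
  then show "i = k"
    by (metis even_iff_mod_2_eq_zero mult_div_mod_eq odd_iff_mod_2_eq_one)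
qed simp

lemma sj_sn_surj: "1 \<le> j \<Longrightarrow> \<exists>i. sj i = j \<and> sn i = \<nu> \<and> (j \<le> m \<longrightarrow> i < 2 * m) \<and> (j < m \<longrightarrow> i < 2 * (m - 1))"
proof -
  assume j: "1 \<le> j"
  have "\<nu> = 1 \<or> \<nu> = 2" using exhaust_2 by auto
  then show ?thesis
  proof
    assume "\<nu> = 1"
    then show ?thesis using j by (intro exI[of _ "2 * (j - 1)"]) (auto simp: sj_def sn_def)
  next
    assume "\<nu> = 2"
    then show ?thesis using j by (intro exI[of _ "Suc (2 * (j - 1))"]) (auto simp: sj_def sn_def)
  qed
qed

abbreviation "Dp i \<equiv> DD (sj i) (sn i)"
abbreviation "cp i \<equiv> th (sj i) (sn i)"
definition "vb i = vbas a (sj i) (sn i)"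

lemma Dp_cp: "i < 2 * n \<Longrightarrow> k < 2 * (n - 1) \<Longrightarrow> Dp i * cp k + cp k * Dp i = (if i = k then 1 else 0)"
  using DD_th[of "sj i" "sj k" "sn i" "sn k"] sj_le[of i n] sj_less[of k n] sj_sn_eq[of i k] by simp

lemma Dp_Dp: "i < 2 * n \<Longrightarrow> k < 2 * n \<Longrightarrow> Dp i * Dp k + Dp k * Dp i = 0"
  using DD_DD[of "sj i" "sj k"] sj_le[of i n] sj_le[of k n] by simp

lemma Dp_cp_app:
  assumes "i < 2 * n" "k < 2 * (n - 1)"
  shows "app (Dp i) (app (cp k) f) s = (if i = k then f s else 0) - app (cp k) (app (Dp i) f) s"
  using arg_cong[OF Dp_cp[OF assms], of "\<lambda>x. app x f s"] by (auto simp: algebra_simps split: if_splits)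

lemma Dp_Dp_app:
  assumes "i < 2 * n" "k < 2 * n"
  shows "app (Dp i) (app (Dp k) f) s = - app (Dp k) (app (Dp i) f) s"
  using arg_cong[OF Dp_Dp[OF assms], of "\<lambda>x. app x f s"] by (simp add: add_eq_0_iff2)

definition vv :: "(fword \<Rightarrow> complex^2) falg \<Rightarrow> tensor"
  where "vv x = app (actL V a (hF x)) (vac n)"

lemma vv_add: "vv (x + y) = (\<lambda>s. vv x s + vv y s)"
  by (simp add: vv_def hF_simps lo.ev_add)

lemma vv_cst: "vv (cst c) = (\<lambda>s. c * vac n s)"
  by (simp add: vv_def hF_simps)

lemma vv_cp: "k < 2 * (n - 1) \<Longrightarrow> vv (gvar (vb k) * x) = app (cp k) (vv x)"
  using sj_less[of k n] by (simp add: vv_def hF_simps lo.ev_mult vb_def thF_vbas actL_theta th_def)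

text \<open>Ordered polynomials, at most linear in each of the first \<open>k\<close> basis vectors,
  with larger indices on the left. Splitting off the last variable lets one annihilator read off its
  coefficient.\<close>

primrec nfs :: "nat \<Rightarrow> (fword \<Rightarrow> complex^2) falg set" where
  "nfs 0 = range cst"
| "nfs (Suc k) = {x0 + gvar (vb k) * x1 | x0 x1. x0 \<in> nfs k \<and> x1 \<in> nfs k}"

lemma vb_H: "vb k \<in> H"
  unfolding vb_def by (rule vbas_H1lf[OF regular])

lemma nfs_carrier: "x \<in> nfs k \<Longrightarrow> x \<in> carrier (free_ring H)"
  by (induction k arbitrary: x) (auto intro!: free_intros simp: vb_H)

text \<open>Annihilators pass the creators of other indices up to sign and reach the vacuum.\<close>

lemma nfs_Dp: "x \<in> nfs k \<Longrightarrow> k \<le> 2 * (n - 1) \<Longrightarrow> k \<le> i \<Longrightarrow> i < 2 * n \<Longrightarrow> app (Dp i) (vv x) = (\<lambda>s. 0)"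
proof (induction k arbitrary: x)
  case 0
  then obtain c where x: "x = cst c" by auto
  show ?case
    using DD_vac[of "sj i" "sn i"] sj_le[of i n] 0 by (simp add: x vv_cst app_scale)
next
  case (Suc k)
  then obtain x0 x1 where x: "x0 \<in> nfs k" "x1 \<in> nfs k" "x = x0 + gvar (vb k) * x1" by auto
  have "app (Dp i) (vv x0) = (\<lambda>s. 0)" "app (Dp i) (vv x1) = (\<lambda>s. 0)"
    using Suc.IH[OF x(1)] Suc.IH[OF x(2)] Suc.prems by auto
  then show ?case
    using Suc.prems Dp_cp_app[of i k "vv x1"] by (simp add: x(3) vv_add vv_cp app_add)
qed

lemma vac_nz: "vac n (\<lambda>_. 1) = 1"
  by (simp add: vac_def indices_def)

text \<open>The annihilator \<open>Dp k\<close> turns \<open>x0 + v x1\<close> into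
  \<open>x1\<close>, so both coefficients vanish one after the other.\<close>

lemma nfs_inj: "x \<in> nfs k \<Longrightarrow> k \<le> 2 * (n - 1) \<Longrightarrow> vv x = (\<lambda>s. 0) \<Longrightarrow> x = 0"
proof (induction k arbitrary: x)
  case 0
  then obtain c where x: "x = cst c" by auto
  then have "c = 0"
    using fun_cong[OF 0(3), of "\<lambda>_. 1"] by (simp add: vv_cst vac_nz)
  then show ?case by (simp add: x)
next
  case (Suc k)
  then obtain x0 x1 where x: "x0 \<in> nfs k" "x1 \<in> nfs k" "x = x0 + gvar (vb k) * x1" by auto
  have k: "k < 2 * n" "k < 2 * (n - 1)" "k \<le> 2 * (n - 1)" using Suc.prems by auto
  have v: "vv x = (\<lambda>s. vv x0 s + app (cp k) (vv x1) s)"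
    using k by (simp add: x(3) vv_add vv_cp)
  have "app (Dp k) (vv x) = (\<lambda>s. vv x1 s)"
    using nfs_Dp[OF x(1) k(3) order_refl k(1)] nfs_Dp[OF x(2) k(3) order_refl k(1)] k
    unfolding v by (simp add: app_add Dp_cp_app)
  then have "vv x1 = (\<lambda>s. 0)"
    using Suc.prems(3) by simp
  then have x1: "x1 = 0"
    using Suc.IH[OF x(2) k(3)] by simp
  then have "vv x0 = (\<lambda>s. 0)"
    using Suc.prems(3) v by (simp add: vv_def hF_simps)
  then show ?case
    using Suc.IH[OF x(1) k(3)] by (simp add: x(3) x1)
qed

text \<open>The inverse reading of the recursion: \<open>Dp k\<close> produces the coefficient of
  the last creator. At the bottom all annihilators vanish, and \<open>vac_line\<close> gives a
  multiple of the vacuum.\<close>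

lemma nfs_surj:
  "f \<in> tens (positions n) \<Longrightarrow> k \<le> 2 * (n - 1) \<Longrightarrow> (\<And>i. k \<le> i \<Longrightarrow> i < 2 * n \<Longrightarrow> app (Dp i) f = (\<lambda>s. 0)) \<Longrightarrow>
    \<exists>x\<in>nfs k. vv x = f"
proof (induction k arbitrary: f)
  case 0
  have D: "app (DD j \<nu>) f = (\<lambda>s. 0)" if le: "j \<le> n" for j \<nu>
  proof (cases "j = 0")
    case False
    then obtain i where "sj i = j" "sn i = \<nu>" "i < 2 * n"
      using sj_sn_surj[of j \<nu> n] le by auto
    then show ?thesis using 0(3)[of i] by auto
  qed (simp add: DD_def)
  have "app (dd j \<nu>) f = (\<lambda>s. 0)" if "1 \<le> j" "j \<le> n" for j \<nu>
    using D[of j \<nu>] D[of "j - 1" \<nu>] that by (simp add: dd_DD)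
  then have "app (aG j \<nu>) f = (\<lambda>s. 0)" if "1 \<le> j" "j \<le> n" for j \<nu>
    using dd_zero_aG that by blast
  then have "vv (cst (f (\<lambda>_. 1))) = f"
    using vac_line[OF 0(1)] by (simp add: vv_cst)
  then show ?case by auto
next
  case (Suc k)
  have k: "k < 2 * n" "k < 2 * (n - 1)" "k \<le> 2 * (n - 1)" using Suc.prems by auto
  define y where "y = app (Dp k) f"
  \<comment> \<open>The remainder after removing the part that contains the last creator; by the
    canonical anticommutation relations it is killed by \<open>Dp k\<close> as well.\<close>
  define g where "g = (\<lambda>s. f s - app (cp k) y s)"
  have t: "tp (Dp k)" "tp (cp k)"
    unfolding th_def aA_def using sj_le[OF k(1)] sj_less[OF k(2)] by (auto intro!: tp_DD tp_intros tp_al tp_ab)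
  have y: "y \<in> tens (positions n)"
    using t(1) Suc.prems(1) by (simp add: tp_def y_def)
  have g: "g \<in> tens (positions n)"
    unfolding g_def using t(2) y Suc.prems(1) by (auto simp: tp_def intro: tens_diff)
  have yD: "app (Dp i) y = (\<lambda>s. 0)" if "k \<le> i" "i < 2 * n" for i
  proof (cases "i = k")
    case True
    then show ?thesis
      using Dp_Dp_app[OF k(1) k(1), of f] by (simp add: y_def fun_eq_iff)
  next
    case False
    then show ?thesis
      using Dp_Dp_app[OF that(2) k(1), of f] Suc.prems(3)[of i] that by (simp add: y_def fun_eq_iff)
  qed
  have gD: "app (Dp i) g = (\<lambda>s. 0)" if "k \<le> i" "i < 2 * n" for i
  proof (cases "i = k")
    case True
    then show ?thesis
      using yD[of k] k by (simp add: g_def app_diff Dp_cp_app) (simp add: y_def)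
  next
    case False
    then show ?thesis
      using yD[of i] that k Suc.prems(3)[of i] by (simp add: g_def app_diff Dp_cp_app)
  qed
  obtain x0 where x0: "x0 \<in> nfs k" "vv x0 = g"
    using Suc.IH[OF g k(3) gD] by blast
  obtain x1 where x1: "x1 \<in> nfs k" "vv x1 = y"
    using Suc.IH[OF y k(3) yD] by blast
  have "vv (x0 + gvar (vb k) * x1) = f"
    using k by (simp add: vv_add vv_cp x0 x1 g_def)
  then show ?case
    using x0(1) x1(1) by auto
qed

subsection \<open>Normal forms in the exterior algebra\<close>

abbreviation "exI \<equiv> ext_ideal H"

lemma ext_add: "u \<in> H \<Longrightarrow> v \<in> H \<Longrightarrow> gvar (\<lambda>w. u w + v w) - gvar u - gvar v \<in> exI"
  and ext_scale: "u \<in> H \<Longrightarrow> gvar (\<lambda>w. c *s u w) - cst c * gvar u \<in> exI"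
  and ext_square: "u \<in> H \<Longrightarrow> gvar u * gvar u \<in> exI"
  by (rule ext_rels_ideal, unfold ext_rels_def, blast)+

lemma ext_anticomm:
  assumes "u \<in> H" "v \<in> H"
  shows "gvar u * gvar v + gvar v * gvar u \<in> exI"
proof -
  let ?s = "gvar (\<lambda>w. u w + v w)"
  note c = free_intros free_gvar[THEN iffD2] assms H1lf_add
  have s: "?s * ?s \<in> exI"
    using ext_square[OF H1lf_add[OF assms]] .
  have d: "?s - gvar u - gvar v \<in> exI" using ext_add[OF assms] .
  \<comment> \<open>Polarization: the square of the sum is in the ideal, and the generator of the
    sum may be replaced by the sum of generators.\<close>
  have "?s * ?s - (?s - gvar u - gvar v) * ?s - (gvar u + gvar v) * (?s - gvar u - gvar v)
      - gvar u * gvar u - gvar v * gvar v \<in> exI"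
    by (intro ex.diffI ex.lmultI ex.rmultI s d ext_square assms) (auto intro!: free_intros simp: assms H1lf_add)
  then show ?thesis
    by (simp add: algebra_simps)
qed

definition "NF x \<longleftrightarrow> (\<exists>y\<in>nfs (2 * (n - 1)). x - y \<in> exI)"

lemma nfs_add: "x \<in> nfs k \<Longrightarrow> y \<in> nfs k \<Longrightarrow> x + y \<in> nfs k"
proof (induction k arbitrary: x y)
  case 0
  then show ?case by (auto simp flip: cst_add)
next
  case (Suc k)
  then obtain x0 x1 y0 y1 where e: "x = x0 + gvar (vb k) * x1" "y = y0 + gvar (vb k) * y1"
    and m: "x0 \<in> nfs k" "x1 \<in> nfs k" "y0 \<in> nfs k" "y1 \<in> nfs k" by auto
  have "x + y = (x0 + y0) + gvar (vb k) * (x1 + y1)"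
    by (simp add: e algebra_simps)
  then show ?case using Suc.IH m by auto
qed

lemma nfs_cst_mult: "x \<in> nfs k \<Longrightarrow> cst c * x \<in> nfs k"
proof (induction k arbitrary: x)
  case 0
  then show ?case by (auto simp flip: cst_mult)
next
  case (Suc k)
  then obtain x0 x1 where e: "x = x0 + gvar (vb k) * x1" and m: "x0 \<in> nfs k" "x1 \<in> nfs k" by auto
  have "cst c * x = cst c * x0 + gvar (vb k) * (cst c * x1)"
    using swap_assoc[OF cst_central[of c "gvar (vb k)"]] by (simp add: e distrib_left)
  then show ?case using Suc.IH m by auto
qed

lemma nfs_0: "0 \<in> nfs k"
proof (induction k)
  case 0
  show ?case using rangeI[of cst 0] by simp
next
  case (Suc k)
  have "0 = 0 + gvar (vb k) * 0" by simp
  then show ?case using Suc by (simp only: nfs.simps) blast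
qed

lemma nfs_vb_mult: "x \<in> nfs k \<Longrightarrow> i < k \<Longrightarrow> \<exists>y\<in>nfs k. gvar (vb i) * x - y \<in> exI"
proof (induction k arbitrary: x)
  case (Suc k)
  then obtain x0 x1 where e: "x = x0 + gvar (vb k) * x1" and m: "x0 \<in> nfs k" "x1 \<in> nfs k" by auto
  note car = nfs_carrier[OF m(1)] nfs_carrier[OF m(2)]
  show ?case
  proof (cases "i = k")
    case True
    have "gvar (vb i) * x - (0 + gvar (vb k) * x0) = (gvar (vb k) * gvar (vb k)) * x1"
      by (simp add: e True algebra_simps)
    moreover have "\<dots> \<in> exI"
      by (intro ex.rmultI ext_square vb_H car)
    moreover have "0 + gvar (vb k) * x0 \<in> nfs (Suc k)"
      using m nfs_0[of k] by (simp only: nfs.simps) blast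
    ultimately show ?thesis by (intro bexI) auto
  next
    case False
    then have i: "i < k" using Suc.prems by simp
    obtain y0 y1 where y: "y0 \<in> nfs k" "gvar (vb i) * x0 - y0 \<in> exI" "y1 \<in> nfs k" "gvar (vb i) * x1 - y1 \<in> exI"
      using Suc.IH[OF m(1) i] Suc.IH[OF m(2) i] by blast
    have "(gvar (vb i) * x0 - y0) + (gvar (vb i) * gvar (vb k) + gvar (vb k) * gvar (vb i)) * x1
        - gvar (vb k) * (gvar (vb i) * x1 - y1) \<in> exI"
      by (intro ex.addI ex.diffI ex.rmultI ex.lmultI y ext_anticomm vb_H car) (simp add: vb_H)
    then have "gvar (vb i) * x - (y0 + gvar (vb k) * (cst (- 1) * y1)) \<in> exI"
      by (simp add: e algebra_simps cst_uminus)
    moreover have "y0 + gvar (vb k) * (cst (- 1) * y1) \<in> nfs (Suc k)"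
      using y nfs_cst_mult[OF y(3), of "- 1"] by auto
    ultimately show ?thesis by blast
  qed
qed simp

lemma gvar_sum:
  assumes "finite A" "\<And>i. i \<in> A \<Longrightarrow> u i \<in> H"
  shows "gvar (\<lambda>w. \<Sum>i\<in>A. c i *s u i w) - (\<Sum>i\<in>A. cst (c i) * gvar (u i)) \<in> exI"
  using assms
proof (induction A rule: finite_induct)
  case empty
  have "gvar (\<lambda>w. 0 *s (\<lambda>w. 0) w) - cst 0 * gvar (\<lambda>w. 0) \<in> exI"
    by (rule ext_scale[OF H1lf_zero])
  then show ?case by (simp add: vector_smult_lzero)
next
  case (insert i A)
  let ?u = "\<lambda>w. c i *s u i w" and ?v = "\<lambda>w. \<Sum>i\<in>A. c i *s u i w"
  have H: "?u \<in> H" "?v \<in> H"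
    using insert by (auto intro!: H1lf_scale H1lf_sum)
  have "(gvar (\<lambda>w. ?u w + ?v w) - gvar ?u - gvar ?v) + (gvar ?u - cst (c i) * gvar (u i)) +
      (gvar ?v - (\<Sum>i\<in>A. cst (c i) * gvar (u i))) \<in> exI"
    using insert by (intro ex.addI ext_add ext_scale H) auto
  then show ?case
    using insert by (simp add: algebra_simps)
qed

lemma gvar_expand:
  assumes d: "d \<in> H"
  shows "gvar d - (\<Sum>p\<in>{1..<n} \<times> UNIV. cst (coef a d (fst p) (snd p)) * gvar (vbas a (fst p) (snd p))) \<in> exI"
proof -
  have "d = (\<lambda>w. \<Sum>p\<in>{1..<n} \<times> UNIV. coef a d (fst p) (snd p) *s vbas a (fst p) (snd p) w)"
    using vbas_expand[OF d regular] by (simp add: n_def sum.cartesian_product case_prod_beta)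
  then have "gvar d = gvar (\<lambda>w. \<Sum>p\<in>{1..<n} \<times> UNIV. coef a d (fst p) (snd p) *s vbas a (fst p) (snd p) w)"
    by (rule arg_cong)
  then show ?thesis
    using gvar_sum[of "{1..<n} \<times> UNIV" "\<lambda>p. vbas a (fst p) (snd p)" "\<lambda>p. coef a d (fst p) (snd p)"]
    by (simp only:) (simp add: vbas_H1lf[OF regular])
qed

lemma NF_cst_mult: "x \<in> carrier (free_ring H) \<Longrightarrow> NF x \<Longrightarrow> NF (cst c * x)"
proof -
  assume "NF x"
  then obtain y where y: "y \<in> nfs (2 * (n - 1))" "x - y \<in> exI" by (auto simp: NF_def)
  have "cst c * (x - y) \<in> exI" using y by (intro ex.lmultI) auto
  then show ?thesis
    using nfs_cst_mult[OF y(1), of c] by (auto simp: NF_def right_diff_distrib)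
qed

lemma NF_add: "NF x \<Longrightarrow> NF y \<Longrightarrow> NF (x + y)"
proof -
  assume "NF x" "NF y"
  then obtain x' y' where m: "x' \<in> nfs (2 * (n - 1))" "x - x' \<in> exI" "y' \<in> nfs (2 * (n - 1))" "y - y' \<in> exI"
    by (auto simp: NF_def)
  have "(x - x') + (y - y') \<in> exI" using m by (intro ex.addI)
  then show ?thesis
    using nfs_add[OF m(1,3)] by (auto simp: NF_def algebra_simps intro!: bexI[of _ "x' + y'"])
qed

lemma NF_sum: "finite A \<Longrightarrow> (\<And>i. i \<in> A \<Longrightarrow> NF (f i)) \<Longrightarrow> NF (sum f A)"
proof (induction A rule: finite_induct)
  case empty
  show ?case using nfs_0 by (auto simp: NF_def intro!: bexI[of _ 0])
qed (auto intro: NF_add)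

lemma NF_cong: "x - y \<in> exI \<Longrightarrow> NF y \<Longrightarrow> NF x"
proof -
  assume d: "x - y \<in> exI" and "NF y"
  then obtain y' where m: "y' \<in> nfs (2 * (n - 1))" "y - y' \<in> exI" by (auto simp: NF_def)
  have "(x - y) + (y - y') \<in> exI" using d m by (intro ex.addI)
  then show ?thesis
    using m by (auto simp: NF_def)
qed

text \<open>Multiplication by a letter preserves normal forms modulo the ideal: the letter is
  expanded in the basis, and each basis vector is moved to its place by anticommutation or squares
  to zero.\<close>

lemma normal_form: "x \<in> carrier (free_ring H) \<Longrightarrow> NF x"
proof (induction rule: free_ring_induct)
  case (cst c)
  have "cst c \<in> nfs k" for k
  proof (induction k)
    case (Suc k)
    have "cst c = cst c + gvar (vb k) * 0" by simp
    then show ?case using Suc nfs_0[of k] by (simp only: nfs.simps) blast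
  qed auto
  then show ?case by (auto simp: NF_def intro!: bexI[of _ "cst c"])
next
  case (gvar_mult d x)
  let ?P = "{1..<n} \<times> (UNIV :: 2 set)"
  let ?s = "\<Sum>p\<in>?P. cst (coef a d (fst p) (snd p)) * gvar (vbas a (fst p) (snd p))"
  obtain y where y: "y \<in> nfs (2 * (n - 1))" "x - y \<in> exI" using gvar_mult by (auto simp: NF_def)
  have "(gvar d - ?s) * x \<in> exI"
    by (intro ex.rmultI gvar_expand gvar_mult)
  then have 1: "gvar d * x - (\<Sum>p\<in>?P. cst (coef a d (fst p) (snd p)) * (gvar (vbas a (fst p) (snd p)) * x)) \<in> exI"
    by (simp add: left_diff_distrib sum_distrib_right mult.assoc)
  have "NF (cst c * (gvar (vbas a (fst p) (snd p)) * x))" if p: "p \<in> ?P" for p c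
  proof -
    obtain i where i: "sj i = fst p" "sn i = snd p" "i < 2 * (n - 1)"
      using sj_sn_surj[of "fst p" "snd p" n] p by auto
    have v: "vbas a (fst p) (snd p) = vb i" using i by (simp add: vb_def)
    have "gvar (vb i) * (x - y) \<in> exI"
      using y(2) by (intro ex.lmultI) (simp_all add: vb_H)
    then have "gvar (vb i) * x - gvar (vb i) * y \<in> exI" by (simp add: right_diff_distrib)
    moreover have "NF (gvar (vb i) * y)"
      using nfs_vb_mult[OF y(1) i(3)] by (auto simp: NF_def)
    ultimately have "NF (gvar (vb i) * x)" by (rule NF_cong)
    then show ?thesis
      unfolding v using gvar_mult by (intro NF_cst_mult free_mult) (simp_all add: vb_H)
  qed
  then show ?case
    by (intro NF_cong[OF 1] NF_sum) auto
qed (rule NF_add)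

text \<open>Faithfulness on the vacuum. That the ideal acts by zero is a hypothesis here because it
  rests on \<open>actL_cliff_ideal\<close>, established afterwards.\<close>

lemma vv_ideal_inj:
  assumes x: "x \<in> carrier (free_ring H)" and v: "vv x = (\<lambda>s. 0)" and ker: "\<And>y. y \<in> exI \<Longrightarrow> vv y = (\<lambda>s. 0)"
  shows "x \<in> exI"
proof -
  obtain y where y: "y \<in> nfs (2 * (n - 1))" "x - y \<in> exI"
    using normal_form[OF x] by (auto simp: NF_def)
  have "vv x = (\<lambda>s. vv (x - y) s + vv y s)"
    unfolding vv_add[symmetric] by simp
  then have "vv y = (\<lambda>s. 0)"
    using v ker[OF y(2)] by simp
  then have "y = 0"
    using nfs_inj[OF y(1)] by simp
  then show ?thesis using y by simp
qed

end

section \<open>The isomorphism with the Clifford algebra\<close>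

lemma (in opring) ker_ideal:
  fixes h :: "'r \<Rightarrow> 'b::ring_1"
  assumes h: "\<And>x y. h (x + y) = h x + h y" "\<And>x y. h (x * y) = h x * h y"
  shows "ideal {x \<in> carrier R. h x = 0} R"
proof -
  have h0: "h 0 = 0" using h(1)[of 0 0] by simp
  have hm: "h (- x) = - h x" for x
    using h(1)[of x "- x"] h0 by (simp add: add_eq_0_iff)
  show ?thesis
  proof (rule idealI[OF ring_axioms])
    show "subgroup {x \<in> carrier R. h x = 0} (add_monoid R)"
    proof
      fix x assume x: "x \<in> {x \<in> carrier R. h x = 0}"
      have "inv\<^bsub>add_monoid R\<^esub> x = - x"
        using a_inv_op[of x] x unfolding a_inv_def by simp
      then show "inv\<^bsub>add_monoid R\<^esub> x \<in> {x \<in> carrier R. h x = 0}"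
        using x uminus_closed by (simp add: hm)
    next
      fix x y assume "x \<in> {x \<in> carrier R. h x = 0}" "y \<in> {x \<in> carrier R. h x = 0}"
      then show "x \<otimes>\<^bsub>add_monoid R\<^esub> y \<in> {x \<in> carrier R. h x = 0}"
        using a_closed[of x y] by (simp add: h)
    qed (use h0 zero_closed in auto)
  next
    fix x y assume "x \<in> {x \<in> carrier R. h x = 0}" "y \<in> carrier R"
    then show "y \<otimes>\<^bsub>R\<^esub> x \<in> {x \<in> carrier R. h x = 0}" "x \<otimes>\<^bsub>R\<^esub> y \<in> {x \<in> carrier R. h x = 0}"
      using m_closed[of x y] m_closed[of y x] by (simp_all add: h)
  qed
qed

context tuple
begin

lemma actL_gens: "actL V a (uE p) = gen p GE" "actL V a (uF p) = gen p GF" "actL V a (uK p) = gen p GK"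
    "actL V a (uKi p) = gen p GKi" "actL V a (uOi p) = gen p GOi"
  by (simp_all add: uE_def uF_def uK_def uKi_def uOi_def)

lemma actL_urels: "r \<in> urels n \<Longrightarrow> actL V a r = 0"
proof -
  assume "r \<in> urels n"
  then consider (st) p where "p \<in> positions n" "r \<in> {uK p * uKi p - 1, uKi p * uK p - 1,
       uK p * uE p + uE p * uK p, uK p * uF p + uF p * uK p,
       uE p * uF p - uF p * uE p - cst (2 * \<i>) * (uK p - uKi p),
       uOm p * uOi p - 1, uOi p * uOm p - 1}"
    | (cr) p q g h where "p \<in> positions n" "q \<in> positions n" "p \<noteq> q"
      "r = gvar (p, g) * gvar (q, h) - gvar (q, h) * gvar (p, g)"
    unfolding urels_def by blast
  then show ?thesis
  proof cases
    case st
    note p = st(1)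
    interpret u: utriple lcs "gen p GE" "gen p GF" "gen p GK" "gen p GKi"
      "zkap (pos_chr a p)" "zeps (pos_chr a p)" "zphi (pos_chr a p)"
      by (rule pos_utriple[OF p])
    have w: "w (fst p) \<noteq> 0" using site(2)[of "fst p"] p by (auto simp: positions_def)
    have "actL V a (uOm p) = lcs (w (fst p))"
      unfolding pos_om[OF p, symmetric] lo.om_def uOm_def
      by (simp add: lo.ev_add lo.ev_mult lo.ev_diff actL_gens lo.sm_def mult.assoc)
    moreover have "lcs (w (fst p)) * lcs (1 / w (fst p)) = 1" "lcs (1 / w (fst p)) * lcs (w (fst p)) = 1"
      using w by (simp_all flip: lo.cs_mult)
    ultimately show ?thesis
      using st(2) u.ef u.ke u.kf
      by (auto simp: lo.ev_add lo.ev_mult lo.ev_diff actL_gens gen_Oi[OF p] lo.sm_def)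
  next
    case cr
    then show ?thesis
      using cross[OF cr(1-3), of g h] by (simp add: lo.ev_mult lo.ev_diff)
  qed
qed

lemma actL_ker_gens: "r \<in> ker_gens a \<Longrightarrow> actL V a r = 0"
proof -
  assume "r \<in> ker_gens a"
  then obtain p where p: "p \<in> positions n" and r: "r \<in> (let x = pos_chr a p in
    {uK p * uK p - cst (zkap x), uKi p * uKi p - cst (1 / zkap x), uE p * uE p - cst (zeps x),
     uF p * uF p - cst (zphi x / zkap x), uOi p * uOi p - cst (1 / omega2 x)})"
    unfolding ker_gens_def n_def by blast
  interpret u: utriple lcs "gen p GE" "gen p GF" "gen p GK" "gen p GKi"
    "zkap (pos_chr a p)" "zeps (pos_chr a p)" "zphi (pos_chr a p)"
    by (rule pos_utriple[OF p])
  have o: "omega2 (pos_chr a p) = (w (fst p))\<^sup>2"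
    using omega_w[of "fst p" "snd p"] p by (auto simp: positions_def)
  have ki: "gen p GKi * gen p GKi = lcs (1 / zkap (pos_chr a p))"
    by (simp add: u.ki u.kk lo.cs_sm)
  show ?thesis
    using r u.kk u.ee u.ff ki
    by (auto simp: Let_def lo.ev_mult lo.ev_diff actL_gens gen_Oi[OF p] o power2_eq_square lo.sm_def
        simp flip: lo.cs_mult)
qed

lemma actL_uring_ideal: "x \<in> Idl\<^bsub>uring n\<^esub> (urels n) \<Longrightarrow> actL V a x = 0"
proof -
  have i: "ideal {x \<in> carrier (uring n). actL V a x = 0} (uring n)"
    by (rule ur.ker_ideal) (simp_all add: lo.ev_add lo.ev_mult)
  have "Idl\<^bsub>uring n\<^esub> (urels n) \<subseteq> {x \<in> carrier (uring n). actL V a x = 0}"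
    by (rule Idl_least[OF i]) (use urels_carrier actL_urels in auto)
  then show "x \<in> Idl\<^bsub>uring n\<^esub> (urels n) \<Longrightarrow> actL V a x = 0" by blast
qed

lemma actL_cliff_ideal: "x \<in> cliff_ideal a \<Longrightarrow> actL V a x = 0"
proof -
  have i: "ideal {x \<in> carrier (cliff (length a)). actL V a x = 0} (cliff (length a))"
    by (rule cl.ker_ideal) (simp_all add: lo.ev_add lo.ev_mult)
  have "actL V a y = 0" if "y \<in> cgens a" for y
    using that actL_uring_ideal[of y] actL_ker_gens[of y] by (auto simp: n_def)
  then have "cliff_ideal a \<subseteq> {x \<in> carrier (cliff (length a)). actL V a x = 0}"
    unfolding cliff_ideal_def using cgens_carrier by (intro Idl_least[OF i]) blast
  then show "x \<in> cliff_ideal a \<Longrightarrow> actL V a x = 0" by blast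
qed

section \<open>Homogeneous lifts of Clifford elements\<close>

definition hmg :: "bool \<Rightarrow> (fword \<Rightarrow> complex^2) falg \<Rightarrow> bool"
  where "hmg par z \<longleftrightarrow> z \<in> carrier (free_ring H) \<and> (\<forall>w\<in>Poly_Mapping.keys z. odd (length (letters w)) = par)"

lemma hmg_add: "hmg par x \<Longrightarrow> hmg par y \<Longrightarrow> hmg par (x + y)"
  using keys_add[of x y] by (auto simp: hmg_def intro: free_add)

lemma hmg_mult: "hmg par x \<Longrightarrow> hmg par' y \<Longrightarrow> hmg (par \<noteq> par') (x * y)"
proof -
  assume x: "hmg par x" and y: "hmg par' y"
  have "odd (length (letters w)) = (par \<noteq> par')" if w: "w \<in> Poly_Mapping.keys (x * y)" for w
  proof -
    obtain u v where "u \<in> Poly_Mapping.keys x" "v \<in> Poly_Mapping.keys y" "w = u + v"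
      using w keys_mult[of x y] by blast
    then show ?thesis
      using x y by (auto simp: hmg_def plus_fmon_def)
  qed
  then show ?thesis
    using x y by (auto simp: hmg_def intro: free_mult)
qed

lemma hmg_cst: "hmg False (cst c)" and hmg_0: "hmg par 0" and hmg_gvar: "d \<in> H \<Longrightarrow> hmg True (gvar d)"
  by (auto simp: hmg_def cst_def zero_fmon_def gvar_def free_gvar[unfolded gvar_def]
      free_cst[unfolded cst_def zero_fmon_def])

lemma scalar_cval: "z \<in> scalar_gens n \<Longrightarrow> \<exists>c. cval a z c"
proof -
  assume "z \<in> scalar_gens n"
  then consider c where "z = cst c" | p where "p \<in> positions (length a)"
      "z \<in> {uK p * uK p, uKi p * uKi p, uE p * uE p, uF p * uF p, uOi p * uOi p}"
    unfolding scalar_gens_def n_def by blast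
  then show ?thesis
  proof cases
    case 1
    then show ?thesis using cval_cst by auto
  next
    case 2
    then show ?thesis using cval_gens[OF 2(1)] by auto
  qed
qed

lemma theta_hF: "t \<in> thetas n \<Longrightarrow> \<exists>d\<in>H. t = hF (gvar d)"
proof -
  assume "t \<in> thetas n"
  then obtain j \<nu> where "t = theta n j \<nu>" "1 \<le> j" "j < n" by (auto simp: thetas_def)
  then show ?thesis
    using thF_vbas vbas_H1lf[OF regular] by (intro bexI[of _ "vbas a j \<nu>"]) (auto simp: hF_simps)
qed

text \<open>Modulo the character every scalar is a number, so only words in the \<open>theta\<close>
  are left, and these come from exterior words with the same number of letters.\<close>

lemma cliff_hom_lift: "(x, par) \<in> cliff_hom n \<Longrightarrow>
    x \<in> carrier (cliff n) \<and> (\<exists>z. hmg par z \<and> hF z - x \<in> cliff_ideal a)"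
proof (induction rule: cliff_hom.induct)
  case (zero par)
  then show ?case using hmg_0 cliff_0 by (auto intro!: exI[of _ 0] simp: hF_simps)
next
  case (scalar z)
  obtain c where c: "cval a z c" using scalar_cval[OF scalar] by blast
  then have "hF (cst c) - z \<in> cliff_ideal a"
    using ci.uminusI[of "z - cst c" a] by (simp add: cval_def hF_simps)
  then show ?case using hmg_cst c by (auto simp: cval_def n_def)
next
  case (theta t)
  obtain d where "d \<in> H" "t = hF (gvar d)" using theta_hF[OF theta] by blast
  then show ?case using hF_carrier by (auto intro!: exI[of _ "gvar d"] hmg_gvar)
next
  case (add x par y)
  then obtain z z' where z: "hmg par z" "hF z - x \<in> cliff_ideal a" "hmg par z'" "hF z' - y \<in> cliff_ideal a"
    by blast
  have "hF (z + z') - (x + y) \<in> cliff_ideal a"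
    using ci.addI[OF z(2,4)] by (simp add: hF_simps algebra_simps)
  then show ?case
    using add.IH z hmg_add cliff_add by blast
next
  case (mult x par y par')
  then obtain z z' where z: "hmg par z" "hF z - x \<in> cliff_ideal a" "hmg par' z'" "hF z' - y \<in> cliff_ideal a"
    by blast
  have "(hF z - x) * hF z' + x * (hF z' - y) \<in> cliff_ideal a"
    using mult.IH z by (intro ci.addI ci.rmultI ci.lmultI) (auto simp: hF_carrier n_def[symmetric])
  then have "hF (z * z') - x * y \<in> cliff_ideal a"
    by (simp add: hF_simps algebra_simps)
  then show ?case
    using mult.IH z hmg_mult[of par z par' z'] cliff_mult by blast
qed

lemma cliff_lift: "x \<in> carrier (cliff n) \<Longrightarrow> \<exists>z\<in>carrier (free_ring H). hF z - x \<in> cliff_ideal a"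
  unfolding cliff_carrier
proof (induction rule: generate_ring.induct)
  case one
  then show ?case by (intro bexI[of _ 1]) (simp_all add: hF_simps uring_def)
next
  case (incl h)
  then obtain par where "(h, par) \<in> cliff_hom n"
    by (auto intro: cliff_hom.intros)
  from cliff_hom_lift[OF this] show ?case by (auto simp: hmg_def)
next
  case (a_inv h)
  then obtain z where z: "z \<in> carrier (free_ring H)" "hF z - h \<in> cliff_ideal a" by blast
  have h: "h \<in> carrier (uring n)"
    using a_inv cliff_uring by (simp add: cliff_carrier)
  have "hF (- z) - (- h) \<in> cliff_ideal a"
    using ci.uminusI[OF z(2)] hF_simps(5)[of 0 z] by (simp add: hF_simps)
  then show ?case
    using z(1) by (auto simp: ur.a_inv_op[OF h] intro!: bexI[of _ "- z"] free_uminus)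
next
  case (eng_add h1 h2)
  then obtain z z' where z: "z \<in> carrier (free_ring H)" "hF z - h1 \<in> cliff_ideal a"
    "z' \<in> carrier (free_ring H)" "hF z' - h2 \<in> cliff_ideal a" by blast
  have "hF (z + z') - (h1 + h2) \<in> cliff_ideal a"
    using ci.addI[OF z(2,4)] by (simp add: hF_simps algebra_simps)
  then show ?case
    using z by (auto simp: uring_def intro!: bexI[of _ "z + z'"] free_add)
next
  case (eng_mult h1 h2)
  then obtain z z' where z: "z \<in> carrier (free_ring H)" "hF z - h1 \<in> cliff_ideal a"
    "z' \<in> carrier (free_ring H)" "hF z' - h2 \<in> cliff_ideal a" by blast
  have "(hF z - h1) * hF z' + h1 * (hF z' - h2) \<in> cliff_ideal a"
    using eng_mult z by (intro ci.addI ci.rmultI ci.lmultI)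
      (auto simp: hF_carrier n_def[symmetric] cliff_carrier hF_carrier[unfolded cliff_carrier])
  then have "hF (z * z') - h1 * h2 \<in> cliff_ideal a"
    by (simp add: hF_simps algebra_simps)
  then show ?case
    using z by (auto simp: uring_def intro!: bexI[of _ "z * z'"] free_mult)
qed

lemma cliff_hom_sum: "(\<And>i. i \<in> A \<Longrightarrow> (f i, par) \<in> cliff_hom m) \<Longrightarrow> (sum f A, par) \<in> cliff_hom m"
  by (induction A rule: infinite_finite_induct) (auto intro: cliff_hom.intros)

lemma cst_hom: "(cst c, False) \<in> cliff_hom m"
  by (rule cliff_hom.scalar) (simp add: scalar_gens_def)

lemma cst_mult_hom: "(x, par) \<in> cliff_hom m \<Longrightarrow> (cst c * x, par) \<in> cliff_hom m"
  using cliff_hom.mult[OF cst_hom, of x par m c] by simp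

lemma thF_hom: "(thF d, True) \<in> cliff_hom n"
  unfolding thF_def
  by (intro cliff_hom_sum cst_mult_hom cliff_hom.theta) (auto simp: thetas_def)

lemma hF_hom:
  assumes "hmg par z"
  shows "(hF z, par) \<in> cliff_hom n"
proof -
  have w: "(hF (prod_list (map gvar ls)), odd (length ls)) \<in> cliff_hom n" for ls :: "(fword \<Rightarrow> complex^2) list"
  proof (induction ls)
    case Nil
    then show ?case using cst_hom[of 1] by (simp add: hF_simps)
  next
    case (Cons d ls)
    then show ?case
      using cliff_hom.mult[OF thF_hom[of d] Cons] by (simp add: hF_simps)
  qed
  have "hF z = (\<Sum>w\<in>Poly_Mapping.keys z. cst (Poly_Mapping.lookup z w) * hF (prod_list (map gvar (letters w))))"
    by (subst falg_expand) (simp add: hF_def fa.ev_sum fa.ev_mult)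
  moreover have "(cst c * hF (prod_list (map gvar (letters w))), par) \<in> cliff_hom n" if "w \<in> Poly_Mapping.keys z" for w c
    using cst_mult_hom[OF w[of "letters w"]] assms that by (auto simp: hmg_def)
  ultimately show ?thesis
    by (auto intro: cliff_hom_sum)
qed

sublocale ph: ideal_pair "ext_ideal H" "free_ring H" "cliff_ideal a" "cliff (length a)" hF
proof (intro ideal_pair.intro ideal_pair_axioms.intro)
  show "ideal exI (free_ring H)" by (rule ex.ideal)
  show "ideal (cliff_ideal a) (cliff (length a))" by (rule ci.ideal)
  show "hF \<in> ring_hom (free_ring H) (cliff (length a))"
    using hF_carrier by (intro ring_hom_memI) (simp_all add: hF_simps n_def)
  show "hF x \<in> cliff_ideal a" if "x \<in> exI" for x using hF_ideal[OF that] .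
qed

end

section \<open>Iterated coproducts\<close>

lemma actL_commute:
  assumes x: "x \<in> carrier (free_ring (P \<times> UNIV))" and y: "y \<in> carrier (free_ring (Q \<times> UNIV))" and d: "P \<inter> Q = {}"
  shows "actL V a x * actL V a y = actL V a y * actL V a x"
proof -
  have g: "actL V a x * gL V a (q, h) = gL V a (q, h) * actL V a x" if q: "q \<in> Q" for q h
    using x
  proof (induction rule: free_ring_induct)
    case (gvar_mult g x)
    obtain p g' where g: "g = (p, g')" "p \<in> P" using gvar_mult(1) by (cases g) auto
    have "gL V a g * gL V a (q, h) = gL V a (q, h) * gL V a g"
      using g d q by (auto simp: gL_def intro!: opL_commute)
    then show ?case
      using gvar_mult(3) by (simp add: lo.ev_mult mult.assoc) (simp flip: mult.assoc)
  qed (simp_all add: lo.cs_comm lo.ev_add algebra_simps)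
  show ?thesis
    using y
  proof (induction rule: free_ring_induct)
    case (gvar_mult g y)
    obtain q h where q: "g = (q, h)" "q \<in> Q" using gvar_mult(1) by (cases g) auto
    have "actL V a x * (gL V a g * actL V a y) = actL V a x * gL V a g * actL V a y"
      by (simp only: mult.assoc)
    also have "\<dots> = gL V a g * (actL V a x * actL V a y)"
      using g[OF q(2), of h] q by (simp only: mult.assoc)
    also have "\<dots> = gL V a g * actL V a y * actL V a x"
      by (simp only: gvar_mult(3) mult.assoc)
    finally show ?case by (simp add: lo.ev_mult)
  qed (simp_all add: lo.cs_comm lo.ev_add algebra_simps)
qed

lemma cop_carrier:
  "copK d m \<in> carrier (free_ring (({1..m} \<times> {d}) \<times> UNIV))"
  "copKi d m \<in> carrier (free_ring (({1..m} \<times> {d}) \<times> UNIV))"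
  "copE d m \<in> carrier (free_ring (({1..m} \<times> {d}) \<times> UNIV))"
  "copF d m \<in> carrier (free_ring (({1..m} \<times> {d}) \<times> UNIV))"
proof -
  have mono: "x \<in> carrier (free_ring (({1..m} \<times> {d}) \<times> UNIV)) \<Longrightarrow> x \<in> carrier (free_ring (({1..Suc m} \<times> {d}) \<times> UNIV))"
    for x :: ualg and d m
    by (fastforce simp: free_carrier)
  have gen: "uE (Suc m, d) \<in> carrier (free_ring (({1..Suc m} \<times> {d}) \<times> UNIV))"
    "uF (Suc m, d) \<in> carrier (free_ring (({1..Suc m} \<times> {d}) \<times> UNIV))"
    "uK (Suc m, d) \<in> carrier (free_ring (({1..Suc m} \<times> {d}) \<times> UNIV))"
    "uKi (Suc m, d) \<in> carrier (free_ring (({1..Suc m} \<times> {d}) \<times> UNIV))" for d m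
    by (simp_all add: uE_def uF_def uK_def uKi_def)
  have K: "copK d m \<in> carrier (free_ring (({1..m} \<times> {d}) \<times> UNIV))" for d m
    by (induction m) (auto intro!: free_mult gen intro: mono simp del: One_nat_def)
  have Ki: "copKi d m \<in> carrier (free_ring (({1..m} \<times> {d}) \<times> UNIV))" for d m
    by (induction m) (auto intro!: free_mult gen intro: mono simp del: One_nat_def)
  have E: "copE d m \<in> carrier (free_ring (({1..m} \<times> {d}) \<times> UNIV))" for d m
    by (induction m) (auto intro!: free_mult free_add gen intro: mono K simp del: One_nat_def split: side.split)
  have F: "copF d m \<in> carrier (free_ring (({1..m} \<times> {d}) \<times> UNIV))" for d m
    by (induction m) (auto intro!: free_mult free_add gen intro: mono Ki simp del: One_nat_def split: side.split)
  show "copK d m \<in> carrier (free_ring (({1..m} \<times> {d}) \<times> UNIV))"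
    "copKi d m \<in> carrier (free_ring (({1..m} \<times> {d}) \<times> UNIV))"
    "copE d m \<in> carrier (free_ring (({1..m} \<times> {d}) \<times> UNIV))"
    "copF d m \<in> carrier (free_ring (({1..m} \<times> {d}) \<times> UNIV))"
    by (rule K Ki E F)+
qed

definition pchr :: "side \<Rightarrow> zchar \<Rightarrow> zchar" where "pchr d x = (if d = Md then x else zinv x)"

lemma zinv_zmult: "zkap x \<noteq> 0 \<Longrightarrow> zkap y \<noteq> 0 \<Longrightarrow> zinv (zmult x y) =
    \<lparr>zkap = zkap (zinv x) * zkap (zinv y), zeps = zeps (zinv x) + zeps (zinv y) * zkap (zinv x),
     zphi = zphi (zinv x) + zphi (zinv y) * zkap (zinv x)\<rparr>"
  by (simp add: zinv_def zmult_def field_simps)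

context tuple
begin

definition "cE d = actL V a (copE d n)"
definition "cF d = actL V a (copF d n)"
definition "cK d = actL V a (copK d n)"
definition "cKi d = actL V a (copKi d n)"

definition tch :: "nat \<Rightarrow> zchar" where "tch m = foldl zmult zone (map fst (take m a))"

lemma tch_total: "tch n = total_chr a"
  by (simp add: tch_def total_chr_def n_def)

lemma tch_Suc: "m < n \<Longrightarrow> tch (Suc m) = zmult (tch m) (chr a (Suc m))"
  by (simp add: tch_def take_Suc_conv_app_nth chr_def n_def)

lemma tch_kap: "m \<le> n \<Longrightarrow> zkap (tch m) \<noteq> 0"
proof (induction m)
  case (Suc m)
  then show ?case using site(1)[of "Suc m"] by (simp add: tch_Suc zmult_def kap_def)
qed (simp add: tch_def zone_def)

text \<open>Iterates the coproduct lemmas. On the dual side the inverse of a product of characters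
  has its factors in reversed order, which matches the opposite coproduct.\<close>

lemma cop_utrip:
  assumes "m \<le> n"
  shows "lo.utrip (actL V a (copE d m)) (actL V a (copF d m)) (actL V a (copK d m)) (actL V a (copKi d m))
    (zkap (pchr d (tch m))) (zeps (pchr d (tch m))) (zphi (pchr d (tch m)))"
  using assms
proof (induction m)
  case 0
  have z: "zinv zone = zone" by (simp add: zinv_def zone_def)
  show ?case
    by (cases d) (simp_all add: lo.utrip_def tch_def pchr_def z, simp_all add: zone_def)
next
  case (Suc m)
  let ?p = "(Suc m, d)"
  have p: "?p \<in> positions n" using Suc.prems by (simp add: pos_simps)
  have g: "lo.utrip (gen ?p GE) (gen ?p GF) (gen ?p GK) (gen ?p GKi)
    (zkap (pchr d (chr a (Suc m)))) (zeps (pchr d (chr a (Suc m)))) (zphi (pchr d (chr a (Suc m))))"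
    using pos_utriple[OF p] by (cases d) (simp_all add: utriple_def utriple_axioms_def pchr_def)
  have c: "actL V a x * gen ?p h = gen ?p h * actL V a x" if "x \<in> carrier (free_ring (({1..m} \<times> {d}) \<times> UNIV))" for x h
    using actL_commute[OF that, of "gvar (?p, h)" "{?p}" V a] by simp
  note C = c[OF cop_carrier(1)] c[OF cop_carrier(2)] c[OF cop_carrier(3)] c[OF cop_carrier(4)]
  have IH: "lo.utrip (actL V a (copE d m)) (actL V a (copF d m)) (actL V a (copK d m)) (actL V a (copKi d m))
    (zkap (pchr d (tch m))) (zeps (pchr d (tch m))) (zphi (pchr d (tch m)))"
    using Suc by simp
  show ?case
  proof (cases d)
    case Md
    show ?thesis
      using lo.utrip_mult_left[OF IH g] C Suc.prems
      by (auto simp: Md lo.ev_mult lo.ev_add actL_gens pchr_def tch_Suc zmult_def)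
  next
    case Dl
    have k: "zkap (tch m) \<noteq> 0" "zkap (chr a (Suc m)) \<noteq> 0"
      using tch_kap[of m] site(1)[of "Suc m"] Suc.prems by (simp_all add: kap_def)
    have t: "pchr d (tch (Suc m)) = zinv (zmult (tch m) (chr a (Suc m)))"
      using Suc.prems by (simp add: Dl pchr_def tch_Suc)
    show ?thesis
      unfolding t zinv_zmult[OF k]
      using lo.utrip_mult_right[OF IH g] C
      by (auto simp: Dl lo.ev_mult lo.ev_add actL_gens pchr_def)
  qed
qed

lemma cE_utrip: "lo.utrip (cE d) (cF d) (cK d) (cKi d)
    (zkap (pchr d (total_chr a))) (zeps (pchr d (total_chr a))) (zphi (pchr d (total_chr a)))"
  using cop_utrip[of n d] by (simp add: cE_def cF_def cK_def cKi_def tch_total)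

lemma cop_cross: "x \<in> {cE Md, cF Md, cK Md, cKi Md} \<Longrightarrow> y \<in> {cE Dl, cF Dl, cK Dl, cKi Dl} \<Longrightarrow> x * y = y * x"
proof -
  have "actL V a u * actL V a v = actL V a v * actL V a u"
    if "u \<in> carrier (free_ring (({1..n} \<times> {Md}) \<times> UNIV))" "v \<in> carrier (free_ring (({1..n} \<times> {Dl}) \<times> UNIV))" for u v
    by (rule actL_commute[OF that]) auto
  then show "x \<in> {cE Md, cF Md, cK Md, cKi Md} \<Longrightarrow> y \<in> {cE Dl, cF Dl, cK Dl, cKi Dl} \<Longrightarrow> x * y = y * x"
    using cop_carrier unfolding cE_def cF_def cK_def cKi_def by blast
qed

lemma actL_copK: "actL V a (copK d m) = KK d [1..<Suc m]"
  by (induction m) (simp_all add: lo.ev_mult KK_append KK_Cons actL_gens gK_def)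

lemma cK_KK: "cK d = KK d [1..<Suc n]"
  unfolding cK_def by (rule actL_copK)

definition KI :: "side \<Rightarrow> nat list \<Rightarrow> lop"
  where "KI d ks = prod_list (map (\<lambda>k. gen (k, d) GKi) ks)"

lemma KI_KK:
  assumes "set ks \<times> {d} \<subseteq> positions n"
  shows "KK d ks * KI d ks = 1"
  using assms
proof (induction ks)
  case (Cons k ks)
  have p: "(k, d) \<in> positions n" using Cons.prems by auto
  have i: "gK (k, d) * gen (k, d) GKi = 1" "gen (k, d) GKi * gK (k, d) = 1"
    unfolding gK_def using kki[OF p] kik[OF p] by auto
  have s: "set ks \<times> {d} \<subseteq> positions n" using Cons.prems by auto
  have "sw False (KK d ks) (gen (k, d) GKi)"
    by (rule sw_inverse[OF sw_KKK[OF s p] i])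
  then have c: "KK d ks * gen (k, d) GKi = gen (k, d) GKi * KK d ks" by (simp add: sw_def)
  have "KK d (k # ks) * KI d (k # ks) = gK (k, d) * (KK d ks * gen (k, d) GKi) * KI d ks"
    by (simp add: KK_Cons KI_def mult.assoc)
  also have "\<dots> = (gK (k, d) * gen (k, d) GKi) * (KK d ks * KI d ks)"
    by (simp only: c mult.assoc)
  also have "\<dots> = 1"
    using i Cons by simp
  finally show ?case .
qed (simp add: KI_def)

lemma KI_val:
  assumes s: "set ks \<times> {d} \<subseteq> positions n" and sq: "KK d ks * KK d ks = lcs c" and c: "c \<noteq> 0"
  shows "KI d ks = lcs (1 / c) * KK d ks"
proof -
  have "KK d ks * KK d ks * KI d ks = KK d ks"
    using KI_KK[OF s] by (simp add: mult.assoc)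
  then have "lcs (1 / c) * (lcs c * KI d ks) = lcs (1 / c) * KK d ks"
    unfolding sq by simp
  then show ?thesis
    using c by (simp add: mult.assoc[symmetric] flip: lo.cs_mult)
qed

lemma actL_copKi: "actL V a (copKi d m) = KI d [1..<Suc m]"
  by (induction m) (simp_all add: lo.ev_mult KI_def actL_gens)

lemma copE_sum: "m \<le> n \<Longrightarrow> actL V a (copE Md m) = (\<Sum>j\<in>{1..m}. gen (j, Md) GE * KK Md [Suc j..<Suc m])"
    "actL V a (copE Dl m) = (\<Sum>j\<in>{1..m}. KK Dl [1..<j] * gen (j, Dl) GE)"
proof -
  show "m \<le> n \<Longrightarrow> actL V a (copE Md m) = (\<Sum>j\<in>{1..m}. gen (j, Md) GE * KK Md [Suc j..<Suc m])"
  proof (induction m)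
    case (Suc m)
    have "(\<Sum>j\<in>{1..m}. gen (j, Md) GE * KK Md [Suc j..<Suc (Suc m)]) =
        (\<Sum>j\<in>{1..m}. gen (j, Md) GE * KK Md [Suc j..<Suc m]) * gK (Suc m, Md)"
      unfolding sum_distrib_right
      by (rule sum.cong) (auto simp: KK_append KK_Cons mult.assoc)
    then show ?case
      using Suc by (simp add: lo.ev_add lo.ev_mult actL_gens gK_def add.commute)
  qed simp
  show "actL V a (copE Dl m) = (\<Sum>j\<in>{1..m}. KK Dl [1..<j] * gen (j, Dl) GE)"
  proof (induction m)
    case (Suc m)
    then show ?case
      using actL_copK[of Dl m] by (simp add: lo.ev_add lo.ev_mult actL_gens add.commute)
  qed simp
qed

lemma copF_sum: "actL V a (copF Md m) = (\<Sum>j\<in>{1..m}. KI Md [1..<j] * gen (j, Md) GF)"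
    "actL V a (copF Dl m) = (\<Sum>j\<in>{1..m}. gen (j, Dl) GF * KI Dl [Suc j..<Suc m])"
proof -
  show "actL V a (copF Md m) = (\<Sum>j\<in>{1..m}. KI Md [1..<j] * gen (j, Md) GF)"
  proof (induction m)
    case (Suc m)
    then show ?case
      using actL_copKi[of Md m] by (simp add: lo.ev_add lo.ev_mult actL_gens add.commute)
  qed simp
  show "actL V a (copF Dl m) = (\<Sum>j\<in>{1..m}. gen (j, Dl) GF * KI Dl [Suc j..<Suc m])"
  proof (induction m)
    case (Suc m)
    have "(\<Sum>j\<in>{1..m}. gen (j, Dl) GF * KI Dl [Suc j..<Suc (Suc m)]) =
        (\<Sum>j\<in>{1..m}. gen (j, Dl) GF * KI Dl [Suc j..<Suc m]) * gen (Suc m, Dl) GKi"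
      unfolding sum_distrib_right
      by (rule sum.cong) (auto simp: KI_def mult.assoc)
    then show ?case
      using Suc by (simp add: lo.ev_add lo.ev_mult actL_gens KI_def add.commute)
  qed simp
qed

text \<open>The relations \<open>\<Omega> K E = i \<epsilon> K F - (\<kappa> - 1) E\<close> and \<open>\<kappa> \<Omega> F = i \<phi> E + (\<kappa> - 1) K F\<close> express
  \<open>K E\<close> and \<open>F\<close> through the generators of the Clifford algebra.\<close>

lemma site_KE:
  assumes j: "1 \<le> j" "j \<le> n"
  shows "gK (j, Md) * gen (j, Md) GE = lcs (- 1 / w j) * (lcs (eps j) * gX 2 (j, Md) + lcs (kap j - 1) * gX 1 (j, Md))"
    and "gK (j, Dl) * gen (j, Dl) GE = lcs (1 / (w j * kap j)) * (lcs (eps j) * gX 2 (j, Dl) + lcs (kap j - 1) * gX 1 (j, Dl))"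
    and "gen (j, Md) GF = lcs (\<i> / (w j * kap j)) * (lcs (phi j) * gX 1 (j, Md) + lcs (kap j - 1) * gX 2 (j, Md))"
    and "gen (j, Dl) GF = lcs (- \<i> / w j) * (lcs (phi j) * gX 1 (j, Dl) + lcs (kap j - 1) * gX 2 (j, Dl))"
proof -
  have w: "w j \<noteq> 0" "kap j \<noteq> 0" using site(1,2)[OF j] by auto
  have g: "gX 1 p = gen p GE" "gX 2 p = lo.sm (- \<i>) (gen p GK * gen p GF)" for p
    by (simp_all add: gX_def)
  have canc: "x = lo.sm c y" if "lcs u * x = lo.sm d y" "u \<noteq> 0" "c = d / u" for x y :: lop and c d u
  proof -
    have "lo.sm (1 / u) (lo.sm u x) = lo.sm (1 / u) (lo.sm d y)"
      using that(1) by (simp add: lo.sm_def)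
    then show ?thesis using that(2,3) by simp
  qed
  have "\<And>x :: lop. x = lo.sm 1 x" by simp
  have "gK (j, d) * gen (j, d) GE = lo.sm (1 / w j) (lo.sm (- zeps (pos_chr a (j, d))) (gX 2 (j, d)) - lo.sm (zkap (pos_chr a (j, d)) - 1) (gX 1 (j, d))) \<and>
    gen (j, d) GF = lo.sm (1 / (w j * zkap (pos_chr a (j, d)))) (lo.sm (\<i> * zphi (pos_chr a (j, d))) (gX 1 (j, d)) + lo.sm (\<i> * (zkap (pos_chr a (j, d)) - 1)) (gX 2 (j, d)))" for d
  proof -
    have p: "(j, d) \<in> positions n" using j by (simp add: pos_simps)
    interpret u: utriple lcs "gen (j, d) GE" "gen (j, d) GF" "gen (j, d) GK" "gen (j, d) GKi"
      "zkap (pos_chr a (j, d))" "zeps (pos_chr a (j, d))" "zphi (pos_chr a (j, d))"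
      by (rule pos_utriple[OF p])
    have o: "lo.om (gen (j, d) GE) (gen (j, d) GF) (gen (j, d) GK) (gen (j, d) GKi) = lcs (w j)"
      using pos_om[OF p] by simp
    have k: "zkap (pos_chr a (j, d)) \<noteq> 0" by (rule u.kap)
    have 1: "lcs (w j) * (gK (j, d) * gen (j, d) GE) =
        lo.sm 1 (lo.sm (- zeps (pos_chr a (j, d))) (gX 2 (j, d)) - lo.sm (zkap (pos_chr a (j, d)) - 1) (gX 1 (j, d)))"
      using u.om_ke[unfolded o] by (simp add: gK_def g mult.commute lo.sm_uminus_left lo.sm_uminus)
    have "lcs (w j * zkap (pos_chr a (j, d))) * gen (j, d) GF = lcs (w j) * lo.sm (zkap (pos_chr a (j, d))) (gen (j, d) GF)"
      by (simp add: lo.sm_def lo.cs_mult mult.assoc)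
    also have "\<dots> = lo.sm 1 (lo.sm (\<i> * zphi (pos_chr a (j, d))) (gX 1 (j, d)) + lo.sm (\<i> * (zkap (pos_chr a (j, d)) - 1)) (gX 2 (j, d)))"
      unfolding u.om_f[unfolded o] by (simp add: g mult.commute mult.left_commute)
    finally have 2: "lcs (w j * zkap (pos_chr a (j, d))) * gen (j, d) GF =
        lo.sm 1 (lo.sm (\<i> * zphi (pos_chr a (j, d))) (gX 1 (j, d)) + lo.sm (\<i> * (zkap (pos_chr a (j, d)) - 1)) (gX 2 (j, d)))" .
    show ?thesis
      using canc[OF 1 w(1) refl] canc[OF 2 _ refl] w k by simp
  qed
  note K = this[of Md] this[of Dl]
  show "gK (j, Md) * gen (j, Md) GE = lcs (- 1 / w j) * (lcs (eps j) * gX 2 (j, Md) + lcs (kap j - 1) * gX 1 (j, Md))"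
    using K(1) by (simp add: eps_def kap_def lo.sm_diff lo.sm_add lo.sm_uminus_left lo.sm_uminus flip: lo.sm_def)
  show "gK (j, Dl) * gen (j, Dl) GE = lcs (1 / (w j * kap j)) * (lcs (eps j) * gX 2 (j, Dl) + lcs (kap j - 1) * gX 1 (j, Dl))"
    using K(2) w by (simp add: eps_def kap_def zinv_def lo.sm_diff lo.sm_add lo.sm_uminus field_simps lo.sm_diff_left diff_divide_distrib flip: lo.sm_def)
  show "gen (j, Md) GF = lcs (\<i> / (w j * kap j)) * (lcs (phi j) * gX 1 (j, Md) + lcs (kap j - 1) * gX 2 (j, Md))"
    using K(1) by (simp add: phi_def kap_def lo.sm_add flip: lo.sm_def)
  have z: "zkap (zinv (chr a j)) = 1 / kap j" "zphi (zinv (chr a j)) = - phi j / kap j"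
    by (simp_all add: zinv_def kap_def phi_def)
  have c: "1 / (w j * (1 / kap j)) * (\<i> * (- phi j / kap j)) = - \<i> / w j * phi j"
    "1 / (w j * (1 / kap j)) * (\<i> * (1 / kap j - 1)) = - \<i> / w j * (kap j - 1)"
    using w by (simp_all add: field_simps)
  show "gen (j, Dl) GF = lcs (- \<i> / w j) * (lcs (phi j) * gX 1 (j, Dl) + lcs (kap j - 1) * gX 2 (j, Dl))"
    using K(2) unfolding chr_pos z lo.sm_add lo.sm_sm c lo.sm_def[symmetric] by simp
qed

lemma total_kap: "zkap (total_chr a) = kpre (Suc n)"
proof -
  have "m \<le> n \<Longrightarrow> zkap (tch m) = kpre (Suc m)" for m
  proof (induction m)
    case (Suc m)
    then show ?case
      using kpre_Suc[of "Suc m"] by (simp add: tch_Suc zmult_def kap_def)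
  qed (simp add: tch_def zone_def kpre_def)
  from this[of n] show ?thesis by (simp add: tch_total)
qed

lemma lcs_cancel: "lcs c = x * lcs d \<Longrightarrow> d \<noteq> 0 \<Longrightarrow> x = lcs (c / d)"
proof -
  assume e: "lcs c = x * lcs d" and d: "d \<noteq> 0"
  have "lcs (c / d) = lcs c * lcs (1 / d)"
    by (simp flip: lo.cs_mult)
  also have "\<dots> = x * (lcs d * lcs (1 / d))"
    by (simp only: e mult.assoc)
  finally show ?thesis using d by (simp flip: lo.cs_mult)
qed

lemma upt_cut: "1 \<le> j \<Longrightarrow> j \<le> Suc n \<Longrightarrow> [1..<Suc n] = [1..<j] @ [j..<Suc n]"
  by (metis le_add_diff_inverse upt_add_eq_append)

lemma KK_tail_sq:
  assumes j: "1 \<le> j" "j \<le> n"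
  shows "KK Md [Suc j..<Suc n] * KK Md [Suc j..<Suc n] = lcs (kpre (Suc n) / kpre (Suc j))"
proof (rule lcs_cancel)
  let ?A = "KK Md [1..<Suc j]" and ?B = "KK Md [Suc j..<Suc n]"
  have p: "set [1..<Suc j] \<times> {Md} \<subseteq> positions n" "set [Suc j..<Suc n] \<times> {Md} \<subseteq> positions n"
    using j by (auto simp: positions_def)
  have c: "?A * ?B = ?B * ?A"
    using sw_KKKK[OF p] by (simp add: sw_def)
  have "lcs (kpre (Suc n)) = (?A * ?B) * (?A * ?B)"
    using KK_sq_Md[of "Suc n"] upt_cut[of "Suc j"] j by (simp add: KK_append[symmetric] del: upt_Suc One_nat_def)
  also have "\<dots> = (?B * ?B) * (?A * ?A)"
    unfolding c by (rule commute_square[OF c[symmetric]])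
  also have "?A * ?A = lcs (kpre (Suc j))"
    using KK_sq_Md[of "Suc j"] j by simp
  finally show "lcs (kpre (Suc n)) = ?B * ?B * lcs (kpre (Suc j))" .
qed (use kpre_nz[of "Suc j"] j in simp)

lemma KK_head_sq:
  assumes j: "1 \<le> j" "j \<le> n"
  shows "KK Dl [1..<j] * KK Dl [1..<j] = lcs (1 / kpre j)"
proof -
  let ?A = "KK Dl [1..<j]" and ?B = "KK Dl [j..<Suc n]"
  have p: "set [1..<j] \<times> {Dl} \<subseteq> positions n" "set [j..<Suc n] \<times> {Dl} \<subseteq> positions n"
    using j by (auto simp: positions_def)
  have nz: "kpre j \<noteq> 0" "kpre (Suc n) \<noteq> 0" using kpre_nz[of j] kpre_nz[of "Suc n"] j by auto
  have c: "?A * ?B = ?B * ?A"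
    using sw_KKKK[OF p] by (simp add: sw_def)
  have "lcs (kpre 1 / kpre (Suc n)) = (?A * ?B) * (?A * ?B)"
    using KK_sq_Dl[of 1] upt_cut[of j] j by (simp add: KK_append[symmetric] del: upt_Suc One_nat_def)
  also have "\<dots> = (?A * ?A) * (?B * ?B)"
    by (rule commute_square[OF c])
  also have "?B * ?B = lcs (kpre j / kpre (Suc n))"
    using KK_sq_Dl[of j] j by simp
  finally have "?A * ?A = lcs (kpre 1 / kpre (Suc n) / (kpre j / kpre (Suc n)))"
    by (rule lcs_cancel) (use nz in simp)
  then show ?thesis
    using nz by (simp add: kpre_def)
qed

lemma gO_lcs: "1 \<le> j \<Longrightarrow> j \<le> n \<Longrightarrow> gO (j, d) = lo.sm (1 / w j) 1"
  using gen_Oi[of "(j, d)"] by (simp add: gO_def pos_simps lo.sm_def)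

lemma al_sm: "1 \<le> j \<Longrightarrow> j \<le> n \<Longrightarrow> al j \<nu> = lo.sm (1 / w j) (KK Md [1..<j] * gX \<nu> (j, Md))"
  and ab_sm: "1 \<le> j \<Longrightarrow> j \<le> n \<Longrightarrow> ab j \<nu> = lo.sm (1 / w j) (cK Md * (gX \<nu> (j, Dl) * KK Dl [Suc j..<Suc n]))"
  by (simp_all add: al_def ab_def gO_lcs cK_KK del: upt_Suc One_nat_def)

lemma DD_sum:
  "lo.sm c (DD n \<nu>) = (\<Sum>j\<in>{1..n}. lo.sm (c * mc j \<nu> 1) (al j 1) + lo.sm (c * mc j \<nu> 2) (al j 2)) -
    (\<Sum>j\<in>{1..n}. lo.sm (c * mc j \<nu> 1) (ab j 1) + lo.sm (c * mc j \<nu> 2) (ab j 2))"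
  by (simp add: DD_def lo.sm_sum dd_def aG_def lo.sm_add lo.sm_diff algebra_simps sum.distrib sum_subtractf flip: lo.sm_def)

lemma mc_val:
  assumes j: "1 \<le> j" "j \<le> n"
  shows "4 * c * mc j 2 1 = - (c / kpre (Suc j) * (kap j - 1))" "4 * c * mc j 2 2 = - (c / kpre (Suc j) * eps j)"
    "- 4 * \<i> * mc j 1 1 = \<i> / kpre (Suc j) * phi j" "- 4 * \<i> * mc j 1 2 = \<i> / kpre (Suc j) * (kap j - 1)"
  using kpre_nz[of "Suc j"] j by (simp_all add: mc_def field_simps)

lemma GE_gX: "gen p GE = gX 1 p"
  by (simp add: gX_def)

text \<open>By \<open>site_KE\<close> each summand of the last annihilator is K E at one factor, and
  the squares of the neighbouring K's complete the sum to total coproducts. Vanishing of this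
  operator is invariance under E.\<close>

lemma DD_2: "lo.sm (4 * kpre (Suc n)) (DD n 2) = cK Md * cE Md + lo.sm (kpre (Suc n)) (cK Md * (cK Dl * cE Dl))"
proof -
  let ?kp = "kpre (Suc n)"
  have 1: "cK Md * (gen (j, Md) GE * KK Md [Suc j..<Suc n]) =
      lo.sm (4 * ?kp * mc j 2 1) (al j 1) + lo.sm (4 * ?kp * mc j 2 2) (al j 2)" if j: "1 \<le> j" "j \<le> n" for j
  proof -
    define d where "d = kap j - 1"
    have d: "kap j - 1 = d" by (simp add: d_def)
    let ?A = "KK Md [1..<j]" and ?B = "KK Md [Suc j..<Suc n]" and ?e = "gen (j, Md) GE"
    have "sw False ?B (gX 1 (j, Md))"
      by (rule sw_eq[OF sw_KKX]) (use j in \<open>auto simp: positions_def\<close>)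
    then have "?B * ?e = ?e * ?B" unfolding GE_gX by (simp add: sw_def)
    \<comment> \<open>The suffix of K's occurs once in the total K and once in the coproduct of E,
      so it collapses to a number and only the prefix of \<open>al\<close> survives.\<close>
    then have "?B * (?e * ?B) = ?e * (?B * ?B)" by (rule swap_assoc)
    also have "\<dots> = lo.sm (?kp / kpre (Suc j)) ?e"
      unfolding KK_tail_sq[OF j] by (simp add: lo.cs_sm)
    finally have "cK Md * (?e * ?B) = lo.sm (?kp / kpre (Suc j)) (?A * (gK (j, Md) * ?e))"
      unfolding cK_KK upt_split[OF j] KK_append KK_Cons by (simp only: mult.assoc lo.sm_right)
    then show ?thesis
      unfolding site_KE(1)[OF j] al_sm[OF j] mc_val[OF j] d
      by (simp add: distrib_left distrib_right left_diff_distrib right_diff_distrib lo.sm_diff lo.sm_add lo.sm_uminus_left lo.sm_uminus flip: lo.sm_def)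
  qed
  have 2: "lo.sm ?kp (cK Md * (cK Dl * (KK Dl [1..<j] * gen (j, Dl) GE))) =
      - (lo.sm (4 * ?kp * mc j 2 1) (ab j 1) + lo.sm (4 * ?kp * mc j 2 2) (ab j 2))" if j: "1 \<le> j" "j \<le> n" for j
  proof -
    define d where "d = kap j - 1"
    have d: "kap j - 1 = d" by (simp add: d_def)
    let ?A = "KK Dl [1..<j]" and ?B = "KK Dl [Suc j..<Suc n]" and ?e = "gen (j, Dl) GE" and ?k = "gK (j, Dl)"
    have p: "set [1..<j] \<times> {Dl} \<subseteq> positions n" "set [Suc j..<Suc n] \<times> {Dl} \<subseteq> positions n" "(j, Dl) \<in> positions n"
      using j by (auto simp: positions_def)
    have "sw False ?B (gX 1 (j, Dl))"
      by (rule sw_eq[OF sw_KKX]) (use j in \<open>auto simp: positions_def\<close>)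
    then have Be: "?B * ?e = ?e * ?B" unfolding GE_gX by (simp add: sw_def)
    have kA: "?k * ?A = ?A * ?k" and BA: "?B * ?A = ?A * ?B"
      using sw_KKK[OF p(1,3)] sw_KKKK[OF p(2,1)] by (simp_all add: sw_def)
    have "cK Dl * (?A * ?e) = (?A * ?A) * (?k * ?e * ?B)"
      unfolding cK_KK upt_split[OF j] KK_append KK_Cons
      by (simp only: mult.assoc swap_assoc[OF BA] Be swap_assoc[OF kA])
    also have "\<dots> = lo.sm (1 / kpre j) (?k * ?e * ?B)"
      unfolding KK_head_sq[OF j] by (simp add: lo.cs_sm)
    finally have "lo.sm ?kp (cK Md * (cK Dl * (?A * ?e))) = lo.sm (?kp / kpre j) (cK Md * (?k * ?e * ?B))"
      by simp
    then show ?thesis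
      unfolding site_KE(2)[OF j] ab_sm[OF j] mc_val[OF j] d
      by (simp add: kpre_Suc[OF j(1)] distrib_left distrib_right left_diff_distrib right_diff_distrib lo.sm_diff lo.sm_add lo.sm_uminus_left lo.sm_uminus mult.commute mult.left_commute flip: lo.sm_def)
  qed
  have "cK Md * cE Md = (\<Sum>j\<in>{1..n}. cK Md * (gen (j, Md) GE * KK Md [Suc j..<Suc n]))"
    unfolding cE_def copE_sum(1)[OF order_refl] sum_distrib_left ..
  also have "\<dots> = (\<Sum>j\<in>{1..n}. lo.sm (4 * ?kp * mc j 2 1) (al j 1) + lo.sm (4 * ?kp * mc j 2 2) (al j 2))"
    by (rule sum.cong) (use 1 in auto)
  finally have E: "cK Md * cE Md = \<dots>" .
  have "lo.sm ?kp (cK Md * (cK Dl * cE Dl)) = (\<Sum>j\<in>{1..n}. lo.sm ?kp (cK Md * (cK Dl * (KK Dl [1..<j] * gen (j, Dl) GE))))"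
    unfolding cE_def copE_sum(2) sum_distrib_left lo.sm_sum ..
  also have "\<dots> = - (\<Sum>j\<in>{1..n}. lo.sm (4 * ?kp * mc j 2 1) (ab j 1) + lo.sm (4 * ?kp * mc j 2 2) (ab j 2))"
    unfolding sum_negf[symmetric] by (rule sum.cong) (use 2 in auto)
  finally show ?thesis
    unfolding DD_sum E by simp
qed

text \<open>The counterpart for F. The inverse K's in the coproduct are multiples of K's, since
  their squares act by numbers.\<close>

lemma DD_1: "lo.sm (- 4 * \<i>) (DD n 1) = cF Md + lo.sm (1 / kpre (Suc n)) (cK Md * cF Dl)"
proof -
  let ?kp = "kpre (Suc n)"
  have kp: "?kp \<noteq> 0" using kpre_nz[of "Suc n"] by simp
  have 1: "KI Md [1..<j] * gen (j, Md) GF =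
      lo.sm (- 4 * \<i> * mc j 1 1) (al j 1) + lo.sm (- 4 * \<i> * mc j 1 2) (al j 2)" if j: "1 \<le> j" "j \<le> n" for j
  proof -
    define d where "d = kap j - 1"
    have d: "kap j - 1 = d" by (simp add: d_def)
    have p: "set [1..<j] \<times> {Md} \<subseteq> positions n" and nz: "kpre j \<noteq> 0"
      using j kpre_nz[of j] by (auto simp: positions_def)
    have "KI Md [1..<j] = lo.sm (1 / kpre j) (KK Md [1..<j])"
      using KI_val[OF p KK_sq_Md nz] j by (simp add: lo.sm_def)
    then show ?thesis
      unfolding site_KE(3)[OF j] al_sm[OF j] mc_val[OF j] d
      by (simp add: kpre_Suc[OF j(1)] distrib_left distrib_right left_diff_distrib right_diff_distrib lo.sm_diff lo.sm_add mult.commute mult.left_commute flip: lo.sm_def)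
  qed
  have 2: "lo.sm (1 / ?kp) (cK Md * (gen (j, Dl) GF * KI Dl [Suc j..<Suc n])) =
      - (lo.sm (- 4 * \<i> * mc j 1 1) (ab j 1) + lo.sm (- 4 * \<i> * mc j 1 2) (ab j 2))" if j: "1 \<le> j" "j \<le> n" for j
  proof -
    define d where "d = kap j - 1"
    have d: "kap j - 1 = d" by (simp add: d_def)
    have p: "set [Suc j..<Suc n] \<times> {Dl} \<subseteq> positions n" and nz: "kpre (Suc j) / ?kp \<noteq> 0"
      using j kpre_nz[of "Suc j"] kp by (auto simp: positions_def)
    have sq: "KK Dl [Suc j..<Suc n] * KK Dl [Suc j..<Suc n] = lcs (kpre (Suc j) / ?kp)"
      using KK_sq_Dl[of "Suc j"] j kp by (cases "j = n") auto
    have "KI Dl [Suc j..<Suc n] = lo.sm (?kp / kpre (Suc j)) (KK Dl [Suc j..<Suc n])"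
      using KI_val[OF p sq nz] by (simp add: lo.sm_def)
    then show ?thesis
      using kp unfolding site_KE(4)[OF j] ab_sm[OF j] mc_val[OF j] d
      by (simp add: distrib_left distrib_right left_diff_distrib right_diff_distrib lo.sm_diff lo.sm_add lo.sm_uminus lo.sm_uminus_left mult.commute mult.left_commute left_diff_distrib right_diff_distrib lo.sm_diff del: upt_Suc flip: lo.sm_def)
  qed
  have "cF Md = (\<Sum>j\<in>{1..n}. KI Md [1..<j] * gen (j, Md) GF)"
    unfolding cF_def copF_sum(1) ..
  also have "\<dots> = (\<Sum>j\<in>{1..n}. lo.sm (- 4 * \<i> * mc j 1 1) (al j 1) + lo.sm (- 4 * \<i> * mc j 1 2) (al j 2))"
    by (rule sum.cong) (use 1 in auto)
  finally have E: "cF Md = \<dots>" .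
  have "lo.sm (1 / ?kp) (cK Md * cF Dl) = (\<Sum>j\<in>{1..n}. lo.sm (1 / ?kp) (cK Md * (gen (j, Dl) GF * KI Dl [Suc j..<Suc n])))"
    unfolding cF_def copF_sum(2) sum_distrib_left lo.sm_sum ..
  also have "\<dots> = - (\<Sum>j\<in>{1..n}. lo.sm (- 4 * \<i> * mc j 1 1) (ab j 1) + lo.sm (- 4 * \<i> * mc j 1 2) (ab j 2))"
    unfolding sum_negf[symmetric] by (rule sum.cong) (use 2 in auto)
  finally show ?thesis
    unfolding DD_sum E by simp
qed

text \<open>The operator of the total K on both sides at once. It serves as the parity operator:
  passing from \<open>\<mu>\<close> to \<open>-\<mu>\<close> on one side changes the sign of K
  there.\<close>

definition "NN = cK Md * cK Dl"

lemma NN_vac: "app NN (vac n) = vac n"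
  unfolding NN_def cK_KK by (rule vac_KK) auto

lemma sw_NN:
  "(l, s) \<in> positions n \<Longrightarrow> sw True NN (gX \<nu> (l, s))" "p \<in> positions n \<Longrightarrow> sw False NN (gO p)"
  "set ks \<times> {d} \<subseteq> positions n \<Longrightarrow> sw False NN (KK d ks)"
proof -
  have P: "set [1..<Suc n] \<times> {d} \<subseteq> positions n" for d by (rule upt_pos_n)
  assume "(l, s) \<in> positions n"
  then show "sw True NN (gX \<nu> (l, s))"
    unfolding NN_def cK_KK
    by (intro sw_eq[OF sw_mult_left[OF sw_KKX[OF P distinct_upt] sw_KKX[OF P distinct_upt]]])
      (auto simp: pos_simps intro: side.exhaust[of s])
next
  have P: "set [1..<Suc n] \<times> {d} \<subseteq> positions n" for d by (rule upt_pos_n)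
  assume "p \<in> positions n"
  from sw_mult_left[OF sw_KKO[OF P this] sw_KKO[OF P this]] show "sw False NN (gO p)"
    unfolding NN_def cK_KK by simp
next
  have P: "set [1..<Suc n] \<times> {d} \<subseteq> positions n" for d by (rule upt_pos_n)
  assume "set ks \<times> {d} \<subseteq> positions n"
  from sw_mult_left[OF sw_KKKK[OF P this] sw_KKKK[OF P this]] show "sw False NN (KK d ks)"
    unfolding NN_def cK_KK by simp
qed

lemma NN_aA: "1 \<le> j \<Longrightarrow> j \<le> n \<Longrightarrow> NN * aA j \<nu> = - (aA j \<nu> * NN)"
proof -
  assume j: "1 \<le> j" "j \<le> n"
  have p: "(j, d) \<in> positions n" "set [1..<j] \<times> {d} \<subseteq> positions n" "set [Suc j..<Suc n] \<times> {d} \<subseteq> positions n"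
    "set [1..<Suc n] \<times> {d} \<subseteq> positions n" for d
    using j by (auto simp: positions_def)
  have "sw ((False \<noteq> True) \<noteq> False) NN (al j \<nu>)"
    unfolding al_def by (intro sw_mult_right sw_NN p)
  moreover have "sw (False \<noteq> ((True \<noteq> False) \<noteq> False)) NN (ab j \<nu>)"
    unfolding ab_def by (intro sw_mult_right sw_NN p)
  ultimately show ?thesis by (simp add: sw_def aA_def algebra_simps)
qed

text \<open>Each \<open>theta\<close> contains one odd letter E or KF, which picks up a sign from
  the K at its own position; scalars act by numbers.\<close>

lemma cliff_hom_NN: "(x, par) \<in> cliff_hom n \<Longrightarrow> sw par NN (actL V a x)"
proof (induction rule: cliff_hom.induct)
  case (scalar z)
  obtain c where c: "cval a z c" using scalar_cval[OF scalar] by blast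
  have "actL V a z = lcs c"
    using actL_cliff_ideal[of "z - cst c"] c by (simp add: cval_def lo.ev_diff)
  then show ?case by (simp add: sw_def lo.cs_comm)
next
  case (theta t)
  then obtain j \<nu> where "t = theta n j \<nu>" "1 \<le> j" "j < n" by (auto simp: thetas_def)
  then show ?case
    using NN_aA[of j \<nu>] NN_aA[of "Suc j" \<nu>] by (simp add: sw_def actL_theta algebra_simps)
next
  case (add x par y)
  then show ?case by (auto simp: sw_def lo.ev_add distrib_left distrib_right)
next
  case (mult x par y par')
  then show ?case using sw_mult_right[OF mult.IH] by (simp add: lo.ev_mult)
qed (simp add: sw_def)

end

section \<open>The Casimir element and multiplicity spaces\<close>

definition q4 :: "'c \<Rightarrow> 'c \<Rightarrow> 'c \<Rightarrow> 'c \<Rightarrow> 2 \<times> 2 \<Rightarrow> 'c"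
  where "q4 a b c d k = (if k = (1, 1) then a else if k = (1, 2) then b else if k = (2, 1) then c else d)"

lemma q4_simps [simp]: "q4 a b c d (1, 1) = a" "q4 a b c d (1, 2) = b" "q4 a b c d (2, 1) = c" "q4 a b c d (2, 2) = d"
  by (simp_all add: q4_def)

text \<open>Structure constants of the four-dimensional algebra spanned by \<open>1, K, E, KF\<close>, where \<open>K\<^sup>2\<close>,
  \<open>E\<^sup>2\<close>, \<open>F\<^sup>2\<close> act through the character \<open>x\<close> and \<open>\<Omega>\<close> acts by \<open>w\<close>.\<close>

definition stc :: "zchar \<Rightarrow> complex \<Rightarrow> 2 \<times> 2 \<Rightarrow> 2 \<times> 2 \<Rightarrow> 2 \<times> 2 \<Rightarrow> complex"
  where "stc x w = (let b = (zkap x - 1) / w; u = \<i> * zeps x / w; v = \<i> * zphi x / w; d = - \<i> * (zkap x - 1) in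
    q4 (q4 (q4 1 0 0 0) (q4 0 1 0 0) (q4 0 0 1 0) (q4 0 0 0 1))
       (q4 (q4 0 1 0 0) (q4 (zkap x) 0 0 0) (q4 0 0 (- b) u) (q4 0 0 v b))
       (q4 (q4 0 0 1 0) (q4 0 0 b (- u)) (q4 (zeps x) 0 0 0) (q4 d (\<i> * w) 0 0))
       (q4 (q4 0 0 0 1) (q4 0 0 (- v) (- b)) (q4 d (- \<i> * w) 0 0) (q4 (- zphi x) 0 0 0)))"

context utriple
begin

definition tU :: "2 \<times> 2 \<Rightarrow> 'a" where "tU = q4 1 k e (k * f)"

text \<open>The right factor \<open>P\<close> makes Omega a number. It is 1 on a single module and
  the projection \<open>PP\<close> for total coproducts, so both obey the same structure
  constants.\<close>

lemma prod_table:
  assumes o: "om e f k ki * P = sm w P" and w: "w \<noteq> 0" and x: "zkap x = \<kappa>" "zeps x = \<epsilon>" "zphi x = \<phi>"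
  shows "tU l * (tU m * P) = (\<Sum>j\<in>UNIV. sm (stc x w l m j) (tU j * P))"
proof -
  define g where "g = k * f"
  let ?o = "om e f k ki"
  have canc: "y = sm (1 / w) z" if "sm w y = z" for y z using that w by auto
  have omk: "?o * (k * P) = sm w (k * P)"
    using arg_cong[OF om_k_comm, of "\<lambda>y. y * P"] o by (simp add: mult.assoc)
  have ome: "?o * (e * P) = sm w (e * P)"
    using arg_cong[OF om_e, of "\<lambda>y. y * P"] o by (simp add: mult.assoc)
  have omf: "?o * (f * P) = sm w (f * P)"
    using arg_cong[OF om_f_comm, of "\<lambda>y. y * P"] o by (simp add: mult.assoc)
  have omk': "?o * (k * y) = k * (?o * y)" for y
    using arg_cong[OF om_k_comm, of "\<lambda>z. z * y"] by (simp add: mult.assoc)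
  note m = arg_cong[where f = "\<lambda>y. y * P"]
  have 1: "k * (k * P) = sm \<kappa> P" "e * (e * P) = sm \<epsilon> P"
    using m[OF kk] m[OF ee] by (simp_all add: mult.assoc)
  have 2: "g * (g * P) = sm (- \<phi>) P"
    using m[OF table(4)] by (simp add: mult.assoc g_def)
  have 3: "e * (g * P) = sm (\<i> * w) (k * P) - sm (\<i> * (\<kappa> - 1)) P"
    using m[OF table(2)] omk by (simp add: mult.assoc g_def left_diff_distrib)
  have 4: "g * (e * P) = - sm (\<i> * w) (k * P) - sm (\<i> * (\<kappa> - 1)) P"
    using m[OF table(3)] omk by (simp add: mult.assoc g_def left_diff_distrib)
  have "sm w (k * (e * P)) = sm (\<i> * \<epsilon>) (g * P) - sm (\<kappa> - 1) (e * P)"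
    using m[OF om_ke] ome omk'[of "e * P"] by (simp add: mult.assoc g_def left_diff_distrib)
  note 5 = canc[OF this]
  have "sm w (k * (g * P)) = sm (\<i> * \<phi>) (e * P) + sm (\<kappa> - 1) (g * P)"
    using m[OF table(6)] omf omk'[of "k * (f * P)"] omk'[of "f * P"] by (simp add: mult.assoc g_def distrib_right)
  note 6 = canc[OF this]
  have 7: "e * (k * P) = - (k * (e * P))" "g * (k * P) = - (k * (g * P))"
    using m[OF ke] m[OF table(5)] by (simp_all add: mult.assoc g_def)
  have "fst l = 1 \<or> fst l = 2" "snd l = 1 \<or> snd l = 2" "fst m = 1 \<or> fst m = 2" "snd m = 1 \<or> snd m = 2"
    using exhaust_2 by auto
  then have l: "l = (1, 1) \<or> l = (1, 2) \<or> l = (2, 1) \<or> l = (2, 2)"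
    and m: "m = (1, 1) \<or> m = (1, 2) \<or> m = (2, 1) \<or> m = (2, 2)"
    by (metis prod.collapse)+
  show ?thesis
    unfolding tU_def stc_def Let_def x g_def[symmetric] UNIV_22
    using l by (elim disjE; use m in \<open>elim disjE\<close>)
      (simp_all add: 1 2 3 4 5 6 7 sm_diff sm_add sm_uminus sm_uminus_left)
qed

end

lemma opL_bU: "opL p (bU m j) = q4 1 (oK p m) (oE p m) (oK p m * oF p m) j"
  by (simp add: bU_def q4_def opL_mat mG_def opL_mult)

lemma opL_sum: "opL p (\<Sum>i\<in>A. M i) = (\<Sum>i\<in>A. opL p (M i))"
proof (induction A rule: infinite_finite_induct)
  case empty
  show ?case using opL_mat[of p 0] by (simp add: mat_0)
qed (use opL_mat[of p 0] in \<open>simp_all add: opL_add mat_0\<close>)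

lemma bU_table:
  assumes m: "modrel m x w" and w: "w \<noteq> 0"
  shows "bU m l ** bU m l' = (\<Sum>j\<in>UNIV. mat (stc x w l l' j) ** bU m j)"
proof -
  define p :: pos where "p = (0, Md)"
  interpret utriple lcs "oE p m" "oF p m" "oK p m" "oKi p m" "zkap x" "zeps x" "zphi x"
    using m by (rule modrel_utriple)
  have t: "opL p (bU m j) = tU j" for j by (simp add: opL_bU tU_def)
  show ?thesis
  proof (rule opL_inj[of p])
    show "opL p (bU m l ** bU m l') = opL p (\<Sum>j\<in>UNIV. mat (stc x w l l' j) ** bU m j)"
      using prod_table[of 1 w x l l'] modrel_utrip(2)[OF m, of p] w
      by (simp add: opL_sum opL_mult[symmetric] t opL_mat lo.sm_def)
  qed
qed

lemma trace_expand:
  assumes m: "modrel m x w" and w: "w \<noteq> 0"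
  shows "A $ l $ q = (\<Sum>k\<in>UNIV. trace (A ** bU m k) * bD m x w k $ l $ q)"
proof -
  have "(\<Sum>k\<in>UNIV. trace (A ** bU m k) * bD m x w k $ l $ q) =
      (\<Sum>k\<in>UNIV. \<Sum>j\<in>UNIV. \<Sum>i\<in>UNIV. A $ j $ i * (bU m k $ i $ j * bD m x w k $ l $ q))"
    by (simp add: trace_def matrix_matrix_mult_def sum_distrib_right mult.assoc)
  also have "\<dots> = (\<Sum>j\<in>UNIV. \<Sum>i\<in>UNIV. A $ j $ i * (\<Sum>k\<in>UNIV. bU m k $ i $ j * bD m x w k $ l $ q))"
    unfolding sum_distrib_left by (subst sum.swap, rule sum.cong[OF refl], subst sum.swap, rule refl)
  also have "\<dots> = (\<Sum>j\<in>UNIV. \<Sum>i\<in>UNIV. if i = q then (if j = l then A $ j $ i else 0) else 0)"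
    unfolding completeness[OF m w] by (intro sum.cong) auto
  also have "\<dots> = A $ l $ q" by simp
  finally show ?thesis ..
qed

lemma stc_trace:
  assumes m: "modrel m x w" and w: "w \<noteq> 0"
  shows "trace (bD m x w i ** bU m l ** bU m l') = stc x w l l' i"
proof -
  have s: "trace (B ** (\<Sum>j\<in>A. mat (c j) ** C j)) = (\<Sum>j\<in>A. c j * trace (B ** C j))"
    for B :: "complex^2^2" and C c and A :: "(2 \<times> 2) set"
  proof (induction A rule: infinite_finite_induct)
    case (insert j A)
    have "B ** (mat (c j) ** C j) = mat (c j) ** (B ** C j)"
      using mat_mult_comm[of B "c j"] by (metis matrix_mul_assoc)
    moreover have "trace (mat (c j) ** (B ** C j)) = c j * trace (B ** C j)"
      by (simp add: trace_def mat_mult_entry sum_distrib_left)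
    ultimately show ?case
      using insert by (simp add: matrix_add_ldistrib trace_add)
  qed (simp_all add: trace_def)
  have "trace (bD m x w i ** bU m l ** bU m l') = trace (bD m x w i ** (bU m l ** bU m l'))"
    by (simp only: matrix_mul_assoc)
  also have "\<dots> = (\<Sum>j\<in>UNIV. stc x w l l' j * (if i = j then 1 else 0))"
    unfolding bU_table[OF m w] s dual_basis[OF m w] ..
  finally show ?thesis by (simp add: if_distrib cong: if_cong)
qed

text \<open>Multiplication in the algebra is transposed to multiplication of the dual basis by
  \<open>bU\<close>; \<open>stc_right\<close> is the other side, by cyclicity of the trace.\<close>

lemma stc_left:
  assumes m: "modrel m x w" and w: "w \<noteq> 0"
  shows "(\<Sum>j\<in>UNIV. stc x w l j i * bD m x w j $ c $ b) = (bD m x w i ** bU m l) $ c $ b"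
  unfolding trace_expand[OF m w, of "bD m x w i ** bU m l"] stc_trace[OF m w] ..

lemma stc_right:
  assumes m: "modrel m x w" and w: "w \<noteq> 0"
  shows "(\<Sum>j\<in>UNIV. stc x w j l i * bD m x w j $ c $ b) = (bU m l ** bD m x w i) $ c $ b"
proof -
  have "trace (bU m l ** bD m x w i ** bU m j) = stc x w j l i" for j
    unfolding stc_trace[OF m w, symmetric] using trace_mul_sym[of "bU m l" "bD m x w i ** bU m j"]
    by (simp only: matrix_mul_assoc)
  then show ?thesis
    unfolding trace_expand[OF m w, of "bU m l ** bD m x w i"] by simp
qed

text \<open>The matrix acts on the index by columns, so that products of operators correspond to
  products of matrices in the same order.\<close>

definition yint :: "lop \<Rightarrow> complex^2^2 \<Rightarrow> (2 \<Rightarrow> tensor) \<Rightarrow> bool"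
  where "yint X A y \<longleftrightarrow> (\<forall>b. app X (y b) = (\<lambda>s. \<Sum>b'\<in>UNIV. A $ b' $ b * y b' s))"

definition itm :: "lop \<Rightarrow> lop \<Rightarrow> lop \<Rightarrow> umod \<Rightarrow> (2 \<Rightarrow> tensor) \<Rightarrow> bool"
  where "itm e f k m y \<longleftrightarrow> yint e (mE m) y \<and> yint f (mF m) y \<and> yint k (mK m) y"

lemma yint_mult: "yint X A y \<Longrightarrow> yint Y B y \<Longrightarrow> yint (X * Y) (A ** B) y"
proof -
  assume X: "yint X A y" and Y: "yint Y B y"
  have "app (X * Y) (y b) = (\<lambda>s. \<Sum>b'\<in>UNIV. (A ** B) $ b' $ b * y b' s)" for b
  proof -
    have "app (X * Y) (y b) = app X (\<lambda>s. B $ 1 $ b * y 1 s + B $ 2 $ b * y 2 s)"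
      using Y by (simp add: yint_def sum_2)
    also have "\<dots> = (\<lambda>s. B $ 1 $ b * app X (y 1) s + B $ 2 $ b * app X (y 2) s)"
      by (rule app_lin)
    also have "\<dots> = (\<lambda>s. \<Sum>b'\<in>UNIV. (A ** B) $ b' $ b * y b' s)"
      using X by (simp add: yint_def sum_2 matrix_matrix_mult_def algebra_simps)
    finally show ?thesis .
  qed
  then show ?thesis by (simp add: yint_def)
qed

lemma yint_add: "yint X A y \<Longrightarrow> yint Y B y \<Longrightarrow> yint (X + Y) (A + B) y"
  and yint_diff: "yint X A y \<Longrightarrow> yint Y B y \<Longrightarrow> yint (X - Y) (A - B) y"
  by (simp_all add: yint_def sum_2 algebra_simps)

lemma yint_mat: "yint (lcs c) (mat c) y"
  unfolding yint_def
proof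
  fix b :: 2
  have "b = 1 \<or> b = 2" using exhaust_2 by auto
  then show "app (lcs c) (y b) = (\<lambda>s. \<Sum>b'\<in>UNIV. mat c $ b' $ b * y b' s)"
    by (auto simp: sum_2 mat_def)
qed

lemma yint_sm: "yint X A y \<Longrightarrow> yint (lo.sm c X) (mat c ** A) y"
  unfolding lo.sm_def by (rule yint_mult[OF yint_mat])

locale casimir = utriple lcs e f k ki "zkap x" "zeps x" "zphi x"
  for e f k ki :: lop and x :: zchar +
  fixes m :: umod and w :: complex
  assumes m: "modrel m x w" and w: "w \<noteq> 0"
begin

abbreviation "Om \<equiv> lo.om e f k ki"

text \<open>Since Omega squares to \<open>w * w\<close>, this is the projection onto its eigenvalue
  \<open>w\<close>, along \<open>- w\<close>.\<close>

definition "PP = lo.sm (1 / 2) (1 + lo.sm (1 / w) Om)"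

lemma Om_Om: "Om * Om = lo.sm (w * w) 1"
  using om_sq modrel_omega2[OF m] by (simp add: omega2_def lo.cs_sm)

lemma Om_PP: "Om * PP = lo.sm w PP"
  using w by (simp add: PP_def distrib_left lo.sm_add Om_Om add.commute)

lemma tU_comm: "tU l * Om = Om * tU l"
proof -
  have "k * f * Om = Om * (k * f)"
    using om_k_comm om_f_comm by (metis mult.assoc)
  moreover have "(l :: 2 \<times> 2) = (1, 1) \<or> l = (1, 2) \<or> l = (2, 1) \<or> l = (2, 2)"
    using exhaust_2 by (metis prod.collapse)
  ultimately show ?thesis
    using om_e om_k_comm by (auto simp: tU_def)
qed

lemma tU_PP: "PP * tU l = tU l * PP"
  by (simp add: PP_def distrib_left distrib_right lo.sm_add tU_comm)

text \<open>The matrix unit in row \<open>b\<close> and column \<open>c\<close>, written in the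
  basis \<open>bU\<close> by means of the dual basis, with matrices replaced by total operators and
  cut down to the part where Omega acts by \<open>w\<close>.\<close>

definition CC :: "2 \<Rightarrow> 2 \<Rightarrow> lop"
  where "CC b c = (\<Sum>j\<in>UNIV. lo.sm (bD m x w j $ c $ b) (tU j * PP))"

lemmas PT = prod_table[OF Om_PP w refl refl refl]

lemma sum_sm: "(\<Sum>i\<in>A. lo.sm (c i) y) = lo.sm (\<Sum>i\<in>A. c i) y"
  by (simp add: lo.sm_def sum_distrib_right[symmetric])
    (induction A rule: infinite_finite_induct; simp add: lo.cs_add distrib_right)

text \<open>A matrix times a matrix unit is a combination of units in the same column. In
  coordinates this is the dual form of associativity given by \<open>stc_left\<close>.\<close>

lemma CC_left: "tU l * CC b c = (\<Sum>b'\<in>UNIV. lo.sm (bU m l $ b' $ b) (CC b' c))"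
proof -
  have "tU l * CC b c = (\<Sum>j\<in>UNIV. \<Sum>i\<in>UNIV. lo.sm (stc x w l j i * bD m x w j $ c $ b) (tU i * PP))"
    by (simp add: CC_def sum_distrib_left PT lo.sm_sum mult.commute)
  also have "\<dots> = (\<Sum>i\<in>UNIV. lo.sm ((bD m x w i ** bU m l) $ c $ b) (tU i * PP))"
    by (subst sum.swap) (simp only: sum_sm stc_left[OF m w])
  also have "\<dots> = (\<Sum>i\<in>UNIV. \<Sum>b'\<in>UNIV. lo.sm (bU m l $ b' $ b * bD m x w i $ c $ b') (tU i * PP))"
    by (simp only: sum_sm matrix_matrix_mult_def vec_lambda_beta mult.commute)
  also have "\<dots> = (\<Sum>b'\<in>UNIV. lo.sm (bU m l $ b' $ b) (CC b' c))"
    by (subst sum.swap) (simp add: CC_def lo.sm_sum)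
  finally show ?thesis .
qed

lemma CC_right: "CC b c * tU l = (\<Sum>c'\<in>UNIV. lo.sm (bU m l $ c $ c') (CC b c'))"
proof -
  have "tU j * PP * tU l = (\<Sum>i\<in>UNIV. lo.sm (stc x w j l i) (tU i * PP))" for j
    using PT[of j l] by (simp add: mult.assoc tU_PP)
  then have "CC b c * tU l = (\<Sum>j\<in>UNIV. \<Sum>i\<in>UNIV. lo.sm (stc x w j l i * bD m x w j $ c $ b) (tU i * PP))"
    by (simp add: CC_def sum_distrib_right lo.sm_sum mult.commute)
  also have "\<dots> = (\<Sum>i\<in>UNIV. lo.sm ((bU m l ** bD m x w i) $ c $ b) (tU i * PP))"
    by (subst sum.swap) (simp only: sum_sm stc_right[OF m w])
  also have "\<dots> = (\<Sum>i\<in>UNIV. \<Sum>c'\<in>UNIV. lo.sm (bU m l $ c $ c' * bD m x w i $ c' $ b) (tU i * PP))"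
    by (simp only: sum_sm matrix_matrix_mult_def vec_lambda_beta)
  also have "\<dots> = (\<Sum>c'\<in>UNIV. lo.sm (bU m l $ c $ c') (CC b c'))"
    by (subst sum.swap) (simp add: CC_def lo.sm_sum)
  finally show ?thesis .
qed

lemma CC_trace: "(\<Sum>b\<in>UNIV. CC b b) = PP"
proof -
  have t: "trace (bD m x w j) = (if j = (1, 1) then 1 else 0)" for j
    using dual_basis[OF m w, of j "(1, 1)"] by (simp add: bU_def)
  have "(\<Sum>b\<in>UNIV. CC b b) = (\<Sum>j\<in>UNIV. lo.sm (trace (bD m x w j)) (tU j * PP))"
    unfolding CC_def by (subst sum.swap) (simp add: trace_def sum_sm)
  also have "\<dots> = PP"
    by (simp add: t UNIV_22 tU_def)
  finally show ?thesis .
qed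

definition "lint X A \<longleftrightarrow> (\<forall>b c. X * CC b c = (\<Sum>b'\<in>UNIV. lo.sm (A $ b' $ b) (CC b' c)))"
definition "rint X A \<longleftrightarrow> (\<forall>b c. CC b c * X = (\<Sum>c'\<in>UNIV. lo.sm (A $ c $ c') (CC b c')))"

lemma lint_mult: "lint X A \<Longrightarrow> lint Y B \<Longrightarrow> lint (X * Y) (A ** B)"
  by (simp add: lint_def mult.assoc sum_2 distrib_left lo.sm_add matrix_matrix_mult_def lo.sm_add_left algebra_simps)

lemma rint_mult: "rint X A \<Longrightarrow> rint Y B \<Longrightarrow> rint (X * Y) (A ** B)"
  by (simp add: rint_def mult.assoc[symmetric] sum_2 distrib_right lo.sm_add matrix_matrix_mult_def lo.sm_add_left algebra_simps)

lemma lint_sm: "lint X A \<Longrightarrow> lint (lo.sm c X) (mat c ** A)"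
  and rint_sm: "rint X A \<Longrightarrow> rint (lo.sm c X) (mat c ** A)"
  by (simp_all add: lint_def rint_def mat_mult_entry lo.sm_sum)

lemma lint_tU: "lint (tU l) (bU m l)" and rint_tU: "rint (tU l) (bU m l)"
  using CC_left CC_right by (simp_all add: lint_def rint_def)

text \<open>The basis contains KF rather than F, so statements about F are obtained from K and
  KF.\<close>

lemma mF_eq: "mF m = mat (1 / zkap x) ** (mK m ** mG m)" and f_eq: "f = lo.sm (1 / zkap x) (k * (k * f))"
proof -
  have "mK m ** (mK m ** mF m) = mat (zkap x) ** mF m"
    using m by (simp add: modrel_def matrix_mul_assoc)
  then have "mat (1 / zkap x) ** (mK m ** mG m) = (mat (1 / zkap x) ** mat (zkap x)) ** mF m"
    by (simp only: mG_def matrix_mul_assoc)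
  also have "mat (1 / zkap x) ** mat (zkap x) = (mat 1 :: complex^2^2)"
    by (simp add: vec_eq_iff mat_mult_entry) (simp add: mat_def)
  finally show "mF m = mat (1 / zkap x) ** (mK m ** mG m)" by simp
  show "f = lo.sm (1 / zkap x) (k * (k * f))" using table(1) by simp
qed

lemma lint_gens: "lint e (mE m)" "lint k (mK m)" "lint f (mF m)"
proof -
  show 1: "lint e (mE m)" "lint k (mK m)"
    using lint_tU[of "(2, 1)"] lint_tU[of "(1, 2)"] by (simp_all add: tU_def bU_def)
  have "lint (k * f) (mG m)"
    using lint_tU[of "(2, 2)"] by (simp add: tU_def bU_def)
  from lint_sm[OF lint_mult[OF 1(2) this], of "1 / zkap x"] show "lint f (mF m)"
    unfolding mF_eq[symmetric] f_eq[symmetric] .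
qed

lemma rint_gens: "rint e (mE m)" "rint k (mK m)" "rint (k * f) (mG m)"
  using rint_tU[of "(2, 1)"] rint_tU[of "(1, 2)"] rint_tU[of "(2, 2)"] by (simp_all add: tU_def bU_def)

lemma CC_itm: "itm e f k m (\<lambda>b. app (CC b c) h)"
proof -
  have "yint X A (\<lambda>b. app (CC b c) h)" if "lint X A" for X A
    unfolding yint_def
  proof
    fix b
    have "app (X * CC b c) h = app (\<Sum>b'\<in>UNIV. lo.sm (A $ b' $ b) (CC b' c)) h"
      using that by (simp add: lint_def)
    then show "app X (app (CC b c) h) = (\<lambda>s. \<Sum>b'\<in>UNIV. A $ b' $ b * app (CC b' c) h s)"
      by (simp add: app_sum_left)
  qed
  then show ?thesis using lint_gens by (simp add: itm_def)
qed

lemma CC_rint: "rint X A \<Longrightarrow> app (CC b c) (app X h) = (\<lambda>s. \<Sum>c'\<in>UNIV. A $ c $ c' * app (CC b c') h s)"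
proof -
  assume "rint X A"
  then have "app (CC b c * X) h = app (\<Sum>c'\<in>UNIV. lo.sm (A $ c $ c') (CC b c')) h"
    by (simp add: rint_def)
  then show ?thesis by (simp add: app_sum_left)
qed

context
  fixes y assumes y: "itm e f k m y"
begin

lemma itm_tU: "yint (tU l) (bU m l) y"
proof -
  have 1: "yint e (mE m) y" "yint f (mF m) y" "yint k (mK m) y" using y by (simp_all add: itm_def)
  have "(l :: 2 \<times> 2) = (1, 1) \<or> l = (1, 2) \<or> l = (2, 1) \<or> l = (2, 2)"
    using exhaust_2 by (metis prod.collapse)
  then show ?thesis
    using 1 yint_mult[OF 1(3,2)] yint_mat[of 1 y] by (auto simp: tU_def bU_def mG_def)
qed

lemma itm_Om: "app Om (y b) = (\<lambda>s. w * y b s)"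
proof -
  have 1: "yint e (mE m) y" "yint f (mF m) y" "yint k (mK m) y" using y by (simp_all add: itm_def)
  have i: "is_umod m" using m by (simp add: modrel_def)
  have "matrix_inv (mK m) = mat (1 / zkap x) ** mK m"
  proof -
    have "mK m ** (mat (1 / zkap x) ** mK m) = mat (1 / zkap x) ** (mK m ** mK m)"
      using mat_mult_comm[of "mK m"] by (metis matrix_mul_assoc)
    also have "\<dots> = mat 1"
      using m by (simp add: modrel_def vec_eq_iff mat_mult_entry) (simp add: mat_def)
    finally have r: "mK m ** (mat (1 / zkap x) ** mK m) = mat 1" .
    have "mat (1 / zkap x) ** mK m ** mK m = mat (1 / zkap x) ** (mK m ** mK m)"
      by (simp only: matrix_mul_assoc)
    also have "\<dots> = mat 1"
      using m by (simp add: modrel_def vec_eq_iff mat_mult_entry) (simp add: mat_def)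
    finally show ?thesis using r by (intro matrix_inv_eqI)
  qed
  then have "yint ki (matrix_inv (mK m)) y"
    unfolding ki using yint_sm[OF 1(3)] by simp
  then have "yint (lo.sm \<i> (e * f) + k - ki) (mat \<i> ** (mE m ** mF m) + mK m - matrix_inv (mK m)) y"
    using 1 by (intro yint_add yint_diff yint_sm yint_mult)
  moreover have "mat \<i> ** (mE m ** mF m) + mK m - matrix_inv (mK m) = mat w"
    using m by (simp add: modrel_def mOm_def matrix_mul_assoc)
  moreover have "lo.sm \<i> (e * f) + k - ki = Om"
    by (simp add: lo.om_def)
  ultimately have "app Om (y b) = (\<lambda>s. \<Sum>b'\<in>UNIV. mat w $ b' $ b * y b' s)"
    by (simp add: yint_def)
  also have "\<dots> = (\<lambda>s. w * y b s)"
    using yint_mat[of w y] by (simp add: yint_def)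
  finally show ?thesis .
qed

lemma itm_PP: "app PP (y b) = y b"
  using w by (simp add: PP_def itm_Om)

text \<open>On the images of a basis under a module map the operators act as genuine matrix units;
  this is \<open>completeness\<close> of the dual bases.\<close>

lemma itm_CC: "app (CC b c) (y c') = (if c = c' then y b else (\<lambda>s. 0))"
proof -
  have "app (CC b c) (y c') = (\<lambda>s. \<Sum>j\<in>UNIV. bD m x w j $ c $ b * (\<Sum>b'\<in>UNIV. bU m j $ b' $ c' * y b' s))"
    using itm_tU by (simp add: CC_def app_sum_left itm_PP yint_def)
  also have "\<dots> = (\<lambda>s. \<Sum>b'\<in>UNIV. (\<Sum>j\<in>UNIV. bU m j $ b' $ c' * bD m x w j $ c $ b) * y b' s)"
    by (rule ext, simp add: sum_distrib_left sum_distrib_right, subst sum.swap, intro sum.cong refl, simp add: algebra_simps)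
  also have "\<dots> = (\<lambda>s. \<Sum>b'\<in>UNIV. if b' = b then (if c = c' then y b s else 0) else 0)"
    unfolding completeness[OF m w] by (intro ext sum.cong) auto
  finally show ?thesis by auto
qed

end

end

section \<open>The multiplicity superspace\<close>

text \<open>The matrix units are built from the generators by sums, products and scalars alone;
  differences and the inverse of K are scalar multiples in disguise. The relation covers closure
  properties of one tuple as well as intertwining between two tuples.\<close>

lemma casimir_rel:
  assumes 1: "casimir e f k ki x m w" and 2: "casimir e' f' k' ki' x m w"
    and g: "Q e e'" "Q f f'" "Q k k'" "Q 1 1"
    and c: "\<And>X X' Y Y'. Q X X' \<Longrightarrow> Q Y Y' \<Longrightarrow> Q (X + Y) (X' + Y')"
      "\<And>X X' Y Y'. Q X X' \<Longrightarrow> Q Y Y' \<Longrightarrow> Q (X * Y) (X' * Y')" "\<And>c X X'. Q X X' \<Longrightarrow> Q (lo.sm c X) (lo.sm c X')"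
  shows "Q (casimir.CC e f k ki x m w b c') (casimir.CC e' f' k' ki' x m w b c')"
proof -
  interpret a: casimir e f k ki x m w by (rule 1)
  interpret b: casimir e' f' k' ki' x m w by (rule 2)
  have i: "Q ki ki'"
    unfolding a.ki b.ki by (intro c g)
  have om: "X + Y - Z = X + Y + lo.sm (- 1) Z" for X Y Z :: lop
    by (simp add: lo.sm_uminus_left)
  have O: "Q a.Om b.Om"
    unfolding lo.om_def om by (intro c g i)
  have U: "Q (a.tU j) (b.tU j)" for j
    unfolding a.tU_def b.tU_def q4_def using g c(2) by auto
  have P: "Q (a.tU j * a.PP) (b.tU j * b.PP)" for j
    unfolding a.PP_def b.PP_def by (intro c U O g)
  show ?thesis
    unfolding a.CC_def b.CC_def UNIV_22 by (intro c(1) c(3) P)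
qed

lemma mat_rules:
  fixes A B :: "complex^2^2"
  shows "(mat c ** A) ** B = mat c ** (A ** B)" "A ** (mat c ** B) = mat c ** (A ** B)"
    "mat c ** (mat d ** A) = mat (c * d) ** A" "- (mat c ** A) = mat (- c) ** A"
    "(- A) ** B = - (A ** B)" "A ** (- B) = - (A ** B)" "mat c ** mat d = (mat (c * d) :: complex^2^2)"
proof -
  show 1: "(mat c ** A) ** B = mat c ** (A ** B)" by (simp only: matrix_mul_assoc)
  have "A ** (mat c ** B) = (A ** mat c) ** B" by (simp only: matrix_mul_assoc)
  then show "A ** (mat c ** B) = mat c ** (A ** B)" by (simp only: mat_mult_comm 1)
  show "mat c ** (mat d ** A) = mat (c * d) ** A" "- (mat c ** A) = mat (- c) ** A"
    by (simp_all add: vec_eq_iff mat_mult_entry)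
  show "(- A) ** B = - (A ** B)" "A ** (- B) = - (A ** B)"
    by (simp_all add: matrix_matrix_mult_def vec_eq_iff sum_negf)
  show "mat c ** mat d = (mat (c * d) :: complex^2^2)"
    by (simp add: vec_eq_iff mat_mult_entry) (simp add: mat_def)
qed

lemma modrel_inv:
  assumes "modrel m x w"
  shows "matrix_inv (mK m) = mat (1 / zkap x) ** mK m"
proof -
  have k: "mK m ** mK m = mat (zkap x)" "zkap x \<noteq> 0" using assms by (simp_all add: modrel_def)
  show ?thesis
    by (rule matrix_inv_eqI) (simp_all add: mat_rules k)
qed

lemma finite_indices: "finite P \<Longrightarrow> finite (indices P)"
  using finite_set_of_finite_funs[of P "UNIV :: 2 set" 1] by (simp add: indices_def)

context tuple
begin

definition mrg :: "side \<Rightarrow> (pos \<Rightarrow> 2) \<Rightarrow> (pos \<Rightarrow> 2) \<Rightarrow> (pos \<Rightarrow> 2)"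
  where "mrg d s t = (\<lambda>p. if snd p = d then t p else s p)"

abbreviation "Ps d \<equiv> {1..n} \<times> {d :: side}"

text \<open>A slice: the indices on the other side are frozen at \<open>s\<close>, which leaves a
  tensor on side \<open>d\<close>. Operators of side \<open>d\<close> commute with slicing.\<close>

definition sl :: "side \<Rightarrow> (pos \<Rightarrow> 2) \<Rightarrow> tensor \<Rightarrow> tensor"
  where "sl d s f = (\<lambda>t. if t \<in> indices (Ps d) then f (mrg d s t) else 0)"

definition slp :: "side \<Rightarrow> lop \<Rightarrow> bool"
  where "slp d X \<longleftrightarrow> (\<forall>s f. app X (sl d s f) = sl d s (app X f))"

text \<open>The tensor product of a tensor on side \<open>d\<close> with one on the other side, in
  coefficients.\<close>

definition pro :: "side \<Rightarrow> tensor \<Rightarrow> tensor \<Rightarrow> tensor"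
  where "pro d f g = (\<lambda>s. f (restr_side d s) * g (restr_side (if d = Md then Dl else Md) s))"

definition prp :: "side \<Rightarrow> lop \<Rightarrow> bool"
  where "prp d X \<longleftrightarrow> (\<forall>f g. app X (pro d f g) = pro d (app X f) g)"

lemma sl_lin: "sl d s (\<lambda>t. f t + g t) = (\<lambda>t. sl d s f t + sl d s g t)" "sl d s (\<lambda>t. c * f t) = (\<lambda>t. c * sl d s f t)"
    "sl d s (\<lambda>t. 0) = (\<lambda>t. 0)"
  by (auto simp: sl_def)

lemma sl_sum: "sl d s (\<lambda>t. \<Sum>i\<in>A. f i t) = (\<lambda>t. \<Sum>i\<in>A. sl d s (f i) t)"
  by (auto simp: sl_def)

lemma slp_opL: "p \<in> Ps d \<Longrightarrow> slp d (opL p M)"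
proof -
  assume p: "p \<in> Ps d"
  have "mrg d s (t(p := b)) = (mrg d s t)(p := b)" for s t b
    using p by (auto simp: mrg_def)
  moreover have "mrg d s t p = t p" for s t using p by (auto simp: mrg_def)
  ultimately show ?thesis
    using indices_upd_iff[OF p] by (auto simp: slp_def sl_def app_opL op_at_def intro!: ext)
qed

lemma prp_opL: "p \<in> Ps d \<Longrightarrow> prp d (opL p M)"
proof -
  assume p: "p \<in> Ps d"
  define d' where "d' = (if d = Md then Dl else Md)"
  have "d' \<noteq> d" by (cases d) (auto simp: d'_def)
  then have r: "restr_side d (s(p := b)) = (restr_side d s)(p := b)" "restr_side d s p = s p"
    "restr_side d' (s(p := b)) = restr_side d' s" for s b
    using p by (auto simp: restr_side_def)
  show ?thesis
    unfolding prp_def pro_def d'_def[symmetric]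
    by (intro allI ext) (simp add: app_opL op_at_def r sum_distrib_right mult.assoc)
qed

lemma slp_closed: "slp d 1" "slp d (lcs c)" "slp d X \<Longrightarrow> slp d Y \<Longrightarrow> slp d (X + Y)" "slp d X \<Longrightarrow> slp d Y \<Longrightarrow> slp d (X * Y)"
    "slp d X \<Longrightarrow> slp d (lo.sm c X)"
  by (simp_all add: slp_def sl_lin)

lemma prp_closed: "prp d 1" "prp d (lcs c)" "prp d X \<Longrightarrow> prp d Y \<Longrightarrow> prp d (X + Y)" "prp d X \<Longrightarrow> prp d Y \<Longrightarrow> prp d (X * Y)"
  by (simp_all add: prp_def, auto simp: pro_def algebra_simps)

lemma side_act:
  assumes "x \<in> carrier (free_ring (Ps d \<times> UNIV))"
  shows "slp d (actL V a x)" "prp d (actL V a x)"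
proof -
  have "slp d (actL V a x) \<and> prp d (actL V a x)"
    using assms
  proof (induction rule: free_ring_induct)
    case (gvar_mult g x)
    then show ?case
      by (cases g) (auto simp: lo.ev_mult gL_def intro!: slp_closed prp_closed slp_opL prp_opL)
  qed (auto simp: lo.ev_add intro: slp_closed prp_closed)
  then show "slp d (actL V a x)" "prp d (actL V a x)" by simp_all
qed

lemma cop_side:
  assumes "X \<in> {cE d, cF d, cK d}"
  shows "slp d X" "prp d X" "f \<in> tens (Ps d) \<Longrightarrow> app X f \<in> tens (Ps d)" "tp X"
proof -
  obtain x where x: "x \<in> carrier (free_ring (Ps d \<times> UNIV))" "X = actL V a x"
    using assms cop_carrier(1,3,4)[of d n] unfolding cE_def cF_def cK_def by blast
  show "slp d X" "prp d X" using side_act[OF x(1)] x(2) by simp_all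
  show "f \<in> tens (Ps d) \<Longrightarrow> app X f \<in> tens (Ps d)"
    unfolding x(2) by (rule tens_actL[OF x(1)])
  have "x \<in> carrier (free_ring (positions n \<times> UNIV))"
    using x(1) by (fastforce simp: free_carrier positions_def)
  then show "tp X" unfolding x(2) tp_def using tens_actL by blast
qed

lemma mult_space_iff:
  "x \<in> mult_space V a d m \<longleftrightarrow> (\<forall>b. x b \<in> tens (Ps d)) \<and> itm (cE d) (cF d) (cK d) m x"
  by (auto simp: mult_space_def itm_def yint_def act_actL n_def[symmetric] cE_def cF_def cK_def)

lemma sw_NN_aG: "1 \<le> j \<Longrightarrow> j \<le> n \<Longrightarrow> NN * aG j \<nu> = - (aG j \<nu> * NN)"
proof -
  assume j: "1 \<le> j" "j \<le> n"
  have p: "(j, d) \<in> positions n" "set [1..<j] \<times> {d} \<subseteq> positions n" "set [Suc j..<Suc n] \<times> {d} \<subseteq> positions n"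
    "set [1..<Suc n] \<times> {d} \<subseteq> positions n" for d
    using j by (auto simp: positions_def)
  have "sw ((False \<noteq> True) \<noteq> False) NN (al j \<nu>)"
    unfolding al_def by (intro sw_mult_right sw_NN p)
  moreover have "sw (False \<noteq> ((True \<noteq> False) \<noteq> False)) NN (ab j \<nu>)"
    unfolding ab_def by (intro sw_mult_right sw_NN p)
  ultimately show ?thesis by (simp add: sw_def aG_def algebra_simps)
qed

lemma NN_DD: "NN * DD n \<nu> = - (DD n \<nu> * NN)"
proof -
  have "NN * lo.sm c (aG j \<nu>) = - (lo.sm c (aG j \<nu>) * NN)" if "1 \<le> j" "j \<le> n" for c j \<nu>
    using sw_NN_aG[OF that] by (simp add: lo.sm_uminus)
  then have "NN * dd j \<nu> = - (dd j \<nu> * NN)" if "1 \<le> j" "j \<le> n" for j \<nu>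
    using that unfolding dd_def lo.sm_def[symmetric] distrib_left distrib_right by simp
  then show ?thesis
    unfolding DD_def by (simp add: sum_distrib_left sum_distrib_right sum_negf)
qed

end

locale total = tuple V a for V a +
  fixes mu :: complex
  assumes tot: "nonsingular (total_chr a)" "ext_char (total_chr a, mu)"
begin

abbreviation "tx \<equiv> total_chr a"
text \<open>The value of Omega on the module \<open>tm e\<close>; the two signs are the two possible
  summands over the total character.\<close>

definition "we e = (if e then - (mu - 1 / mu) else mu - 1 / mu)"
abbreviation "tm e \<equiv> total_mod V a mu e"
definition "sg par = (if par then - 1 else 1 :: complex)"

lemma sg_sq [simp]: "sg p * sg p = 1" "sg p * (sg p * z) = z"
  by (simp_all add: sg_def)

lemma tm_modrel: "modrel (tm e) tx (we e)"
proof -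
  have "modrel (V (tx, mu)) tx (mu - 1 / mu)"
    using is_V_modrel[OF V[of "(tx, mu)"]] tot by (simp add: ext_char_def)
  then show ?thesis
    using modrel_flip[of "V (tx, mu)" tx "mu - 1 / mu"] by (auto simp: total_mod_def we_def)
qed

lemma we_nz: "we e \<noteq> 0"
  using modrel_omega2[OF tm_modrel[of e]] tot by (auto simp: nonsingular_def)

lemma tx_nz: "zkap tx \<noteq> 0"
  using tm_modrel[of False] by (simp add: modrel_def)

lemma cas_Md: "casimir (cE Md) (cF Md) (cK Md) (cKi Md) tx (tm e) (we e)"
  using cE_utrip[of Md] tm_modrel[of e] we_nz[of e] lo.calg_axioms
  by (simp add: casimir_def casimir_axioms_def utriple_def utriple_axioms_def pchr_def)

lemma cas_Dl: "casimir (cE Dl) (cF Dl) (cK Dl) (cKi Dl) (zinv tx) (dual_umod (tm e)) (we e)"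
  using cE_utrip[of Dl] modrel_dual[OF tm_modrel[of e]] we_nz[of e] lo.calg_axioms
  by (simp add: casimir_def casimir_axioms_def utriple_def utriple_axioms_def pchr_def)

definition "CM e b c = casimir.CC (cE Md) (cF Md) (cK Md) (cKi Md) tx (tm e) (we e) b c"
definition "CD e b c = casimir.CC (cE Dl) (cF Dl) (cK Dl) (cKi Dl) (zinv tx) (dual_umod (tm e)) (we e) b c"
definition "PM e = casimir.PP (cE Md) (cF Md) (cK Md) (cKi Md) (we e)"

lemma CM_closed:
  assumes "Q (cE Md)" "Q (cF Md)" "Q (cK Md)" "Q 1" "\<And>X Y. Q X \<Longrightarrow> Q Y \<Longrightarrow> Q (X + Y)"
    "\<And>X Y. Q X \<Longrightarrow> Q Y \<Longrightarrow> Q (X * Y)" "\<And>c X. Q X \<Longrightarrow> Q (lo.sm c X)"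
  shows "Q (CM e b c)"
  unfolding CM_def using casimir_rel[OF cas_Md cas_Md, of "\<lambda>X _. Q X"] assms by blast

lemma CD_closed:
  assumes "Q (cE Dl)" "Q (cF Dl)" "Q (cK Dl)" "Q 1" "\<And>X Y. Q X \<Longrightarrow> Q Y \<Longrightarrow> Q (X + Y)"
    "\<And>X Y. Q X \<Longrightarrow> Q Y \<Longrightarrow> Q (X * Y)" "\<And>c X. Q X \<Longrightarrow> Q (lo.sm c X)"
  shows "Q (CD e b c)"
  unfolding CD_def using casimir_rel[OF cas_Dl cas_Dl, of "\<lambda>X _. Q X"] assms by blast

lemma tp_CM: "tp (CM e b c)"
  by (rule CM_closed) (auto intro: cop_side(4) tp_intros tp_sm)

lemma slp_CD: "slp Dl (CD e b c)"
  by (rule CD_closed) (auto intro: cop_side slp_closed)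

lemma tens_CD: "f \<in> tens (Ps Dl) \<Longrightarrow> app (CD e b c) f \<in> tens (Ps Dl)"
proof -
  have "\<forall>f\<in>tens (Ps Dl). app (CD e b c) f \<in> tens (Ps Dl)"
    by (rule CD_closed) (auto intro: cop_side(3) tens_add tens_scale simp del: One_nat_def)
  then show "f \<in> tens (Ps Dl) \<Longrightarrow> app (CD e b c) f \<in> tens (Ps Dl)" by blast
qed

lemma CM_cross: "X \<in> {cE Dl, cF Dl, cK Dl} \<Longrightarrow> CM e b c * X = X * CM e b c"
proof -
  assume X: "X \<in> {cE Dl, cF Dl, cK Dl}"
  show ?thesis
  proof (rule CM_closed)
    fix Y Z assume h: "Y * X = X * Y" "Z * X = X * Z"
    have "Y * Z * X = Y * (X * Z)" by (simp only: h mult.assoc)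
    also have "\<dots> = X * (Y * Z)" by (rule swap_assoc[OF h(1)])
    finally show "Y * Z * X = X * (Y * Z)" .
  qed (use X cop_cross in \<open>auto simp: distrib_left distrib_right\<close>)
qed

text \<open>The elements of a multiplicity block as intertwiners in both indices, without a
  presentation as a sum of products.\<close>

definition "blk e1 e2 y \<longleftrightarrow> (\<forall>b c. y b c \<in> tens (positions n)) \<and>
  (\<forall>c. itm (cE Md) (cF Md) (cK Md) (tm e1) (\<lambda>b. y b c)) \<and>
  (\<forall>b. itm (cE Dl) (cF Dl) (cK Dl) (dual_umod (tm e2)) (y b))"

lemma restr_tens:
  assumes "s \<notin> indices (positions n)"
  shows "restr_side Md s \<notin> indices (Ps Md) \<or> restr_side Dl s \<notin> indices (Ps Dl)"
proof -
  obtain p where p: "p \<notin> positions n" "s p \<noteq> 1" using assms by (auto simp: indices_def)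
  have "restr_side (snd p) s p \<noteq> 1" "p \<notin> Ps (snd p)"
    using p by (auto simp: restr_side_def positions_def)
  then have "restr_side (snd p) s \<notin> indices (Ps (snd p))"
    unfolding indices_def by blast
  then show ?thesis by (cases "snd p") simp_all
qed

lemma restr_indices: "s \<in> indices (positions n) \<Longrightarrow> restr_side d s \<in> indices (Ps d)"
  by (auto simp: indices_def restr_side_def positions_def)

lemma mult_block_blk:
  assumes "y \<in> mult_block V a mu e1 e2"
  shows "blk e1 e2 y"
proof -
  obtain N x x' where y: "y = (\<lambda>b c s. \<Sum>k<(N::nat). x k b (restr_side Md s) * x' k c (restr_side Dl s))"
    and x: "\<And>k. k < N \<Longrightarrow> x k \<in> mult_space V a Md (tm e1)" "\<And>k. k < N \<Longrightarrow> x' k \<in> mult_space V a Dl (dual_umod (tm e2))"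
    using assms unfolding mult_block_def by blast
  have yM: "y b c = (\<lambda>s. \<Sum>k<N. pro Md (x k b) (x' k c) s)" for b c by (simp add: y pro_def)
  have yD: "y b c = (\<lambda>s. \<Sum>k<N. pro Dl (x' k c) (x k b) s)" for b c by (simp add: y pro_def mult.commute)
  note m = x[unfolded mult_space_iff]
  have t: "y b c s = 0" if s: "s \<notin> indices (positions n)" for b c s
  proof -
    have "x k b (restr_side Md s) * x' k c (restr_side Dl s) = 0" if "k < N" for k
      using restr_tens[OF s] m[OF that] by (auto simp: tens_def)
    then show ?thesis unfolding y by (intro sum.neutral) auto
  qed
  have A: "yint X A (\<lambda>b. y b c)" if X: "prp Md X" and k: "\<And>k. k < N \<Longrightarrow> yint X A (x k)" for X A c
    unfolding yint_def
  proof
    fix b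
    have "app X (y b c) = (\<lambda>s. \<Sum>k<N. pro Md (app X (x k b)) (x' k c) s)"
      using X by (simp add: yM app_sum prp_def)
    also have "\<dots> = (\<lambda>s. \<Sum>k<N. pro Md (\<lambda>s. \<Sum>b'\<in>UNIV. A $ b' $ b * x k b' s) (x' k c) s)"
      by (intro ext sum.cong refl) (use k in \<open>simp add: yint_def\<close>)
    also have "\<dots> = (\<lambda>s. \<Sum>b'\<in>UNIV. A $ b' $ b * y b' c s)"
      by (rule ext) (simp add: pro_def yM sum_2 algebra_simps sum.distrib sum_distrib_left)
    finally show "app X (y b c) = \<dots>" .
  qed
  have B: "yint X A (y b)" if X: "prp Dl X" and k: "\<And>k. k < N \<Longrightarrow> yint X A (x' k)" for X A b
    unfolding yint_def
  proof
    fix c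
    have "app X (y b c) = (\<lambda>s. \<Sum>k<N. pro Dl (app X (x' k c)) (x k b) s)"
      using X by (simp add: yD app_sum prp_def)
    also have "\<dots> = (\<lambda>s. \<Sum>k<N. pro Dl (\<lambda>s. \<Sum>b'\<in>UNIV. A $ b' $ c * x' k b' s) (x k b) s)"
      by (intro ext sum.cong refl) (use k in \<open>simp add: yint_def\<close>)
    also have "\<dots> = (\<lambda>s. \<Sum>b'\<in>UNIV. A $ b' $ c * y b b' s)"
      by (rule ext) (simp add: pro_def yD sum_2 algebra_simps sum.distrib sum_distrib_left)
    finally show "app X (y b c) = \<dots>" .
  qed
  have p: "prp d (cE d)" "prp d (cF d)" "prp d (cK d)" for d
    by (simp_all add: cop_side(2))
  have xM: "yint (cE Md) (mE (tm e1)) (x k)" "yint (cF Md) (mF (tm e1)) (x k)" "yint (cK Md) (mK (tm e1)) (x k)"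
    and xD: "yint (cE Dl) (mE (dual_umod (tm e2))) (x' k)" "yint (cF Dl) (mF (dual_umod (tm e2))) (x' k)"
      "yint (cK Dl) (mK (dual_umod (tm e2))) (x' k)" if "k < N" for k
    using m[OF that] by (simp_all only: itm_def)
  show ?thesis
    unfolding blk_def itm_def
  proof (intro conjI allI)
    show "y b c \<in> tens (positions n)" for b c using t by (simp add: tens_def)
    show "yint (cE Md) (mE (tm e1)) (\<lambda>b. y b c)" "yint (cF Md) (mF (tm e1)) (\<lambda>b. y b c)"
      "yint (cK Md) (mK (tm e1)) (\<lambda>b. y b c)" for c
      by (rule A[OF p(1)], erule xM, rule A[OF p(2)], erule xM, rule A[OF p(3)], erule xM)
    show "yint (cE Dl) (mE (dual_umod (tm e2))) (y b)" "yint (cF Dl) (mF (dual_umod (tm e2))) (y b)"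
      "yint (cK Dl) (mK (dual_umod (tm e2))) (y b)" for b
      by (rule B[OF p(1)], erule xD, rule B[OF p(2)], erule xD, rule B[OF p(3)], erule xD)
  qed
qed

text \<open>A presentation by products: the dual leg is expanded in delta tensors, projected to
  module maps by \<open>CD\<close>, and paired with the corresponding slices of the module
  leg.\<close>

lemma blk_mult_block:
  assumes y: "blk e1 e2 y"
  shows "y \<in> mult_block V a mu e1 e2"
proof -
  define I where "I = (UNIV :: 2 set) \<times> indices (Ps Dl)"
  \<comment> \<open>The factor 1/2 compensates that \<open>half\<close> reproduces the element for
    each of the two values of the auxiliary index.\<close>
  define dl where "dl t = (\<lambda>s. if s = t then 1 / 2 else 0 :: complex)" for t :: "pos \<Rightarrow> 2"
  have fin: "finite (indices (Ps Dl))" by (rule finite_indices) simp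
  then have "finite I" by (simp add: I_def)
  then obtain h where h: "bij_betw h {0..<card I} I" using ex_bij_betw_nat_finite by blast
  define x where "x k b = sl Md (snd (h k)) (y b (fst (h k)))" for k b
  define x' where "x' k c = app (CD e2 c (fst (h k))) (dl (snd (h k)))" for k c
  have hI: "h k \<in> I" if "k < card I" for k using h that by (auto simp: bij_betw_def)
  have sl_t: "sl Md t f \<in> tens (Ps Md)" for t f by (auto simp: sl_def tens_def)
  have 1: "x k \<in> mult_space V a Md (tm e1)" for k
  proof -
    have "yint X A (\<lambda>b. sl Md t (y b c))" if "yint X A (\<lambda>b. y b c)" "slp Md X" for X A t c
      using that by (simp add: yint_def slp_def sl_sum sl_lin)
    then show ?thesis
      using y sl_t cop_side(1)[of _ Md] unfolding mult_space_iff x_def blk_def itm_def by blast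
  qed
  have 2: "x' k \<in> mult_space V a Dl (dual_umod (tm e2))" if "k < card I" for k
  proof -
    have "dl (snd (h k)) \<in> tens (Ps Dl)"
      using hI[OF that] by (auto simp: I_def dl_def tens_def)
    then show ?thesis
      unfolding mult_space_iff x'_def using tens_CD casimir.CC_itm[OF cas_Dl] by (auto simp: CD_def)
  qed
  have half: "app (CD e2 c c') (y b c') = y b c" for b c c'
    unfolding CD_def using casimir.itm_CC[OF cas_Dl, of e2 "y b" c c' c'] y by (simp add: blk_def)
  have "y b c s = (\<Sum>k<card I. x k b (restr_side Md s) * x' k c (restr_side Dl s))" for b c s
  proof -
    have "(\<Sum>k<card I. x k b (restr_side Md s) * x' k c (restr_side Dl s)) =
        (\<Sum>i\<in>I. sl Md (snd i) (y b (fst i)) (restr_side Md s) * app (CD e2 c (fst i)) (dl (snd i)) (restr_side Dl s))"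
      unfolding x_def x'_def lessThan_atLeast0
      by (rule sum.reindex_bij_betw[OF h, where g = "\<lambda>i. sl Md (snd i) (y b (fst i)) (restr_side Md s) *
        app (CD e2 c (fst i)) (dl (snd i)) (restr_side Dl s)"])
    also have "\<dots> = (\<Sum>c'\<in>UNIV. \<Sum>t\<in>indices (Ps Dl). sl Md t (y b c') (restr_side Md s) * app (CD e2 c c') (dl t) (restr_side Dl s))"
      unfolding I_def by (simp add: sum.cartesian_product case_prod_beta)
    also have "\<dots> = y b c s"
    proof (cases "s \<in> indices (positions n)")
      case True
      note r = restr_indices[OF True]
      have mm: "mrg Md t (restr_side Md s) = mrg Dl s t" if "t \<in> indices (Ps Dl)" for t
      proof
        fix p :: pos
        show "mrg Md t (restr_side Md s) p = mrg Dl s t p"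
          by (cases "snd p") (auto simp: mrg_def restr_side_def)
      qed
      have ms: "mrg Dl s (restr_side Dl s) = s"
        by (rule ext) (auto simp: mrg_def restr_side_def)
      have "(\<Sum>t\<in>indices (Ps Dl). sl Md t (y b c') (restr_side Md s) * app (CD e2 c c') (dl t) (restr_side Dl s)) = y b c s / 2" (is "?S c' = _") for c'
      proof -
        have e: "sl Dl s (y b c') = (\<lambda>r. \<Sum>t\<in>indices (Ps Dl). 2 * y b c' (mrg Dl s t) * dl t r)"
        proof
          fix r
          have "(\<Sum>t\<in>indices (Ps Dl). 2 * y b c' (mrg Dl s t) * dl t r) =
              (\<Sum>t\<in>indices (Ps Dl). if r = t then y b c' (mrg Dl s t) else 0)"
            by (rule sum.cong) (auto simp: dl_def)
          then show "sl Dl s (y b c') r = (\<Sum>t\<in>indices (Ps Dl). 2 * y b c' (mrg Dl s t) * dl t r)"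
            using fin by (simp add: sl_def)
        qed
        have "y b c s = sl Dl s (app (CD e2 c c') (y b c')) (restr_side Dl s)"
          using r by (simp add: half sl_def ms)
        also have "\<dots> = app (CD e2 c c') (sl Dl s (y b c')) (restr_side Dl s)"
          using slp_CD by (simp add: slp_def)
        also have "\<dots> = (\<Sum>t\<in>indices (Ps Dl). 2 * y b c' (mrg Dl s t) * app (CD e2 c c') (dl t) (restr_side Dl s))"
          unfolding e by (simp only: app_sum app_scale)
        also have "\<dots> = 2 * (\<Sum>t\<in>indices (Ps Dl). sl Md t (y b c') (restr_side Md s) * app (CD e2 c c') (dl t) (restr_side Dl s))"
          unfolding sum_distrib_left by (rule sum.cong) (use r mm in \<open>auto simp: sl_def\<close>)
        finally show ?thesis by simp
      qed
      then have "(\<Sum>c'\<in>UNIV. ?S c') = (\<Sum>c'\<in>(UNIV :: 2 set). y b c s / 2)" by (intro sum.cong refl)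
      then show ?thesis by (simp add: sum_2)
    next
      case False
      have "dl t \<in> tens (Ps Dl)" if "t \<in> indices (Ps Dl)" for t
        using that by (auto simp: dl_def tens_def)
      then have "app (CD e2 c c') (dl t) \<in> tens (Ps Dl)" if "t \<in> indices (Ps Dl)" for t c'
        using that tens_CD by blast
      then have z: "sl Md t (y b c') (restr_side Md s) * app (CD e2 c c') (dl t) (restr_side Dl s) = 0"
        if "t \<in> indices (Ps Dl)" for t c'
        using that restr_tens[OF False] by (auto simp: sl_def tens_def)
      have "y b c s = 0" using y False by (auto simp: blk_def tens_def)
      then show ?thesis by (simp only:) (intro sum.neutral ballI z)
    qed
    finally show ?thesis ..
  qed
  then have "y = (\<lambda>b c s. \<Sum>k<card I. x k b (restr_side Md s) * x' k c (restr_side Dl s))" by blast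
  then show ?thesis
    unfolding mult_block_def using 1 2 by blast
qed

end

lemmas mr = mat_rules(1,3-7) mat_rules(2)[of "mK m" for m] mat_rules(2)[of "mE m" for m] mat_rules(2)[of "mF m" for m]

section \<open>Invariant vectors and the inverse of \<open>mult_vec\<close>\<close>

context total
begin

lemma kk_total: "cK Md * (cK Md * x) = lo.sm (zkap tx) x" "cK Dl * (cK Dl * x) = lo.sm (1 / zkap tx) x"
proof -
  have 1: "cK Md * cK Md = lo.sm (zkap tx) 1" "cK Dl * cK Dl = lo.sm (1 / zkap tx) 1"
    using utriple.kk[OF casimir.axioms(1)[OF cas_Md]] utriple.kk[OF casimir.axioms(1)[OF cas_Dl]]
    by (simp_all add: zinv_def)
  show "cK Md * (cK Md * x) = lo.sm (zkap tx) x" "cK Dl * (cK Dl * x) = lo.sm (1 / zkap tx) x"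
    unfolding mult.assoc[symmetric] 1 by simp_all
qed

lemma NN_NN: "app NN (app NN f) = f"
proof -
  have c: "cK Dl * (cK Md * x) = cK Md * (cK Dl * x)" for x
    using cop_cross[of "cK Md" "cK Dl"] by (intro swap_assoc) simp
  have "NN * NN = 1"
    unfolding NN_def mult.assoc c using tx_nz kk_total(1)[of 1] kk_total(2)[of 1] by (simp add: kk_total)
  then have "app (NN * NN) f = f" by simp
  then show ?thesis by simp
qed

definition "Inv W \<longleftrightarrow> W \<in> tens (positions n) \<and> (\<forall>\<nu>. app (DD n \<nu>) W = (\<lambda>s. 0))"

text \<open>On an eigenvector of \<open>NN\<close> the equations of \<open>DD_1\<close> and
  \<open>DD_2\<close> can be solved for the dual generators: up to the sign \<open>z\<close> they
  act through the antipode on the module side.\<close>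

lemma inv_rel:
  assumes W: "Inv W" and N: "app NN W = (\<lambda>s. z * W s)"
  shows "app (cK Dl) W = (\<lambda>s. z / zkap tx * app (cK Md) W s)"
    and "app (cE Dl) W = (\<lambda>s. - (z / zkap tx) * app (cE Md * cK Md) W s)"
    and "app (cF Dl) W = (\<lambda>s. - 1 * app (cK Md * cF Md) W s)"
proof -
  have c: "cK Dl * (cK Md * x) = cK Md * (cK Dl * x)" for x
    using cop_cross[of "cK Md" "cK Dl"] by (intro swap_assoc) simp
  have ce: "cK Dl * cE Md = cE Md * cK Dl"
    using cop_cross[of "cE Md" "cK Dl"] by simp
  have "app (cK Md * (cK Md * cK Dl)) W = app (lo.sm z (cK Md)) W"
    using N by (simp add: NN_def app_scale)
  then have "app (lo.sm (zkap tx) (cK Dl)) W = app (lo.sm z (cK Md)) W"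
    by (simp only: kk_total)
  then show K: "app (cK Dl) W = (\<lambda>s. z / zkap tx * app (cK Md) W s)"
    using tx_nz by (simp add: fun_eq_iff field_simps)
  have D: "app (lo.sm d (DD n \<nu>)) W = (\<lambda>s. 0)" for d \<nu>
    using W by (simp add: Inv_def)
  let ?A = "cK Md * cE Md + lo.sm (zkap tx) (cK Md * (cK Dl * cE Dl))"
  have "app (cK Dl * (cK Md * ?A)) W = app (cK Dl * cK Md) (app ?A W)"
    by (simp only: app_simps)
  also have "app ?A W = (\<lambda>s. 0)"
    using D[of "4 * kpre (Suc n)" 2] unfolding DD_2 total_kap .
  finally have "app (cK Dl * (cK Md * ?A)) W = (\<lambda>s. 0)" by (simp only: app_zero)
  moreover have "cK Dl * (cK Md * ?A) = lo.sm (zkap tx) (cE Md * cK Dl + cE Dl)"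
    using tx_nz unfolding distrib_left lo.sm_right kk_total ce by (simp add: lo.sm_add)
  ultimately have "app (cE Md) (app (cK Dl) W) s + app (cE Dl) W s = 0" for s
    using tx_nz by (simp add: fun_eq_iff)
  then have "app (cE Dl) W s = - app (cE Md) (app (cK Dl) W) s" for s
    by (simp add: eq_neg_iff_add_eq_0 add.commute)
  then have "app (cE Dl) W s = - (z / zkap tx * app (cE Md) (app (cK Md) W) s)" for s
    unfolding K app_scale .
  then show "app (cE Dl) W = (\<lambda>s. - (z / zkap tx) * app (cE Md * cK Md) W s)"
    by (simp add: fun_eq_iff)
  let ?B = "cF Md + lo.sm (1 / zkap tx) (cK Md * cF Dl)"
  have "app (cK Md * ?B) W = app (cK Md) (app ?B W)"
    by (simp only: app_simps)
  also have "app ?B W = (\<lambda>s. 0)"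
    using D[of "- 4 * \<i>" 1] unfolding DD_1 total_kap .
  finally have "app (cK Md * ?B) W = (\<lambda>s. 0)" by (simp only: app_zero)
  moreover have "cK Md * ?B = cK Md * cF Md + cF Dl"
    using tx_nz unfolding distrib_left lo.sm_right kk_total by simp
  ultimately have "app (cK Md * cF Md) W s + app (cF Dl) W s = 0" for s
    by (simp add: fun_eq_iff)
  then have "app (cF Dl) W s = - app (cK Md * cF Md) W s" for s
    by (simp add: eq_neg_iff_add_eq_0 add.commute)
  then show "app (cF Dl) W = (\<lambda>s. - 1 * app (cK Md * cF Md) W s)" by auto
qed

text \<open>\<open>flip_umod\<close> keeps E and KF and negates K, so both signs share one matrix
  model and the dual matrices match \<open>inv_rel\<close> with \<open>z\<close> equal to the
  relative sign.\<close>

lemma tm_dual: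
  "mK (dual_umod (tm e2)) = transpose (mat (sg (e1 \<noteq> e2) / zkap tx) ** mK (tm e1))"
  "mE (dual_umod (tm e2)) = transpose (mat (- (sg (e1 \<noteq> e2) / zkap tx)) ** (mE (tm e1) ** mK (tm e1)))"
  "mF (dual_umod (tm e2)) = transpose (mat (- 1) ** mG (tm e1))"
proof -
  have neg: "- A = mat (- 1) ** A" for A :: "complex^2^2"
    by (simp add: vec_eq_iff mat_mult_entry)
  have K: "mK (tm e2) = mat (sg (e1 \<noteq> e2)) ** mK (tm e1)"
    by (cases e1; cases e2) (simp_all add: total_mod_def flip_umod_def sg_def neg[of "mK _"] mr)
  have E: "mE (tm e2) = mE (tm e1)"
    by (cases e1; cases e2) (simp_all add: total_mod_def flip_umod_def)
  have G: "mG (tm e2) = mG (tm e1)"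
    by (cases e1; cases e2) (simp_all add: total_mod_def flip_umod_def mG_def mr)
  have i: "matrix_inv (mK (tm e2)) = mat (sg (e1 \<noteq> e2) / zkap tx) ** mK (tm e1)"
    using trans[OF modrel_inv[OF tm_modrel[of e2]] arg_cong[OF K, of "\<lambda>A. mat (1 / zkap tx) ** A"]]
    by (simp add: mr)
  show "mK (dual_umod (tm e2)) = transpose (mat (sg (e1 \<noteq> e2) / zkap tx) ** mK (tm e1))"
    by (simp add: dual_umod_def i)
  show "mE (dual_umod (tm e2)) = transpose (mat (- (sg (e1 \<noteq> e2) / zkap tx)) ** (mE (tm e1) ** mK (tm e1)))"
    unfolding dual_umod_def umod.simps i E by (simp only: mr)
  show "mF (dual_umod (tm e2)) = transpose (mat (- 1) ** mG (tm e1))"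
    unfolding dual_umod_def umod.simps mG_def[symmetric] G neg[of "mG _"] ..
qed

text \<open>Dual generators commute with the matrix units, act on \<open>W\<close> as module-side
  elements, and are then absorbed from the right into the column index, where they appear
  transposed.\<close>

lemma blk_CM:
  assumes W: "Inv W" and N: "app NN W = (\<lambda>s. sg (e1 \<noteq> e2) * W s)"
  shows "blk e1 e2 (\<lambda>b c. app (CM e1 b c) W)"
proof -
  interpret M: casimir "cE Md" "cF Md" "cK Md" "cKi Md" tx "tm e1" "we e1" by (rule cas_Md)
  note R = inv_rel[OF W N]
  have D: "yint X (transpose (mat d ** A)) (\<lambda>c. app (CM e1 b c) W)"
    if X: "X \<in> {cE Dl, cF Dl, cK Dl}" and r: "app X W = (\<lambda>s. d * app U W s)" and U: "M.rint U A" for X d A U b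
    unfolding yint_def
  proof
    fix c
    have "app X (app (CM e1 b c) W) = app (CM e1 b c * X) W"
      unfolding CM_cross[OF X] by simp
    also have "\<dots> = (\<lambda>s. d * (\<Sum>c'\<in>UNIV. A $ c $ c' * app (CM e1 b c') W s))"
      using M.CC_rint[OF U, of b c W] by (simp add: r app_scale CM_def)
    also have "\<dots> = (\<lambda>s. \<Sum>c'\<in>UNIV. transpose (mat d ** A) $ c' $ c * app (CM e1 b c') W s)"
      by (simp add: transpose_def mat_mult_entry sum_distrib_left mult.assoc)
    finally show "app X (app (CM e1 b c) W) = \<dots>" .
  qed
  have "app (CM e1 b c) W \<in> tens (positions n)" for b c
    using tp_CM W by (simp add: tp_def Inv_def)
  moreover have "itm (cE Md) (cF Md) (cK Md) (tm e1) (\<lambda>b. app (CM e1 b c) W)" for c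
    using M.CC_itm by (simp add: CM_def)
  moreover have "itm (cE Dl) (cF Dl) (cK Dl) (dual_umod (tm e2)) (\<lambda>c. app (CM e1 b c) W)" for b
    unfolding itm_def tm_dual[of e2 e1]
    using D[OF _ R(1) M.rint_gens(2)] D[OF _ R(2) M.rint_mult[OF M.rint_gens(1,2)]] D[OF _ R(3) M.rint_gens(3)]
    by simp
  ultimately show ?thesis by (simp add: blk_def)
qed

text \<open>The eigenvalue projection of \<open>NN\<close> decides whether the two signs agree, and
  the matrix unit selects the first sign and the coordinates; together they separate the four
  blocks.\<close>

definition unv :: "tensor \<Rightarrow> mult_elem"
  where "unv W e1 e2 b c = app (CM e1 b c) (\<lambda>s. 1 / 2 * W s + sg (e1 \<noteq> e2) / 2 * app NN W s)"

lemma unv_lin: "unv (\<lambda>s. c * f s + d * g s) e1 e2 b b' = (\<lambda>s. c * unv f e1 e2 b b' s + d * unv g e1 e2 b b' s)"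
proof -
  have "(\<lambda>s. 1 / 2 * (c * f s + d * g s) + sg (e1 \<noteq> e2) / 2 * app NN (\<lambda>s. c * f s + d * g s) s) =
    (\<lambda>s. c * (1 / 2 * f s + sg (e1 \<noteq> e2) / 2 * app NN f s) + d * (1 / 2 * g s + sg (e1 \<noteq> e2) / 2 * app NN g s))"
    unfolding app_lin by (simp add: algebra_simps add_divide_distrib)
  then show ?thesis unfolding unv_def by (simp only: app_lin)
qed

lemma Inv_lin: "Inv f \<Longrightarrow> Inv g \<Longrightarrow> Inv (\<lambda>s. c * f s + d * g s)"
  by (auto simp: Inv_def app_lin intro!: tens_add tens_scale)

lemma Inv_NN: "Inv W \<Longrightarrow> Inv (app NN W)"
proof -
  assume W: "Inv W"
  have "tp NN" unfolding NN_def by (intro tp_intros cop_side(4)) auto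
  moreover have "app (DD n \<nu>) (app NN W) = (\<lambda>s. 0)" for \<nu>
  proof -
    have "DD n \<nu> * NN = - (NN * DD n \<nu>)" using NN_DD[of \<nu>] by simp
    then have "app (DD n \<nu> * NN) W = app (- (NN * DD n \<nu>)) W" by simp
    then show ?thesis using W by (simp add: Inv_def)
  qed
  ultimately show ?thesis using W by (simp add: Inv_def tp_def)
qed

lemma unv_super: "Inv W \<Longrightarrow> unv W \<in> mult_super V a mu"
proof -
  assume W: "Inv W"
  have "unv W e1 e2 \<in> mult_block V a mu e1 e2" for e1 e2
  proof -
    let ?W = "\<lambda>s. 1 / 2 * W s + sg (e1 \<noteq> e2) / 2 * app NN W s"
    have "Inv ?W" by (intro Inv_lin Inv_NN W)
    moreover have "app NN ?W = (\<lambda>s. sg (e1 \<noteq> e2) * ?W s)"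
      unfolding app_lin NN_NN by (simp add: algebra_simps)
    ultimately have "blk e1 e2 (\<lambda>b c. app (CM e1 b c) ?W)" by (rule blk_CM)
    then show ?thesis using blk_mult_block unfolding unv_def[symmetric] by blast
  qed
  then show ?thesis by (simp add: mult_super_def)
qed

lemma CM_trace: "(\<Sum>b\<in>UNIV. app (CM e b b) h s) = app (PM e) h s"
proof -
  have "app (\<Sum>b\<in>UNIV. CM e b b) h s = app (PM e) h s"
    unfolding CM_def PM_def casimir.CC_trace[OF cas_Md] ..
  then show ?thesis by (simp add: app_sum_left)
qed

lemma PM_sum: "app (PM True) h s + app (PM False) h s = h s"
proof -
  have "we True = - we False" by (simp add: we_def)
  then show ?thesis
    using we_nz[of False] unfolding PM_def casimir.PP_def[OF cas_Md[of True]] casimir.PP_def[OF cas_Md[of False]]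
    by (simp add: field_simps)
qed

text \<open>The diagonal matrix units sum to the projection for Omega, and the projections for both
  signs and both parities sum to the identity.\<close>

lemma mult_vec_unv: "mult_vec (unv W) = W"
proof
  fix s
  have "mult_vec (unv W) s = (\<Sum>e1\<in>UNIV. \<Sum>e2\<in>UNIV. app (PM e1) (\<lambda>s. 1 / 2 * W s + sg (e1 \<noteq> e2) / 2 * app NN W s) s)"
    unfolding mult_vec_def unv_def CM_trace ..
  also have "\<dots> = (\<Sum>e1\<in>UNIV. app (PM e1) W s)"
    unfolding app_lin by (simp add: UNIV_bool sg_def)
  also have "\<dots> = W s"
    using PM_sum[of W s] by (simp add: UNIV_bool add.commute)
  finally show "mult_vec (unv W) s = W s" .
qed

text \<open>The vector described by the matrix \<open>M\<close> in a block. Operators on the module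
  side multiply \<open>M\<close> from the left, those on the dual side from the right.\<close>

definition tv :: "(2 \<Rightarrow> 2 \<Rightarrow> tensor) \<Rightarrow> complex^2^2 \<Rightarrow> tensor"
  where "tv y M = (\<lambda>s. \<Sum>b\<in>UNIV. \<Sum>c\<in>UNIV. M $ b $ c * y b c s)"
definition tw :: "(2 \<Rightarrow> 2 \<Rightarrow> tensor) \<Rightarrow> tensor"
  where "tw y = (\<lambda>s. \<Sum>b\<in>UNIV. y b b s)"

context
  fixes e1 e2 y
  assumes y: "blk e1 e2 y"
begin

lemma tv_Md: "(\<And>c. yint X A (\<lambda>b. y b c)) \<Longrightarrow> app X (tv y M) = tv y (A ** M)"
  unfolding tv_def app_sum app_scale yint_def
  by (simp add: sum_2 matrix_matrix_mult_def algebra_simps)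

lemma tv_Dl: "(\<And>b. yint X (transpose A) (y b)) \<Longrightarrow> app X (tv y M) = tv y (M ** A)"
  unfolding tv_def app_sum app_scale yint_def
  by (simp add: sum_2 matrix_matrix_mult_def transpose_def algebra_simps)

lemma tv_gens:
  "app (cE Md) (tv y M) = tv y (mE (tm e1) ** M)" "app (cK Md) (tv y M) = tv y (mK (tm e1) ** M)"
  "app (cF Md) (tv y M) = tv y (mF (tm e1) ** M)"
  "app (cK Dl) (tv y M) = tv y (M ** (mat (sg (e1 \<noteq> e2) / zkap tx) ** mK (tm e1)))"
  "app (cE Dl) (tv y M) = tv y (M ** (mat (- (sg (e1 \<noteq> e2) / zkap tx)) ** (mE (tm e1) ** mK (tm e1))))"
  "app (cF Dl) (tv y M) = tv y (M ** (mat (- 1) ** mG (tm e1)))"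
  using y unfolding blk_def itm_def tm_dual[of e2 e1] by (blast intro!: tv_Md tv_Dl)+

lemma tv_scale: "tv y (mat c ** M) = (\<lambda>s. c * tv y M s)"
  by (simp add: tv_def mat_mult_entry sum_distrib_left mult.assoc)

lemma tw_tv: "tw y = tv y (mat 1)"
proof -
  have "(\<Sum>c\<in>UNIV. mat 1 $ b $ c * y b c s) = y b b s" for b s
  proof -
    have "(\<Sum>c\<in>UNIV. mat 1 $ b $ c * y b c s) = (\<Sum>c\<in>UNIV. if b = c then y b c s else 0)"
      by (rule sum.cong) (auto simp: mat_def)
    then show ?thesis by simp
  qed
  then show ?thesis by (simp add: tw_def tv_def)
qed

lemma tm_sq: "mK (tm e1) ** mK (tm e1) = mat (zkap tx)" "mK (tm e1) ** (mK (tm e1) ** A) = mat (zkap tx) ** A"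
  using tm_modrel[of e1] by (simp_all add: modrel_def matrix_mul_assoc)

lemma tw_NN: "app NN (tw y) = (\<lambda>s. sg (e1 \<noteq> e2) * tw y s)"
proof -
  have "app NN (tw y) = tv y (mK (tm e1) ** (mat (sg (e1 \<noteq> e2) / zkap tx) ** mK (tm e1)))"
    by (simp add: NN_def tw_tv tv_gens)
  also have "mK (tm e1) ** (mat (sg (e1 \<noteq> e2) / zkap tx) ** mK (tm e1)) = mat (sg (e1 \<noteq> e2)) ** mat 1"
    using tx_nz by (simp add: mr tm_sq)
  finally show ?thesis unfolding tv_scale tw_tv .
qed

text \<open>The identity matrix makes the left action and the antipode action cancel in
  \<open>DD_1\<close> and \<open>DD_2\<close>.\<close>

lemma tw_Inv: "Inv (tw y)"
proof -
  have "tw y \<in> tens (positions n)" unfolding tw_def using y by (intro tens_sum) (simp add: blk_def)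
  moreover have "app (DD n \<nu>) (tw y) = (\<lambda>s. 0)" for \<nu>
  proof -
    let ?z = "sg (e1 \<noteq> e2) / zkap tx" and ?k = "zkap tx" and ?K = "mK (tm e1)" and ?E = "mE (tm e1)"
    have "app (lo.sm (4 * kpre (Suc n)) (DD n 2)) (tw y) = (\<lambda>s. 0)"
    proof -
      have "app (lo.sm (4 * kpre (Suc n)) (DD n 2)) (tw y) = (\<lambda>s. tv y (?K ** ?E) s + ?k * tv y (?K ** (mat (- ?z) ** (?E ** ?K) ** (mat ?z ** ?K))) s)"
        unfolding DD_2 unfolding total_kap[symmetric] by (simp add: tw_tv tv_gens)
      also have "?K ** (mat (- ?z) ** (?E ** ?K) ** (mat ?z ** ?K)) = mat (- (?z * ?z)) ** (?K ** (?E ** (?K ** ?K)))"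
        by (simp add: mr matrix_mul_assoc[symmetric])
      also have "\<dots> = mat (- (1 / ?k)) ** (?K ** ?E)"
        using tx_nz unfolding tm_sq(1) mat_mult_comm[of "mE (tm e1)"] mr by (simp add: sg_def)
      finally show ?thesis
        using tx_nz by (simp add: tv_scale)
    qed
    moreover have "app (lo.sm (- 4 * \<i>) (DD n 1)) (tw y) = (\<lambda>s. 0)"
    proof -
      have "app (lo.sm (- 4 * \<i>) (DD n 1)) (tw y) = (\<lambda>s. tv y (mF (tm e1)) s + 1 / ?k * tv y (?K ** (mat (- 1) ** mG (tm e1))) s)"
        unfolding DD_1 total_kap[symmetric] by (simp add: tw_tv tv_gens)
      also have "?K ** (mat (- 1) ** mG (tm e1)) = mat (- ?k) ** mF (tm e1)"
        unfolding mr mG_def tm_sq by (simp add: mr)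
      finally show ?thesis
        using tx_nz by (simp add: tv_scale)
    qed
    moreover have "kpre (Suc n) \<noteq> 0" using tx_nz by (simp add: total_kap)
    moreover have "\<nu> = 1 \<or> \<nu> = 2" using exhaust_2 by auto
    ultimately show ?thesis by (auto simp: fun_eq_iff)
  qed
  ultimately show ?thesis by (simp add: Inv_def)
qed

text \<open>Matrix units for the other sign vanish because Omega has the opposite eigenvalue; those
  for the right sign extract a single coordinate.\<close>

lemma tw_CM: "app (CM e b c) (tw y) = (if e = e1 then y b c else (\<lambda>s. 0))"
proof (cases "e = e1")
  case True
  have "app (CM e1 b c) (y b' b') = (if c = b' then y b b' else (\<lambda>s. 0))" for b'
    unfolding CM_def using casimir.itm_CC[OF cas_Md, of e1 "\<lambda>b. y b b'" b c b'] y by (simp add: blk_def)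
  then have "app (CM e1 b c) (tw y) = (\<lambda>s. \<Sum>b'\<in>UNIV. if c = b' then y b b' s else 0)"
    unfolding tw_def app_sum by (intro ext sum.cong) auto
  then show ?thesis using True by simp
next
  case False
  then have w: "we e = - we e1" by (cases e; cases e1) (auto simp: we_def)
  have "app (PM e) (y b' b') = (\<lambda>s. 0)" for b'
  proof -
    have "app (lo.om (cE Md) (cF Md) (cK Md) (cKi Md)) (y b' b') = (\<lambda>s. we e1 * y b' b' s)"
      using casimir.itm_Om[OF cas_Md, of e1 "\<lambda>b. y b b'" b'] y by (simp add: blk_def)
    then show ?thesis
      using we_nz[of e1] unfolding PM_def casimir.PP_def[OF cas_Md[of e]] unfolding w by (simp add: fun_eq_iff)
  qed
  then have p: "app (PM e) (tw y) = (\<lambda>s. 0)"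
    unfolding tw_def app_sum by simp
  have "app (CM e b c) (tw y) = (\<lambda>s. 0)"
    unfolding CM_def casimir.CC_def[OF cas_Md] PM_def[symmetric] app_sum_left by (simp add: p)
  then show ?thesis using False by simp
qed

end

lemma super_blk: "y \<in> mult_super V a mu \<Longrightarrow> blk e1 e2 (y e1 e2)"
  using mult_block_blk by (simp add: mult_super_def)

lemma mult_vec_tw: "mult_vec y = (\<lambda>s. \<Sum>e1\<in>UNIV. \<Sum>e2\<in>UNIV. 1 * tw (y e1 e2) s)"
  by (simp add: mult_vec_def tw_def)

lemma super_Inv: "y \<in> mult_super V a mu \<Longrightarrow> Inv (mult_vec y)"
  using tw_Inv[OF super_blk[of y]]
  unfolding mult_vec_tw Inv_def app_sum by (auto intro!: tens_sum)

lemma NN_mult_vec: "y \<in> mult_super V a mu \<Longrightarrow>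
    app NN (mult_vec y) = (\<lambda>s. \<Sum>e1\<in>UNIV. \<Sum>e2\<in>UNIV. sg (e1 \<noteq> e2) * tw (y e1 e2) s)"
  using tw_NN[OF super_blk[of y]] unfolding mult_vec_tw app_sum by simp

lemma unv_mult_vec:
  assumes y: "y \<in> mult_super V a mu"
  shows "unv (mult_vec y) = y"
proof -
  have "unv (mult_vec y) e1 e2 b c s = y e1 e2 b c s" for e1 e2 b c s
  proof -
    have "(\<lambda>s. 1 / 2 * mult_vec y s + sg (e1 \<noteq> e2) / 2 * app NN (mult_vec y) s) =
        (\<lambda>s. \<Sum>d1\<in>UNIV. \<Sum>d2\<in>UNIV. (1 / 2 + sg (e1 \<noteq> e2) / 2 * sg (d1 \<noteq> d2)) * tw (y d1 d2) s)"
      unfolding NN_mult_vec[OF y] unfolding mult_vec_tw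
      by (cases e1; cases e2) (simp_all add: UNIV_bool sg_def algebra_simps add_divide_distrib)
    then have "unv (mult_vec y) e1 e2 b c s = (\<Sum>d1\<in>UNIV. \<Sum>d2\<in>UNIV.
        (1 / 2 + sg (e1 \<noteq> e2) / 2 * sg (d1 \<noteq> d2)) * app (CM e1 b c) (tw (y d1 d2)) s)"
      unfolding unv_def by (simp only: app_sum app_scale)
    also have "\<dots> = y e1 e2 b c s"
      unfolding tw_CM[OF super_blk[OF y]] by (cases e1; cases e2) (simp_all add: UNIV_bool sg_def)
    finally show ?thesis .
  qed
  then show ?thesis by (intro ext)
qed

lemma unv_part:
  assumes W: "Inv W" and N: "app NN W = (\<lambda>s. sg par * W s)"
  shows "unv W \<in> mult_part V a mu par"
proof -
  have "unv W e1 e2 = (\<lambda>b c s. 0)" if "(e1 \<noteq> e2) \<noteq> par" for e1 e2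
  proof -
    have "(\<lambda>s. 1 / 2 * W s + sg (e1 \<noteq> e2) / 2 * app NN W s) = (\<lambda>s. 0)"
      unfolding N using that by (auto simp: sg_def)
    then show ?thesis unfolding unv_def by auto
  qed
  then show ?thesis using unv_super[OF W] by (simp add: mult_part_def)
qed

lemma part_NN:
  assumes y: "y \<in> mult_part V a mu par"
  shows "app NN (mult_vec y) = (\<lambda>s. sg par * mult_vec y s)"
proof -
  have s: "y \<in> mult_super V a mu" using y by (simp add: mult_part_def)
  have "sg (e1 \<noteq> e2) * tw (y e1 e2) s = sg par * tw (y e1 e2) s" for e1 e2 s
  proof (cases "(e1 \<noteq> e2) = par")
    case False
    then have "y e1 e2 = (\<lambda>b c s. 0)" using y by (simp add: mult_part_def)
    then show ?thesis by (simp add: tw_def)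
  qed simp
  then show ?thesis
    unfolding NN_mult_vec[OF s] unfolding mult_vec_tw by (simp only: sum_distrib_left mult_1_left)
qed

end

section \<open>The two isomorphisms\<close>

context tuple
begin

lemma vv_ideal: "y \<in> exI \<Longrightarrow> vv y = (\<lambda>s. 0)"
  using actL_cliff_ideal[OF hF_ideal[of y]] by (simp add: vv_def)

lemma vv_diff: "vv (x - y) = (\<lambda>s. vv x s - vv y s)"
  by (simp add: vv_def hF_simps lo.ev_diff)

lemma vv_act: "hF z - x \<in> cliff_ideal a \<Longrightarrow> vv z = app (actL V a x) (vac n)"
  using actL_cliff_ideal[of "hF z - x"] by (simp add: vv_def lo.ev_diff)

lemma vv_inj: "x \<in> carrier (free_ring H) \<Longrightarrow> hF x \<in> cliff_ideal a \<Longrightarrow> x \<in> exI"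
  using vv_ideal_inj[of x] vv_ideal vv_act[of x 0] by simp

definition "Phi = quot_map (cliff (length a)) (cliff_ideal a) hF"

lemma Phi_cls: "x \<in> carrier (free_ring H) \<Longrightarrow> Phi (ext_cls H x) = cliff_cls a (hF x)"
  using ph.quot_map_coset[of x] by (simp add: Phi_def ext_cls_def cliff_cls_def)

lemma cls_eq: "x \<in> carrier (cliff n) \<Longrightarrow> y \<in> carrier (cliff n) \<Longrightarrow> cliff_cls a x = cliff_cls a y \<longleftrightarrow> x - y \<in> cliff_ideal a"
  unfolding cliff_cls_def n_def by (rule ci.coset_eq)

lemma red_carrier: "X \<in> carrier (cliff_red a) \<longleftrightarrow> (\<exists>x\<in>carrier (cliff n). X = cliff_cls a x)"
  using ph.coset_carrier'[of X] by (simp add: cliff_red_def cliff_cls_def n_def)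

lemma ext_carrier: "X \<in> carrier (exterior H) \<longleftrightarrow> (\<exists>x\<in>carrier (free_ring H). X = ext_cls H x)"
  using ph.coset_carrier[of X] by (simp add: exterior_def ext_cls_def)

lemma Phi_iso_Phi: "Phi_iso a Phi"
  unfolding Phi_iso_def
proof (intro conjI allI impI)
  show "Phi \<in> ring_iso (exterior H) (cliff_red a)"
    unfolding Phi_def exterior_def cliff_red_def
  proof (rule ph.quot_map_iso)
    show "x \<in> exI" if "x \<in> carrier (free_ring H)" "hF x \<in> cliff_ideal a" for x
      using vv_inj that by blast
    show "\<exists>x\<in>carrier (free_ring H). cliff_ideal a +>\<^bsub>cliff (length a)\<^esub> hF x = cliff_ideal a +>\<^bsub>cliff (length a)\<^esub> y"
      if y: "y \<in> carrier (cliff (length a))" for y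
    proof -
      obtain z where z: "z \<in> carrier (free_ring H)" "hF z - y \<in> cliff_ideal a"
        using cliff_lift[of y] y by (auto simp: n_def)
      then show ?thesis
        using ci.coset_eq[of "hF z" a y] hF_carrier[of z] y by (auto simp: n_def)
    qed
  qed
next
  fix c show "Phi (ext_cls H (cst c)) = cliff_cls a (cst c)"
    by (simp add: Phi_cls hF_simps)
next
  fix j \<nu> assume "1 \<le> j \<and> j < length a"
  then show "Phi (ext_cls H (gvar (vbas a j \<nu>))) = cliff_cls a (theta (length a) j \<nu>)"
    using vbas_H1lf[OF regular] thF_vbas[of j \<nu>] by (simp add: Phi_cls hF_simps n_def)
next
  fix par
  have 1: "ext_part H par = {ext_cls H x | x. hmg par x}"
    by (simp add: ext_part_def hmg_def)
  show "Phi ` ext_part H par = cliff_part a par"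
  proof
    show "Phi ` ext_part H par \<subseteq> cliff_part a par"
    proof
      fix X assume "X \<in> Phi ` ext_part H par"
      then obtain z where z: "hmg par z" "X = Phi (ext_cls H z)" by (auto simp: 1)
      have "X = cliff_cls a (hF z)" using z by (simp add: Phi_cls hmg_def)
      then show "X \<in> cliff_part a par"
        using hF_hom[OF z(1)] by (auto simp: cliff_part_def n_def)
    qed
    show "cliff_part a par \<subseteq> Phi ` ext_part H par"
    proof
      fix X assume "X \<in> cliff_part a par"
      then obtain x where x: "X = cliff_cls a x" "(x, par) \<in> cliff_hom n"
        by (auto simp: cliff_part_def n_def)
      obtain z where z: "hmg par z" "hF z - x \<in> cliff_ideal a" "x \<in> carrier (cliff n)"
        using cliff_hom_lift[OF x(2)] by blast
      have "X = Phi (ext_cls H z)"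
        using z cls_eq[OF hF_carrier[of z] z(3)] Phi_cls[of z] by (simp add: x(1) hmg_def)
      moreover have "ext_cls H z \<in> ext_part H par" unfolding 1 using z(1) by blast
      ultimately show "X \<in> Phi ` ext_part H par" by (rule image_eqI)
    qed
  qed
qed

lemma hmg_split: "z \<in> carrier (free_ring H) \<Longrightarrow> \<exists>z0 z1. hmg False z0 \<and> hmg True z1 \<and> z = z0 + z1"
proof (induction rule: free_ring_induct)
  case (cst c)
  have "cst c = cst c + 0" by simp
  then show ?case using hmg_cst hmg_0 by blast
next
  case (gvar_mult d x)
  then obtain z0 z1 where z: "hmg False z0" "hmg True z1" "x = z0 + z1" by blast
  have "gvar d * x = gvar d * z1 + gvar d * z0" by (simp add: z(3) distrib_left add.commute)
  moreover have "hmg False (gvar d * z1)" "hmg True (gvar d * z0)"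
    using hmg_mult[OF hmg_gvar[OF gvar_mult(1)] z(2)] hmg_mult[OF hmg_gvar[OF gvar_mult(1)] z(1)] by simp_all
  ultimately show ?case by blast
next
  case (add x y)
  then obtain x0 x1 y0 y1 where h: "hmg False x0" "hmg True x1" "x = x0 + x1" "hmg False y0" "hmg True y1" "y = y0 + y1"
    by blast
  have "x + y = (x0 + y0) + (x1 + y1)" unfolding h(3,6) by simp
  then show ?case using hmg_add[OF h(1,4)] hmg_add[OF h(2,5)] by blast
qed

end

context total
begin

text \<open>The element may be replaced by its normal form, which the two unpaired annihilators at
  \<open>j = n\<close> kill by \<open>nfs_Dp\<close>.\<close>

lemma vv_Inv: "z \<in> carrier (free_ring H) \<Longrightarrow> Inv (vv z)"
proof -
  assume z: "z \<in> carrier (free_ring H)"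
  obtain y where y: "y \<in> nfs (2 * (n - 1))" "z - y \<in> exI"
    using normal_form[OF z] by (auto simp: NF_def)
  have e: "vv z = vv y"
    using vv_ideal[OF y(2)] by (simp add: vv_diff fun_eq_iff)
  have "vv z \<in> tens (positions n)"
    using tens_actL[of "hF z" "positions n" "vac n"] cliff_uring[OF hF_carrier[of z]] vac_tens
    by (simp add: vv_def uring_def)
  moreover have "app (DD n \<nu>) (vv y) = (\<lambda>s. 0)" for \<nu>
  proof (cases "n = 0")
    case False
    then obtain i where i: "sj i = n" "sn i = \<nu>" "i < 2 * n"
      using sj_sn_surj[of n \<nu> n] by auto
    then have "2 * (n - 1) \<le> i" unfolding sj_def by simp
    then show ?thesis using nfs_Dp[OF y(1) order_refl _ i(3)] i by simp
  qed (simp add: DD_def)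
  ultimately show ?thesis by (simp add: Inv_def e)
qed

lemma act_Inv: "x \<in> carrier (cliff n) \<Longrightarrow> Inv (app (actL V a x) (vac n))"
  using cliff_lift[of x] vv_Inv vv_act by metis

lemma Inv_vv: "Inv W \<Longrightarrow> \<exists>z\<in>carrier (free_ring H). vv z = W"
proof -
  assume W: "Inv W"
  have "app (Dp i) W = (\<lambda>s. 0)" if "2 * (n - 1) \<le> i" "i < 2 * n" for i
  proof -
    have "sj i = n" using that unfolding sj_def by auto
    then show ?thesis using W by (simp add: Inv_def)
  qed
  then obtain x where "x \<in> nfs (2 * (n - 1))" "vv x = W"
    using nfs_surj[of W "2 * (n - 1)"] W by (auto simp: Inv_def)
  then show ?thesis using nfs_carrier by blast
qed

text \<open>The choice of representative is harmless: the ideal acts by the zero operator on the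
  tensors.\<close>

definition "Psi X = unv (app (actL V a (SOME x. x \<in> carrier (cliff n) \<and> X = cliff_cls a x)) (vac n))"

lemma Psi_cls: "x \<in> carrier (cliff n) \<Longrightarrow> Psi (cliff_cls a x) = unv (app (actL V a x) (vac n))"
proof -
  assume x: "x \<in> carrier (cliff n)"
  define y where "y = (SOME y. y \<in> carrier (cliff n) \<and> cliff_cls a x = cliff_cls a y)"
  have y: "y \<in> carrier (cliff n) \<and> cliff_cls a x = cliff_cls a y"
    unfolding y_def by (rule someI[of _ x]) (use x in simp)
  then have "x - y \<in> cliff_ideal a" using cls_eq[OF x, of y] by simp
  then have "actL V a x = actL V a y"
    using actL_cliff_ideal[of "x - y"] by (simp add: lo.ev_diff)
  then show ?thesis unfolding Psi_def y_def[symmetric] by simp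
qed

lemma Psi_Phi: "x \<in> carrier (free_ring H) \<Longrightarrow> Psi (Phi (ext_cls H x)) = unv (vv x)"
  by (simp add: Phi_cls Psi_cls hF_carrier vv_def)

lemma mult_vec_psi: "x \<in> carrier (cliff n) \<Longrightarrow> mult_vec (Psi (cliff_cls a x)) = app (actL V a x) (vac n)"
  by (simp add: Psi_cls mult_vec_unv)

lemma hom_NN: "(x, par) \<in> cliff_hom n \<Longrightarrow>
    app NN (app (actL V a x) (vac n)) = (\<lambda>s. sg par * app (actL V a x) (vac n) s)"
proof -
  assume "(x, par) \<in> cliff_hom n"
  from cliff_hom_NN[OF this] have "NN * actL V a x = (if par then - (actL V a x * NN) else actL V a x * NN)"
    by (simp add: sw_def)
  then have "app (NN * actL V a x) (vac n) = app (if par then - (actL V a x * NN) else actL V a x * NN) (vac n)"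
    by simp
  then show ?thesis
    using NN_vac by (cases par) (auto simp: sg_def)
qed

lemma psi_part: "Psi ` cliff_part a par = mult_part V a mu par"
proof
  show "Psi ` cliff_part a par \<subseteq> mult_part V a mu par"
  proof
    fix Y assume "Y \<in> Psi ` cliff_part a par"
    then obtain x where x: "Y = Psi (cliff_cls a x)" "(x, par) \<in> cliff_hom n"
      by (auto simp: cliff_part_def n_def)
    have c: "x \<in> carrier (cliff n)" using cliff_hom_lift[OF x(2)] by blast
    show "Y \<in> mult_part V a mu par"
      unfolding x(1) Psi_cls[OF c] by (rule unv_part[OF act_Inv[OF c] hom_NN[OF x(2)]])
  qed
  show "mult_part V a mu par \<subseteq> Psi ` cliff_part a par"
  proof
    fix y assume y: "y \<in> mult_part V a mu par"
    then have s: "y \<in> mult_super V a mu" by (simp add: mult_part_def)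
    obtain z where z: "z \<in> carrier (free_ring H)" "vv z = mult_vec y"
      using Inv_vv[OF super_Inv[OF s]] by blast
    obtain z0 z1 where h: "hmg False z0" "hmg True z1" "z = z0 + z1" using hmg_split[OF z(1)] by blast
    define zp where "zp = (if par then z1 else z0)"
    have hp: "hmg par zp" using h by (simp add: zp_def)
    have N: "app NN (vv z0) = vv z0" "app NN (vv z1) = (\<lambda>s. - vv z1 s)"
      using hom_NN[OF hF_hom[OF h(1)]] hom_NN[OF hF_hom[OF h(2)]] by (simp_all add: vv_def sg_def)
    have e: "mult_vec y = (\<lambda>s. vv z0 s + vv z1 s)"
      using z(2) by (simp add: h(3) vv_add)
    \<comment> \<open>Comparing the eigenvalue of \<open>NN\<close> on the whole vector with those
      on its even and odd parts annihilates the part of wrong parity.\<close>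
    have q: "vv z0 s + - vv z1 s = sg par * (vv z0 s + vv z1 s)" for s
      by (rule fun_cong[OF part_NN[OF y, unfolded e app_add N]])
    have "mult_vec y s = vv zp s" for s
    proof (cases par)
      case True
      have "vv z0 s = ((vv z0 s + - vv z1 s) + (vv z0 s + vv z1 s)) / 2" by simp
      also have "\<dots> = 0" unfolding q using True by (simp add: sg_def)
      finally show ?thesis using True by (simp add: e zp_def)
    next
      case False
      have "vv z1 s = ((vv z0 s + vv z1 s) - (vv z0 s + - vv z1 s)) / 2" by simp
      also have "\<dots> = 0" unfolding q using False by (simp add: sg_def)
      finally show ?thesis using False by (simp add: e zp_def)
    qed
    then have "mult_vec y = vv zp" by (rule ext)
    then have "y = unv (vv zp)" using unv_mult_vec[OF s] by simp
    then have "y = Psi (cliff_cls a (hF zp))"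
      by (simp add: Psi_cls hF_carrier vv_def)
    then show "y \<in> Psi ` cliff_part a par"
      using hF_hom[OF hp] by (auto simp: cliff_part_def n_def)
  qed
qed

lemma mult_iso_psi: "mult_iso V a mu Psi"
proof -
  have ops: "cliff_cls a x \<oplus>\<^bsub>cliff_red a\<^esub> cliff_cls a y = cliff_cls a (x + y)"
    "cliff_cls a x \<otimes>\<^bsub>cliff_red a\<^esub> cliff_cls a y = cliff_cls a (x * y)"
    if "x \<in> carrier (cliff n)" "y \<in> carrier (cliff n)" for x y
  proof -
    have o: "x \<oplus>\<^bsub>cliff (length a)\<^esub> y = x + y" "x \<otimes>\<^bsub>cliff (length a)\<^esub> y = x * y" by simp_all
    show "cliff_cls a x \<oplus>\<^bsub>cliff_red a\<^esub> cliff_cls a y = cliff_cls a (x + y)"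
      using ph.coset_ops'(2)[OF that[unfolded n_def]] unfolding o cliff_red_def cliff_cls_def .
    show "cliff_cls a x \<otimes>\<^bsub>cliff_red a\<^esub> cliff_cls a y = cliff_cls a (x * y)"
      using ph.coset_ops'(1)[OF that[unfolded n_def]] unfolding o cliff_red_def cliff_cls_def .
  qed
  have inj: "inj_on Psi (carrier (cliff_red a))"
  proof (rule inj_onI)
    fix X Y assume "X \<in> carrier (cliff_red a)" "Y \<in> carrier (cliff_red a)" and e: "Psi X = Psi Y"
    then obtain x y where x: "x \<in> carrier (cliff n)" "X = cliff_cls a x" "y \<in> carrier (cliff n)" "Y = cliff_cls a y"
      unfolding red_carrier by blast
    have v: "app (actL V a x) (vac n) = app (actL V a y) (vac n)"
      using e mult_vec_psi[OF x(1)] mult_vec_psi[OF x(3)] by (simp add: x(2,4))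
    have d: "x - y \<in> carrier (cliff n)" using x(1,3) by (rule cl.diff_closed)
    obtain z where z: "z \<in> carrier (free_ring H)" "hF z - (x - y) \<in> cliff_ideal a"
      using cliff_lift[OF d] by blast
    have "vv z = (\<lambda>s. 0)"
      using vv_act[OF z(2)] v by (simp add: lo.ev_diff)
    then have "hF z \<in> cliff_ideal a"
      using vv_ideal_inj[OF z(1)] vv_ideal hF_ideal by blast
    from ci.diffI[OF this z(2)] have "x - y \<in> cliff_ideal a" by simp
    then show "X = Y" using cls_eq[OF x(1,3)] by (simp add: x(2,4))
  qed
  have img: "Psi ` carrier (cliff_red a) = mult_super V a mu"
  proof
    show "Psi ` carrier (cliff_red a) \<subseteq> mult_super V a mu"
    proof
      fix Y assume "Y \<in> Psi ` carrier (cliff_red a)"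
      then obtain x where x: "x \<in> carrier (cliff n)" "Y = Psi (cliff_cls a x)" by (auto simp: red_carrier)
      show "Y \<in> mult_super V a mu" unfolding x(2) Psi_cls[OF x(1)] by (rule unv_super[OF act_Inv[OF x(1)]])
    qed
    show "mult_super V a mu \<subseteq> Psi ` carrier (cliff_red a)"
    proof
      fix y assume y: "y \<in> mult_super V a mu"
      obtain z where z: "z \<in> carrier (free_ring H)" "vv z = mult_vec y"
        using Inv_vv[OF super_Inv[OF y]] by blast
      have "y = Psi (cliff_cls a (hF z))"
        using unv_mult_vec[OF y] z by (simp add: Psi_cls hF_carrier vv_def)
      moreover have "cliff_cls a (hF z) \<in> carrier (cliff_red a)"
        unfolding red_carrier using hF_carrier by blast
      ultimately show "y \<in> Psi ` carrier (cliff_red a)" by (rule image_eqI)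
    qed
  qed
  show ?thesis
    unfolding mult_iso_def
  proof (intro conjI ballI allI)
    show "bij_betw Psi (carrier (cliff_red a)) (mult_super V a mu)"
      using inj img by (simp add: bij_betw_def)
    fix X Y assume "X \<in> carrier (cliff_red a)" "Y \<in> carrier (cliff_red a)"
    then obtain x y where x: "x \<in> carrier (cliff n)" "X = cliff_cls a x" "y \<in> carrier (cliff n)" "Y = cliff_cls a y"
      unfolding red_carrier by blast
    show "Psi (X \<oplus>\<^bsub>cliff_red a\<^esub> Y) = (\<lambda>e1 e2 b c s. Psi X e1 e2 b c s + Psi Y e1 e2 b c s)"
      using unv_lin[of 1 "app (actL V a x) (vac n)" 1 "app (actL V a y) (vac n)"] x
      by (simp add: ops Psi_cls cliff_add lo.ev_add fun_eq_iff)
  next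
    fix k X assume "X \<in> carrier (cliff_red a)"
    then obtain x where x: "x \<in> carrier (cliff n)" "X = cliff_cls a x"
      unfolding red_carrier by blast
    show "Psi (cliff_cls a (cst k) \<otimes>\<^bsub>cliff_red a\<^esub> X) = (\<lambda>e1 e2 b c s. k * Psi X e1 e2 b c s)"
      using unv_lin[of k "app (actL V a x) (vac n)" 0 "app (actL V a x) (vac n)"] x
      by (simp add: ops Psi_cls cliff_mult cliff_cst lo.ev_mult fun_eq_iff)
  next
    fix par show "Psi ` cliff_part a par = mult_part V a mu par" by (rule psi_part)
  next
    fix x assume "x \<in> carrier (cliff (length a))"
    then show "mult_vec (Psi (cliff_cls a x)) = act V a x (vac (length a))"
      using mult_vec_psi[of x] by (simp add: n_def act_actL)
  qed
qed

end

section \<open>The Burau map\<close>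

lemma bs_append: "braid_subst g (u @ v) = braid_subst g u @ braid_subst g v"
  and bs_Nil: "braid_subst g [] = []"
  and bs_Cons: "braid_subst g (l # w) = (if snd l then artin g (fst l) else word_inv (artin g (fst l))) @ braid_subst g w"
  by (cases l; simp add: braid_subst_def)+

lemma word_inv_Cons: "word_inv (l # w) = word_inv w @ [(fst l, \<not> snd l)]"
  and word_inv_Nil: "word_inv [] = []"
  by (simp_all add: word_inv_def case_prod_beta)

lemma word_inv_inv: "word_inv (word_inv w) = w"
  by (simp add: word_inv_def rev_map comp_def case_prod_beta)

lemma word_inv_fwords: "word_inv w \<in> fwords n \<longleftrightarrow> w \<in> fwords n"
  by (induction w) (auto simp: word_inv_Cons word_inv_Nil fwords_append fwords_Cons)

lemma H1lf_winv:
  assumes d: "d \<in> H1lf a" and a: "regular a"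
  shows "u \<in> fwords (length a) \<Longrightarrow> d (x @ u @ word_inv u @ y) = d (x @ y)"
proof (induction u arbitrary: x y)
  case (Cons l u)
  have "x @ (l # u) @ word_inv (l # u) @ y = (x @ [l]) @ u @ word_inv u @ ((fst l, \<not> snd l) # y)"
    by (simp add: word_inv_Cons)
  then have "d (x @ (l # u) @ word_inv (l # u) @ y) = d ((x @ [l]) @ ((fst l, \<not> snd l) # y))"
    using Cons by (simp only: fwords_Cons)
  then show ?case
    using H1lf_cancel[OF d a, of "fst l" x "snd l" y] Cons.prems by (simp add: fwords_Cons)
qed (simp add: word_inv_Nil)

lemma rho_winv:
  assumes a: "regular a"
  shows "u \<in> fwords (length a) \<Longrightarrow> rho a (x @ u @ word_inv u @ y) = rho a (x @ y)"
proof (induction u arbitrary: x y)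
  case (Cons l u)
  have "x @ (l # u) @ word_inv (l # u) @ y = (x @ [l]) @ u @ word_inv u @ ((fst l, \<not> snd l) # y)"
    by (simp add: word_inv_Cons)
  then have "rho a (x @ (l # u) @ word_inv (l # u) @ y) = rho a ((x @ [l]) @ ((fst l, \<not> snd l) # y))"
    using Cons by (simp only: fwords_Cons)
  then show ?case
    using rho_cancel[OF a, of "fst l" x "snd l" y] Cons.prems by (simp add: fwords_Cons del: rho.simps)
qed (simp add: word_inv_Nil)

lemma rho_word_inv:
  assumes a: "regular a" and u: "u \<in> fwords (length a)"
  shows "rho a (word_inv u) = matrix_inv (rho a u)"
proof -
  have "rho a u ** rho a (word_inv u) = mat 1" if "u \<in> fwords (length a)" for u
    using rho_winv[OF a that, of "[]" "[]"] by (simp add: rho_append)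
  from this[OF u] this[of "word_inv u"] show ?thesis
    using matrix_inv_eqI(1)[of "rho a u" "rho a (word_inv u)"] u by (simp add: word_inv_fwords word_inv_inv)
qed

lemma artin_fwords: "1 \<le> i \<Longrightarrow> i < n \<Longrightarrow> g \<in> {Sig i, SigInv i} \<Longrightarrow> artin g j \<in> fwords n \<longleftrightarrow> j \<in> {1..n}"
  by (auto simp: fwords_Cons split: if_splits)

lemma bs_fwords: "1 \<le> i \<Longrightarrow> i < n \<Longrightarrow> g \<in> {Sig i, SigInv i} \<Longrightarrow> braid_subst g w \<in> fwords n \<longleftrightarrow> w \<in> fwords n"
proof (induction w)
  case (Cons l w)
  then show ?case
    using artin_fwords[OF Cons.prems, of "fst l"]
    by (simp only: bs_Cons fwords_append fwords_Cons word_inv_fwords split: if_split) auto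
qed (simp add: bs_Nil)

lemma rho_subst:
  assumes a: "regular a" and i: "1 \<le> i" "i < length a" "g \<in> {Sig i, SigInv i}" and len: "length b = length a"
    and r: "\<And>j. j \<in> {1..length a} \<Longrightarrow> rho a (artin g j) = rho_gen b j"
  shows "u \<in> fwords (length a) \<Longrightarrow> rho a (braid_subst g u) = rho b u"
proof (induction u)
  case (Cons l u)
  then have l: "fst l \<in> {1..length a}" "u \<in> fwords (length a)" by (auto simp: fwords_Cons)
  have "rho a (word_inv (artin g (fst l))) = matrix_inv (rho_gen b (fst l))"
    using rho_word_inv[OF a, of "artin g (fst l)"] artin_fwords[OF i] l r by simp
  then show ?case
    using Cons.IH[OF l(2)] r[OF l(1)] by (simp add: bs_Cons rho_append)
qed (simp add: bs_Nil)

lemma bs_y_low: "1 \<le> i \<Longrightarrow> g \<in> {Sig i, SigInv i} \<Longrightarrow> j < i \<Longrightarrow> braid_subst g (y_loop j) = y_loop j"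
  by (induction j) (auto simp: bs_Nil y_loop_Suc bs_Cons)

text \<open>Holds only after free reduction, hence the evaluation on a class. The prefix
  \<open>x\<close> lets the induction strip the leading letter, which the generator fixes beyond
  \<open>Suc i\<close>.\<close>

lemma bs_y_high:
  assumes d: "d \<in> H1lf a" and a: "regular a" and i: "1 \<le> i" "g \<in> {Sig i, SigInv i}" and j: "Suc i \<le> j" "j \<le> length a"
  shows "d (x @ braid_subst g (y_loop j)) = d (x @ y_loop j)"
  using j
proof (induction j arbitrary: x rule: dec_induct)
  case base
  obtain k where k: "i = Suc k" using i by (cases i) auto
  have y: "braid_subst g (y_loop k) = y_loop k" using bs_y_low[OF i] k by simp
  show ?case
  proof (cases "g = Sig i")
    case True
    have "braid_subst g (y_loop (Suc i)) = [(i, True), (i, False)] @ (Suc i, True) # (i, True) # y_loop k"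
      using y True by (simp add: k y_loop_Suc bs_Cons)
    then show ?thesis
      using H1lf_cancel[OF d a, of i x True "(Suc i, True) # (i, True) # y_loop k"] base i
      by (simp add: k y_loop_Suc)
  next
    case False
    then have g: "g = SigInv i" using i by auto
    have "braid_subst g (y_loop (Suc i)) = [(Suc i, True), (i, True)] @ [(Suc i, False), (Suc i, True)] @ y_loop k"
      using y g by (simp add: k y_loop_Suc bs_Cons)
    then show ?thesis
      using H1lf_cancel[OF d a, of "Suc i" "x @ [(Suc i, True), (i, True)]" False "y_loop k"] base i
      by (simp add: k y_loop_Suc)
  qed
next
  case (step j)
  have "braid_subst g (y_loop (Suc j)) = (Suc j, True) # braid_subst g (y_loop j)"
    using step i by (auto simp: y_loop_Suc bs_Cons)
  then show ?case
    using step.IH[of "x @ [(Suc j, True)]"] step.prems by (simp add: y_loop_Suc)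
qed

text \<open>The substitution carries one representation to the other, preserves inverse pairs up to
  reduction, and fixes the boundary loop; these are the conditions defining a class.\<close>

lemma subst_H1lf:
  assumes a: "regular a" "regular b" and i: "1 \<le> i" "i < length a" "g \<in> {Sig i, SigInv i}" and len: "length b = length a"
    and r: "\<And>j. j \<in> {1..length a} \<Longrightarrow> rho a (artin g j) = rho_gen b j"
    and d: "d \<in> H1lf a"
  shows "d \<circ> braid_subst g \<in> H1lf b"
  unfolding H1lf_def
proof (safe, goal_cases)
  case (1 w)
  then show ?case using H1lf_out[OF d] bs_fwords[OF i] len by simp
next
  case (2 u v)
  then show ?case
    using H1lf_append[OF d] bs_fwords[OF i] len rho_subst[OF a(1) i len r] by (simp add: bs_append)
next
  case (3 j)
  have "artin g j \<in> fwords (length a)" using 3 artin_fwords[OF i, of j] len by simp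
  from H1lf_winv[OF d a(1) this, of "[]" "[]"] show ?case
    by (simp add: bs_Cons bs_Nil H1lf_Nil[OF d])
next
  case (4 j)
  have "word_inv (artin g j) \<in> fwords (length a)" using 4 artin_fwords[OF i, of j] len by (simp add: word_inv_fwords)
  from H1lf_winv[OF d a(1) this, of "[]" "[]"] show ?case
    by (simp add: bs_Cons bs_Nil H1lf_Nil[OF d] word_inv_inv)
next
  case 5
  show ?case
    using bs_y_high[OF d a(1) i(1,3), of "length a" "[]"] i len H1lf_y[OF d] by simp
qed

lemma matrix_inv_mult:
  assumes "invertible (A :: complex^2^2)" "invertible (B :: complex^2^2)"
  shows "matrix_inv (A ** B) = matrix_inv B ** matrix_inv A"
proof (rule matrix_inv_eqI)
  note A = invertible_inv[OF assms(1)] and B = invertible_inv[OF assms(2)]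
  have "A ** B ** (matrix_inv B ** matrix_inv A) = A ** (B ** matrix_inv B) ** matrix_inv A"
    by (simp only: matrix_mul_assoc)
  then show "A ** B ** (matrix_inv B ** matrix_inv A) = mat 1" by (simp add: A B)
  have "matrix_inv B ** matrix_inv A ** (A ** B) = matrix_inv B ** (matrix_inv A ** A) ** B"
    by (simp only: matrix_mul_assoc)
  then show "matrix_inv B ** matrix_inv A ** (A ** B) = mat 1" by (simp add: A B)
qed

text \<open>The value on the \<open>j\<close>-th loop in the frame given by the product of the first
  \<open>j\<close> matrices; its entries are the coordinates in the basis
  \<open>vbas\<close>.\<close>

definition Cv :: "xchar list \<Rightarrow> (fword \<Rightarrow> complex^2) \<Rightarrow> nat \<Rightarrow> complex^2"
  where "Cv a d j = matrix_inv (prodp a j) *v d (y_loop j)"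

section \<open>A braid generator acting on representations and cocycles\<close>

locale sigma =
  fixes i :: nat and a b :: "xchar list"
  assumes step: "sigma_step i a b"
begin

lemma i: "1 \<le> i" "i < length a" and len: "length b = length a"
  and ext: "list_all ext_char a" "list_all ext_char b"
  using step by (auto simp: sigma_step_def)

lemma chr_other: "j \<in> {1..length a} \<Longrightarrow> j \<noteq> i \<Longrightarrow> j \<noteq> Suc i \<Longrightarrow> b ! (j - 1) = a ! (j - 1)"
proof -
  assume j: "j \<in> {1..length a}" "j \<noteq> i" "j \<noteq> Suc i"
  have "j - 1 < length a" "j - 1 \<noteq> i - 1" "j - 1 \<noteq> i" using j i by auto
  then show ?thesis using step unfolding sigma_step_def by blast
qed

lemma chr_oth: "j \<in> {1..length a} \<Longrightarrow> j \<noteq> i \<Longrightarrow> j \<noteq> Suc i \<Longrightarrow> chr b j = chr a j"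
  using chr_other[of j] by (simp add: chr_def)

lemma reg: "regular a" "regular b" using ext by (auto intro: regular_ext_char)

abbreviation "Q \<equiv> prodp a (i - 1)"
abbreviation "pa \<equiv> chip (chr a i)"
abbreviation "ma \<equiv> chim (chr a i)"
abbreviation "Pa \<equiv> chip (chr a (Suc i))"
abbreviation "Ma \<equiv> chim (chr a (Suc i))"
abbreviation "pb \<equiv> chip (chr b i)"
abbreviation "mb \<equiv> chim (chr b i)"
abbreviation "Pb \<equiv> chip (chr b (Suc i))"
abbreviation "Mb \<equiv> chim (chr b (Suc i))"

lemma eqs: "pa ** Pa = pb ** Pb" "ma ** Ma = mb ** Mb" "ma ** Pa = pb ** Mb"
  using step by (auto simp: sigma_step_def)

lemma kap_nz: "zkap (chr a i) \<noteq> 0" "zkap (chr a (Suc i)) \<noteq> 0" "zkap (chr b i) \<noteq> 0" "zkap (chr b (Suc i)) \<noteq> 0"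
  using reg i len by (auto simp: regular_def)

lemma inv: "invertible Q" "invertible pa" "invertible ma" "invertible Pa" "invertible Ma"
    "invertible pb" "invertible mb" "invertible Pb" "invertible Mb"
  using kap_nz reg i by (auto intro: prodp_invertible chip_invertible chim_invertible)

lemma prodp_low: "j < i \<Longrightarrow> prodp b j = prodp a j"
proof (induction j)
  case (Suc j)
  then show ?case using chr_oth[of "Suc j"] i by (simp add: prodp_Suc)
qed (simp add: prodp_0)

lemma prodp_i: "prodp a i = Q ** pa" "prodp b i = Q ** pb" "prodp a (Suc i) = Q ** pa ** Pa" "prodp b (Suc i) = Q ** pb ** Pb"
proof -
  obtain k where k: "i = Suc k" using i by (cases i) auto
  have "prodp b k = prodp a k" using prodp_low[of k] k by simp
  then show "prodp a i = Q ** pa" "prodp b i = Q ** pb" "prodp a (Suc i) = Q ** pa ** Pa" "prodp b (Suc i) = Q ** pb ** Pb"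
    by (simp_all add: k prodp_Suc)
qed

lemma prodp_high: "Suc i \<le> j \<Longrightarrow> j \<le> length a \<Longrightarrow> prodp b j = prodp a j"
proof (induction j rule: dec_induct)
  case base
  show ?case unfolding prodp_i using eqs(1) by (simp only: matrix_mul_assoc[symmetric])
next
  case (step j)
  then show ?case using chr_oth[of "Suc j"] by (simp add: prodp_Suc)
qed

lemma prodp_other: "j \<le> length a \<Longrightarrow> j \<noteq> i \<Longrightarrow> prodp b j = prodp a j"
  using prodp_low[of j] prodp_high[of j] by (cases "j < i") auto

lemmas mi = inv[THEN invertible_inv(2)] inv[THEN invertible_inv(1)]

lemma mcancel: "matrix_inv Q ** (Q ** X) = X" "matrix_inv pa ** (pa ** X) = X" "matrix_inv Pa ** (Pa ** X) = X"
    "Q ** (matrix_inv Q ** X) = X" "Pa ** (matrix_inv Pa ** X) = X" "Mb ** (matrix_inv Mb ** X) = X" "pa ** (matrix_inv pa ** X) = X"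
    "matrix_inv ma ** (ma ** X) = X" "ma ** (matrix_inv ma ** X) = X"
  unfolding matrix_mul_assoc mi by simp_all

lemma rho_a: "rho_gen a i = Q ** (pa ** (matrix_inv ma ** matrix_inv Q))"
    "rho_gen a (Suc i) = Q ** (pa ** (Pa ** (matrix_inv Ma ** (matrix_inv pa ** matrix_inv Q))))"
    "matrix_inv (rho_gen a i) = Q ** (ma ** (matrix_inv pa ** matrix_inv Q))"
proof -
  show 1: "rho_gen a i = Q ** (pa ** (matrix_inv ma ** matrix_inv Q))"
    by (simp add: rho_gen_def psi_def matrix_mul_assoc)
  show "rho_gen a (Suc i) = Q ** (pa ** (Pa ** (matrix_inv Ma ** (matrix_inv pa ** matrix_inv Q))))"
    using matrix_inv_mult[OF inv(1,2)] by (simp add: rho_gen_def psi_def prodp_i matrix_mul_assoc)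
  show "matrix_inv (rho_gen a i) = Q ** (ma ** (matrix_inv pa ** matrix_inv Q))"
    unfolding 1 by (rule matrix_inv_eqI) (simp_all only: matrix_mul_assoc[symmetric] mcancel mi)
qed

lemma rho_b: "rho_gen b i = Q ** (pb ** (matrix_inv mb ** matrix_inv Q))"
    "rho_gen b (Suc i) = Q ** (pb ** (Pb ** (matrix_inv Mb ** (matrix_inv pb ** matrix_inv Q))))"
proof -
  have q: "prodp b (i - 1) = Q" using prodp_low[of "i - 1"] i by simp
  show "rho_gen b i = Q ** (pb ** (matrix_inv mb ** matrix_inv Q))"
    unfolding rho_gen_def psi_def q by (simp only: matrix_mul_assoc)
  show "rho_gen b (Suc i) = Q ** (pb ** (Pb ** (matrix_inv Mb ** (matrix_inv pb ** matrix_inv Q))))"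
    using matrix_inv_mult[OF inv(1,6)] by (simp add: rho_gen_def psi_def prodp_i matrix_mul_assoc)
qed

lemma rho_q: "rho_gen b (Suc i) = rho_gen a i"
proof -
  have e: "matrix_inv Mb ** (matrix_inv pb ** X) = matrix_inv Pa ** (matrix_inv ma ** X)" for X
    using arg_cong[OF eqs(3), of matrix_inv] unfolding matrix_inv_mult[OF inv(3,4)] matrix_inv_mult[OF inv(6,9)]
    by (simp add: matrix_mul_assoc)
  have f: "pb ** (Pb ** X) = pa ** (Pa ** X)" for X
    unfolding matrix_mul_assoc eqs ..
  show ?thesis unfolding rho_b rho_a e f mcancel ..
qed

lemma rho_p: "rho_gen b i = matrix_inv (rho_gen a i) ** (rho_gen a (Suc i) ** rho_gen a i)"
proof -
  have e: "matrix_inv Ma ** (matrix_inv ma ** X) = matrix_inv Mb ** (matrix_inv mb ** X)" for X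
    using arg_cong[OF eqs(2), of matrix_inv] unfolding matrix_inv_mult[OF inv(3,5)] matrix_inv_mult[OF inv(7,9)]
    by (simp add: matrix_mul_assoc)
  have f: "ma ** (Pa ** X) = pb ** (Mb ** X)" for X
    unfolding matrix_mul_assoc eqs ..
  show ?thesis
    unfolding rho_b rho_a(3) unfolding rho_a(1,2) matrix_mul_assoc[symmetric] mcancel e f ..
qed

lemma rho_artin: "j \<in> {1..length a} \<Longrightarrow> rho a (artin (Sig i) j) = rho_gen b j"
proof -
  assume j: "j \<in> {1..length a}"
  consider "j = i" | "j = Suc i" | "j \<noteq> i" "j \<noteq> Suc i" by blast
  then show ?thesis
  proof cases
    case 3
    then have "rho_gen b j = rho_gen a j"
      using chr_oth[OF j] prodp_other[of "j - 1"] j by (auto simp: rho_gen_def)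
    then show ?thesis using 3 by simp
  qed (simp_all add: rho_p rho_q)
qed

lemma rho_artin_inv: "j \<in> {1..length b} \<Longrightarrow> rho b (artin (SigInv i) j) = rho_gen a j"
proof -
  assume j: "j \<in> {1..length b}"
  have r: "invertible (rho_gen a i)" using rho_gen_invertible[OF reg(1), of i] i by simp
  have "rho_gen a i ** (rho_gen b i ** matrix_inv (rho_gen a i)) =
      (rho_gen a i ** matrix_inv (rho_gen a i)) ** rho_gen a (Suc i) ** (rho_gen a i ** matrix_inv (rho_gen a i))"
    unfolding rho_p by (simp only: matrix_mul_assoc)
  then have q: "rho_gen a i ** (rho_gen b i ** matrix_inv (rho_gen a i)) = rho_gen a (Suc i)"
    by (simp add: invertible_inv[OF r])
  consider "j = i" | "j = Suc i" | "j \<noteq> i" "j \<noteq> Suc i" by blast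
  then show ?thesis
  proof cases
    case 3
    then have "rho_gen b j = rho_gen a j"
      using chr_oth[of j] prodp_other[of "j - 1"] j len by (auto simp: rho_gen_def)
    then show ?thesis using 3 by simp
  qed (simp_all add: rho_q q)
qed

lemma burau_Sig: "d \<in> H1lf a \<Longrightarrow> d \<circ> braid_subst (Sig i) \<in> H1lf b"
  by (rule subst_H1lf[OF reg i _ len rho_artin]) simp_all

lemma burau_SigInv: "d \<in> H1lf b \<Longrightarrow> d \<circ> braid_subst (SigInv i) \<in> H1lf a"
  using i len by (intro subst_H1lf[OF reg(2,1) _ _ _ _ rho_artin_inv, of i]) simp_all

text \<open>By \<open>H1lf_ext\<close> it suffices to evaluate on the loops; only the
  \<open>i\<close>-th loop needs an actual reduction.\<close>

lemma burau_inverse: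
  assumes d: "d \<in> H1lf b"
  shows "d \<circ> braid_subst (SigInv i) \<circ> braid_subst (Sig i) = d"
proof (rule H1lf_ext[OF burau_Sig[OF burau_SigInv[OF d]] d reg(2)])
  fix k assume k: "k \<in> {1..<length b}"
  let ?d = "d \<circ> braid_subst (SigInv i)"
  obtain j where j: "i = Suc j" using i by (cases i) auto
  consider "k < i" | "k = i" | "Suc i \<le> k" by linarith
  then show "(?d \<circ> braid_subst (Sig i)) (y_loop k) = d (y_loop k)"
  proof cases
    case 1
    then show ?thesis using bs_y_low[OF i(1)] by simp
  next
    case 2
    have "braid_subst (SigInv i) (braid_subst (Sig i) (y_loop i)) =
        [] @ [(Suc i, False), (Suc i, True)] @ ((i, True) # [(Suc i, False), (Suc i, True)] @ y_loop j)"
      using bs_y_low[OF i(1), of "Sig i" j] bs_y_low[OF i(1), of "SigInv i" j]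
      by (simp add: j y_loop_Suc bs_Cons word_inv_Cons word_inv_Nil)
    then show ?thesis
      using H1lf_cancel[OF d reg(2), of "Suc i" "[]" False "(i, True) # [(Suc i, False), (Suc i, True)] @ y_loop j"]
        H1lf_cancel[OF d reg(2), of "Suc i" "[(i, True)]" False "y_loop j"] i len 2
      by (simp add: j y_loop_Suc)
  next
    case 3
    have "?d ([] @ braid_subst (Sig i) (y_loop k)) = ?d ([] @ y_loop k)"
      using 3 k len by (intro bs_y_high[OF burau_SigInv[OF d] reg(1) i(1)]) auto
    moreover have "d ([] @ braid_subst (SigInv i) (y_loop k)) = d ([] @ y_loop k)"
      using 3 k by (intro bs_y_high[OF d reg(2) i(1)]) auto
    ultimately show ?thesis by simp
  qed
qed

text \<open>The first column of \<open>pb ** Mb\<close> is that of \<open>pb\<close>, and the second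
  column of \<open>ma ** Pa\<close> is that of \<open>ma\<close>. As the two products agree,
  \<open>pb - mat 1 = ma ** Pa - ma\<close>.\<close>

lemma chip_chim_sum: "pb *v x = x + (ma ** Pa) *v x - ma *v x"
proof -
  have e: "(ma ** Pa) $ k $ l = (pb ** Mb) $ k $ l" for k l by (simp only: eqs)
  have "pb = mat 1 + ma ** Pa - ma"
    using e[of 1 1] e[of 1 2] e[of 2 1] e[of 2 2]
    by (simp add: vec_eq_iff forall_2 matrix_matrix_mult_def sum_2 chip_entries chim_entries mat_def)
  then have "pb *v x = (mat 1 + ma ** Pa - ma) *v x" by (rule arg_cong)
  then show ?thesis
    by (simp only: matrix_vector_mult_diff_rdistrib matrix_vector_mult_add_rdistrib matrix_vector_mul_lid)
qed

lemma Cv_other: "d \<in> H1lf a \<Longrightarrow> j \<le> length a \<Longrightarrow> j \<noteq> i \<Longrightarrow> Cv b (d \<circ> braid_subst (Sig i)) j = Cv a d j"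
proof -
  assume d: "d \<in> H1lf a" and j: "j \<le> length a" "j \<noteq> i"
  have "d (braid_subst (Sig i) (y_loop j)) = d (y_loop j)"
    using bs_y_low[OF i(1), of "Sig i" j] bs_y_high[OF d reg(1) i(1), of "Sig i" j "[]"] j by (cases "j < i") auto
  then show ?thesis using prodp_other[OF j] by (simp add: Cv_def)
qed

text \<open>The substituted loop reduces to the inverse of the \<open>i\<close>-th generator
  followed by the next loop. The result is written in differences of consecutive values because
  these are the coefficients in \<open>dop\<close>.\<close>

lemma Cv_i:
  assumes d: "d \<in> H1lf a"
  shows "Cv b (d \<circ> braid_subst (Sig i)) i = Cv a d (i - 1) +
    ((Cv a d i - Cv a d (i - 1)) - matrix_inv pb *v (Cv a d i - Cv a d (i - 1))) + Mb *v (Cv a d (Suc i) - Cv a d i)"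
proof -
  obtain k where k: "i = Suc k" using i by (cases i) auto
  have y: "d (y_loop j) = prodp a j *v Cv a d j" if "j \<le> length a" for j
    unfolding Cv_def using zinvertible(1)[OF prodp_invertible[OF reg(1) that]] by simp
  define c0 c1 c2 where c: "c0 = Cv a d (i - 1)" "c1 = Cv a d i" "c2 = Cv a d (Suc i)"
  have y0: "d (y_loop k) = Q *v c0" using y[of "i - 1"] i by (simp add: c k)
  have y1: "d (y_loop i) = Q *v (pa *v c1)" using y[of i] i by (simp add: c prodp_i matrix_vector_mul_assoc)
  have y2: "d (y_loop (Suc i)) = Q *v (pa *v (Pa *v c2))" using y[of "Suc i"] i by (simp add: c prodp_i matrix_vector_mul_assoc matrix_mul_assoc)
  let ?R = "matrix_inv (rho_gen a i)"
  have f: "[(i, False)] \<in> fwords (length a)" "y_loop i \<in> fwords (length a)" "y_loop (Suc i) \<in> fwords (length a)"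
    using i y_loop_fwords by (simp_all add: fwords_Cons)
  have 1: "d ([(i, False)] @ y_loop i) = d [(i, False)] + ?R *v d (y_loop i)"
    using H1lf_append[OF d f(1,2)] by simp
  have 2: "d ([(i, False)] @ y_loop (Suc i)) = d [(i, False)] + ?R *v d (y_loop (Suc i))"
    using H1lf_append[OF d f(1,3)] by simp
  have 3: "d ([(i, False)] @ y_loop i) = d (y_loop k)"
    using H1lf_cancel[OF d reg(1), of i "[]" False "y_loop k"] i by (simp add: k y_loop_Suc)
  have "braid_subst (Sig i) (y_loop i) = [(i, False)] @ y_loop (Suc i)"
    using bs_y_low[OF i(1), of "Sig i" k] by (simp add: k y_loop_Suc bs_Cons)
  then have "d (braid_subst (Sig i) (y_loop i)) = d [(i, False)] + ?R *v d (y_loop (Suc i))"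
    by (simp only: 2)
  also have "d [(i, False)] = d (y_loop k) - ?R *v d (y_loop i)"
    by (simp only: eq_diff_eq 1[symmetric] 3)
  finally have "d (braid_subst (Sig i) (y_loop i)) = d (y_loop k) - ?R *v d (y_loop i) + ?R *v d (y_loop (Suc i))" .
  also have "?R *v d (y_loop i) = Q *v (ma *v c1)"
    unfolding y1 rho_a(3) matrix_vector_mul_assoc matrix_mul_assoc[symmetric] mcancel by (simp only: mi matrix_mul_rid)
  also have "?R *v d (y_loop (Suc i)) = Q *v ((ma ** Pa) *v c2)"
    unfolding y2 rho_a(3) matrix_vector_mul_assoc matrix_mul_assoc[symmetric] mcancel by (simp only: mi matrix_mul_rid)
  finally have D: "d (braid_subst (Sig i) (y_loop i)) = Q *v (c0 - ma *v c1 + (ma ** Pa) *v c2)"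
    by (simp only: y0 matrix_vector_mult_diff_distrib matrix_vector_right_distrib)
  \<comment> \<open>The claimed value; multiplying by \<open>pb\<close> clears the inverse, and
    \<open>chip_chim_sum\<close> together with the third braiding equation identifies it.\<close>
  define Z where "Z = c0 + ((c1 - c0) - matrix_inv pb *v (c1 - c0)) + Mb *v (c2 - c1)"
  have "pb *v Z = pb *v c1 - (c1 - c0) + (ma ** Pa) *v (c2 - c1)"
    unfolding Z_def matrix_vector_right_distrib matrix_vector_mult_diff_distrib[of pb] zinvertible(1)[OF inv(6)]
      eqs(3) matrix_vector_mul_assoc[symmetric] by simp
  also have "\<dots> = c0 - ma *v c1 + (ma ** Pa) *v c2"
    unfolding chip_chim_sum matrix_vector_mult_diff_distrib by simp
  finally have "d (braid_subst (Sig i) (y_loop i)) = prodp b i *v Z"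
    unfolding D prodp_i by (simp add: matrix_vector_mul_assoc[symmetric])
  then have "Cv b (d \<circ> braid_subst (Sig i)) i = Z"
    using zinvertible(2)[OF prodp_invertible[OF reg(2), of i]] i len by (simp add: Cv_def)
  then show ?thesis by (simp add: Z_def c)
qed

end

section \<open>The action of a braid generator\<close>

text \<open>The module half of the operator attached to a class, after summation by parts:
  differences of coordinates against single \<open>alpha\<close> in place of coordinates against
  differences.\<close>

definition dop :: "(xchar \<Rightarrow> umod) \<Rightarrow> xchar list \<Rightarrow> (fword \<Rightarrow> complex^2) \<Rightarrow> lop"
  where "dop V a d = (\<Sum>j\<in>{1..length a}. \<Sum>\<nu>\<in>UNIV.
    lo.sm ((Cv a d j - Cv a d (j - 1)) $ nidx \<nu>) (actL V a (alpha j \<nu>)))"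

lemma (in tuple) alpha_al: "actL V a (alpha j \<nu>) = al j \<nu>"
proof -
  have "(\<lambda>(p, g). gL V a (p, g)) = gL V a" by auto
  then show ?thesis using ev_alpha[of j \<nu>] by simp
qed

locale sigma_map = A: tuple V a + B: tuple V b + sigma i a b for V i a b +
  fixes T :: "tensor \<Rightarrow> tensor"
  assumes T: "is_T_sigma V i a b T"
begin

abbreviation "N \<equiv> length a"
abbreviation "p \<equiv> (i, Md)"
abbreviation "q \<equiv> (Suc i, Md)"

lemma nN: "A.n = N" "B.n = N"
  by (simp_all add: A.n_def B.n_def len)

lemma pq: "p \<in> positions N" "q \<in> positions N" "(i, Dl) \<in> positions N" "(Suc i, Dl) \<in> positions N"
  using i by (simp_all add: positions_def)

lemma T_local: "\<exists>C. \<forall>f s. T f s =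
    (\<Sum>t\<in>indices ({i, Suc i} \<times> UNIV). C (override_on (\<lambda>_. 1) s ({i, Suc i} \<times> UNIV)) t * f (override_on s t ({i, Suc i} \<times> UNIV)))"
  using T by (simp add: is_T_sigma_def local_map_def)

lemma T_lin: "T (\<lambda>s. c * f s + e * g s) = (\<lambda>s. c * T f s + e * T g s)"
proof -
  obtain C where C: "\<And>f s. T f s = (\<Sum>t\<in>indices ({i, Suc i} \<times> UNIV).
      C (override_on (\<lambda>_. 1) s ({i, Suc i} \<times> UNIV)) t * f (override_on s t ({i, Suc i} \<times> UNIV)))"
    using T_local by blast
  show ?thesis
    unfolding C by (simp add: fun_eq_iff algebra_simps sum.distrib sum_distrib_left)
qed

lemma T_tens: "f \<in> tens (positions N) \<Longrightarrow> T f \<in> tens (positions N)"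
proof -
  assume f: "f \<in> tens (positions N)"
  obtain C where C: "\<And>f s. T f s = (\<Sum>t\<in>indices ({i, Suc i} \<times> UNIV).
      C (override_on (\<lambda>_. 1) s ({i, Suc i} \<times> UNIV)) t * f (override_on s t ({i, Suc i} \<times> UNIV)))"
    using T_local by blast
  have "T f s = 0" if s: "s \<notin> indices (positions N)" for s
  proof -
    obtain r where r: "r \<notin> positions N" "s r \<noteq> 1" using s by (auto simp: indices_def)
    have "r \<notin> {i, Suc i} \<times> UNIV" using r i by (cases r) (auto simp: positions_def)
    then have "override_on s t ({i, Suc i} \<times> UNIV) r \<noteq> 1" for t using r by (simp add: override_on_def)
    then have "override_on s t ({i, Suc i} \<times> UNIV) \<notin> indices (positions N)" for t
      using r(1) unfolding indices_def by blast
    then have "f (override_on s t ({i, Suc i} \<times> UNIV)) = 0" for t using f unfolding tens_def by blast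
    then show ?thesis unfolding C by simp
  qed
  then show ?thesis by (simp add: tens_def)
qed

lemma T_opL:
  assumes r: "fst r \<noteq> i" "fst r \<noteq> Suc i"
  shows "T (app (opL r M) f) = app (opL r M) (T f)"
proof -
  let ?P = "{i, Suc i} \<times> (UNIV :: side set)"
  obtain C where C: "\<And>f s. T f s = (\<Sum>t\<in>indices ?P. C (override_on (\<lambda>_. 1) s ?P) t * f (override_on s t ?P))"
    using T_local by blast
  have rP: "r \<notin> ?P" using r by (cases r) auto
  then have 1: "override_on s t ?P r = s r" "override_on (\<lambda>_. 1) (s(r := x)) ?P = override_on (\<lambda>_. 1) s ?P"
    "override_on (s(r := x)) t ?P = (override_on s t ?P)(r := x)" for s t :: "pos \<Rightarrow> 2" and x
    by (auto simp: override_on_def fun_eq_iff)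
  show ?thesis
  proof
    fix s
    have "T (app (opL r M) f) s = (\<Sum>t\<in>indices ?P. \<Sum>x\<in>UNIV. M $ s r $ x * (C (override_on (\<lambda>_. 1) s ?P) t * f ((override_on s t ?P)(r := x))))"
      unfolding C app_opL op_at_def 1 sum_distrib_left by (simp only: mult.left_commute)
    also have "\<dots> = (\<Sum>x\<in>UNIV. \<Sum>t\<in>indices ?P. M $ s r $ x * (C (override_on (\<lambda>_. 1) s ?P) t * f ((override_on s t ?P)(r := x))))"
      by (rule sum.swap)
    also have "\<dots> = app (opL r M) (T f) s"
      unfolding app_opL op_at_def C 1 sum_distrib_left ..
    finally show "T (app (opL r M) f) s = app (opL r M) (T f) s" .
  qed
qed

text \<open>Includes preservation of \<open>tens\<close> on the source, since the intertwining
  property of \<open>T\<close> is available only on tensors supported on the given factors.\<close>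

definition itw :: "lop \<Rightarrow> lop \<Rightarrow> bool"
  where "itw X Y \<longleftrightarrow> A.tp X \<and> (\<forall>f\<in>tens (positions N). T (app X f) = app Y (T f))"

lemma itw_add: "itw X Y \<Longrightarrow> itw X' Y' \<Longrightarrow> itw (X + X') (Y + Y')"
  using T_lin[of 1 _ 1] by (simp add: itw_def A.tp_intros)

lemma itw_diff: "itw X Y \<Longrightarrow> itw X' Y' \<Longrightarrow> itw (X - X') (Y - Y')"
  using T_lin[of 1 _ "- 1"] by (simp add: itw_def A.tp_intros)

lemma itw_sm: "itw X Y \<Longrightarrow> itw (lo.sm c X) (lo.sm c Y)"
  using T_lin[of c _ 0] by (simp add: itw_def A.tp_sm)

lemma itw_mult: "itw X Y \<Longrightarrow> itw X' Y' \<Longrightarrow> itw (X * X') (Y * Y')"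
  by (simp add: itw_def A.tp_intros A.tp_def nN)

lemma itw_1: "itw 1 1" and itw_0: "itw 0 0"
  using T_lin[of 0 "\<lambda>_. 0" 0 "\<lambda>_. 0"] by (simp_all add: itw_def A.tp_intros)

lemma itw_sum: "finite S \<Longrightarrow> (\<And>j. j \<in> S \<Longrightarrow> itw (X j) (Y j)) \<Longrightarrow> itw (sum X S) (sum Y S)"
  by (induction S rule: finite_induct) (auto intro: itw_0 itw_add)

lemma itw_pair:
  assumes "(x, x') \<in> Rcheck p q \<union> Rcheck_bar (i, Dl) (Suc i, Dl)" "x \<in> carrier (free_ring (positions N \<times> UNIV))"
  shows "itw (actL V a x) (actL V b x')"
proof -
  have "T (act V a x f) = act V b x' (T f)" if "f \<in> tens (positions N)" for f
    using T assms(1) that unfolding is_T_sigma_def by blast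
  then show ?thesis
    using tens_actL[OF assms(2)] by (simp add: itw_def A.tp_def act_actL nN)
qed

lemma itw_gen: "r \<in> positions N \<Longrightarrow> fst r \<noteq> i \<Longrightarrow> fst r \<noteq> Suc i \<Longrightarrow> itw (A.gen r g) (B.gen r g)"
proof -
  assume r: "r \<in> positions N" "fst r \<noteq> i" "fst r \<noteq> Suc i"
  have "b ! (fst r - 1) = a ! (fst r - 1)"
    using r by (intro chr_other) (auto simp: positions_def)
  then have "B.gen r g = A.gen r g" by (simp add: gL_def pos_mod_def)
  then show ?thesis
    using A.tp_gL[of r g] T_opL[OF r(2,3)] r(1) by (simp add: itw_def nN gL_def)
qed

lemma itw_R:
  "itw (A.gen p GE) (B.gen p GK * B.gen q GE)"
  "itw (A.gen q GF) (B.gen p GF * B.gen q GKi)"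
  "itw (A.gen p GK) (B.gen q GK - lo.sm \<i> (B.gen p GK * B.gen p GF * B.gen q GE))"
  "itw (A.gen p GKi * A.gen q GF + A.gen p GF) (B.gen p GKi * B.gen q GF + B.gen p GF)"
  "itw (A.gen q GE + A.gen p GE * A.gen q GK) (B.gen q GE + B.gen p GE * B.gen q GK)"
  "itw (A.gen p GK * A.gen q GK) (B.gen p GK * B.gen q GK)"
  "itw (A.gen p GKi * A.gen q GKi) (B.gen p GKi * B.gen q GKi)"
proof -
  have g: "gvar (r, g) \<in> carrier (free_ring (positions N \<times> UNIV))" if "r \<in> {p, q}" for r g
    using that pq by auto
  note c = free_mult free_add g[unfolded uE_def[symmetric] uF_def[symmetric]]
  have c: "uE p \<in> carrier (free_ring (positions N \<times> UNIV))" "uF q \<in> carrier (free_ring (positions N \<times> UNIV))"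
    "uK p \<in> carrier (free_ring (positions N \<times> UNIV))" "uKi p * uF q + uF p \<in> carrier (free_ring (positions N \<times> UNIV))"
    "uE q + uE p * uK q \<in> carrier (free_ring (positions N \<times> UNIV))" "uK p * uK q \<in> carrier (free_ring (positions N \<times> UNIV))"
    "uKi p * uKi q \<in> carrier (free_ring (positions N \<times> UNIV))"
    unfolding uE_def uF_def uK_def uKi_def by (intro free_mult free_add g; simp)+
  have m: "(x, x') \<in> Rcheck p q \<Longrightarrow> (x, x') \<in> Rcheck p q \<union> Rcheck_bar (i, Dl) (Suc i, Dl)" for x x' by blast
  note I = itw_pair[OF m]
  have "itw (actL V a (uE p)) (actL V b (uK p * uE q))"
    "itw (actL V a (uF q)) (actL V b (uF p * uKi q))"
    "itw (actL V a (uK p)) (actL V b (uK q - cst \<i> * uK p * uF p * uE q))"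
    "itw (actL V a (uKi p * uF q + uF p)) (actL V b (uKi p * uF q + uF p))"
    "itw (actL V a (uE q + uE p * uK q)) (actL V b (uE q + uE p * uK q))"
    "itw (actL V a (uK p * uK q)) (actL V b (uK p * uK q))"
    "itw (actL V a (uKi p * uKi q)) (actL V b (uKi p * uKi q))"
    by (rule I[OF _ c(1)], simp add: Rcheck_def, rule I[OF _ c(2)], simp add: Rcheck_def,
      rule I[OF _ c(3)], simp add: Rcheck_def, rule I[OF _ c(4)], simp add: Rcheck_def,
      rule I[OF _ c(5)], simp add: Rcheck_def, rule I[OF _ c(6)], simp add: Rcheck_def,
      rule I[OF _ c(7)], simp add: Rcheck_def)
  then show "itw (A.gen p GE) (B.gen p GK * B.gen q GE)"
    "itw (A.gen q GF) (B.gen p GF * B.gen q GKi)"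
    "itw (A.gen p GK) (B.gen q GK - lo.sm \<i> (B.gen p GK * B.gen p GF * B.gen q GE))"
    "itw (A.gen p GKi * A.gen q GF + A.gen p GF) (B.gen p GKi * B.gen q GF + B.gen p GF)"
    "itw (A.gen q GE + A.gen p GE * A.gen q GK) (B.gen q GE + B.gen p GE * B.gen q GK)"
    "itw (A.gen p GK * A.gen q GK) (B.gen p GK * B.gen q GK)"
    "itw (A.gen p GKi * A.gen q GKi) (B.gen p GKi * B.gen q GKi)"
    by (simp_all add: lo.ev_add lo.ev_mult lo.ev_diff A.actL_gens B.actL_gens lo.sm_def[symmetric] mult.assoc)
qed

lemma itw_KDl: "itw (A.gen (i, Dl) GK * A.gen (Suc i, Dl) GK) (B.gen (i, Dl) GK * B.gen (Suc i, Dl) GK)"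
proof -
  have c: "uK (Suc i, Dl) * uK (i, Dl) \<in> carrier (free_ring (positions N \<times> UNIV))"
    unfolding uK_def using pq by (intro free_mult) auto
  have "itw (actL V a (uK (Suc i, Dl) * uK (i, Dl))) (actL V b (uK (Suc i, Dl) * uK (i, Dl)))"
    by (rule itw_pair[OF _ c]) (simp add: Rcheck_bar_def Rcheck_def)
  moreover have "gL V c ((Suc i, Dl), GK) * gL V c ((i, Dl), GK) = gL V c ((i, Dl), GK) * gL V c ((Suc i, Dl), GK)" for c
    unfolding gL_def by (simp add: opL_commute)
  ultimately show ?thesis
    by (simp add: lo.ev_mult A.actL_gens B.actL_gens)
qed

text \<open>Stated for initial segments of factors, so that an induction reaches the total
  coproducts; a segment ending at \<open>i\<close> would cut through the two braided
  factors.\<close>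

definition "copW m \<longleftrightarrow> itw (actL V a (copE Md m)) (actL V b (copE Md m)) \<and>
  itw (actL V a (copF Md m)) (actL V b (copF Md m)) \<and> itw (actL V a (copK Md m)) (actL V b (copK Md m)) \<and>
  itw (actL V a (copKi Md m)) (actL V b (copKi Md m)) \<and> itw (actL V a (copK Dl m)) (actL V b (copK Dl m))"

lemma copW_step: "copW m \<Longrightarrow> m < N \<Longrightarrow> Suc m \<noteq> i \<Longrightarrow> m \<noteq> i \<Longrightarrow> copW (Suc m)"
proof -
  assume W: "copW m" and m: "m < N" "Suc m \<noteq> i" "m \<noteq> i"
  have g: "itw (A.gen (Suc m, d) g) (B.gen (Suc m, d) g)" for d g
    by (rule itw_gen) (use m in \<open>auto simp: positions_def\<close>)
  show ?thesis
    using W unfolding copW_def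
    by (auto simp: lo.ev_add lo.ev_mult A.actL_gens B.actL_gens intro!: itw_add itw_mult g)
qed

text \<open>Coassociativity lets both braided factors be added in one step through their own
  coproduct, which R-check fixes.\<close>

lemma copW_jump:
  assumes k: "i = Suc k" and W: "copW k"
  shows "copW (Suc i)"
proof -
  have w: "itw (actL V a (copE Md k)) (actL V b (copE Md k))"
    "itw (actL V a (copF Md k)) (actL V b (copF Md k))" "itw (actL V a (copK Md k)) (actL V b (copK Md k))"
    "itw (actL V a (copKi Md k)) (actL V b (copKi Md k))" "itw (actL V a (copK Dl k)) (actL V b (copK Dl k))"
    using W by (simp_all add: copW_def)
  have e: "lo.ev h (copE Md (Suc i)) = (h (q, GE) + h (p, GE) * h (q, GK)) + lo.ev h (copE Md k) * (h (p, GK) * h (q, GK))"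
    "lo.ev h (copF Md (Suc i)) = lo.ev h (copKi Md k) * (h (p, GKi) * h (q, GF) + h (p, GF)) + lo.ev h (copF Md k)"
    "lo.ev h (copK Md (Suc i)) = lo.ev h (copK Md k) * (h (p, GK) * h (q, GK))"
    "lo.ev h (copKi Md (Suc i)) = lo.ev h (copKi Md k) * (h (p, GKi) * h (q, GKi))"
    "lo.ev h (copK Dl (Suc i)) = lo.ev h (copK Dl k) * (h ((i, Dl), GK) * h ((Suc i, Dl), GK))" for h :: "pos \<times> ugen \<Rightarrow> lop"
    by (simp_all add: k lo.ev_add lo.ev_mult uE_def uF_def uK_def uKi_def algebra_simps)
  show ?thesis
    unfolding copW_def e by (intro conjI itw_add itw_mult w itw_R itw_KDl)
qed

lemma copW_all: "m \<le> N \<Longrightarrow> m \<noteq> i \<Longrightarrow> copW m"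
proof -
  have low: "copW m" if "m < i" for m
    using that
  proof (induction m)
    case 0
    show ?case by (simp add: copW_def itw_1 itw_0)
  next
    case (Suc m)
    then show ?case using copW_step[of m] i by simp
  qed
  obtain k where k: "i = Suc k" using i by (cases i) auto
  have mid: "copW (Suc i)" using copW_jump[OF k low] k by simp
  have "copW m" if "Suc i \<le> m" "m \<le> N" for m
    using that
  proof (induction m rule: dec_induct)
    case base
    show ?case by (rule mid)
  next
    case (step m)
    then show ?case using copW_step[of m] by simp
  qed
  then show "m \<le> N \<Longrightarrow> m \<noteq> i \<Longrightarrow> copW m" using low by (cases "m < i") auto
qed

lemma itw_cops: "itw (A.cE Md) (B.cE Md)" "itw (A.cF Md) (B.cF Md)" "itw (A.cK Md) (B.cK Md)" "itw (A.cK Dl) (B.cK Dl)"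
  using copW_all[of N] i
  by (simp_all add: copW_def A.cE_def B.cE_def A.cF_def B.cF_def A.cK_def B.cK_def nN)

lemma itw_KK: "1 \<le> j \<Longrightarrow> j \<le> Suc N \<Longrightarrow> j \<noteq> Suc i \<Longrightarrow> itw (A.KK Md [1..<j]) (B.KK Md [1..<j])"
  using copW_all[of "j - 1"] A.actL_copK[of Md "j - 1"] B.actL_copK[of Md "j - 1"]
  by (simp add: copW_def del: upt_Suc One_nat_def)

sublocale u: utriple lcs "B.gen p GE" "B.gen p GF" "B.gen p GK" "B.gen p GKi" "B.kap i" "B.eps i" "B.phi i"
  using B.pos_utriple[of p] pq nN by (simp add: B.kap_def B.eps_def B.phi_def)

sublocale v: utriple lcs "B.gen q GE" "B.gen q GF" "B.gen q GK" "B.gen q GKi" "B.kap (Suc i)" "B.eps (Suc i)" "B.phi (Suc i)"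
  using B.pos_utriple[of q] pq nN by (simp add: B.kap_def B.eps_def B.phi_def)

lemma pq_comm: "B.gen q h * B.gen p g = B.gen p g * B.gen q h"
    "B.gen q h * (B.gen p g * x) = B.gen p g * (B.gen q h * x)"
proof -
  show 1: "B.gen q h * B.gen p g = B.gen p g * B.gen q h" for g h
    unfolding gL_def by (simp add: opL_commute)
  show "B.gen q h * (B.gen p g * x) = B.gen p g * (B.gen q h * x)"
    by (rule swap_assoc[OF 1])
qed

lemma om_pq: "lo.om (B.gen p GE) (B.gen p GF) (B.gen p GK) (B.gen p GKi) = lcs (B.w i)"
    "lo.om (B.gen q GE) (B.gen q GF) (B.gen q GK) (B.gen q GKi) = lcs (B.w (Suc i))"
  using B.pos_om[of p] B.pos_om[of q] pq nN by simp_all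

lemma gX_gen: "A.gX 1 r = A.gen r GE" "A.gX 2 r = lo.sm (- \<i>) (A.gen r GK * A.gen r GF)"
    "B.gX 1 r = B.gen r GE" "B.gX 2 r = lo.sm (- \<i>) (B.gen r GK * B.gen r GF)"
    "A.gK r = A.gen r GK" "B.gK r = B.gen r GK"
  by (simp_all add: A.gX_def B.gX_def A.gK_def B.gK_def)

lemma site_pq: "1 \<le> i" "i \<le> B.n" "1 \<le> Suc i" "Suc i \<le> B.n" "B.w i \<noteq> 0" "B.w (Suc i) \<noteq> 0" "B.kap i \<noteq> 0"
  using i nN B.site(1,2)[of i] B.site(2)[of "Suc i"] by auto

section \<open>Images of the odd generators under R-check\<close>

lemma img1: "itw (A.gX 1 p) (B.gK p * B.gX 1 q)"
  unfolding gX_gen by (rule itw_R)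

lemma img2: "itw (A.gK p * A.gX 2 q) (B.gX 2 p)"
proof -
  have 1: "A.gen p GK * lo.sm (- \<i>) (A.gen q GK * A.gen q GF) = lo.sm (- \<i>) ((A.gen p GK * A.gen q GK) * A.gen q GF)"
    by (simp add: mult.assoc)
  have 2: "lo.sm (- \<i>) (B.gen p GK * B.gen p GF) = lo.sm (- \<i>) ((B.gen p GK * B.gen q GK) * (B.gen p GF * B.gen q GKi))"
    by (simp add: mult.assoc pq_comm)
  show ?thesis unfolding gX_gen 1 2 by (intro itw_sm itw_mult itw_R)
qed

text \<open>R-check is prescribed only on some generators, so KF in the first factor is expressed
  through the coproduct of F and F in the second factor. The scalar ratio in the result comes from
  Omega in the second factor.\<close>

lemma img3: "itw (A.gX 2 p) (lo.sm (1 / B.kap i) (B.gK p * B.gX 2 q) +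
    lo.sm (B.w (Suc i) / (B.w i * B.kap i)) (lo.sm (B.phi i) (B.gX 1 p) + lo.sm (B.kap i - 1) (B.gX 2 p)) -
    lo.sm (B.phi i / B.kap i) (B.gK p * B.gX 1 q))"
proof -
  let ?E = "B.gen p GE" and ?F = "B.gen p GF" and ?K = "B.gen p GK" and ?Ki = "B.gen p GKi"
  let ?E' = "B.gen q GE" and ?F' = "B.gen q GF" and ?K' = "B.gen q GK" and ?Ki' = "B.gen q GKi"
  let ?X = "(?K' - lo.sm \<i> (?K * ?F * ?E')) * (?Ki * ?F' + ?F) - ?F * ?Ki'"
  obtain ia: "A.gen p GK * A.gen p GKi = 1"
    using utriple.kki(1)[OF A.pos_utriple[of p]] pq nN by auto
  have "A.gen p GK * (A.gen p GKi * A.gen q GF) = A.gen q GF"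
    using arg_cong[OF ia, of "\<lambda>x. x * A.gen q GF"] by (simp add: mult.assoc)
  then have s: "A.gX 2 p = lo.sm (- \<i>) (A.gen p GK * (A.gen p GKi * A.gen q GF + A.gen p GF) - A.gen q GF)"
    unfolding gX_gen distrib_left by simp
  have i: "itw (A.gX 2 p) (lo.sm (- \<i>) ?X)"
    unfolding s by (intro itw_sm itw_diff itw_mult itw_R)
  \<comment> \<open>Rewriting to normal form collects the value of Omega in the second factor, which
    then acts by a number.\<close>
  have X: "?X = lo.sm (1 / B.kap i) (?K * (?K' * ?F')) + ?F * lo.om ?E' ?F' ?K' ?Ki' - lo.sm (\<i> * B.phi i / B.kap i) (?K * ?E')"
    by (simp add: lo.om_def u.nf v.nf pq_comm lo.fin)
  let ?Z = "lo.sm (B.phi i) (B.gX 1 p) + lo.sm (B.kap i - 1) (B.gX 2 p)" and ?c = "B.w (Suc i) / (B.w i * B.kap i)"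
  \<comment> \<open>The bare F is rewritten through E and KF, so that the image stays in the span of
    the Clifford generators.\<close>
  have F: "?F * lcs (B.w (Suc i)) = lo.sm (\<i> * ?c) ?Z"
  proof -
    have 1: "?F * lcs (B.w (Suc i)) = lo.sm (B.w (Suc i)) ?F" by (simp only: lo.cs_comm[symmetric] lo.sm_def)
    have 2: "?F = lo.sm (\<i> / (B.w i * B.kap i)) ?Z"
      using B.site_KE(3)[OF site_pq(1,2)] by (simp only: lo.sm_def)
    have c: "B.w (Suc i) * (\<i> / (B.w i * B.kap i)) = \<i> * ?c" by simp
    show ?thesis
      using trans[OF 1 arg_cong[OF 2, of "lo.sm (B.w (Suc i))"]] unfolding lo.sm_sm c .
  qed
  have ii: "- \<i> * (\<i> * c) = c" "- \<i> * (\<i> * c / e) = c / e" for c e :: complex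
    by (simp_all flip: mult.assoc)
  have t1: "lo.sm (- \<i>) (lo.sm (1 / B.kap i) (?K * (?K' * ?F'))) = lo.sm (1 / B.kap i) (B.gK p * B.gX 2 q)"
    by (simp add: gX_gen)
  have t2: "lo.sm (- \<i>) (lo.sm (\<i> * ?c) y) = lo.sm ?c y" "lo.sm (- \<i>) (lo.sm (\<i> * B.phi i / B.kap i) y) = lo.sm (B.phi i / B.kap i) y" for y
    unfolding lo.sm_sm ii by (rule refl)+
  have "lo.sm (- \<i>) ?X = lo.sm (- \<i>) (lo.sm (1 / B.kap i) (?K * (?K' * ?F'))) + lo.sm (- \<i>) (lo.sm (\<i> * ?c) ?Z) -
      lo.sm (- \<i>) (lo.sm (\<i> * B.phi i / B.kap i) (?K * ?E'))"
    unfolding X om_pq F lo.sm_diff lo.sm_add[of "- \<i>" "lo.sm (1 / B.kap i) (?K * (?K' * ?F'))"] by (rule refl)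
  also have "\<dots> = lo.sm (1 / B.kap i) (B.gK p * B.gX 2 q) + lo.sm ?c ?Z - lo.sm (B.phi i / B.kap i) (B.gK p * B.gX 1 q)"
    unfolding t1 t2 gX_gen(3,6) by (rule refl)
  finally have "lo.sm (- \<i>) ?X = \<dots>" .
  with i show ?thesis by simp
qed

lemma img4: "itw (A.gK p * A.gX 1 q) (lo.sm (B.w i) (B.gK p * lo.sm (- 1 / B.w (Suc i)) (lo.sm (B.eps (Suc i)) (B.gX 2 q) + lo.sm (B.kap (Suc i) - 1) (B.gX 1 q))) +
    lo.sm (B.kap (Suc i)) (B.gX 1 p) + lo.sm (B.eps (Suc i)) (B.gX 2 p))"
proof -
  let ?E = "B.gen p GE" and ?F = "B.gen p GF" and ?K = "B.gen p GK" and ?Ki = "B.gen p GKi"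
  let ?E' = "B.gen q GE" and ?F' = "B.gen q GF" and ?K' = "B.gen q GK" and ?Ki' = "B.gen q GKi"
  let ?X = "(?K' - lo.sm \<i> (?K * ?F * ?E')) * (?E' + ?E * ?K') + (?K * ?E') * (?K * ?K')"
  have ke: "A.gen p GK * A.gen p GE = - (A.gen p GE * A.gen p GK)"
    using utriple.ke[OF A.pos_utriple[of p]] pq nN by auto
  have "A.gen p GK * (A.gen p GE * A.gen q GK) = - (A.gen p GE * (A.gen p GK * A.gen q GK))"
    using arg_cong[OF ke, of "\<lambda>x. x * A.gen q GK"] by (simp add: mult.assoc)
  \<comment> \<open>Uses K E = - E K in the first factor to trade E in the second factor for its
    coproduct, whose image is known.\<close>
  then have s: "A.gK p * A.gX 1 q = A.gen p GK * (A.gen q GE + A.gen p GE * A.gen q GK) + A.gen p GE * (A.gen p GK * A.gen q GK)"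
    unfolding gX_gen distrib_left by simp
  have i: "itw (A.gK p * A.gX 1 q) ?X"
    unfolding s by (intro itw_add itw_mult itw_R)
  have X: "?X = lo.om ?E ?F ?K ?Ki * (?K * (?K' * ?E')) + lo.sm (B.kap (Suc i)) ?E + lo.sm (B.eps (Suc i)) (lo.sm (- \<i>) (?K * ?F))"
    by (simp add: lo.om_def u.nf v.nf pq_comm lo.fin mult.commute[of "B.eps (Suc i)" "\<i>"])
  have K: "?K' * ?E' = lo.sm (- 1 / B.w (Suc i)) (lo.sm (B.eps (Suc i)) (B.gX 2 q) + lo.sm (B.kap (Suc i) - 1) (B.gX 1 q))"
    using B.site_KE(1)[OF site_pq(3,4)] unfolding gX_gen(6) by (simp only: lo.sm_def)
  have "?X = lo.sm (B.w i) (B.gK p * lo.sm (- 1 / B.w (Suc i)) (lo.sm (B.eps (Suc i)) (B.gX 2 q) + lo.sm (B.kap (Suc i) - 1) (B.gX 1 q))) +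
    lo.sm (B.kap (Suc i)) (B.gX 1 p) + lo.sm (B.eps (Suc i)) (B.gX 2 p)"
    unfolding X om_pq K by (simp only: gX_gen lo.sm_def)
  with i show ?thesis by simp
qed

lemma w_swap: "A.w i = B.w (Suc i)" "A.w (Suc i) = B.w i"
  using step by (simp_all add: A.w_def B.w_def wt_def sigma_step_def)

text \<open>The braiding exchanges the fractional eigenvalues, so the normalization by Omega at
  factor \<open>i\<close> of the source is that of factor \<open>Suc i\<close> of the
  target.\<close>

lemma al_ab:
  "A.al i \<nu> = lo.sm (1 / B.w (Suc i)) (A.KK Md [1..<i] * A.gX \<nu> p)"
  "A.al (Suc i) \<nu> = lo.sm (1 / B.w i) (A.KK Md [1..<i] * (A.gK p * A.gX \<nu> q))"
  "B.al i \<nu> = lo.sm (1 / B.w i) (B.KK Md [1..<i] * B.gX \<nu> p)"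
  "B.al (Suc i) \<nu> = lo.sm (1 / B.w (Suc i)) (B.KK Md [1..<i] * (B.gK p * B.gX \<nu> q))"
proof -
  have u: "[1..<Suc i] = [1..<i] @ [i]" using i by simp
  have n: "1 \<le> i" "i \<le> A.n" "1 \<le> Suc i" "Suc i \<le> A.n" using i nN by auto
  show "A.al i \<nu> = lo.sm (1 / B.w (Suc i)) (A.KK Md [1..<i] * A.gX \<nu> p)"
    "A.al (Suc i) \<nu> = lo.sm (1 / B.w i) (A.KK Md [1..<i] * (A.gK p * A.gX \<nu> q))"
    using A.al_sm[OF n(1,2)] A.al_sm[OF n(3,4)] by (simp_all only: w_swap u A.KK_append A.KK_Cons A.KK_Nil mult_1_right mult.assoc)
  show "B.al i \<nu> = lo.sm (1 / B.w i) (B.KK Md [1..<i] * B.gX \<nu> p)"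
    "B.al (Suc i) \<nu> = lo.sm (1 / B.w (Suc i)) (B.KK Md [1..<i] * (B.gK p * B.gX \<nu> q))"
    using B.al_sm[OF site_pq(1,2)] B.al_sm[OF site_pq(3,4)] by (simp_all only: u B.KK_append B.KK_Cons B.KK_Nil mult_1_right mult.assoc)
qed

text \<open>With these normalizations the ratios of Omega in \<open>img3\<close> and
  \<open>img4\<close> cancel, and only coordinates of the target characters remain.\<close>

lemma itw_al:
  "itw (A.al i 1) (B.al (Suc i) 1)" "itw (A.al (Suc i) 2) (B.al i 2)"
  "itw (A.al i 2) (lo.sm (1 / B.kap i) (B.al (Suc i) 2) + lo.sm (B.phi i / B.kap i) (B.al i 1) +
    lo.sm (1 - 1 / B.kap i) (B.al i 2) - lo.sm (B.phi i / B.kap i) (B.al (Suc i) 1))"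
  "itw (A.al (Suc i) 1) (lo.sm (B.kap (Suc i)) (B.al i 1) + lo.sm (B.eps (Suc i)) (B.al i 2) +
    lo.sm (1 - B.kap (Suc i)) (B.al (Suc i) 1) - lo.sm (B.eps (Suc i)) (B.al (Suc i) 2))"
proof -
  have K: "itw (A.KK Md [1..<i]) (B.KK Md [1..<i])" using itw_KK[of i] i by simp
  show "itw (A.al i 1) (B.al (Suc i) 1)" "itw (A.al (Suc i) 2) (B.al i 2)"
    unfolding al_ab by (intro itw_sm itw_mult K img1 img2)+
  let ?B = "B.KK Md [1..<i]"
  have c: "1 / B.w (Suc i) * (1 / B.kap i) = 1 / B.kap i * (1 / B.w (Suc i))"
    "1 / B.w (Suc i) * (B.w (Suc i) / (B.w i * B.kap i)) * B.phi i = B.phi i / B.kap i * (1 / B.w i)"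
    "1 / B.w (Suc i) * (B.w (Suc i) / (B.w i * B.kap i)) * (B.kap i - 1) = (1 - 1 / B.kap i) * (1 / B.w i)"
    "1 / B.w (Suc i) * (B.phi i / B.kap i) = B.phi i / B.kap i * (1 / B.w (Suc i))"
    "1 / B.w i * B.w i * (- 1 / B.w (Suc i)) * B.eps (Suc i) = - (B.eps (Suc i) * (1 / B.w (Suc i)))"
    "1 / B.w i * B.w i * (- 1 / B.w (Suc i)) * (B.kap (Suc i) - 1) = (1 - B.kap (Suc i)) * (1 / B.w (Suc i))"
    using site_pq by (simp_all add: field_simps)
  have "itw (A.al i 2) (lo.sm (1 / B.w (Suc i)) (?B * (lo.sm (1 / B.kap i) (B.gK p * B.gX 2 q) +
    lo.sm (B.w (Suc i) / (B.w i * B.kap i)) (lo.sm (B.phi i) (B.gX 1 p) + lo.sm (B.kap i - 1) (B.gX 2 p)) -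
    lo.sm (B.phi i / B.kap i) (B.gK p * B.gX 1 q))))"
    unfolding al_ab by (intro itw_sm itw_mult K img3)
  then show "itw (A.al i 2) (lo.sm (1 / B.kap i) (B.al (Suc i) 2) + lo.sm (B.phi i / B.kap i) (B.al i 1) +
    lo.sm (1 - 1 / B.kap i) (B.al i 2) - lo.sm (B.phi i / B.kap i) (B.al (Suc i) 1))"
    unfolding al_ab(3,4) distrib_left right_diff_distrib[of ?B] lo.sm_right lo.sm_add lo.sm_diff lo.sm_sm mult.assoc[symmetric, where 'a = complex] c
    by (simp only: add.assoc)
  have "itw (A.al (Suc i) 1) (lo.sm (1 / B.w i) (?B * (lo.sm (B.w i) (B.gK p * lo.sm (- 1 / B.w (Suc i)) (lo.sm (B.eps (Suc i)) (B.gX 2 q) + lo.sm (B.kap (Suc i) - 1) (B.gX 1 q))) +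
    lo.sm (B.kap (Suc i)) (B.gX 1 p) + lo.sm (B.eps (Suc i)) (B.gX 2 p))))"
    unfolding al_ab by (intro itw_sm itw_mult K img4)
  then show "itw (A.al (Suc i) 1) (lo.sm (B.kap (Suc i)) (B.al i 1) + lo.sm (B.eps (Suc i)) (B.al i 2) +
    lo.sm (1 - B.kap (Suc i)) (B.al (Suc i) 1) - lo.sm (B.eps (Suc i)) (B.al (Suc i) 2))"
    unfolding al_ab(3,4) distrib_left lo.sm_right lo.sm_add lo.sm_sm mult.assoc[symmetric, where 'a = complex] c lo.sm_uminus_left
    by (simp add: algebra_simps)
qed

lemma itw_al_other: "j \<in> {1..N} \<Longrightarrow> j \<noteq> i \<Longrightarrow> j \<noteq> Suc i \<Longrightarrow> itw (A.al j \<nu>) (B.al j \<nu>)"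
proof -
  assume j: "j \<in> {1..N}" "j \<noteq> i" "j \<noteq> Suc i"
  have r: "(j, Md) \<in> positions N" using j by (simp add: positions_def)
  have g: "itw (A.gen (j, Md) g) (B.gen (j, Md) g)" for g by (rule itw_gen[OF r]) (use j in auto)
  have "itw (A.gX \<nu> (j, Md)) (B.gX \<nu> (j, Md))"
    unfolding A.gX_def B.gX_def using itw_sm[OF itw_mult[OF g[of GK] g[of GF]]] g[of GE] by simp
  moreover have "itw (A.KK Md [1..<j]) (B.KK Md [1..<j])" using itw_KK[of j] j by auto
  ultimately show ?thesis
    unfolding A.al_def B.al_def A.gO_def B.gO_def by (intro itw_mult g)
qed

text \<open>Away from the two braided factors both sides agree term by term. On those factors the
  coefficients from \<open>Cv_i\<close> are matched with the images in \<open>itw_al\<close>; the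
  loop beyond them is unchanged, so the sum of the two differences is preserved.\<close>

lemma itw_dop:
  assumes d: "d \<in> H1lf a"
  shows "itw (dop V a d) (dop V b (d \<circ> braid_subst (Sig i)))"
proof -
  define d' where "d' = d \<circ> braid_subst (Sig i)"
  define x where "x j = Cv a d j - Cv a d (j - 1)" for j
  define x' where "x' j = Cv b d' j - Cv b d' (j - 1)" for j
  let ?tA = "\<lambda>j. lo.sm (x j $ 2) (A.al j 1) + lo.sm (x j $ 1) (A.al j 2)"
  let ?tB = "\<lambda>j. lo.sm (x' j $ 2) (B.al j 1) + lo.sm (x' j $ 1) (B.al j 2)"
  have dA: "dop V a d = (\<Sum>j\<in>{1..N}. ?tA j)" and dB: "dop V b d' = (\<Sum>j\<in>{1..N}. ?tB j)"
    unfolding dop_def A.alpha_al B.alpha_al len sum_2 x_def x'_def by (simp_all add: nidx_def)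
  define J where "J = {1..N} - {i, Suc i}"
  have J: "{1..N} = insert i (insert (Suc i) J)" "finite J" "i \<notin> insert (Suc i) J" "Suc i \<notin> J"
    using i by (auto simp: J_def)
  have split: "sum t {1..N} = (t i + t (Suc i)) + sum t J" for t :: "nat \<Rightarrow> lop"
    unfolding J(1) using J(2-4) by (simp add: add.assoc)
  have o: "Cv b d' j = Cv a d j" if "j \<le> N" "j \<noteq> i" for j
    unfolding d'_def by (rule Cv_other[OF d that])
  have oth: "itw (sum ?tA J) (sum ?tB J)"
  proof (rule itw_sum[OF J(2)])
    fix j assume j: "j \<in> J"
    then have "x' j = x j" using o[of j] o[of "j - 1"] by (auto simp: x_def x'_def J_def)
    then show "itw (?tA j) (?tB j)"
      using j by (auto simp: J_def intro!: itw_add itw_sm itw_al_other)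
  qed
  \<comment> \<open>The inverse of the triangular matrix \<open>pb\<close> is evaluated by solving
    the two scalar equations for \<open>r\<close>.\<close>
  define r where "r = matrix_inv pb *v x i"
  have "pb *v r = x i" unfolding r_def by (rule zinvertible(1)[OF inv(6)])
  then have r: "B.kap i * r $ 1 = x i $ 1" "B.phi i * r $ 1 + r $ 2 = x i $ 2"
    by (simp_all add: vec_eq_iff forall_2 matrix_vector_mult_def sum_2 chip_entries B.kap_def B.phi_def)
  have r1: "r $ 1 = x i $ 1 / B.kap i"
    unfolding r(1)[symmetric] using site_pq by simp
  have r2: "r $ 2 = x i $ 2 - B.phi i * (x i $ 1 / B.kap i)"
    unfolding r1[symmetric] r(2)[symmetric] by simp
  have p: "Cv b d' (i - 1) = Cv a d (i - 1)" "Cv b d' (Suc i) = Cv a d (Suc i)"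
    using o[of "i - 1"] o[of "Suc i"] i by auto
  have x'i: "x' i = x i - r + Mb *v x (Suc i)"
    unfolding x'_def p r_def using Cv_i[OF d] by (simp add: d'_def x_def)
  have x'q: "x' (Suc i) = x i + x (Suc i) - x' i"
    unfolding x'_def x_def using p by simp
  have M: "(Mb *v y) $ 1 = y $ 1 + B.eps (Suc i) * y $ 2" "(Mb *v y) $ 2 = B.kap (Suc i) * y $ 2" for y
    by (simp_all add: matrix_vector_mult_def sum_2 chim_entries B.kap_def B.eps_def)
  let ?u = "x i" and ?v = "x (Suc i)" and ?k = "B.kap i" and ?f = "B.phi i" and ?K = "B.kap (Suc i)" and ?e = "B.eps (Suc i)"
  have "?tB i + ?tB (Suc i) =
    (lo.sm (?u $ 2) (B.al (Suc i) 1) +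
     lo.sm (?u $ 1) (lo.sm (1 / ?k) (B.al (Suc i) 2) + lo.sm (?f / ?k) (B.al i 1) + lo.sm (1 - 1 / ?k) (B.al i 2) - lo.sm (?f / ?k) (B.al (Suc i) 1))) +
    (lo.sm (?v $ 2) (lo.sm ?K (B.al i 1) + lo.sm ?e (B.al i 2) + lo.sm (1 - ?K) (B.al (Suc i) 1) - lo.sm ?e (B.al (Suc i) 2)) +
     lo.sm (?v $ 1) (B.al i 2))"
    unfolding x'q x'i vector_add_component vector_minus_component M r1 r2
    by (simp add: lo.sm_add lo.sm_diff lo.sm_add_left lo.sm_diff_left algebra_simps)
  moreover have "itw (?tA i + ?tA (Suc i)) \<dots>"
    by (intro itw_add itw_sm itw_al)
  ultimately have "itw (?tA i + ?tA (Suc i)) (?tB i + ?tB (Suc i))" by simp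
  from itw_add[OF this oth] show ?thesis
    unfolding d'_def[symmetric] dA dB split .
qed

end

section \<open>Admissible braids\<close>

text \<open>The total operators from which the matrix units \<open>CM\<close> and the parity
  operator \<open>NN\<close> are built.\<close>

definition cops :: "nat \<Rightarrow> ualg set"
  where "cops n = {copE Md n, copF Md n, copK Md n, copK Dl n}"

text \<open>The properties of one letter that compose along a word. Intertwining is recorded for the
  module halves \<open>dop\<close>, since words on the vacuum are expressed through these
  alone.\<close>

definition bstep :: "(xchar \<Rightarrow> umod) \<Rightarrow> xchar list \<Rightarrow> xchar list \<Rightarrow> (tensor \<Rightarrow> tensor) \<Rightarrow>
    ((fword \<Rightarrow> complex^2) \<Rightarrow> (fword \<Rightarrow> complex^2)) \<Rightarrow> bool"
  where "bstep V a b T h \<longleftrightarrow> length b = length a \<and> total_chr b = total_chr a \<and>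
    (\<forall>x\<in>set b. ext_char x \<and> nonsingular (fst x)) \<and> (\<forall>d\<in>H1lf a. h d \<in> H1lf b) \<and>
    (\<forall>f\<in>tens (positions (length a)). \<forall>g\<in>tens (positions (length a)). \<forall>c e.
      T (\<lambda>s. c * f s + e * g s) = (\<lambda>s. c * T f s + e * T g s)) \<and>
    (\<forall>f\<in>tens (positions (length a)). T f \<in> tens (positions (length a))) \<and>
    T (vac (length a)) = vac (length a) \<and>
    (\<forall>x\<in>cops (length a). \<forall>f\<in>tens (positions (length a)). T (app (actL V a x) f) = app (actL V b x) (T f)) \<and>
    (\<forall>d\<in>H1lf a. \<forall>f\<in>tens (positions (length a)). T (app (dop V a d) f) = app (dop V b (h d)) (T f))"

lemma (in tuple) cops_tens: "x \<in> cops n \<Longrightarrow> f \<in> tens (positions n) \<Longrightarrow> app (actL V a x) f \<in> tens (positions n)"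
  using cop_side(4)[of _ Md] cop_side(4)[of _ Dl] by (auto simp: cops_def tp_def cE_def cF_def cK_def)

lemma (in tuple) tp_dop: "tp (dop V a d)"
  unfolding dop_def alpha_al n_def[symmetric] by (intro tp_sum tp_sm tp_al) auto

lemma bstep_id: "(\<And>x. x \<in> set a \<Longrightarrow> ext_char x \<and> nonsingular (fst x)) \<Longrightarrow> bstep V a a id id"
  by (simp add: bstep_def)

lemma bstep_comp: "bstep V a b T h \<Longrightarrow> bstep V b c T' h' \<Longrightarrow> bstep V a c (T' \<circ> T) (h' \<circ> h)"
  by (simp add: bstep_def)

context sigma
begin

text \<open>The fractional eigenvalues are permuted and determine the values of Omega squared, so
  nonsingularity passes between source and target.\<close>

lemma omega_perm: "k < length a \<Longrightarrow> \<exists>j<length a. omega2 (fst (b ! k)) = omega2 (fst (a ! j))"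
    "k < length a \<Longrightarrow> \<exists>j<length a. omega2 (fst (a ! k)) = omega2 (fst (b ! j))"
proof -
  have o: "omega2 (fst x) = (snd x - 1 / snd x)\<^sup>2" if "ext_char x" for x using that by (simp add: ext_char_def)
  have e: "ext_char (a ! k)" "ext_char (b ! k)" if "k < length a" for k
    using ext len that by (auto simp: list_all_length)
  have s: "snd (b ! (i - 1)) = snd (a ! i)" "snd (b ! i) = snd (a ! (i - 1))"
    "\<And>k. k < length a \<Longrightarrow> k \<noteq> i - 1 \<Longrightarrow> k \<noteq> i \<Longrightarrow> b ! k = a ! k"
    using step unfolding sigma_step_def by blast+
  define t where "t k = (if k = i - 1 then i else if k = i then i - 1 else k)" for k
  have t: "t k < length a" if "k < length a" for k using that i by (auto simp: t_def)
  have t': "snd (b ! k) = snd (a ! t k)" "snd (a ! k) = snd (b ! t k)" if "k < length a" for k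
    using s(1,2) s(3)[OF that] i by (auto simp: t_def)
  show "k < length a \<Longrightarrow> \<exists>j<length a. omega2 (fst (b ! k)) = omega2 (fst (a ! j))"
    using t t' o e by metis
  show "k < length a \<Longrightarrow> \<exists>j<length a. omega2 (fst (a ! k)) = omega2 (fst (b ! j))"
    using t t' o e by metis
qed

lemma nonsing_iff: "(\<forall>x\<in>set a. ext_char x \<and> nonsingular (fst x)) \<longleftrightarrow> (\<forall>x\<in>set b. ext_char x \<and> nonsingular (fst x))"
proof -
  have e: "\<forall>x\<in>set a. ext_char x" "\<forall>x\<in>set b. ext_char x" using ext by (simp_all add: list_all_iff)
  have "(\<forall>x\<in>set a. nonsingular (fst x)) \<longleftrightarrow> (\<forall>x\<in>set b. nonsingular (fst x))"
    unfolding all_set_conv_all_nth nonsingular_def len using omega_perm by metis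
  then show ?thesis using e by blast
qed

lemma total_eq: "total_chr b = total_chr a"
proof -
  define tc where "tc l m = foldl zmult zone (map fst (take m l))" for l :: "xchar list" and m
  have S: "tc l (Suc m) = zmult (tc l m) (chr l (Suc m))" if "m < length l" for l m
    using that by (simp add: tc_def take_Suc_conv_app_nth chr_def)
  have z: "zmult (chr b i) (chr b (Suc i)) = zmult (chr a i) (chr a (Suc i))"
  proof -
    have e: "(chip (chr a i) ** chip (chr a (Suc i))) $ k $ l = (chip (chr b i) ** chip (chr b (Suc i))) $ k $ l"
      "(chim (chr a i) ** chim (chr a (Suc i))) $ k $ l = (chim (chr b i) ** chim (chr b (Suc i))) $ k $ l" for k l
      by (simp_all only: eqs)
    show ?thesis
      using e(1)[of 1 1] e(1)[of 2 1] e(2)[of 1 2]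
      by (simp add: zmult_def matrix_matrix_mult_def sum_2 chip_entries chim_entries add.commute mult.commute)
  qed
  have assoc: "zmult (zmult u v) w = zmult u (zmult v w)" for u v w
    by (simp add: zmult_def algebra_simps)
  have low: "m < i \<Longrightarrow> tc b m = tc a m" for m
  proof (induction m)
    case (Suc m)
    then show ?case using chr_oth[of "Suc m"] i len by (simp add: S)
  qed (simp add: tc_def)
  obtain k where k: "i = Suc k" using i by (cases i) auto
  have mid: "tc b (Suc i) = tc a (Suc i)"
    using low[of k] z i len by (simp add: k S assoc)
  have "Suc i \<le> m \<Longrightarrow> m \<le> length a \<Longrightarrow> tc b m = tc a m" for m
  proof (induction m rule: dec_induct)
    case base
    show ?case by (rule mid)
  next
    case (step m)
    then show ?case using chr_oth[of "Suc m"] len by (simp add: S)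
  qed
  from this[of "length a"] show ?thesis using i len by (simp add: tc_def total_chr_def)
qed

end

lemma bstep_Sig:
  assumes "tuple V a" and s: "sigma_step i a b" and T: "is_T_sigma V i a b T"
  shows "bstep V a b T (\<lambda>d. d \<circ> braid_subst (Sig i))"
proof -
  interpret A: tuple V a by fact
  interpret S: sigma i a b by unfold_locales (rule s)
  have nb: "\<forall>x\<in>set b. ext_char x \<and> nonsingular (fst x)" using S.nonsing_iff A.a by blast
  interpret B: tuple V b by unfold_locales (use A.V nb in blast)+
  interpret M: sigma_map V i a b T by unfold_locales (rule T)
  have "T (app (actL V a x) f) = app (actL V b x) (T f)" if "x \<in> cops (length a)" "f \<in> tens (positions (length a))" for x f
    using that M.itw_cops by (auto simp: cops_def M.itw_def A.cE_def B.cE_def A.cF_def B.cF_def A.cK_def B.cK_def M.nN)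
  moreover have "T (vac (length a)) = vac (length a)" using T S.len by (simp add: is_T_sigma_def)
  ultimately show ?thesis
    using M.itw_dop unfolding bstep_def M.itw_def
    by (simp add: S.len S.total_eq nb S.burau_Sig M.T_lin M.T_tens)
qed

text \<open>Every property of the forward map \<open>S\<close> is applied to \<open>T f\<close> and
  read backwards, as the two maps are inverse on \<open>tens\<close>.\<close>

lemma bstep_SigInv:
  assumes "tuple V a" and s: "sigma_step i b a" and S: "is_T_sigma V i b a S"
    and 1: "\<forall>f\<in>tens (positions (length b)). T (S f) = f"
    and 2: "\<forall>f\<in>tens (positions (length a)). T f \<in> tens (positions (length b)) \<and> S (T f) = f"
  shows "bstep V a b T (\<lambda>d. d \<circ> braid_subst (SigInv i))"
proof -
  interpret A: tuple V a by fact
  interpret S: sigma i b a by unfold_locales (rule s)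
  have nb: "\<forall>x\<in>set b. ext_char x \<and> nonsingular (fst x)" using S.nonsing_iff A.a by blast
  interpret B: tuple V b by unfold_locales (use A.V nb in blast)+
  have st: "bstep V b a S (\<lambda>d. d \<circ> braid_subst (Sig i))"
    by (rule bstep_Sig[OF B.tuple_axioms s S])
  have len: "length b = length a" using S.len by simp
  let ?t = "tens (positions (length a))"
  have S: "\<And>f g c e. f \<in> ?t \<Longrightarrow> g \<in> ?t \<Longrightarrow> S (\<lambda>s. c * f s + e * g s) = (\<lambda>s. c * S f s + e * S g s)"
    "\<And>f. f \<in> ?t \<Longrightarrow> S f \<in> ?t" "S (vac (length a)) = vac (length a)"
    "\<And>x f. x \<in> cops (length a) \<Longrightarrow> f \<in> ?t \<Longrightarrow> S (app (actL V b x) f) = app (actL V a x) (S f)"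
    "\<And>d f. d \<in> H1lf b \<Longrightarrow> f \<in> ?t \<Longrightarrow> S (app (dop V b d) f) = app (dop V a (d \<circ> braid_subst (Sig i))) (S f)"
    using st unfolding bstep_def len by blast+
  have T: "f \<in> ?t \<Longrightarrow> T (S f) = f" "f \<in> ?t \<Longrightarrow> T f \<in> ?t" "f \<in> ?t \<Longrightarrow> S (T f) = f" for f
    using 1 2 len by auto
  have inter: "T (app X f) = app Y (T f)" if f: "f \<in> ?t" and Y: "app Y (T f) \<in> ?t" and X: "S (app Y (T f)) = app X (S (T f))" for X Y f
    using T(1)[OF Y] X T(3)[OF f] by simp
  have lin: "T (\<lambda>s. c * f s + e * g s) = (\<lambda>s. c * T f s + e * T g s)" if f: "f \<in> ?t" "g \<in> ?t" for f g c e
  proof -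
    have "S (\<lambda>s. c * T f s + e * T g s) = (\<lambda>s. c * f s + e * g s)"
      using S(1)[OF T(2)[OF f(1)] T(2)[OF f(2)]] T(3) f by simp
    moreover have "(\<lambda>s. c * T f s + e * T g s) \<in> ?t" using T(2) f by (intro tens_add tens_scale) auto
    ultimately show ?thesis using T(1) by metis
  qed
  have vc: "T (vac (length a)) = vac (length a)"
    using T(1)[OF vac_tens] S(3) by simp
  have cp: "T (app (actL V a x) f) = app (actL V b x) (T f)" if "x \<in> cops (length a)" "f \<in> ?t" for x f
    using that B.cops_tens[of x "T f"] S(4)[OF that(1) T(2)[OF that(2)]] T(2)
    by (intro inter) (auto simp: B.n_def len)
  have dp: "T (app (dop V a d) f) = app (dop V b (d \<circ> braid_subst (SigInv i))) (T f)" if d: "d \<in> H1lf a" and f: "f \<in> ?t" for d f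
  proof (rule inter[OF f])
    show "app (dop V b (d \<circ> braid_subst (SigInv i))) (T f) \<in> ?t"
      using B.tp_dop T(2)[OF f] by (simp add: B.tp_def B.n_def len)
    show "S (app (dop V b (d \<circ> braid_subst (SigInv i))) (T f)) = app (dop V a d) (S (T f))"
      using S(5)[OF S.burau_SigInv[OF d] T(2)[OF f]] by (simp only: S.burau_inverse[OF d])
  qed
  show ?thesis
    unfolding bstep_def using lin vc cp dp T(2) len nb S.total_eq S.burau_SigInv by simp
qed

lemma braid_bstep:
  assumes V: "\<And>x. ext_char x \<Longrightarrow> nonsingular (fst x) \<Longrightarrow> is_V x (V x)"
  shows "braid_T V \<beta> a b T \<Longrightarrow> (\<And>x. x \<in> set a \<Longrightarrow> ext_char x \<and> nonsingular (fst x)) \<Longrightarrow> bstep V a b T (burau \<beta>)"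
proof (induction rule: braid_T.induct)
  case (Nil a)
  then show ?case using bstep_id by (simp add: burau_def id_def)
next
  case (Sig i a b T \<beta> c T')
  have "tuple V a" by unfold_locales (use V Sig.prems in blast)+
  from bstep_Sig[OF this Sig(1,2)] have s: "bstep V a b T (\<lambda>d. d \<circ> braid_subst (Sig i))" .
  then have "bstep V b c T' (burau \<beta>)" by (intro Sig.IH) (simp add: bstep_def)
  from bstep_comp[OF s this] show ?case by (simp add: burau_def comp_def)
next
  case (SigInv i b a S T \<beta> c T')
  have "tuple V a" by unfold_locales (use V SigInv.prems in blast)+
  from bstep_SigInv[OF this SigInv(1,2,3,4)] have s: "bstep V a b T (\<lambda>d. d \<circ> braid_subst (SigInv i))" .
  then have "bstep V b c T' (burau \<beta>)" by (intro SigInv.IH) (simp add: bstep_def)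
  from bstep_comp[OF s this] show ?case by (simp add: burau_def comp_def)
qed

section \<open>Words in the \<open>\<theta>\<^sub>j\<^sup>\<nu>\<close> on the vacuum\<close>

text \<open>Writing each \<open>\<theta>\<close> as \<open>A + B\<close>, where the \<open>A\<close> anticommute with the \<open>B\<close> and both agree on the vacuum, a word in the
  \<open>\<theta>\<close> applied to the vacuum is a polynomial in the \<open>A\<close> alone.\<close>

primrec wl :: "('d \<Rightarrow> lop) \<Rightarrow> 'd list \<Rightarrow> lop" where
  "wl A [] = 1"
| "wl A (d # ds) = A d * wl A ds + lo.sm ((- 1) ^ length ds) (wl A ds * A d)"

lemma wl_anticomm:
  assumes "\<And>d. B * A d = - (A d * B)"
  shows "B * wl A ds = lo.sm ((- 1) ^ length ds) (wl A ds * B)"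
proof (induction ds)
  case (Cons d ds)
  let ?W = "wl A ds" and ?s = "(- 1) ^ length ds :: complex"
  have "B * (A d * ?W) = - (A d * (B * ?W))"
    using arg_cong[OF assms, of "\<lambda>x. x * ?W" d] by (simp add: mult.assoc)
  moreover have "B * (?W * A d) = - lo.sm ?s (?W * (A d * B))"
    using arg_cong[OF Cons, of "\<lambda>x. x * A d"] by (simp add: mult.assoc assms lo.sm_uminus)
  ultimately show ?case
    by (simp add: Cons distrib_left distrib_right lo.sm_add lo.sm_uminus lo.sm_uminus_left mult.assoc)
qed simp

context tuple
begin

definition dopB :: "(fword \<Rightarrow> complex^2) \<Rightarrow> lop"
  where "dopB d = (\<Sum>j\<in>{1..n}. \<Sum>\<nu>\<in>UNIV. lo.sm ((Cv a d j - Cv a d (j - 1)) $ nidx \<nu>) (ab j \<nu>))"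

lemma dop_al: "dop V a d = (\<Sum>j\<in>{1..n}. \<Sum>\<nu>\<in>UNIV. lo.sm ((Cv a d j - Cv a d (j - 1)) $ nidx \<nu>) (al j \<nu>))"
  unfolding dop_def alpha_al n_def ..

lemma abel: "c 0 = 0 \<Longrightarrow> (\<Sum>j\<in>{1..m}. lo.sm (c j - c (j - 1)) (x j)) =
    (\<Sum>j\<in>{1..<m}. lo.sm (c j) (x j - x (Suc j))) + lo.sm (c m) (x m)" for c :: "nat \<Rightarrow> complex" and x :: "nat \<Rightarrow> lop"
proof (induction m)
  case (Suc m)
  show ?case
  proof (cases "m = 0")
    case False
    then have "{1..<Suc m} = insert m {1..<m}" by auto
    then show ?thesis using Suc False by (simp add: lo.sm_diff lo.sm_diff_left)
  qed (use Suc in simp)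
qed simp

text \<open>Summation by parts. The boundary terms vanish because a class is 0 on the empty word and
  on the boundary loop.\<close>

lemma actL_thF:
  assumes d: "d \<in> H"
  shows "actL V a (thF d) = dop V a d + dopB d"
proof -
  have c: "coef a d j \<nu> = Cv a d j $ nidx \<nu>" for j \<nu> by (simp add: coef_def Cv_def)
  have z: "Cv a d 0 = 0" "Cv a d n = 0"
    using H1lf_Nil[OF d] H1lf_y[OF d] by (simp_all add: Cv_def n_def)
  have "actL V a (thF d) = (\<Sum>\<nu>\<in>UNIV. \<Sum>j\<in>{1..<n}. lo.sm (Cv a d j $ nidx \<nu>) (aA j \<nu> - aA (Suc j) \<nu>))"
    unfolding thF_def by (subst sum.swap) (simp add: lo.ev_sum lo.ev_mult actL_theta c lo.sm_def)
  also have "\<dots> = (\<Sum>\<nu>\<in>UNIV. \<Sum>j\<in>{1..n}. lo.sm (Cv a d j $ nidx \<nu> - Cv a d (j - 1) $ nidx \<nu>) (aA j \<nu>))"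
  proof (rule sum.cong[OF refl])
    fix \<nu> :: 2
    show "(\<Sum>j\<in>{1..<n}. lo.sm (Cv a d j $ nidx \<nu>) (aA j \<nu> - aA (Suc j) \<nu>)) =
        (\<Sum>j\<in>{1..n}. lo.sm (Cv a d j $ nidx \<nu> - Cv a d (j - 1) $ nidx \<nu>) (aA j \<nu>))"
      using abel[where c = "\<lambda>j. Cv a d j $ nidx \<nu>" and m = n and x = "\<lambda>j. aA j \<nu>"] z
      by (simp del: One_nat_def)
  qed
  also have "\<dots> = dop V a d + dopB d"
    unfolding dop_al dopB_def aA_def lo.sm_add sum.distrib[symmetric] vector_minus_component[symmetric]
    by (rule sum.swap)
  finally show ?thesis .
qed

lemma dopB_dop: "dopB d * dop V a d' = - (dop V a d' * dopB d)"
proof -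
  have s: "ab j \<nu> * al l \<xi> = - (al l \<xi> * ab j \<nu>)" if "j \<in> {1..n}" "l \<in> {1..n}" for j l \<nu> \<xi>
    using sw_al_ab[of l j \<xi> \<nu>] that by (simp add: sw_def)
  define I where "I = {1..n} \<times> (UNIV :: 2 set)"
  let ?x = "\<lambda>d k. (Cv a d (fst k) - Cv a d (fst k - 1)) $ nidx (snd k)"
  have e: "dopB d = (\<Sum>k\<in>I. lo.sm (?x d k) (ab (fst k) (snd k)))" "dop V a d' = (\<Sum>k\<in>I. lo.sm (?x d' k) (al (fst k) (snd k)))"
    unfolding dopB_def dop_al I_def by (simp_all only: sum.cartesian_product case_prod_unfold)
  have "dopB d * dop V a d' = (\<Sum>k\<in>I. \<Sum>l\<in>I. - (lo.sm (?x d' l) (al (fst l) (snd l)) * lo.sm (?x d k) (ab (fst k) (snd k))))"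
    unfolding e sum_product by (intro sum.cong refl) (auto simp: I_def s lo.sm_uminus mult.commute)
  also have "\<dots> = - (dop V a d' * dopB d)"
    unfolding e sum_product sum_negf by (subst sum.swap) (rule refl)
  finally show ?thesis .
qed

lemma dopB_vac: "app (dopB d) (vac n) = app (dop V a d) (vac n)"
proof -
  have "app (ab j \<nu>) (vac n) = app (al j \<nu>) (vac n)" if "j \<in> {1..n}" for j \<nu>
    using aG_vac[of j \<nu>] that by (simp add: aG_def fun_eq_iff)
  then show ?thesis
    unfolding dopB_def dop_al app_sum_left app_sm by (intro HOL.ext sum.cong refl) simp
qed

lemma theta_word: "set ds \<subseteq> H \<Longrightarrow> app (prod_list (map (\<lambda>d. actL V a (thF d)) ds)) (vac n) = app (wl (dop V a) ds) (vac n)"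
proof (induction ds)
  case (Cons d ds)
  let ?W = "wl (dop V a) ds"
  have "app (prod_list (map (\<lambda>d. actL V a (thF d)) (d # ds))) (vac n) = app ((dop V a d + dopB d) * ?W) (vac n)"
    using Cons actL_thF[of d] by simp
  \<comment> \<open>The dual half is pushed to the right with one sign per letter; on the vacuum it
    becomes the module half, which explains the second term of \<open>wl\<close>.\<close>
  also have "(dop V a d + dopB d) * ?W = dop V a d * ?W + lo.sm ((- 1) ^ length ds) (?W * dopB d)"
    unfolding distrib_right using wl_anticomm[of "dopB d" "dop V a" ds] dopB_dop by simp
  also have "app \<dots> (vac n) = app (wl (dop V a) (d # ds)) (vac n)"
    by (simp add: dopB_vac)
  finally show ?case .
qed simp

lemma vv_word: "set ds \<subseteq> H \<Longrightarrow> vv (prod_list (map gvar ds)) = app (wl (dop V a) ds) (vac n)"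
proof -
  assume d: "set ds \<subseteq> H"
  have "actL V a (hF (prod_list (map gvar ds))) = prod_list (map (\<lambda>d. actL V a (thF d)) ds)" for ds
    by (induction ds) (simp_all add: hF_simps lo.ev_mult)
  then show ?thesis using theta_word[OF d] by (simp add: vv_def)
qed

lemma wl_tens: "f \<in> tens (positions n) \<Longrightarrow> app (wl (dop V a) ds) f \<in> tens (positions n)"
proof (induction ds arbitrary: f)
  case (Cons d ds)
  then show ?case
    using tp_dop by (auto simp: tp_def intro!: tens_add tens_scale)
qed simp

lemma vv_expand: "vv z = (\<lambda>s. \<Sum>w\<in>Poly_Mapping.keys z. Poly_Mapping.lookup z w * vv (prod_list (map gvar (letters w))) s)"
proof -
  have "actL V a (hF z) = (\<Sum>w\<in>Poly_Mapping.keys z. lcs (Poly_Mapping.lookup z w) * actL V a (hF (prod_list (map gvar (letters w)))))"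
    by (subst falg_expand) (simp add: hF_def fa.ev_sum fa.ev_mult lo.ev_sum lo.ev_mult)
  then show ?thesis by (simp add: vv_def app_sum_left)
qed

end

section \<open>Compatibility of the isomorphisms with the braiding\<close>

locale braided = A: total V a mu + B: total V b mu for V a b mu +
  fixes T :: "tensor \<Rightarrow> tensor" and h :: "(fword \<Rightarrow> complex^2) \<Rightarrow> (fword \<Rightarrow> complex^2)"
  assumes st: "bstep V a b T h"
begin

abbreviation "tt \<equiv> tens (positions (length a))"

lemma len: "length b = length a" and tot: "total_chr b = total_chr a" and hH: "d \<in> H1lf a \<Longrightarrow> h d \<in> H1lf b"
  and lin: "f \<in> tt \<Longrightarrow> g \<in> tt \<Longrightarrow> T (\<lambda>s. c * f s + e * g s) = (\<lambda>s. c * T f s + e * T g s)"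
  and Tt: "f \<in> tt \<Longrightarrow> T f \<in> tt" and Tv: "T (vac (length a)) = vac (length a)"
  and Tc: "x \<in> cops (length a) \<Longrightarrow> f \<in> tt \<Longrightarrow> T (app (actL V a x) f) = app (actL V b x) (T f)"
  and Td: "d \<in> H1lf a \<Longrightarrow> f \<in> tt \<Longrightarrow> T (app (dop V a d) f) = app (dop V b (h d)) (T f)"
  using st unfolding bstep_def by blast+

lemma nn: "A.n = length a" "B.n = length a"
  by (simp_all add: A.n_def B.n_def len)

lemma T_wl: "set ds \<subseteq> H1lf a \<Longrightarrow> f \<in> tt \<Longrightarrow> T (app (wl (dop V a) ds) f) = app (wl (dop V b) (map h ds)) (T f)"
proof (induction ds arbitrary: f)
  case (Cons d ds)
  have t: "app (wl (dop V a) ds) f \<in> tt" "app (dop V a d) f \<in> tt" if "f \<in> tt" for f ds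
    using A.wl_tens[of f ds] A.tp_dop[of d] that by (simp_all add: A.tp_def nn)
  have IH: "T (app (wl (dop V a) ds) g) = app (wl (dop V b) (map h ds)) (T g)" if "g \<in> tt" for g
    using Cons that by simp
  have d: "d \<in> H1lf a" using Cons.prems by simp
  let ?g = "app (dop V a d) (app (wl (dop V a) ds) f)" and ?k = "app (wl (dop V a) ds) (app (dop V a d) f)"
  have "T (\<lambda>s. 1 * ?g s + (- 1) ^ length ds * ?k s) = (\<lambda>s. 1 * T ?g s + (- 1) ^ length ds * T ?k s)"
    using Cons.prems t by (intro lin) auto
  also have "T ?g = app (dop V b (h d)) (app (wl (dop V b) (map h ds)) (T f))"
    using Td[OF d t(1)] IH Cons.prems by simp
  also have "T ?k = app (wl (dop V b) (map h ds)) (app (dop V b (h d)) (T f))"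
    using IH[OF t(2)] Td[OF d] Cons.prems by simp
  finally show ?case by simp
qed simp

lemma T_sum: "finite S \<Longrightarrow> (\<And>k. k \<in> S \<Longrightarrow> f k \<in> tt) \<Longrightarrow> T (\<lambda>s. \<Sum>k\<in>S. c k * f k s) = (\<lambda>s. \<Sum>k\<in>S. c k * T (f k) s)"
proof (induction S rule: finite_induct)
  case empty
  show ?case using lin[of "\<lambda>_. 0" "\<lambda>_. 0" 0 0] by simp
next
  case (insert k S)
  then have "(\<lambda>s. \<Sum>k\<in>S. c k * f k s) \<in> tt" by (intro tens_sum tens_scale) auto
  from lin[OF _ this, of "f k" "c k" 1] insert show ?case by simp
qed

definition hh :: "(fword \<Rightarrow> complex^2) falg \<Rightarrow> (fword \<Rightarrow> complex^2) falg"
  where "hh = fa.ev (\<lambda>d. gvar (h d))"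

lemma hh_carrier: "z \<in> carrier (free_ring (H1lf a)) \<Longrightarrow> hh z \<in> carrier (free_ring (H1lf b))"
proof (induction rule: free_ring_induct)
  case (gvar_mult g x)
  then show ?case using hH by (auto simp: hh_def fa.ev_mult intro!: free_mult)
qed (auto simp: hh_def fa.ev_add intro: free_add)

text \<open>On words this is the intertwining of the polynomials \<open>wl\<close> together with
  invariance of the vacuum; sums follow by linearity.\<close>

lemma T_vv:
  assumes z: "z \<in> carrier (free_ring (H1lf a))"
  shows "T (A.vv z) = B.vv (hh z)"
proof -
  have ls: "set (letters w) \<subseteq> H1lf a" if "w \<in> Poly_Mapping.keys z" for w
    using z that by (auto simp: free_carrier)
  have v: "vac (length a) \<in> tt" by (rule vac_tens)
  have w: "T (A.vv (prod_list (map gvar (letters w)))) = B.vv (hh (prod_list (map gvar (letters w))))"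
    "A.vv (prod_list (map gvar (letters w))) \<in> tt" if "w \<in> Poly_Mapping.keys z" for w
  proof -
    note l = ls[OF that]
    have e: "hh (prod_list (map gvar ds)) = prod_list (map gvar (map h ds))" for ds
      by (induction ds) (simp_all add: hh_def fa.ev_mult)
    have m: "set (map h (letters w)) \<subseteq> H1lf b" using l hH by auto
    show "T (A.vv (prod_list (map gvar (letters w)))) = B.vv (hh (prod_list (map gvar (letters w))))"
      unfolding e A.vv_word[OF l] B.vv_word[OF m] nn T_wl[OF l v] Tv ..
    show "A.vv (prod_list (map gvar (letters w))) \<in> tt"
      using A.wl_tens[of "vac (length a)"] v by (simp add: A.vv_word[OF l] nn)
  qed
  have "T (A.vv z) = (\<lambda>s. \<Sum>w\<in>Poly_Mapping.keys z. Poly_Mapping.lookup z w * B.vv (hh (prod_list (map gvar (letters w)))) s)"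
    unfolding A.vv_expand[of z] using w by (subst T_sum) auto
  also have "\<dots> = B.vv (hh z)"
  proof -
    have "B.vv (cst c * x) = (\<lambda>s. c * B.vv x s)" for c x
      by (simp add: B.vv_def B.hF_simps lo.ev_mult)
    moreover have "B.vv (sum f S) = (\<lambda>s. \<Sum>k\<in>S. B.vv (f k) s)" if "finite S" for f :: "(fword \<Rightarrow> complex^2) fmon \<Rightarrow> (fword \<Rightarrow> complex^2) falg" and S
      using that
    proof (induction S rule: finite_induct)
      case empty
      show ?case using B.vv_cst[of 0] by simp
    qed (simp add: B.vv_add)
    moreover have "hh z = (\<Sum>w\<in>Poly_Mapping.keys z. cst (Poly_Mapping.lookup z w) * hh (prod_list (map gvar (letters w))))"
      by (subst falg_expand) (simp add: hh_def fa.ev_sum fa.ev_mult)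
    ultimately show ?thesis by simp
  qed
  finally show ?thesis .
qed

lemma T_zero: "T (\<lambda>s. 0) = (\<lambda>s. 0)"
  using lin[of "\<lambda>_. 0" "\<lambda>_. 0" 0 0] by simp

sublocale bp: ideal_pair "ext_ideal (H1lf a)" "free_ring (H1lf a)" "ext_ideal (H1lf b)" "free_ring (H1lf b)" hh
proof (intro ideal_pair.intro ideal_pair_axioms.intro)
  show "ideal (ext_ideal (H1lf a)) (free_ring (H1lf a))" "ideal (ext_ideal (H1lf b)) (free_ring (H1lf b))"
    by (rule ex.ideal)+
  show "hh \<in> ring_hom (free_ring (H1lf a)) (free_ring (H1lf b))"
    using hh_carrier by (intro ring_hom_memI) (simp_all add: hh_def fa.ev_add fa.ev_mult)
  show "hh x \<in> ext_ideal (H1lf b)" if "x \<in> ext_ideal (H1lf a)" for x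
  proof -
    have x: "x \<in> carrier (free_ring (H1lf a))" using that by (rule ex.in_carrier)
    \<comment> \<open>In place of checking the exterior relations for the Burau map, the vanishing
      on the vacuum is transported by \<open>T\<close>, and faithfulness gives membership in the
      ideal.\<close>
    have "B.vv (hh x) = (\<lambda>s. 0)" using T_vv[OF x] A.vv_ideal[OF that] T_zero by simp
    then show ?thesis using B.vv_ideal_inj[OF hh_carrier[OF x]] B.vv_ideal by blast
  qed
qed

definition "Bq = quot_map (free_ring (H1lf b)) (ext_ideal (H1lf b)) hh"

lemma Bq_cls: "x \<in> carrier (free_ring (H1lf a)) \<Longrightarrow> Bq (ext_cls (H1lf a) x) = ext_cls (H1lf b) (hh x)"
  using bp.quot_map_coset[of x] by (simp add: Bq_def ext_cls_def)

lemma exterior_map_Bq: "exterior_map (H1lf a) (H1lf b) h Bq"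
  unfolding exterior_map_def
proof (intro conjI allI ballI)
  show "h ` H1lf a \<subseteq> H1lf b" using hH by blast
  show "Bq \<in> ring_hom (exterior (H1lf a)) (exterior (H1lf b))"
    unfolding Bq_def exterior_def by (rule bp.quot_map_hom)
  show "Bq (ext_cls (H1lf a) (cst c)) = ext_cls (H1lf b) (cst c)" for c
    by (simp add: Bq_cls hh_def)
  show "Bq (ext_cls (H1lf a) (gvar d)) = ext_cls (H1lf b) (gvar (h d))" if "d \<in> H1lf a" for d
    using that by (simp add: Bq_cls hh_def)
qed

definition "tw2 X Y \<longleftrightarrow> (\<forall>f\<in>tt. app X f \<in> tt \<and> T (app X f) = app Y (T f))"

lemma tw2_closed: "tw2 1 1" "tw2 X X' \<Longrightarrow> tw2 Y Y' \<Longrightarrow> tw2 (X + Y) (X' + Y')"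
    "tw2 X X' \<Longrightarrow> tw2 Y Y' \<Longrightarrow> tw2 (X * Y) (X' * Y')" "tw2 X X' \<Longrightarrow> tw2 (lo.sm c X) (lo.sm c X')"
proof -
  show "tw2 1 1" by (simp add: tw2_def)
  show "tw2 X X' \<Longrightarrow> tw2 Y Y' \<Longrightarrow> tw2 (X + Y) (X' + Y')"
    using lin[of _ _ 1 1] by (simp add: tw2_def tens_add)
  show "tw2 X X' \<Longrightarrow> tw2 Y Y' \<Longrightarrow> tw2 (X * Y) (X' * Y')" by (simp add: tw2_def)
  show "tw2 X X' \<Longrightarrow> tw2 (lo.sm c X) (lo.sm c X')"
    using lin[of _ "\<lambda>_. 0" c 0] by (simp add: tw2_def tens_scale)
qed

lemma tw2_cops: "tw2 (A.cE Md) (B.cE Md)" "tw2 (A.cF Md) (B.cF Md)" "tw2 (A.cK Md) (B.cK Md)" "tw2 (A.cK Dl) (B.cK Dl)"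
proof -
  have "tw2 (actL V a x) (actL V b x)" if "x \<in> cops (length a)" for x
    using that Tc A.cops_tens[of x] by (simp add: tw2_def nn)
  then show "tw2 (A.cE Md) (B.cE Md)" "tw2 (A.cF Md) (B.cF Md)" "tw2 (A.cK Md) (B.cK Md)" "tw2 (A.cK Dl) (B.cK Dl)"
    by (simp_all add: cops_def A.cE_def B.cE_def A.cF_def B.cF_def A.cK_def B.cK_def nn)
qed

text \<open>The braid preserves the total character, so source and target use the same module model,
  and \<open>casimir_rel\<close> applies with intertwining as the relation.\<close>

lemma tw2_CM: "tw2 (A.CM e c c') (B.CM e c c')"
proof -
  have m: "total_mod V b mu e = total_mod V a mu e"
    by (simp add: total_mod_def tot)
  show ?thesis
    unfolding A.CM_def B.CM_def m tot
    by (rule casimir_rel[OF A.cas_Md B.cas_Md[of e, unfolded m tot], where Q = tw2]) (intro tw2_cops tw2_closed; assumption)+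
qed

text \<open>\<open>unv\<close> is assembled from \<open>CM\<close> and \<open>NN\<close>, both
  intertwined by \<open>T\<close>; hence the map induced on multiplicity spaces is determined by the
  effect of \<open>T\<close> on the described vector.\<close>

lemma T_unv: "A.Inv W \<Longrightarrow> mult_map T (A.unv W) = B.unv (T W)"
proof -
  assume "A.Inv W"
  then have W: "W \<in> tt" by (simp add: A.Inv_def nn)
  have N: "tw2 A.NN B.NN" unfolding A.NN_def B.NN_def by (intro tw2_closed tw2_cops)
  have "T (A.unv W e1 e2 c c') = B.unv (T W) e1 e2 c c'" for e1 e2 c c'
  proof -
    let ?g = "\<lambda>s. 1 / 2 * W s + A.sg (e1 \<noteq> e2) / 2 * app A.NN W s"
    have NW: "app A.NN W \<in> tt" "T (app A.NN W) = app B.NN (T W)" using N W by (simp_all add: tw2_def)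
    have g: "?g \<in> tt" using W NW by (intro tens_add tens_scale)
    have "T (app (A.CM e1 c c') ?g) = app (B.CM e1 c c') (T ?g)"
      using tw2_CM g unfolding tw2_def by blast
    also have "T ?g = (\<lambda>s. 1 / 2 * T W s + B.sg (e1 \<noteq> e2) / 2 * app B.NN (T W) s)"
      using lin[OF W NW(1), of "1 / 2" "A.sg (e1 \<noteq> e2) / 2"] NW(2) by (simp only: A.sg_def B.sg_def)
    finally show ?thesis unfolding A.unv_def B.unv_def .
  qed
  then show ?thesis by (simp add: mult_map_def fun_eq_iff)
qed

lemma final:
  assumes "\<omega> \<in> carrier (exterior (H1lf a))"
  shows "mult_map T (A.Psi (A.Phi \<omega>)) = B.Psi (B.Phi (Bq \<omega>))"
proof -
  obtain x where x: "x \<in> carrier (free_ring (H1lf a))" "\<omega> = ext_cls (H1lf a) x"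
    using assms A.ext_carrier by blast
  show ?thesis
    using T_unv[OF A.vv_Inv[OF x(1)]] T_vv[OF x(1)]
    by (simp add: x Bq_cls A.Psi_Phi B.Psi_Phi hh_carrier)
qed

end

theorem corollary7p17:
  fixes V :: "xchar \<Rightarrow> umod" and a a' :: "xchar list" and \<beta> :: "bgen list"
    and T :: "tensor \<Rightarrow> tensor" and \<mu> :: complex
  assumes "\<And>x. ext_char x \<Longrightarrow> nonsingular (fst x) \<Longrightarrow> is_V x (V x)"
    and "\<forall>x\<in>set a. ext_char x \<and> nonsingular (fst x)"
    and "nonsingular (total_chr a)"
    and "ext_char (total_chr a, \<mu>)"
    and "braid_T V \<beta> a a' T"
  shows "\<exists>\<Phi> \<Phi>' \<Psi> \<Psi>' B.
    Phi_iso a \<Phi> \<and> mult_iso V a \<mu> \<Psi> \<and>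
    Phi_iso a' \<Phi>' \<and> mult_iso V a' \<mu> \<Psi>' \<and>
    exterior_map (H1lf a) (H1lf a') (burau \<beta>) B \<and>
    (\<forall>\<omega>\<in>carrier (exterior (H1lf a)).
      mult_map T (\<Psi> (\<Phi> \<omega>)) = \<Psi>' (\<Phi>' (B \<omega>)))"
proof -
  have st: "bstep V a a' T (burau \<beta>)"
    by (rule braid_bstep[OF assms(1) assms(5)]) (use assms(2) in auto)
  then have t: "total_chr a' = total_chr a" "\<forall>x\<in>set a'. ext_char x \<and> nonsingular (fst x)"
    by (simp_all add: bstep_def)
  interpret braided V a a' \<mu> T "burau \<beta>"
    by unfold_locales (use assms(1-4) t st in \<open>simp_all\<close>)
  show ?thesis
    using A.Phi_iso_Phi A.mult_iso_psi B.Phi_iso_Phi B.mult_iso_psi exterior_map_Bq final by blast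
qed

end
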